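(* Let $X$ be a compact connected Riemann surface of genus $g$. Then the complex vector space $\Omega^1(X)$ of holomorphic differential $1$-forms on $X$ has dimension $g$.
   Context: The genus $g$ of $X$ is the topological genus: $X$ is homeomorphic to a sphere with $g$ handles (a torus with $g$ holes). *)

theory Defs
  imports "HOL-Complex_Analysis.Complex_Analysis" "HOL-Library.Function_Algebras"
begin

section \<open>Riemann surfaces\<close>

text \<open>A chart is a pair of a domain and a coordinate map; the values of the coordinate map
  outside the domain are irrelevant.\<close>

type_synonym 'a chart = "'a set \<times> ('a \<Rightarrow> complex)"

definition chart_image :: "'a chart \<Rightarrow> complex set" where
  "chart_image k = snd k ` fst k"

definition is_chart :: "'a topology \<Rightarrow> 'a chart \<Rightarrow> bool" where
  "is_chart X k \<longleftrightarrow>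
     openin X (fst k) \<and> open (chart_image k) \<and>
     homeomorphic_map (subtopology X (fst k)) (top_of_set (chart_image k)) (snd k)"

text \<open>The overlap of two charts, seen in the coordinate of the first one, and the change of
  coordinate from the first to the second.\<close>

definition overlap :: "'a chart \<Rightarrow> 'a chart \<Rightarrow> complex set" where
  "overlap k l = snd k ` (fst k \<inter> fst l)"

definition transition :: "'a chart \<Rightarrow> 'a chart \<Rightarrow> complex \<Rightarrow> complex" where
  "transition k l = snd l \<circ> the_inv_into (fst k) (snd k)"

text \<open>A Riemann surface is a Hausdorff space with a holomorphic atlas, which need not be maximal.
  Connectedness is not part of the definition. Second countability is not required either;
  compact surfaces satisfy it automatically.\<close>

locale riemann_surface =
  fixes X :: "'a topology" and A :: "'a chart set"
  assumes Hausdorff: "Hausdorff_space X"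
    and charts: "\<And>k. k \<in> A \<Longrightarrow> is_chart X k"
    and cover: "(\<Union>k\<in>A. fst k) = topspace X"
    and holomorphic_transition:
      "\<And>k l. k \<in> A \<Longrightarrow> l \<in> A \<Longrightarrow> transition k l holomorphic_on overlap k l"

section \<open>Holomorphic 1-forms\<close>

text \<open>A family \<open>\<omega>\<close> stands for the collection of the local expressions \<open>\<omega> k z dz\<close>, where \<open>z\<close> is the
  coordinate of the chart \<open>k\<close>. The second condition is \<open>f(z) dz = h(w) dw\<close> for \<open>w = T z\<close>.
  The last condition only makes the family of functions determined by the form.\<close>

definition holomorphic_forms :: "'a chart set \<Rightarrow> ('a chart \<Rightarrow> complex \<Rightarrow> complex) set" where
  "holomorphic_forms A = {\<omega>.
     (\<forall>k\<in>A. \<omega> k holomorphic_on chart_image k) \<and>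
     (\<forall>k\<in>A. \<forall>l\<in>A. \<forall>z\<in>overlap k l.
        \<omega> k z = \<omega> l (transition k l z) * deriv (transition k l) z) \<and>
     (\<forall>k z. k \<notin> A \<or> z \<notin> chart_image k \<longrightarrow> \<omega> k z = 0)}"

definition form_scale ::
    "complex \<Rightarrow> ('a chart \<Rightarrow> complex \<Rightarrow> complex) \<Rightarrow> 'a chart \<Rightarrow> complex \<Rightarrow> complex" where
  "form_scale c \<omega> = (\<lambda>k z. c * \<omega> k z)"

global_interpretation forms: vector_space form_scale
  by unfold_locales (auto simp: form_scale_def fun_eq_iff algebra_simps)

lemma subspace_holomorphic_forms: "forms.subspace (holomorphic_forms A)"
  unfolding forms.subspace_def
  by (auto simp: holomorphic_forms_def form_scale_def plus_fun_def zero_fun_def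
           intro!: holomorphic_intros)
     (metis distrib_right)

section \<open>The genus\<close>

text \<open>The quotient of a space by an equivalence relation; points of the quotient are the
  equivalence classes.\<close>

definition quotient_topology :: "'a topology \<Rightarrow> ('a \<Rightarrow> 'a \<Rightarrow> bool) \<Rightarrow> 'a set topology" where
  "quotient_topology Y r = topology (\<lambda>W.
     W \<subseteq> (\<lambda>x. Collect (r x)) ` topspace Y \<and> openin Y {x \<in> topspace Y. Collect (r x) \<in> W})"

lemma openin_quotient_topology:
  "openin (quotient_topology Y r) W \<longleftrightarrow>
     W \<subseteq> (\<lambda>x. Collect (r x)) ` topspace Y \<and> openin Y {x \<in> topspace Y. Collect (r x) \<in> W}"
proof -
  have 1: "{x \<in> topspace Y. Collect (r x) \<in> S \<inter> T} =
      {x \<in> topspace Y. Collect (r x) \<in> S} \<inter> {x \<in> topspace Y. Collect (r x) \<in> T}" for S T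
    by auto
  have 2: "{x \<in> topspace Y. Collect (r x) \<in> \<Union>K} =
      (\<Union>W\<in>K. {x \<in> topspace Y. Collect (r x) \<in> W})" for K
    by auto
  have "istopology (\<lambda>W. W \<subseteq> (\<lambda>x. Collect (r x)) ` topspace Y \<and>
      openin Y {x \<in> topspace Y. Collect (r x) \<in> W})"
    unfolding istopology_def 1 2 by blast
  then show ?thesis
    by (simp add: quotient_topology_def)
qed

lemma quotient_map_quotient_topology:
  "quotient_map Y (quotient_topology Y r) (\<lambda>x. Collect (r x))"
proof -
  let ?Q = "(\<lambda>x. Collect (r x)) ` topspace Y"
  have "{x \<in> topspace Y. Collect (r x) \<in> ?Q} = topspace Y"
    by auto
  then have "openin (quotient_topology Y r) ?Q"
    by (simp add: openin_quotient_topology)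
  moreover have "topspace (quotient_topology Y r) \<subseteq> ?Q"
    using openin_topspace[of "quotient_topology Y r"]
    unfolding openin_quotient_topology by (rule conjunct1)
  ultimately have "topspace (quotient_topology Y r) = ?Q"
    by (intro subset_antisym openin_subset)
  then show ?thesis
    by (simp add: quotient_map_def openin_quotient_topology)
qed

text \<open>The sphere is the one-point compactification of the plane. To attach \<open>g\<close> handles, remove from
  it the \<open>2 * g\<close> disjoint open discs of radius 1 around \<open>0, 3, 6, \<dots>\<close>, and take the disjoint
  union with \<open>g\<close> cylinders. Component \<open>0\<close> of the union is the sphere with holes; component
  \<open>Suc j\<close> is the \<open>j\<close>-th cylinder, realised as the annulus \<open>1 \<le> |z| \<le> 2\<close>.\<close>

definition hole_centre :: "nat \<Rightarrow> complex" where
  "hole_centre n = 3 * of_nat n"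

definition handle_piece :: "nat \<Rightarrow> nat \<Rightarrow> complex option set" where
  "handle_piece g i =
     (if i = 0 then UNIV - (\<Union>n<2 * g. Some ` ball (hole_centre n) 1)
      else Some ` {z. 1 \<le> cmod z \<and> cmod z \<le> 2})"

definition handle_pieces :: "nat \<Rightarrow> (nat \<times> complex option) topology" where
  "handle_pieces g =
     sum_topology
       (\<lambda>i. subtopology (Alexandroff_compactification euclidean) (handle_piece g i)) {..g}"

text \<open>The two ends of the \<open>j\<close>-th cylinder are glued to the boundaries of the holes \<open>2 * j\<close> and
  \<open>2 * j + 1\<close>. Conjugation at exactly one end makes the result orientable: without it
  the tube would be a Klein handle.\<close>

inductive handle_glue :: "nat \<Rightarrow> nat \<times> complex option \<Rightarrow> nat \<times> complex option \<Rightarrow> bool"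
  for g where
  inner_end: "j < g \<Longrightarrow> cmod z = 1 \<Longrightarrow>
    handle_glue g (Suc j, Some z) (0, Some (hole_centre (2 * j) + z))"
| outer_end: "j < g \<Longrightarrow> cmod z = 1 \<Longrightarrow>
    handle_glue g (Suc j, Some (2 * z)) (0, Some (hole_centre (2 * j + 1) + cnj z))"

definition sphere_with_handles :: "nat \<Rightarrow> (nat \<times> complex option) set topology" where
  "sphere_with_handles g = quotient_topology (handle_pieces g) (equivclp (handle_glue g))"

definition has_genus :: "'a topology \<Rightarrow> nat \<Rightarrow> bool" where
  "has_genus X g \<longleftrightarrow> X homeomorphic_space sphere_with_handles g"

end

(*
Real parts of holomorphic forms are exactly the harmonic 1-forms, so it suffices to show that
every real cohomology class contains exactly one harmonic form: the space of holomorphic forms then has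
real dimension 2g. Classes are represented by circle-valued maps F: removing one point from
the sphere with g handles, every closed 1-form is uniquely an exact one plus a real combination of
d arg F_i for 2g explicit maps F_i, one winding around and one along each handle.
To find a continuous real b for which arg F + b is harmonic, solve the Dirichlet problem for arg F + b off
a closed disc by Perron's method, and adjust the boundary values by a contraction until the solution
agrees on an annulus with a harmonic function on a larger disc. They agree up to a multiple of
log |w|, which vanishes because the harmonic form has no flux around the disc.
Uniqueness is the maximum principle.
*)
theory Submission
  imports Defs
begin

section \<open>The Poisson integral on the unit disc\<close>

text \<open>The genus is given by a mere homeomorphism, which carries no differentiable structure
  from the model to X. So cohomology is computed from continuous data only, germs of increments and
  circle-valued maps, and these can be transported in both directions. The puncture serves twice. It
  leaves a plane with holes and cylinders, whose halves are retracts of the plane, where every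
  cocycle is exact. And since the basis maps are defined at the puncture too, their arguments have
  branches on a whole disc around it; this is what removes the flux. The argument of F is not
  subharmonic, so Perron's method has no obvious subsolution to start from. One is glued as a
  maximum of local branches, after adding large multiples of potentials that equal 1 on half of one
  disc and drop below 1 outside that disc. The contraction is measured by oscillations: adding a
  constant to the data adds the same constant to the solution, so the supremum norm would not
  shrink. Harnack's inequality at the inner radius 1/4 gives the factor 2/5.\<close>

definition poisson_kernel :: "complex \<Rightarrow> complex \<Rightarrow> real" where
  "poisson_kernel \<zeta> z = Re ((\<zeta> + z) / (\<zeta> - z))"

text \<open>The path \<open>circlepath 0 1\<close> is parametrised by [0,1], so the integral is
  already a normalised average. Taking \<phi> itself off the open disc makes the function continuous
  up to the circle, so that a modification inside the disc joins the unmodified function.\<close>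

definition poisson :: "(complex \<Rightarrow> real) \<Rightarrow> complex \<Rightarrow> real" where
  "poisson \<phi> z = (if norm z < 1
     then integral {0..1} (\<lambda>t. \<phi> (circlepath 0 1 t) * poisson_kernel (circlepath 0 1 t) z) else \<phi> z)"

lemma norm_circlepath_01 [simp]: "norm (circlepath 0 1 t) = 1"
  by (simp add: circlepath)

lemma continuous_on_circlepath_01 [continuous_intros]: "continuous_on S (circlepath 0 1)"
  unfolding circlepath by (intro continuous_intros)

lemma has_contour_integral_circlepath_01:
  "(f has_contour_integral I) (circlepath 0 1) \<longleftrightarrow>
    ((\<lambda>t. f (circlepath 0 1 t) * (2 * of_real pi * \<i> * circlepath 0 1 t)) has_integral I) {0..1}"
proof -
  have "vector_derivative (circlepath 0 1) (at t within {0..1}) = 2 * of_real pi * \<i> * circlepath 0 1 t"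
    if "t \<in> {0..1}" for t
    using that by (simp add: vector_derivative_circlepath01) (simp add: circlepath)
  then show ?thesis
    unfolding has_contour_integral_def by (intro has_integral_cong) simp
qed

lemma poisson_kernel_eq:
  assumes "norm \<zeta> = 1" "norm z < 1"
  shows "poisson_kernel \<zeta> z = (1 - (norm z)\<^sup>2) / (norm (\<zeta> - z))\<^sup>2"
proof -
  have "\<zeta> - z \<noteq> 0" using assms by auto
  have "(\<zeta> + z) / (\<zeta> - z) = (\<zeta> + z) * cnj (\<zeta> - z) / of_real ((norm (\<zeta> - z))\<^sup>2)"
    using \<open>\<zeta> - z \<noteq> 0\<close> unfolding complex_norm_square by simp
  then have "poisson_kernel \<zeta> z = Re ((\<zeta> + z) * cnj (\<zeta> - z)) / (norm (\<zeta> - z))\<^sup>2"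
    unfolding poisson_kernel_def by (metis Re_divide_of_real)
  also have "Re ((\<zeta> + z) * cnj (\<zeta> - z)) = (norm \<zeta>)\<^sup>2 - (norm z)\<^sup>2"
    unfolding cmod_power2 by (simp add: algebra_simps power2_eq_square)
  finally show ?thesis using assms by simp
qed

text \<open>In the closed form (1 - |z|^2) / |\<zeta> - z|^2 the distance lies between 1 - |z| and 1
  + |z|, and one of these factors cancels against the numerator.\<close>

lemma poisson_kernel_Harnack:
  assumes "norm \<zeta> = 1" "norm z < 1"
  shows "(1 - norm z) / (1 + norm z) \<le> poisson_kernel \<zeta> z"
    and "poisson_kernel \<zeta> z \<le> (1 + norm z) / (1 - norm z)"
proof -
  have 1: "norm (\<zeta> - z) \<le> 1 + norm z" "1 - norm z \<le> norm (\<zeta> - z)"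
    using norm_triangle_ineq4[of \<zeta> z] norm_triangle_ineq2[of \<zeta> z] assms by auto
  have e: "1 - (norm z)\<^sup>2 = (1 - norm z) * (1 + norm z)"
    by (simp add: algebra_simps power2_eq_square)
  have "(1 - norm z) / (1 + norm z) = (1 - (norm z)\<^sup>2) / (1 + norm z)\<^sup>2"
    unfolding e using assms by (simp add: power2_eq_square add_nonneg_eq_0_iff)
  also have "\<dots> \<le> (1 - (norm z)\<^sup>2) / (norm (\<zeta> - z))\<^sup>2"
    using 1 assms by (intro divide_left_mono power_mono) (auto simp: power_le_one zero_less_mult_iff)
  finally show "(1 - norm z) / (1 + norm z) \<le> poisson_kernel \<zeta> z"
    using poisson_kernel_eq[OF assms] by simp
  have "(1 - (norm z)\<^sup>2) / (norm (\<zeta> - z))\<^sup>2 \<le> (1 - (norm z)\<^sup>2) / (1 - norm z)\<^sup>2"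
    using 1 assms by (intro divide_left_mono power_mono) (auto simp: power_le_one zero_less_mult_iff)
  also have "\<dots> = (1 + norm z) / (1 - norm z)"
    unfolding e using assms by (simp add: power2_eq_square)
  finally show "poisson_kernel \<zeta> z \<le> (1 + norm z) / (1 - norm z)"
    using poisson_kernel_eq[OF assms] by simp
qed

lemma poisson_kernel_nonneg: "norm \<zeta> = 1 \<Longrightarrow> norm z < 1 \<Longrightarrow> 0 \<le> poisson_kernel \<zeta> z"
  by (simp add: poisson_kernel_eq power_le_one)

lemma continuous_on_circle_comp:
  assumes "continuous_on (sphere 0 1) \<phi>" shows "continuous_on S (\<lambda>t. \<phi> (circlepath 0 1 t))"
  by (rule continuous_on_compose2[OF assms continuous_on_circlepath_01]) auto

lemma poisson_integrable:
  assumes "continuous_on (sphere 0 1) (\<phi> :: complex \<Rightarrow> real)" "norm z < 1"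
  shows "(\<lambda>t. \<phi> (circlepath 0 1 t) * poisson_kernel (circlepath 0 1 t) z) integrable_on {0..1}"
proof (rule integrable_continuous_real)
  have "circlepath 0 1 t - z \<noteq> 0" for t using assms(2) norm_circlepath_01[of t] by force
  then show "continuous_on {0..1} (\<lambda>t. \<phi> (circlepath 0 1 t) * poisson_kernel (circlepath 0 1 t) z)"
    unfolding poisson_kernel_def
    by (intro continuous_intros continuous_on_circle_comp assms) auto
qed

lemma poisson_add:
  assumes "continuous_on (sphere 0 1) \<phi>" "continuous_on (sphere 0 1) \<psi>"
  shows "poisson (\<lambda>w. \<phi> w + \<psi> w) z = poisson \<phi> z + poisson \<psi> z"
  unfolding poisson_def using assms
  by (simp add: distrib_right integral_add poisson_integrable)

lemma poisson_cmul: "poisson (\<lambda>w. c * \<phi> w) z = c * poisson \<phi> z"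
  unfolding poisson_def by (simp add: mult.assoc)

lemma poisson_diff:
  assumes "continuous_on (sphere 0 1) \<phi>" "continuous_on (sphere 0 1) \<psi>"
  shows "poisson (\<lambda>w. \<phi> w - \<psi> w) z = poisson \<phi> z - poisson \<psi> z"
  unfolding poisson_def using assms
  by (simp add: left_diff_distrib integral_diff poisson_integrable)

lemma poisson_cong:
  assumes "\<And>w. norm w = 1 \<Longrightarrow> \<phi> w = \<psi> w" "norm z \<le> 1"
  shows "poisson \<phi> z = poisson \<psi> z"
  unfolding poisson_def using assms by auto

lemma poisson_mono:
  assumes "continuous_on (sphere 0 1) \<phi>" "continuous_on (sphere 0 1) \<psi>"
    and "\<And>w. norm w = 1 \<Longrightarrow> \<phi> w \<le> \<psi> w" "norm z \<le> 1"
  shows "poisson \<phi> z \<le> poisson \<psi> z"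
  unfolding poisson_def using assms
  by (auto intro!: integral_le poisson_integrable mult_right_mono poisson_kernel_nonneg)

lemma poisson_Re_holomorphic:
  assumes h: "continuous_on (cball 0 1) h" "h holomorphic_on ball 0 1" and z: "norm z < 1"
  shows "poisson (\<lambda>w. Re (h w)) z = Re (h z)"
proof -
  let ?c = "circlepath 0 1"
  have nz: "1 - cnj z * w \<noteq> 0" if "norm w \<le> 1" for w
  proof
    assume "1 - cnj z * w = 0"
    then have "norm (cnj z * w) = 1" by simp
    moreover have "norm (cnj z * w) \<le> norm z * 1"
      unfolding norm_mult by (intro mult_mono) (use that in auto)
    ultimately show False using z by simp
  qed
  have 1: "((\<lambda>u. h u / (u - z)) has_contour_integral (2 * of_real pi * \<i> * h z)) ?c"
    using Cauchy_integral_circlepath[OF h] z by simp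
  \<comment> \<open>The pole of \<open>k\<close> is the mirror image of z in the circle, hence
    outside the disc, so Cauchy's formula contributes only k 0 = 0. On the circle, where
    \<open>cnj w\<close> is 1/w, adding this kernel turns the Cauchy kernel into the real Poisson
    kernel.\<close>
  define k where "k = (\<lambda>w. h w * w * cnj z / (1 - cnj z * w))"
  have 2: "((\<lambda>u. k u / (u - 0)) has_contour_integral (2 * of_real pi * \<i> * k 0)) ?c"
    unfolding k_def using z nz
    by (intro Cauchy_integral_circlepath continuous_intros holomorphic_intros h) auto
  have "((\<lambda>u. h u / (u - z) + k u / u) has_contour_integral (2 * of_real pi * \<i> * h z)) ?c"
    using has_contour_integral_add[OF 1 2] by (simp add: k_def)
  then have I0: "((\<lambda>t. (h (?c t) / (?c t - z) + k (?c t) / ?c t) * (2 * of_real pi * \<i> * ?c t))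
      has_integral (2 * of_real pi * \<i> * h z)) {0..1}"
    unfolding has_contour_integral_circlepath_01 .
  have E: "inverse (2 * of_real pi * \<i>) *
        ((h (?c t) / (?c t - z) + k (?c t) / ?c t) * (2 * of_real pi * \<i> * ?c t))
      = h (?c t) * of_real (poisson_kernel (?c t) z)" for t
  proof -
    let ?w = "?c t"
    have w: "norm ?w = 1" by simp
    have w0: "?w \<noteq> 0" "?w - z \<noteq> 0" using z w by (metis norm_zero zero_neq_one, force)
    have "of_real (poisson_kernel ?w z) = ?w / (?w - z) + ?w * cnj z / (1 - cnj z * ?w)"
    proof -
      have cw: "cnj ?w = 1 / ?w" using w w0(1)
        by (metis complex_norm_square mult.commute nonzero_eq_divide_eq of_real_1 one_power2)
      have "2 * of_real (poisson_kernel ?w z) = (?w + z) / (?w - z) + cnj ((?w + z) / (?w - z))"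
        unfolding poisson_kernel_def complex_add_cnj by simp
      also have "cnj ((?w + z) / (?w - z)) = (1 + cnj z * ?w) / (1 - cnj z * ?w)"
        using w0 nz[of ?w] w by (simp add: cw field_simps)
      also have "(?w + z) / (?w - z) = 2 * (?w / (?w - z)) - 1"
        using w0 by (simp add: field_simps)
      also have "(1 + cnj z * ?w) / (1 - cnj z * ?w) = 1 + 2 * (?w * cnj z / (1 - cnj z * ?w))"
        using nz[of ?w] w by (simp add: field_simps)
      finally have "2 * complex_of_real (poisson_kernel ?w z)
          = 2 * (?w / (?w - z) + ?w * cnj z / (1 - cnj z * ?w))"
        by (simp only: ring_distribs) simp
      from this[THEN mult_left_cancel[THEN iffD1, rotated]] show ?thesis by simp
    qed
    moreover have "(h ?w / (?w - z) + k ?w / ?w) * ?w = h ?w * (?w / (?w - z) + ?w * cnj z / (1 - cnj z * ?w))"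
      using w0 by (simp add: k_def distrib_left distrib_right)
    moreover have canc: "inverse c * (S * (c * u)) = S * u" if "c \<noteq> 0" for c S u :: complex
      using that by simp
    ultimately show "inverse (2 * of_real pi * \<i>) *
        ((h ?w / (?w - z) + k ?w / ?w) * (2 * of_real pi * \<i> * ?w)) = h ?w * of_real (poisson_kernel ?w z)"
      by (subst canc) (simp, simp only:)
  qed
  from has_integral_mult_right[OF I0, of "inverse (2 * of_real pi * \<i>)"]
  have "((\<lambda>t. h (?c t) * of_real (poisson_kernel (?c t) z)) has_integral h z) {0..1}"
    unfolding E by (simp add: field_simps)
  from has_integral_linear[OF this bounded_linear_Re]
  have "((\<lambda>t. Re (h (?c t)) * poisson_kernel (?c t) z) has_integral Re (h z)) {0..1}"
    by (simp add: o_def)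
  then show ?thesis using z by (simp add: poisson_def integral_unique)
qed

lemma poisson_const [simp]: "norm z \<le> 1 \<Longrightarrow> poisson (\<lambda>w. c) z = c"
  using poisson_Re_holomorphic[of "\<lambda>w. of_real c" z]
  by (cases "norm z < 1") (auto simp: poisson_def)

lemma poisson_Harnack:
  assumes c: "continuous_on (sphere 0 1) \<phi>" and pos: "\<And>w. norm w = 1 \<Longrightarrow> 0 \<le> \<phi> w" and z: "norm z < 1"
  shows "(1 - norm z) / (1 + norm z) * poisson \<phi> 0 \<le> poisson \<phi> z"
    and "poisson \<phi> z \<le> (1 + norm z) / (1 - norm z) * poisson \<phi> 0"
proof -
  have p0: "poisson \<phi> 0 = integral {0..1} (\<lambda>t. \<phi> (circlepath 0 1 t))"
  proof -
    have "poisson_kernel (circlepath 0 1 t) 0 = 1" for t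
      using poisson_kernel_eq[of "circlepath 0 1 t" 0] by simp
    then show ?thesis unfolding poisson_def by simp
  qed
  have i: "(\<lambda>t. \<phi> (circlepath 0 1 t)) integrable_on {0..1}"
    by (intro integrable_continuous_real continuous_on_circle_comp c)
  note K = poisson_kernel_Harnack[OF norm_circlepath_01 z]
  have "(1 - norm z) / (1 + norm z) * poisson \<phi> 0
      = integral {0..1} (\<lambda>t. \<phi> (circlepath 0 1 t) * ((1 - norm z) / (1 + norm z)))"
    unfolding p0 by (metis (no_types) integral_mult_left mult.commute)
  also have "\<dots> \<le> poisson \<phi> z"
    unfolding poisson_def if_P[OF z]
    by (intro integral_le poisson_integrable c mult_left_mono pos K integrable_on_mult_left i z) auto
  finally show "(1 - norm z) / (1 + norm z) * poisson \<phi> 0 \<le> poisson \<phi> z" .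
  have "poisson \<phi> z \<le> integral {0..1} (\<lambda>t. \<phi> (circlepath 0 1 t) * ((1 + norm z) / (1 - norm z)))"
    unfolding poisson_def if_P[OF z]
    by (intro integral_le poisson_integrable c mult_left_mono pos K integrable_on_mult_left i z) auto
  also have "\<dots> = (1 + norm z) / (1 - norm z) * poisson \<phi> 0"
    unfolding p0 by (metis (no_types) integral_mult_left mult.commute)
  finally show "poisson \<phi> z \<le> (1 + norm z) / (1 - norm z) * poisson \<phi> 0" .
qed

lemma poisson_holomorphic:
  assumes c: "continuous_on (sphere 0 1) \<phi>"
  obtains g where "g holomorphic_on ball 0 1" "\<And>z. norm z < 1 \<Longrightarrow> poisson \<phi> z = Re (g z)"
proof -
  let ?c = "circlepath 0 1"
  let ?f = "\<lambda>u. complex_of_real (\<phi> u)"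
  let ?G = "\<lambda>z. contour_integral ?c (\<lambda>u. ?f u / (u - z))"
  have cf: "continuous_on (path_image ?c) ?f"
    using c by (auto intro!: continuous_intros)
  have I: "((\<lambda>u. ?f u / (u - z)) has_contour_integral ?G z) ?c" if "norm z < 1" for z
  proof (rule has_contour_integral_integral, rule contour_integrable_continuous_circlepath)
    show "continuous_on (path_image ?c) (\<lambda>u. ?f u / (u - z))"
      using cf that by (intro continuous_intros) auto
  qed
  have D: "(?G has_field_derivative (1 * contour_integral ?c (\<lambda>u. ?f u / (u - z)^2))) (at z)"
    if "norm z < 1" for z
    using Cauchy_next_derivative_circlepath(2)[OF cf, of 1 ?G z] I that by (simp add: numeral_2_eq_2)
  have G: "?G holomorphic_on ball 0 1"
    unfolding holomorphic_on_open[OF open_ball]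
  proof
    fix z :: complex assume "z \<in> ball 0 1"
    then have "norm z < 1" by simp
    from D[OF this] show "\<exists>f'. (?G has_field_derivative f') (at z)" by (rule exI)
  qed
  \<comment> \<open>The Schwarz integral: 2 \<zeta> / (\<zeta> - z) - 1 = (\<zeta> + z) / (\<zeta> -
    z), whose real part is the Poisson kernel.\<close>
  define g where "g = (\<lambda>z. (2 * ?G z - ?G 0) / (2 * of_real pi * \<i>))"
  have "poisson \<phi> z = Re (g z)" if z: "norm z < 1" for z
  proof -
    have "((\<lambda>u. 2 * (?f u / (u - z)) - ?f u / (u - 0)) has_contour_integral (2 * ?G z - ?G 0)) ?c"
      by (intro has_contour_integral_diff has_contour_integral_lmul I) (use z in auto)
    then have "((\<lambda>t. (2 * (?f (?c t) / (?c t - z)) - ?f (?c t) / ?c t) * (2 * of_real pi * \<i> * ?c t))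
        has_integral (2 * ?G z - ?G 0)) {0..1}"
      unfolding has_contour_integral_circlepath_01 by simp
    from has_integral_mult_right[OF this, of "inverse (2 * of_real pi * \<i>)"]
    have "((\<lambda>t. inverse (2 * of_real pi * \<i>) *
        ((2 * (?f (?c t) / (?c t - z)) - ?f (?c t) / ?c t) * (2 * of_real pi * \<i> * ?c t)))
       has_integral g z) {0..1}"
      by (simp add: g_def field_simps)
    moreover have "inverse (2 * of_real pi * \<i>) *
        ((2 * (?f (?c t) / (?c t - z)) - ?f (?c t) / ?c t) * (2 * of_real pi * \<i> * ?c t))
        = ?f (?c t) * ((?c t + z) / (?c t - z))" for t
    proof -
      have "?c t \<noteq> 0" "?c t - z \<noteq> 0" using z norm_circlepath_01[of t]
        by (metis norm_zero zero_neq_one, force)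
      then show ?thesis by (simp add: field_simps)
    qed
    ultimately have "((\<lambda>t. ?f (?c t) * ((?c t + z) / (?c t - z))) has_integral g z) {0..1}"
      by simp
    from has_integral_linear[OF this bounded_linear_Re]
    have "((\<lambda>t. \<phi> (?c t) * poisson_kernel (?c t) z) has_integral Re (g z)) {0..1}"
      by (simp add: o_def poisson_kernel_def del: times_divide_eq_right)
    then show ?thesis using z by (simp add: poisson_def integral_unique)
  qed
  moreover have "g holomorphic_on ball 0 1"
    unfolding g_def by (intro holomorphic_intros G) auto
  ultimately show ?thesis using that by blast
qed

text \<open>A harmonic barrier replaces the usual splitting of the integral: \<open>L\<close>
  vanishes at \<zeta>, and a multiple of it dominates the oscillation of \<phi> away from \<zeta>.
  The bound on the circle is inherited by the Poisson integrals.\<close>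

lemma poisson_boundary:
  assumes c: "continuous_on (sphere 0 1) \<phi>" and \<zeta>: "norm \<zeta> = 1" and "\<epsilon> > 0"
  shows "\<exists>d>0. \<forall>z. norm z \<le> 1 \<and> dist z \<zeta> < d \<longrightarrow> \<bar>poisson \<phi> z - \<phi> \<zeta>\<bar> < \<epsilon>"
proof -
  obtain d where d: "d > 0" "\<And>w. norm w = 1 \<Longrightarrow> dist w \<zeta> < d \<Longrightarrow> \<bar>\<phi> w - \<phi> \<zeta>\<bar> < \<epsilon> / 2"
    using c \<zeta> \<open>\<epsilon> > 0\<close> unfolding continuous_on_iff dist_real_def
    by (metis half_gt_zero_iff mem_sphere_0)
  have "compact (\<phi> ` sphere 0 1)" by (intro compact_continuous_image c) auto
  then obtain M where M: "\<And>w. norm w = 1 \<Longrightarrow> \<bar>\<phi> w\<bar> \<le> M"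
    using compact_imp_bounded bounded_iff by (metis image_eqI mem_sphere_0 real_norm_def)
  then have M0: "M \<ge> 0" using \<zeta> abs_ge_zero order_trans by blast
  \<comment> \<open>The affine, hence harmonic, function that equals |w - \<zeta>|^2 on the unit
    circle.\<close>
  define L where "L = (\<lambda>w. 2 - 2 * Re (cnj \<zeta> * w))"
  have L: "L w = (dist w \<zeta>)\<^sup>2" if "norm w = 1" for w
  proof -
    have "(dist w \<zeta>)\<^sup>2 = (norm w)\<^sup>2 + (norm \<zeta>)\<^sup>2 - 2 * Re (cnj \<zeta> * w)"
      unfolding dist_norm cmod_power2 by (simp add: power2_eq_square algebra_simps)
    then show ?thesis using that \<zeta> by (simp add: L_def)
  qed
  \<comment> \<open>At distance d or more from \<zeta> the barrier is at least d^2, so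
    \<open>D * L\<close> reaches the largest possible oscillation 2 * M.\<close>
  define D where "D = 2 * M / d\<^sup>2"
  have D: "D \<ge> 0" using M0 by (simp add: D_def)
  have bd: "\<bar>\<phi> w - \<phi> \<zeta>\<bar> \<le> \<epsilon> / 2 + D * L w" if w: "norm w = 1" for w
  proof (cases "dist w \<zeta> < d")
    case True
    then show ?thesis using d(2)[OF w True] D L[OF w] by (smt (verit) mult_nonneg_nonneg zero_le_power2)
  next
    case False
    then have "d\<^sup>2 \<le> (dist w \<zeta>)\<^sup>2" using d(1) by (intro power_mono) auto
    then have "2 * M \<le> D * L w"
      using M0 d(1) unfolding D_def L[OF w] by (simp add: field_simps mult_left_mono)
    then show ?thesis using M[OF w] M[OF \<zeta>] \<open>\<epsilon> > 0\<close> by linarith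
  qed
  have cL: "continuous_on (sphere 0 1) L" unfolding L_def by (intro continuous_intros)
  have PL: "poisson L z = L z" if "norm z < 1" for z
  proof -
    have "L = (\<lambda>w. Re (2 - 2 * (cnj \<zeta> * w)))" by (simp add: L_def fun_eq_iff)
    then show ?thesis
      using that by (simp only:) (intro poisson_Re_holomorphic continuous_intros holomorphic_intros)
  qed
  have "\<bar>poisson \<phi> z - \<phi> \<zeta>\<bar> \<le> \<epsilon> / 2 + D * L z" if z: "norm z \<le> 1" for z
  proof (cases "norm z < 1")
    case False then show ?thesis using bd[of z] z by (simp add: poisson_def)
  next
    case True
    have c1: "continuous_on (sphere 0 1) (\<lambda>w. \<epsilon> / 2 + D * L w)" by (intro continuous_intros cL)
    have P: "poisson (\<lambda>w. \<epsilon> / 2 + D * L w) z = \<epsilon> / 2 + D * L z"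
      using True by (subst poisson_add) (auto intro!: continuous_intros cL simp: poisson_cmul PL)
    have "poisson (\<lambda>w. \<phi> w - \<phi> \<zeta>) z \<le> poisson (\<lambda>w. \<epsilon> / 2 + D * L w) z"
      using bd z by (intro poisson_mono c1 continuous_intros c) (auto simp: abs_le_iff)
    moreover have "poisson (\<lambda>w. - (\<epsilon> / 2 + D * L w)) z \<le> poisson (\<lambda>w. \<phi> w - \<phi> \<zeta>) z"
      using bd z by (intro poisson_mono continuous_intros c1 c cL) (force simp: abs_le_iff)+
    moreover have "poisson (\<lambda>w. - (\<epsilon> / 2 + D * L w)) z = - (\<epsilon> / 2 + D * L z)"
      using poisson_cmul[of "-1" "\<lambda>w. \<epsilon> / 2 + D * L w" z] P by simp
    moreover have "poisson (\<lambda>w. \<phi> w - \<phi> \<zeta>) z = poisson \<phi> z - \<phi> \<zeta>"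
      using z by (subst poisson_diff) (auto intro!: continuous_intros c)
    ultimately show ?thesis using P by linarith
  qed
  moreover have "\<exists>d>0. \<forall>z. dist z \<zeta> < d \<longrightarrow> D * L z < \<epsilon> / 2"
  proof -
    have "continuous_on UNIV (\<lambda>z. D * L z)" unfolding L_def by (intro continuous_intros)
    then have "isCont (\<lambda>z. D * L z) \<zeta>" by (simp add: continuous_on_eq_continuous_at)
    moreover have "D * L \<zeta> = 0" using L[OF \<zeta>] by simp
    ultimately show ?thesis using \<open>\<epsilon> > 0\<close> unfolding continuous_at_eps_delta dist_real_def
      by (smt (verit) half_gt_zero_iff)
  qed
  ultimately show ?thesis by (smt (verit) field_sum_of_halves)
qed

lemma continuous_on_poisson:
  assumes c: "continuous_on (sphere 0 1) \<phi>"
  shows "continuous_on (cball 0 1) (poisson \<phi>)"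
proof -
  have "\<exists>d>0. \<forall>x'\<in>cball 0 1. dist x' x < d \<longrightarrow> dist (poisson \<phi> x') (poisson \<phi> x) < e"
    if x: "x \<in> cball 0 1" and e: "e > 0" for x e
  proof (cases "norm x < 1")
    case False
    then have n: "norm x = 1" using x by auto
    have "poisson \<phi> x = \<phi> x" using n by (simp add: poisson_def)
    then show ?thesis using poisson_boundary[OF c n e] by (auto simp: dist_real_def)
  next
    case True
    obtain g where g: "g holomorphic_on ball 0 1" "\<And>z. norm z < 1 \<Longrightarrow> poisson \<phi> z = Re (g z)"
      using poisson_holomorphic[OF c] by blast
    then have "continuous_on (ball 0 1) (\<lambda>z. Re (g z))"
      by (intro continuous_intros holomorphic_on_imp_continuous_on)
    then have "continuous_on (ball 0 1) (poisson \<phi>)" using g(2) by (simp cong: continuous_on_cong_simp)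
    then have "isCont (poisson \<phi>) x" using True by (simp add: continuous_on_eq_continuous_at)
    then show ?thesis using e unfolding continuous_at_eps_delta by (metis dist_commute)
  qed
  then show ?thesis unfolding continuous_on_iff by blast
qed

text \<open>Equality case of the mean value inequality. A positive boundary value would make the
  Poisson integral positive nearby, while Harnack's inequality bounds it by a multiple of its value
  at the centre.\<close>

lemma poisson_pos_zero:
  assumes c: "continuous_on (sphere 0 1) \<phi>" and pos: "\<And>w. norm w = 1 \<Longrightarrow> 0 \<le> \<phi> w"
    and "poisson \<phi> 0 \<le> 0" and w: "norm w = 1"
  shows "\<phi> w = 0"
proof (rule ccontr)
  assume "\<phi> w \<noteq> 0"
  then have "\<phi> w > 0" using pos[OF w] by simp
  then obtain d where d: "d > 0" "\<And>z. norm z \<le> 1 \<Longrightarrow> dist z w < d \<Longrightarrow> \<bar>poisson \<phi> z - \<phi> w\<bar> < \<phi> w"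
    using poisson_boundary[OF c w] by blast
  \<comment> \<open>A point on the radius to w, inside the disc and within d of w.\<close>
  define z where "z = of_real (1 - min (1/2) (d/2)) * w"
  have nz: "norm z < 1" unfolding z_def norm_mult norm_of_real using w d(1) by simp
  have "z - w = of_real (- min (1/2) (d/2)) * w" by (simp add: z_def algebra_simps)
  then have "dist z w < d" unfolding dist_norm using w d(1) by (simp add: norm_mult)
  then have "poisson \<phi> z > 0" using d(2)[of z] nz by fastforce
  moreover have "poisson \<phi> 0 \<ge> 0"
    using poisson_mono[of "\<lambda>w. 0" \<phi> 0] c pos by auto
  then have "poisson \<phi> z \<le> 0"
    using poisson_Harnack(2)[OF c pos nz] assms(3) by auto
  ultimately show False by simp
qed

section \<open>Cocycles of increments\<close>

text \<open>A real closed 1-form, or a multivalued function, is represented by its increments \<open>d x y\<close>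
  between nearby points. Only their germs at the diagonal matter, and \<open>prim\<close> plays the role of \<open>d f = d\<close>.\<close>

definition prim :: "'a topology \<Rightarrow> ('a \<Rightarrow> 'a \<Rightarrow> real) \<Rightarrow> ('a \<Rightarrow> real) \<Rightarrow> bool" where
  "prim Y d f \<longleftrightarrow> (\<forall>x\<in>topspace Y. \<exists>N. openin Y N \<and> x \<in> N \<and> (\<forall>y\<in>N. f y - f x = d x y))"

definition cocycle :: "'a topology \<Rightarrow> ('a \<Rightarrow> 'a \<Rightarrow> real) \<Rightarrow> bool" where
  "cocycle Y d \<longleftrightarrow> (\<forall>x\<in>topspace Y. \<exists>N f. openin Y N \<and> x \<in> N \<and> prim (subtopology Y N) d f)"

lemma prim_imp_cocycle: "prim Y d f \<Longrightarrow> cocycle Y d"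
  unfolding cocycle_def by (metis openin_topspace subtopology_topspace)

lemma prim_pullback:
  assumes f: "prim Y d f" and q: "continuous_map Z Y q"
  shows "prim Z (\<lambda>s t. d (q s) (q t)) (\<lambda>s. f (q s))"
  unfolding prim_def
proof
  fix s assume s: "s \<in> topspace Z"
  then have "q s \<in> topspace Y" using q by (meson continuous_map_image_subset_topspace image_subset_iff)
  then obtain N where N: "openin Y N" "q s \<in> N" "\<forall>y\<in>N. f y - f (q s) = d (q s) y"
    using f unfolding prim_def by blast
  let ?N = "{t \<in> topspace Z. q t \<in> N}"
  have "openin Z ?N" using q N(1) by (rule openin_continuous_map_preimage)
  then show "\<exists>N. openin Z N \<and> s \<in> N \<and> (\<forall>t\<in>N. f (q t) - f (q s) = d (q s) (q t))"
    using N(2,3) s by (intro exI[of _ ?N] conjI) blast+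
qed

lemma prim_subtopology: "prim Y d f \<Longrightarrow> prim (subtopology Y S) d f"
  using prim_pullback[of Y d f "subtopology Y S" "\<lambda>x. x"] by (simp add: continuous_map_from_subtopology)

lemma prim_subset: "prim (subtopology Y S) d f \<Longrightarrow> T \<subseteq> S \<Longrightarrow> prim (subtopology Y T) d f"
  using prim_subtopology[of "subtopology Y S" d f T] by (simp add: subtopology_subtopology Int_absorb1)

lemma prim_local:
  assumes "\<And>x. x \<in> topspace Y \<Longrightarrow> \<exists>N. openin Y N \<and> x \<in> N \<and> prim (subtopology Y N) d f"
  shows "prim Y d f"
  unfolding prim_def
proof
  fix x assume "x \<in> topspace Y"
  then obtain N where N: "openin Y N" "x \<in> N" "prim (subtopology Y N) d f" using assms by blast
  have "x \<in> topspace (subtopology Y N)" using N openin_subset by auto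
  then obtain M where M: "openin (subtopology Y N) M" "x \<in> M" "\<forall>y\<in>M. f y - f x = d x y"
    using N(3) unfolding prim_def by blast
  then show "\<exists>N. openin Y N \<and> x \<in> N \<and> (\<forall>y\<in>N. f y - f x = d x y)"
    using N(1) openin_trans_full by blast
qed

lemma prim_cong:
  assumes "prim Y d f" "\<And>x. x \<in> topspace Y \<Longrightarrow> f x = g x"
    "\<And>x y. x \<in> topspace Y \<Longrightarrow> y \<in> topspace Y \<Longrightarrow> d x y = d' x y"
  shows "prim Y d' g"
  unfolding prim_def
proof
  fix x assume x: "x \<in> topspace Y"
  then obtain N where N: "openin Y N" "x \<in> N" "\<forall>y\<in>N. f y - f x = d x y"
    using assms(1) unfolding prim_def by blast
  then have "N \<subseteq> topspace Y" using openin_subset by blast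
  then have "\<forall>y\<in>N. g y - g x = d' x y" using N(3) assms(2)[symmetric] assms(3)[symmetric] x by (simp add: subset_iff)
  then show "\<exists>N. openin Y N \<and> x \<in> N \<and> (\<forall>y\<in>N. g y - g x = d' x y)" using N by blast
qed

lemma prim_shift: "prim Y d f \<Longrightarrow> prim Y d (\<lambda>x. f x + c)"
  unfolding prim_def by simp

lemma prim_zero: "prim Y (\<lambda>x y. 0) (\<lambda>x. c)"
  unfolding prim_def by force

lemma prim_add:
  assumes "prim Y d f" "prim Y d' f'"
  shows "prim Y (\<lambda>x y. d x y + d' x y) (\<lambda>x. f x + f' x)"
  unfolding prim_def
proof
  fix x assume "x \<in> topspace Y"
  then obtain N N' where N: "openin Y N" "x \<in> N" "\<forall>y\<in>N. f y - f x = d x y"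
    "openin Y N'" "x \<in> N'" "\<forall>y\<in>N'. f' y - f' x = d' x y"
    using assms unfolding prim_def by meson
  have "f y + f' y - (f x + f' x) = d x y + d' x y" if "y \<in> N \<inter> N'" for y
  proof -
    have "f y - f x = d x y" "f' y - f' x = d' x y" using that N(3,6) by blast+
    then show ?thesis by linarith
  qed
  then show "\<exists>N. openin Y N \<and> x \<in> N \<and> (\<forall>y\<in>N. f y + f' y - (f x + f' x) = d x y + d' x y)"
    using N by (intro exI[of _ "N \<inter> N'"] conjI openin_Int) blast+
qed

lemma prim_cmul: "prim Y d f \<Longrightarrow> prim Y (\<lambda>x y. c * d x y) (\<lambda>x. c * f x)"
  unfolding prim_def by (metis right_diff_distrib)

lemma prim_diff:
  "prim Y d f \<Longrightarrow> prim Y d' f' \<Longrightarrow> prim Y (\<lambda>x y. d x y - d' x y) (\<lambda>x. f x - f' x)"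
  using prim_add[OF _ prim_cmul[of Y d' f' "-1"], of d f] by simp

lemma prim_sum:
  assumes "finite I" "\<And>i. i \<in> I \<Longrightarrow> prim Y (d i) (f i)"
  shows "prim Y (\<lambda>x y. \<Sum>i\<in>I. d i x y) (\<lambda>x. \<Sum>i\<in>I. f i x)"
  using assms by (induction I) (auto intro: prim_zero prim_add)

lemma cocycle_pullback:
  assumes d: "cocycle Y d" and q: "continuous_map Z Y q"
  shows "cocycle Z (\<lambda>s t. d (q s) (q t))"
  unfolding cocycle_def
proof
  fix s assume s: "s \<in> topspace Z"
  then have "q s \<in> topspace Y" using q by (meson continuous_map_image_subset_topspace image_subset_iff)
  then obtain N f where N: "openin Y N" "q s \<in> N" "prim (subtopology Y N) d f"
    using d unfolding cocycle_def by blast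
  let ?N = "{t \<in> topspace Z. q t \<in> N}"
  have o: "openin Z ?N" using q N(1) by (rule openin_continuous_map_preimage)
  have "continuous_map (subtopology Z ?N) (subtopology Y N) q"
    using q by (auto simp: continuous_map_in_subtopology continuous_map_from_subtopology)
  from prim_pullback[OF N(3) this] o N s
  show "\<exists>N f. openin Z N \<and> s \<in> N \<and> prim (subtopology Z N) (\<lambda>s t. d (q s) (q t)) f"
    by (intro exI[of _ ?N]) auto
qed

lemma cocycle_subtopology: "cocycle Y d \<Longrightarrow> cocycle (subtopology Y S) d"
  using cocycle_pullback[of Y d "subtopology Y S" "\<lambda>x. x"] by (simp add: continuous_map_from_subtopology)

lemma cocycle_add:
  assumes "cocycle Y d" "cocycle Y d'"
  shows "cocycle Y (\<lambda>x y. d x y + d' x y)"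
  unfolding cocycle_def
proof
  fix x assume "x \<in> topspace Y"
  then obtain N N' f f' where N: "openin Y N" "x \<in> N" "prim (subtopology Y N) d f"
    "openin Y N'" "x \<in> N'" "prim (subtopology Y N') d' f'"
    using assms unfolding cocycle_def by meson
  have "prim (subtopology Y (N \<inter> N')) (\<lambda>x y. d x y + d' x y) (\<lambda>x. f x + f' x)"
    by (intro prim_add prim_subset[OF N(3)] prim_subset[OF N(6)]) auto
  then show "\<exists>N f. openin Y N \<and> x \<in> N \<and> prim (subtopology Y N) (\<lambda>x y. d x y + d' x y) f"
    using N by (meson IntI openin_Int)
qed

lemma cocycle_cmul:
  assumes "cocycle Y d" shows "cocycle Y (\<lambda>x y. c * d x y)"
  unfolding cocycle_def
proof
  fix x assume "x \<in> topspace Y"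
  then obtain N f where N: "openin Y N" "x \<in> N" "prim (subtopology Y N) d f"
    using assms unfolding cocycle_def by blast
  then show "\<exists>N f. openin Y N \<and> x \<in> N \<and> prim (subtopology Y N) (\<lambda>x y. c * d x y) f"
    using prim_cmul[OF N(3), of c] by blast
qed

lemma cocycle_diff:
  "cocycle Y d \<Longrightarrow> cocycle Y d' \<Longrightarrow> cocycle Y (\<lambda>x y. d x y - d' x y)"
  using cocycle_add[OF _ cocycle_cmul[of Y d' "-1"], of d] by simp

lemma cocycle_sum:
  assumes "finite I" "\<And>i. i \<in> I \<Longrightarrow> cocycle Y (d i)"
  shows "cocycle Y (\<lambda>x y. \<Sum>i\<in>I. d i x y)"
  using assms by (induction I) (auto intro: prim_imp_cocycle[OF prim_zero] cocycle_add)

text \<open>Two primitives of the same increments differ by a locally constant function, so every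
  condition on the difference is open. Used for a value and for its complement, this yields
  uniqueness on connected spaces.\<close>

lemma prim_unique_local:
  assumes "prim Y d f" "prim Y d g"
  shows "openin Y {y \<in> topspace Y. P (f y - g y)}"
proof (subst openin_subopen, clarify)
  fix x assume x: "x \<in> topspace Y" "P (f x - g x)"
  then obtain N N' where N: "openin Y N" "x \<in> N" "\<forall>y\<in>N. f y - f x = d x y"
    "openin Y N'" "x \<in> N'" "\<forall>y\<in>N'. g y - g x = d x y"
    using assms unfolding prim_def by meson
  have "N \<inter> N' \<subseteq> {y \<in> topspace Y. P (f y - g y)}"
  proof
    fix y assume y: "y \<in> N \<inter> N'"
    then have "f y - f x = d x y" "g y - g x = d x y" using N(3,6) by blast+
    then have "f y - g y = f x - g x" by linarith
    then show "y \<in> {y \<in> topspace Y. P (f y - g y)}" using x y N(1) openin_subset by fastforce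
  qed
  then show "\<exists>T. openin Y T \<and> x \<in> T \<and> T \<subseteq> {y \<in> topspace Y. P (f y - g y)}"
    using N by (intro exI[of _ "N \<inter> N'"] conjI openin_Int) blast+
qed

lemma prim_unique:
  assumes Y: "connected_space Y" and "prim Y d f" "prim Y d g" and x: "x \<in> topspace Y" "y \<in> topspace Y"
  shows "f y - g y = f x - g x"
proof (rule ccontr)
  assume *: "f y - g y \<noteq> f x - g x"
  note o = prim_unique_local[OF assms(2,3)]
  show False using Y unfolding connected_space_def
    using o[of "\<lambda>t. t = f x - g x"] o[of "\<lambda>t. t \<noteq> f x - g x"] * x by blast
qed

lemma prim_unique_connectedin:
  assumes "connectedin Y S" "prim (subtopology Y S) d f" "prim (subtopology Y S) d g" "x \<in> S" "y \<in> S"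
  shows "f y - g y = f x - g x"
proof -
  have "connected_space (subtopology Y S)" "S \<subseteq> topspace Y"
    using assms(1) by (auto simp: connectedin_def)
  then show ?thesis using prim_unique[of "subtopology Y S" d f g x y] assms by auto
qed

lemma prim_closed_union:
  assumes A: "closedin Y A" and B: "closedin Y B" and AB: "topspace Y \<subseteq> A \<union> B"
    and f: "prim (subtopology Y A) d f" and g: "prim (subtopology Y B) d f"
  shows "prim Y d f"
proof -
  have *: "\<exists>N. openin Y N \<and> x \<in> N \<and> (\<forall>y\<in>N \<inter> A. f y - f x = d x y)"
    if A: "closedin Y A" and f: "prim (subtopology Y A) d f" and x: "x \<in> topspace Y" for A x
  proof (cases "x \<in> A")
    case True
    then obtain N where "openin (subtopology Y A) N" "x \<in> N" "\<forall>y\<in>N. f y - f x = d x y"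
      using f x unfolding prim_def by auto
    then show ?thesis unfolding openin_subtopology by blast
  next
    case False
    then show ?thesis using A x by (intro exI[of _ "topspace Y - A"]) auto
  qed
  show ?thesis unfolding prim_def
  proof
    fix x assume x: "x \<in> topspace Y"
    obtain N M where N: "openin Y N" "x \<in> N" "\<forall>y\<in>N \<inter> A. f y - f x = d x y"
      and M: "openin Y M" "x \<in> M" "\<forall>y\<in>M \<inter> B. f y - f x = d x y"
      using *[OF A f x] *[OF B g x] by blast
    moreover have "N \<subseteq> A \<union> B" using AB N(1) openin_subset by blast
    ultimately show "\<exists>N. openin Y N \<and> x \<in> N \<and> (\<forall>y\<in>N. f y - f x = d x y)"
      by (intro exI[of _ "N \<inter> M"]) auto
  qed
qed

lemma prim_glue:
  assumes A: "closedin Y A" and B: "closedin Y B" and AB: "topspace Y \<subseteq> A \<union> B"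
    and f: "prim (subtopology Y A) d f" and g: "prim (subtopology Y B) d g"
    and eq: "\<And>x. x \<in> A \<inter> B \<Longrightarrow> f x = g x"
  shows "prim Y d (\<lambda>x. if x \<in> A then f x else g x)"
  by (rule prim_closed_union[OF A B AB]) (auto intro: prim_cong[OF f] prim_cong[OF g] simp: eq)

text \<open>On a connected overlap the two primitives differ by a single constant, which shifts one
  of them onto the other.\<close>

lemma prim_glue_connected:
  assumes A: "closedin Y A" and B: "closedin Y B" and AB: "topspace Y \<subseteq> A \<union> B"
    and f: "prim (subtopology Y A) d f" and g: "prim (subtopology Y B) d g"
    and con: "connectedin Y (A \<inter> B)"
  shows "\<exists>h. prim Y d h"
proof (cases "A \<inter> B = {}")
  case True
  then show ?thesis using prim_glue[OF A B AB f g] by auto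
next
  case False
  then obtain x where x: "x \<in> A \<inter> B" by auto
  have "g y + (f x - g x) = f y" if "y \<in> A \<inter> B" for y
    using prim_unique_connectedin[OF con prim_subset[OF f] prim_subset[OF g] x that] by auto
  then show ?thesis
    using prim_glue[OF A B AB f prim_shift[OF g, of "f x - g x"]] by fastforce
qed

text \<open>The increments on \<open>Z\<close> alone give no neighbourhoods in \<open>Y\<close>. But
  f differs from a local primitive \<open>u\<close> on \<open>Y\<close> by a function that is
  locally constant after pullback, and the quotient map carries the openness of its level sets
  down.\<close>

lemma prim_quotient:
  assumes q: "quotient_map Z Y q" and d: "cocycle Y d"
    and f: "prim Z (\<lambda>s t. d (q s) (q t)) (\<lambda>s. f (q s))"
  shows "prim Y d f"
proof (rule prim_local)
  fix x assume "x \<in> topspace Y"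
  then obtain N u where N: "openin Y N" "x \<in> N" "prim (subtopology Y N) d u"
    using d unfolding cocycle_def by blast
  define N' where "N' = {s \<in> topspace Z. q s \<in> N}"
  have q': "quotient_map (subtopology Z N') (subtopology Y N) q"
    unfolding N'_def by (rule quotient_map_restriction[OF q]) (use N in auto)
  then have c: "continuous_map (subtopology Z N') (subtopology Y N) q"
    by (rule quotient_imp_continuous_map)
  have o: "openin (subtopology Y N) {y \<in> N. f y - u y = c}" for c
  proof -
    have "openin (subtopology Z N') {s \<in> topspace (subtopology Z N'). f (q s) - u (q s) = c}"
      by (rule prim_unique_local[OF prim_subtopology[OF f] prim_pullback[OF N(3) c]])
    moreover have "{s \<in> topspace (subtopology Z N'). f (q s) - u (q s) = c}
        = {s \<in> topspace (subtopology Z N'). q s \<in> {y \<in> N. f y - u y = c}}"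
      by (auto simp: N'_def)
    moreover have "{y \<in> N. f y - u y = c} \<subseteq> topspace (subtopology Y N)"
      using openin_subset[OF N(1)] by auto
    ultimately show ?thesis
      using q'[unfolded quotient_map_def, THEN conjunct2, rule_format, of "{y \<in> N. f y - u y = c}"]
      by simp
  qed
  have "prim (subtopology Y N) d f" unfolding prim_def
  proof
    fix x assume x: "x \<in> topspace (subtopology Y N)"
    then obtain M where M: "openin (subtopology Y N) M" "x \<in> M" "\<forall>y\<in>M. u y - u x = d x y"
      using N(3) unfolding prim_def by blast
    let ?S = "{y \<in> N. f y - u y = f x - u x}"
    have "openin (subtopology Y N) (M \<inter> ?S)" using M o by (intro openin_Int)
    moreover have "\<forall>y\<in>M \<inter> ?S. f y - f x = d x y" using M by (smt (verit) IntE mem_Collect_eq)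
    moreover have "x \<in> M \<inter> ?S" using M x by auto
    ultimately show "\<exists>N'. openin (subtopology Y N) N' \<and> x \<in> N' \<and> (\<forall>y\<in>N'. f y - f x = d x y)"
      by blast
  qed
  then show "\<exists>N. openin Y N \<and> x \<in> N \<and> prim (subtopology Y N) d f" using N by blast
qed

text \<open>Subtracting the value at one base point makes the primitives on the nested connected
  sets extend each other.\<close>

lemma prim_exhaust:
  fixes S :: "nat \<Rightarrow> 'a set"
  assumes mono: "\<And>m n. m \<le> n \<Longrightarrow> S m \<subseteq> S n"
    and cov: "\<And>x. x \<in> topspace Y \<Longrightarrow> \<exists>n N. openin Y N \<and> x \<in> N \<and> N \<subseteq> S n"
    and con: "\<And>n. connectedin Y (S n)"
    and ex: "\<And>n. \<exists>f. prim (subtopology Y (S n)) d f"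
  shows "\<exists>f. prim Y d f"
proof (cases "topspace Y = {}")
  case True then show ?thesis by (auto simp: prim_def)
next
  case False
  then obtain x0 n0 where x0: "x0 \<in> S n0" using cov by blast
  obtain f where f: "\<And>n. prim (subtopology Y (S n)) d (f n)" using ex by metis
  define h where "h = (\<lambda>n x. f n x - f n x0)"
  have h: "prim (subtopology Y (S n)) d (h n)" for n
    unfolding h_def using prim_shift[OF f, of n "- f n x0"] by simp
  have eq: "h m x = h n x" if "n0 \<le> n" "n \<le> m" "x \<in> S n" for m n x
  proof -
    have "h m x - h n x = h m x0 - h n x0"
      by (rule prim_unique_connectedin[OF con prim_subset[OF h] h])
        (use mono[OF that(1)] mono[OF that(2)] that x0 in auto)
    then show ?thesis by (simp add: h_def)
  qed
  \<comment> \<open>Every stage from n0 on that contains x gives the same value; the least one is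
    merely a choice.\<close>
  define F where "F = (\<lambda>x. h (LEAST n. n0 \<le> n \<and> x \<in> S n) x)"
  have F: "F x = h n x" if "n0 \<le> n" "x \<in> S n" for n x
  proof -
    define m where "m = (LEAST n. n0 \<le> n \<and> x \<in> S n)"
    have "n0 \<le> m \<and> x \<in> S m" unfolding m_def by (rule LeastI[of _ n]) (use that in auto)
    moreover have "m \<le> n" unfolding m_def by (rule Least_le) (use that in auto)
    ultimately show ?thesis using eq[of m n x] unfolding F_def m_def[symmetric] by simp
  qed
  have "prim Y d F"
  proof (rule prim_local)
    fix x assume "x \<in> topspace Y"
    then obtain n N where N: "openin Y N" "x \<in> N" "N \<subseteq> S n" using cov by blast
    define m where "m = max n n0"
    have "N \<subseteq> S m" using N(3) mono[of n m] by (auto simp: m_def)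
    then have "prim (subtopology Y N) d F"
      by (intro prim_cong[OF prim_subset[OF h[of m]]]) (use F[of m] in \<open>auto simp: m_def subset_iff\<close>)
    then show "\<exists>N. openin Y N \<and> x \<in> N \<and> prim (subtopology Y N) d F" using N by blast
  qed
  then show ?thesis by blast
qed

section \<open>Exactness of cocycles on the plane and its retracts\<close>

definition rect :: "real \<Rightarrow> real \<Rightarrow> real \<Rightarrow> real \<Rightarrow> complex set" where
  "rect a b c d = {z. a \<le> Re z \<and> Re z \<le> b \<and> c \<le> Im z \<and> Im z \<le> d}"

lemma rect_cbox: "rect a b c d = cbox (Complex a c) (Complex b d)"
  by (auto simp: rect_def in_cbox_complex_iff)

lemma prim_rect_glue:
  fixes A B :: "complex set"
  assumes "prim (top_of_set A) \<delta> f" "prim (top_of_set B) \<delta> g"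
    and "closed A" "closed B" "convex A" "convex B"
  shows "\<exists>f. prim (top_of_set (A \<union> B)) \<delta> f"
proof (rule prim_glue_connected[of _ A B])
  show "closedin (top_of_set (A \<union> B)) A" "closedin (top_of_set (A \<union> B)) B"
    using assms by (auto intro!: closed_subset)
  show "connectedin (top_of_set (A \<union> B)) (A \<inter> B)"
    using convex_connected[OF convex_Int[OF assms(5,6)]] by (auto simp: connectedin_subtopology)
  show "prim (subtopology (top_of_set (A \<union> B)) A) \<delta> f" "prim (subtopology (top_of_set (A \<union> B)) B) \<delta> g"
    using assms by (simp_all add: subtopology_subtopology Int_absorb1 Un_Int_eq)
qed simp

text \<open>Bisection in both directions: exactness passes to the union of two adjacent rectangles
  because their intersection is convex, and the cocycle condition settles small rectangles around a
  point.\<close>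

lemma exact_rect:
  assumes co: "cocycle euclidean \<delta>" and ab: "a \<le> b" "c \<le> d"
  shows "\<exists>f. prim (top_of_set (rect a b c d)) \<delta> f"
  using ab(1)
proof (induction rule: Bolzano)
  case (trans a b e)
  then obtain f g where "prim (top_of_set (rect a b c d)) \<delta> f" "prim (top_of_set (rect b e c d)) \<delta> g" by blast
  from prim_rect_glue[OF this] have "\<exists>f. prim (top_of_set (rect a b c d \<union> rect b e c d)) \<delta> f"
    by (simp add: rect_cbox closed_cbox)
  moreover have "rect a b c d \<union> rect b e c d = rect a e c d" using trans by (auto simp: rect_def)
  ultimately show ?case by simp
next
  case (local x)
  \<comment> \<open>The width r has to serve the full height from c to d; a second bisection, now in
    the vertical direction, takes the place of a compactness argument.\<close>
  have "\<exists>r>0. \<forall>a b. a \<le> x \<and> x \<le> b \<and> b - a < r \<longrightarrow> (\<exists>f. prim (top_of_set (rect a b c d)) \<delta> f)"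
    using ab(2)
  proof (induction rule: Bolzano)
    case (trans c d e)
    then obtain r s where r: "r > 0" "\<And>a b. a \<le> x \<and> x \<le> b \<and> b - a < r \<Longrightarrow> (\<exists>f. prim (top_of_set (rect a b c d)) \<delta> f)"
      and s: "s > 0" "\<And>a b. a \<le> x \<and> x \<le> b \<and> b - a < s \<Longrightarrow> (\<exists>f. prim (top_of_set (rect a b d e)) \<delta> f)"
      by blast
    have "\<exists>f. prim (top_of_set (rect a b c e)) \<delta> f" if "a \<le> x" "x \<le> b" "b - a < min r s" for a b
    proof -
      have "\<exists>f. prim (top_of_set (rect a b c d)) \<delta> f" "\<exists>g. prim (top_of_set (rect a b d e)) \<delta> g"
        using that by (auto intro!: r(2) s(2))
      then obtain f g where "prim (top_of_set (rect a b c d)) \<delta> f" "prim (top_of_set (rect a b d e)) \<delta> g"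
        by blast
      from prim_rect_glue[OF this] have "\<exists>f. prim (top_of_set (rect a b c d \<union> rect a b d e)) \<delta> f"
        by (simp add: rect_cbox closed_cbox)
      moreover have "rect a b c d \<union> rect a b d e = rect a b c e" using trans by (auto simp: rect_def)
      ultimately show ?thesis by simp
    qed
    then show ?case using r(1) s(1) by (intro exI[of _ "min r s"] conjI allI impI) (simp, blast)
  next
    case (local y)
    obtain N f where "open N" "Complex x y \<in> N" and f: "prim (top_of_set N) \<delta> f"
      using co[unfolded cocycle_def, rule_format, of "Complex x y"] open_openin by (metis UNIV_I topspace_euclidean)
    then obtain r where r: "r > 0" "ball (Complex x y) r \<subseteq> N" unfolding open_contains_ball by blast
    \<comment> \<open>Sides shorter than r/2 keep every point within r of the centre, by |z| \<le>
      |Re z| + |Im z|.\<close>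
    have "\<exists>f. prim (top_of_set (rect a b c d)) \<delta> f"
      if "a \<le> x" "x \<le> b" "b - a < r/2" "c \<le> y" "y \<le> d" "d - c < r/2" for a b c d
    proof -
      have "rect a b c d \<subseteq> N"
      proof
        fix z assume "z \<in> rect a b c d"
        then have "\<bar>Re (z - Complex x y)\<bar> < r/2" "\<bar>Im (z - Complex x y)\<bar> < r/2"
          using that unfolding rect_def mem_Collect_eq complex.sel minus_complex.sel by linarith+
        then have "norm (z - Complex x y) < r" using cmod_le[of "z - Complex x y"] by linarith
        then have "z \<in> ball (Complex x y) r" by (simp add: dist_norm norm_minus_commute)
        then show "z \<in> N" using r(2) by blast
      qed
      from prim_subset[OF f this] show ?thesis by blast
    qed
    then show ?case using r(1) by (intro exI[of _ "r/2"] conjI allI impI exI[of _ "r/2"]) auto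
  qed
  then show ?case .
qed

lemma exact_complex:
  fixes d :: "complex \<Rightarrow> complex \<Rightarrow> real"
  assumes "cocycle euclidean d"
  shows "\<exists>f. prim euclidean d f"
proof (rule prim_exhaust[of "\<lambda>n. rect (- real n) (real n) (- real n) (real n)"])
  show "\<exists>n N. openin euclidean N \<and> x \<in> N \<and> N \<subseteq> rect (- real n) (real n) (- real n) (real n)"
    if "x \<in> topspace euclidean" for x :: complex
  proof -
    obtain n where n: "norm x + 1 < real n" using reals_Archimedean2 by blast
    have "ball x 1 \<subseteq> rect (- real n) (real n) (- real n) (real n)"
    proof
      fix z assume "z \<in> ball x 1"
      then have "norm z < real n" using n norm_triangle_ineq2[of z x] by (auto simp: dist_norm norm_minus_commute)
      then show "z \<in> rect (- real n) (real n) (- real n) (real n)"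
        using abs_Re_le_cmod[of z] abs_Im_le_cmod[of z] by (auto simp: rect_def)
    qed
    then show ?thesis by (intro exI[of _ n] exI[of _ "ball x 1"]) auto
  qed
  show "\<exists>f. prim (top_of_set (rect (- real n) (real n) (- real n) (real n))) d f" for n
    by (rule exact_rect[OF assms]) auto
  show "rect (- real m) (real m) (- real m) (real m) \<subseteq> rect (- real n) (real n) (- real n) (real n)"
    if "m \<le> n" for m n
    using that by (auto simp: rect_def)
qed (simp add: rect_cbox convex_connected)

text \<open>Through \<open>s\<close> and \<open>q\<close> the space is a retract of the plane. The
  pulled back cocycle has a primitive on the plane, and its restriction along \<open>s\<close> is a
  primitive of d, because \<open>q (s y)\<close> is y again.\<close>

lemma exact_retract:
  fixes s :: "'a \<Rightarrow> complex"
  assumes d: "cocycle Y d" and s: "continuous_map Y euclidean s" and q: "continuous_map euclidean Y q"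
    and qs: "\<And>y. y \<in> topspace Y \<Longrightarrow> q (s y) = y"
  shows "\<exists>f. prim Y d f"
proof -
  obtain f where f: "prim euclidean (\<lambda>s t. d (q s) (q t)) f"
    using exact_complex[OF cocycle_pullback[OF d q]] by blast
  have "prim Y d (\<lambda>y. f (s y))"
    by (rule prim_cong[OF prim_pullback[OF f s]]) (auto simp: qs)
  then show ?thesis by blast
qed

text \<open>The increments of \<open>arg F\<close>, for a map \<open>F\<close> into the unit circle.\<close>

definition dlog :: "('a \<Rightarrow> complex) \<Rightarrow> 'a \<Rightarrow> 'a \<Rightarrow> real" where
  "dlog F x y = Im (Ln (F y / F x))"

lemma prim_dlog:
  assumes \<theta>: "continuous_map Y euclideanreal \<theta>" and F: "\<And>x. x \<in> topspace Y \<Longrightarrow> F x = cis (\<theta> x)"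
  shows "prim Y (dlog F) \<theta>"
  unfolding prim_def
proof
  fix x assume x: "x \<in> topspace Y"
  \<comment> \<open>Within \<pi> of \<theta> x the principal logarithm returns the true difference
    of the angles.\<close>
  let ?N = "{y \<in> topspace Y. \<theta> y \<in> {\<theta> x - pi<..<\<theta> x + pi}}"
  have "openin Y ?N" by (rule openin_continuous_map_preimage[OF \<theta>]) auto
  moreover have "\<theta> y - \<theta> x = dlog F x y" if "y \<in> ?N" for y
  proof -
    have "F y / F x = exp (\<i> * of_real (\<theta> y - \<theta> x))"
      using that x F by (auto simp: cis_conv_exp exp_diff right_diff_distrib)
    then show ?thesis using that unfolding dlog_def
      by (subst \<open>F y / F x = _\<close>, subst Ln_exp) auto
  qed
  ultimately show "\<exists>N. openin Y N \<and> x \<in> N \<and> (\<forall>y\<in>N. \<theta> y - \<theta> x = dlog F x y)"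
    using x pi_gt_zero by (intro exI[of _ ?N]) auto
qed

lemma cocycle_dlog:
  assumes F: "continuous_map Y euclidean F" "\<And>x. x \<in> topspace Y \<Longrightarrow> norm (F x) = 1"
  shows "cocycle Y (dlog F)"
  unfolding cocycle_def
proof
  fix x assume x: "x \<in> topspace Y"
  have Fx: "F x \<noteq> 0" using F(2)[OF x] by auto
  \<comment> \<open>On the right half plane the principal logarithm is continuous, so it provides a
    branch of the argument near x.\<close>
  let ?N = "{y \<in> topspace Y. F y / F x \<in> {z. Re z > 0}}"
  have "continuous_on UNIV (\<lambda>w. w / F x)" using Fx by (intro continuous_intros) auto
  then have cq: "continuous_map Y euclidean (\<lambda>y. F y / F x)"
    using continuous_map_compose[OF F(1), of euclidean "\<lambda>w. w / F x"] by (simp add: o_def)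
  have o: "openin Y ?N"
    by (rule openin_continuous_map_preimage[OF cq]) (auto simp: open_halfspace_Re_gt)
  have "continuous_on {z. Re z > 0} (\<lambda>w. Arg (F x) + Im (Ln w))"
    by (intro continuous_intros) (auto simp: complex_nonpos_Reals_iff)
  moreover have "continuous_map (subtopology Y ?N) (top_of_set {z. Re z > 0}) (\<lambda>y. F y / F x)"
    using cq by (auto simp: continuous_map_in_subtopology continuous_map_from_subtopology)
  ultimately have c: "continuous_map (subtopology Y ?N) euclideanreal (\<lambda>y. Arg (F x) + Im (Ln (F y / F x)))"
    using continuous_map_compose[of "subtopology Y ?N" "top_of_set {z. Re z > 0}" "\<lambda>y. F y / F x" euclideanreal "\<lambda>w. Arg (F x) + Im (Ln w)"]
    by (simp add: o_def)
  have "prim (subtopology Y ?N) (dlog F) (\<lambda>y. Arg (F x) + Im (Ln (F y / F x)))"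
  proof (rule prim_dlog[OF c])
    fix y assume y: "y \<in> topspace (subtopology Y ?N)"
    have n: "norm (F y / F x) = 1" using y x F(2) by (auto simp: norm_divide)
    then have "F y / F x \<noteq> 0" by auto
    then have "cis (Im (Ln (F y / F x))) = F y / F x"
      using cis_Arg[of "F y / F x"] Arg_eq_Im_Ln[of "F y / F x"] n by (simp only: sgn_div_norm) simp
    moreover have "cis (Arg (F x)) = F x" using cis_Arg[OF Fx] F(2)[OF x] by (simp add: sgn_div_norm)
    ultimately show "F y = cis (Arg (F x) + Im (Ln (F y / F x)))"
      using Fx by (simp add: cis_mult[symmetric])
  qed
  then show "\<exists>N f. openin Y N \<and> x \<in> N \<and> prim (subtopology Y N) (dlog F) f"
    using o x Fx by (intro exI[of _ ?N]) auto
qed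

section \<open>Subharmonic and harmonic multivalued functions\<close>

lemma continuous_map_glue:
  assumes A: "closedin X A" and B: "closedin X B" and AB: "topspace X \<subseteq> A \<union> B"
    and f: "continuous_map (subtopology X A) Y f" and g: "continuous_map (subtopology X B) Y g"
    and eq: "\<And>x. x \<in> A \<Longrightarrow> x \<in> B \<Longrightarrow> f x = g x"
  shows "continuous_map X Y (\<lambda>x. if x \<in> A then f x else g x)"
  unfolding continuous_map_closedin
proof (intro conjI allI impI)
  have "f \<in> topspace (subtopology X A) \<rightarrow> topspace Y" "g \<in> topspace (subtopology X B) \<rightarrow> topspace Y"
    using f g continuous_map_funspace by blast+
  then show "(\<lambda>x. if x \<in> A then f x else g x) \<in> topspace X \<rightarrow> topspace Y"
    using AB unfolding Pi_iff topspace_subtopology by auto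
  fix C assume "closedin Y C"
  from closedin_continuous_map_preimage[OF f this] closedin_continuous_map_preimage[OF g this]
  have "closedin X {x \<in> topspace (subtopology X A). f x \<in> C}"
     "closedin X {x \<in> topspace (subtopology X B). g x \<in> C}"
    using A B closedin_trans_full by blast+
  then have "closedin X ({x \<in> topspace (subtopology X A). f x \<in> C} \<union> {x \<in> topspace (subtopology X B). g x \<in> C})"
    by (rule closedin_Un)
  moreover have "{x \<in> topspace X. (if x \<in> A then f x else g x) \<in> C} =
    {x \<in> topspace (subtopology X A). f x \<in> C} \<union> {x \<in> topspace (subtopology X B). g x \<in> C}"
    using AB eq by auto
  ultimately show "closedin X {x \<in> topspace X. (if x \<in> A then f x else g x) \<in> C}" by simp
qed

definition coord :: "(complex \<Rightarrow> 'a) \<Rightarrow> 'a \<Rightarrow> complex" where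
  "coord e = the_inv_into (cball 0 1) e"

text \<open>All that the analysis needs from a Riemann surface is its family \<open>E\<close> of closed coordinate discs.\<close>

locale disc_surface =
  fixes X :: "'a topology" and E :: "(complex \<Rightarrow> 'a) set"
  assumes compact: "compact_space X" and connected: "connected_space X" and Hausdorff: "Hausdorff_space X"
    and disc_cont: "e \<in> E \<Longrightarrow> continuous_map (top_of_set (cball 0 1)) X e"
    and disc_inj: "e \<in> E \<Longrightarrow> inj_on e (cball 0 1)"
    and disc_open: "e \<in> E \<Longrightarrow> open S \<Longrightarrow> S \<subseteq> ball 0 1 \<Longrightarrow> openin X (e ` S)"
    and disc_ex: "openin X U \<Longrightarrow> x \<in> U \<Longrightarrow> \<exists>e\<in>E. e 0 = x \<and> e ` cball 0 1 \<subseteq> U"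
    and disc_sub: "e \<in> E \<Longrightarrow> 0 < r \<Longrightarrow> cball c r \<subseteq> cball 0 1 \<Longrightarrow> (\<lambda>w. e (c + of_real r * w)) \<in> E"
    and disc_trans: "e \<in> E \<Longrightarrow> e' \<in> E \<Longrightarrow> e' ` cball 0 1 \<subseteq> e ` ball 0 1 \<Longrightarrow>
      (\<lambda>w. coord e (e' w)) holomorphic_on ball 0 1"
begin

abbreviation contX :: "('a \<Rightarrow> real) \<Rightarrow> bool" where
  "contX b \<equiv> continuous_map X euclideanreal b"

definition circle_map :: "('a \<Rightarrow> complex) \<Rightarrow> bool" where
  "circle_map F \<longleftrightarrow> continuous_map X euclidean F \<and> (\<forall>x\<in>topspace X. norm (F x) = 1)"

text \<open>The multivalued function under study is \<open>arg F + b\<close>; on a disc \<open>e\<close> it has the branch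
  \<open>val F b e\<close>, determined up to a constant. Taking \<open>F = 1\<close> gives ordinary functions, up to a constant on each disc.\<close>

definition lift :: "('a \<Rightarrow> complex) \<Rightarrow> (complex \<Rightarrow> 'a) \<Rightarrow> complex \<Rightarrow> real" where
  "lift F e = (SOME \<phi>. continuous_on (cball 0 1) \<phi> \<and> (\<forall>w\<in>cball 0 1. F (e w) = cis (\<phi> w)))"

definition val :: "('a \<Rightarrow> complex) \<Rightarrow> ('a \<Rightarrow> real) \<Rightarrow> (complex \<Rightarrow> 'a) \<Rightarrow> complex \<Rightarrow> real" where
  "val F b e w = lift F e w + b (e w)"

text \<open>The Poisson kernel at 0 is 1, so this is the average over the circle of radius r. The
  additive constant hidden in \<open>val\<close> cancels in every comparison with
  \<open>val F b e 0\<close>.\<close>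

definition mean :: "('a \<Rightarrow> complex) \<Rightarrow> ('a \<Rightarrow> real) \<Rightarrow> (complex \<Rightarrow> 'a) \<Rightarrow> real \<Rightarrow> real" where
  "mean F b e r = poisson (\<lambda>w. val F b e (of_real r * w)) 0"

definition sub :: "('a \<Rightarrow> complex) \<Rightarrow> 'a set \<Rightarrow> ('a \<Rightarrow> real) \<Rightarrow> bool" where
  "sub F V b \<longleftrightarrow> (\<forall>e\<in>E. e ` cball 0 1 \<subseteq> V \<longrightarrow> (\<forall>r. 0 < r \<and> r < 1 \<longrightarrow> val F b e 0 \<le> mean F b e r))"

definition super :: "('a \<Rightarrow> complex) \<Rightarrow> 'a set \<Rightarrow> ('a \<Rightarrow> real) \<Rightarrow> bool" where
  "super F V b \<longleftrightarrow> (\<forall>e\<in>E. e ` cball 0 1 \<subseteq> V \<longrightarrow> (\<forall>r. 0 < r \<and> r < 1 \<longrightarrow> mean F b e r \<le> val F b e 0))"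

text \<open>Only one disc around each point is tested. This makes the condition easy to verify for
  glued functions, and for continuous b it implies \<open>sub\<close> by comparison with Poisson
  modifications.\<close>

definition lsub :: "('a \<Rightarrow> complex) \<Rightarrow> 'a set \<Rightarrow> ('a \<Rightarrow> real) \<Rightarrow> bool" where
  "lsub F V b \<longleftrightarrow> (\<forall>x\<in>V. \<exists>e\<in>E. e 0 = x \<and> e ` cball 0 1 \<subseteq> V \<and>
     (\<forall>r. 0 < r \<and> r < 1 \<longrightarrow> val F b e 0 \<le> mean F b e r))"

definition harm :: "('a \<Rightarrow> complex) \<Rightarrow> 'a set \<Rightarrow> ('a \<Rightarrow> real) \<Rightarrow> bool" where
  "harm F V b \<longleftrightarrow> (\<forall>e\<in>E. e ` cball 0 1 \<subseteq> V \<longrightarrow>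
     (\<exists>g. g holomorphic_on ball 0 1 \<and> (\<forall>w\<in>ball 0 1. val F b e w = Re (g w))))"

text \<open>Perron's Poisson modification, performed on a branch of the multivalued function.
  Subtracting \<open>lift\<close> again turns the new branch into a change of b alone.\<close>

definition modify :: "('a \<Rightarrow> complex) \<Rightarrow> (complex \<Rightarrow> 'a) \<Rightarrow> ('a \<Rightarrow> real) \<Rightarrow> 'a \<Rightarrow> real" where
  "modify F e b x = (if x \<in> e ` cball 0 1
     then poisson (val F b e) (coord e x) - lift F e (coord e x) else b x)"

lemma coord_eq [simp]: "e \<in> E \<Longrightarrow> norm w \<le> 1 \<Longrightarrow> coord e (e w) = w"
  unfolding coord_def by (intro the_inv_into_f_f disc_inj) auto

lemma disc_coord: "e \<in> E \<Longrightarrow> x \<in> e ` cball 0 1 \<Longrightarrow> e (coord e x) = x" "e \<in> E \<Longrightarrow> x \<in> e ` cball 0 1 \<Longrightarrow> norm (coord e x) \<le> 1"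
  by auto

lemma disc_topspace: "e \<in> E \<Longrightarrow> norm w \<le> 1 \<Longrightarrow> e w \<in> topspace X"
  using disc_cont by (force simp: continuous_map_def)

lemma disc_image_topspace: "e \<in> E \<Longrightarrow> S \<subseteq> cball 0 1 \<Longrightarrow> e ` S \<subseteq> topspace X"
  using disc_topspace by force

lemma disc_scale: "e \<in> E \<Longrightarrow> 0 < r \<Longrightarrow> r \<le> 1 \<Longrightarrow> (\<lambda>w. e (of_real r * w)) \<in> E"
  using disc_sub[of e r 0] subset_cball[of r 1 "0::complex"] by simp

lemma disc_closed:
  assumes "e \<in> E" "closed S" "S \<subseteq> cball 0 1" shows "closedin X (e ` S)"
proof -
  have "closed_map (top_of_set (cball 0 1)) X e"
    by (rule continuous_imp_closed_map[OF disc_cont[OF assms(1)] _ Hausdorff]) (simp add: compact_space_subtopology compactin_euclidean_iff)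
  moreover have "closedin (top_of_set (cball 0 1)) S" using assms by (simp add: closed_subset)
  ultimately show ?thesis by (simp add: closed_map_def)
qed

lemma continuous_coord:
  assumes "e \<in> E" shows "continuous_map (subtopology X (e ` cball 0 1)) (top_of_set (cball 0 1)) (coord e)"
proof -
  have "continuous_map (subtopology X (e ` cball 0 1)) euclidean (coord e)"
    unfolding continuous_map_closedin
  proof (intro conjI allI impI)
    fix C :: "complex set" assume "closedin euclidean C"
    then have "closed (C \<inter> cball 0 1)" by (simp add: closed_Int)
    then have "closedin X (e ` (C \<inter> cball 0 1))" using assms by (intro disc_closed) auto
    moreover have "{x \<in> topspace (subtopology X (e ` cball 0 1)). coord e x \<in> C} = e ` (C \<inter> cball 0 1)"
      using assms disc_topspace by auto
    ultimately show "closedin (subtopology X (e ` cball 0 1)) {x \<in> topspace (subtopology X (e ` cball 0 1)). coord e x \<in> C}"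
      by (auto intro: closedin_subset_topspace)
  qed auto
  then show ?thesis using assms by (auto simp: continuous_map_in_subtopology)
qed

lemma continuous_disc:
  assumes "e \<in> E" "contX b" shows "continuous_on (cball 0 1) (\<lambda>w. b (e w))"
  using continuous_map_compose[OF disc_cont[OF assms(1)] assms(2)] by (simp add: o_def)

lemma lift:
  assumes F: "circle_map F" and e: "e \<in> E"
  shows "continuous_on (cball 0 1) (lift F e)" "norm w \<le> 1 \<Longrightarrow> F (e w) = cis (lift F e w)"
proof -
  have c: "continuous_on (cball 0 1) (\<lambda>w. F (e w))"
    using continuous_map_compose[OF disc_cont[OF e], of euclidean F] F by (simp add: o_def circle_map_def)
  have n: "norm (F (e w)) = 1" if "w \<in> cball 0 1" for w
    using F disc_topspace[OF e] that by (simp add: circle_map_def)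
  then have "F (e w) \<noteq> 0" if "w \<in> cball 0 1" for w using that by fastforce
  then obtain h where h: "continuous_on (cball 0 1) h" "\<And>w. w \<in> cball 0 1 \<Longrightarrow> F (e w) = exp (h w)"
    using continuous_logarithm_on_cball[OF c] by blast
  have "F (e w) = cis (Im (h w))" if "w \<in> cball 0 1" for w
    using h(2)[OF that] n[OF that] by (metis exp_eq_polar mult_1 norm_exp_eq_Re of_real_1)
  then have "\<exists>\<phi>. continuous_on (cball 0 1) \<phi> \<and> (\<forall>w\<in>cball 0 1. F (e w) = cis (\<phi> w))"
    using h(1) by (intro exI[of _ "\<lambda>w. Im (h w)"]) (auto intro: continuous_intros)
  from someI_ex[OF this] have "continuous_on (cball 0 1) (lift F e) \<and> (\<forall>w\<in>cball 0 1. F (e w) = cis (lift F e w))"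
    unfolding lift_def .
  then show "continuous_on (cball 0 1) (lift F e)" "norm w \<le> 1 \<Longrightarrow> F (e w) = cis (lift F e w)"
    by auto
qed

text \<open>Both angles are primitives of the same increments \<open>dlog\<close>, and primitives on
  a connected set are unique up to a constant.\<close>

lemma cis_lift_unique:
  fixes S :: "complex set"
  assumes "connected S" "continuous_on S \<phi>" "continuous_on S \<psi>" "\<And>w. w \<in> S \<Longrightarrow> cis (\<phi> w) = cis (\<psi> w)"
  shows "\<exists>c. \<forall>w\<in>S. \<phi> w = \<psi> w + (c::real)"
proof (cases "S = {}")
  case False
  then obtain x where x: "x \<in> S" by blast
  have "prim (top_of_set S) (dlog (\<lambda>w. cis (\<phi> w))) \<phi>" "prim (top_of_set S) (dlog (\<lambda>w. cis (\<phi> w))) \<psi>"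
    using assms by (auto intro!: prim_dlog)
  moreover have "connected_space (top_of_set S)"
    using assms(1) connectedin_iff_connected[of S] unfolding connectedin_def by blast
  ultimately have "\<phi> y - \<psi> y = \<phi> x - \<psi> x" if "y \<in> S" for y
    by (intro prim_unique[of "top_of_set S"]) (use x that in auto)
  then show ?thesis by (intro exI[of _ "\<phi> x - \<psi> x"]) (auto simp: algebra_simps)
qed auto

lemma continuous_val:
  assumes "circle_map F" "e \<in> E" "contX b" shows "continuous_on (cball 0 1) (val F b e)"
  unfolding val_def by (intro continuous_intros lift(1) continuous_disc assms)

lemma continuous_on_scale:
  assumes "continuous_on (cball 0 1) \<phi>" "0 \<le> r" "r \<le> 1"
  shows "continuous_on (cball 0 1) (\<lambda>w. \<phi> (of_real r * w :: complex))"
  by (rule continuous_on_compose2[OF assms(1)])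
    (use assms(2,3) in \<open>auto intro!: continuous_intros simp: norm_mult mult_le_one\<close>)

lemma continuous_on_scale_sphere:
  assumes "continuous_on (cball 0 1) \<phi>" "0 \<le> r" "r \<le> 1"
  shows "continuous_on (sphere 0 1) (\<lambda>w. \<phi> (of_real r * w :: complex))"
  by (rule continuous_on_subset[OF continuous_on_scale[OF assms]]) auto

text \<open>The constant compares two lifts of F and does not involve b, so one c serves all b at
  once, in particular a function and its modification.\<close>

lemma val_subdisc:
  assumes F: "circle_map F" and e: "e \<in> E" "e' \<in> E" and sub: "e' ` cball 0 1 \<subseteq> e ` cball 0 1"
  obtains c where "\<And>w b. norm w \<le> 1 \<Longrightarrow> val F b e' w = val F b e (coord e (e' w)) + c"
proof -
  have in1: "norm w \<le> 1 \<Longrightarrow> e' w \<in> e ` cball 0 1" for w using sub by auto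
  have "continuous_map (top_of_set (cball 0 1)) (subtopology X (e ` cball 0 1)) e'"
    using disc_cont[OF e(2)] sub by (auto simp: continuous_map_in_subtopology)
  from continuous_map_compose[OF this continuous_coord[OF e(1)]]
  have c: "continuous_on (cball 0 1) (\<lambda>w. coord e (e' w))" "(\<lambda>w. coord e (e' w)) ` cball 0 1 \<subseteq> cball 0 1"
    by (auto simp: o_def continuous_map_in_subtopology)
  have "\<exists>c. \<forall>w\<in>cball 0 1. lift F e' w = lift F e (coord e (e' w)) + c"
  proof (rule cis_lift_unique)
    show "continuous_on (cball 0 1) (\<lambda>w. lift F e (coord e (e' w)))"
      by (rule continuous_on_compose2[OF lift(1)[OF F e(1)] c])
    show "cis (lift F e' w) = cis (lift F e (coord e (e' w)))" if "w \<in> cball 0 1" for w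
      using that lift(2)[OF F e(2), of w] lift(2)[OF F e(1), of "coord e (e' w)"] in1[of w] disc_coord[OF e(1)]
      by (metis mem_cball_0)
  qed (auto intro: lift[OF F e(2)] convex_connected)
  then obtain c where "\<And>w. norm w \<le> 1 \<Longrightarrow> lift F e' w = lift F e (coord e (e' w)) + c" by auto
  then have "val F b e' w = val F b e (coord e (e' w)) + c" if "norm w \<le> 1" for w b
    unfolding val_def using that in1[OF that] disc_coord[OF e(1)] by auto
  then show ?thesis using that by blast
qed

lemma val_scale:
  assumes F: "circle_map F" and e: "e \<in> E" and r: "0 < r" "r \<le> 1"
  obtains c where "\<And>w b. norm w \<le> 1 \<Longrightarrow> val F b (\<lambda>w. e (of_real r * w)) w = val F b e (of_real r * w) + c"
proof -
  have n: "norm w \<le> 1 \<Longrightarrow> norm (of_real r * w) \<le> 1" for w :: complex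
    using r by (simp add: norm_mult mult_le_one)
  obtain c where "\<And>w b. norm w \<le> 1 \<Longrightarrow> val F b (\<lambda>w. e (of_real r * w)) w = val F b e (coord e (e (of_real r * w))) + c"
    using val_subdisc[OF F e disc_scale[OF e r]] n by (auto simp: image_subset_iff)
  then show ?thesis using that e n by simp
qed

lemma circle_map_cnj: "circle_map F \<Longrightarrow> circle_map (\<lambda>x. cnj (F x))"
  using continuous_map_compose[of X euclidean F euclidean cnj]
  by (auto simp: circle_map_def o_def continuous_on_cnj)

lemma val_neg:
  assumes F: "circle_map F" and e: "e \<in> E"
  obtains c where "\<And>w b. norm w \<le> 1 \<Longrightarrow> val (\<lambda>x. cnj (F x)) (\<lambda>x. - b x) e w = - val F b e w + c"
proof -
  have "\<exists>c. \<forall>w\<in>cball 0 1. lift (\<lambda>x. cnj (F x)) e w = - lift F e w + c"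
    by (rule cis_lift_unique)
      (use lift[OF circle_map_cnj[OF F] e] lift[OF F e] in \<open>auto intro!: convex_connected continuous_intros simp: cis_cnj\<close>)
  then show ?thesis using that unfolding val_def by auto
qed

lemma mean_neg:
  assumes F: "circle_map F" and e: "e \<in> E" and b: "contX b" and r: "0 < r" "r < 1"
    and c: "\<And>w. norm w \<le> 1 \<Longrightarrow> val F' b' e w = s * val F b e w + c"
  shows "mean F' b' e r = s * mean F b e r + c"
proof -
  have cv: "continuous_on (sphere 0 1) (\<lambda>w. val F b e (of_real r * w))"
    using r by (intro continuous_on_scale_sphere continuous_val F e b) auto
  have "mean F' b' e r = poisson (\<lambda>w. s * val F b e (of_real r * w) + c) 0"
    unfolding mean_def by (rule poisson_cong) (use r in \<open>auto intro!: c simp: norm_mult\<close>)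
  also have "\<dots> = s * mean F b e r + c"
    unfolding mean_def by (subst poisson_add) (auto intro!: continuous_intros cv simp: poisson_cmul)
  finally show ?thesis .
qed

text \<open>Conjugating F reverses the sign of its argument, so every result on subsolutions yields
  its counterpart for supersolutions.\<close>

lemma sub_cnj_iff:
  assumes F: "circle_map F" and b: "contX b"
  shows "sub (\<lambda>x. cnj (F x)) V (\<lambda>x. - b x) \<longleftrightarrow> super F V b"
proof -
  have "val (\<lambda>x. cnj (F x)) (\<lambda>x. - b x) e 0 \<le> mean (\<lambda>x. cnj (F x)) (\<lambda>x. - b x) e r \<longleftrightarrow>
     mean F b e r \<le> val F b e 0" if e: "e \<in> E" and r: "0 < r" "r < 1" for e r
  proof -
    obtain c where c: "\<And>w b. norm w \<le> 1 \<Longrightarrow> val (\<lambda>x. cnj (F x)) (\<lambda>x. - b x) e w = -1 * val F b e w + c"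
      using val_neg[OF F e] by auto
    show ?thesis using c[of 0 b] mean_neg[OF F e b r c] by auto
  qed
  then show ?thesis unfolding sub_def super_def by blast
qed

lemma mean_Re:
  assumes g: "g holomorphic_on ball 0 1" and v: "\<And>w. norm w < 1 \<Longrightarrow> val F b e w = Re (g w)" and r: "0 < r" "r < 1"
  shows "mean F b e r = val F b e 0"
proof -
  have lt: "norm (of_real r * w) < 1" if "norm w \<le> 1" for w :: complex
    using that r mult_le_one[of r "norm w"] by (simp add: norm_mult) (smt (verit) mult_left_le norm_ge_zero)
  have "mean F b e r = poisson (\<lambda>w. Re (g (of_real r * w))) 0"
    unfolding mean_def by (rule poisson_cong) (use lt in \<open>auto intro!: v\<close>)
  also have "\<dots> = Re (g (of_real r * 0))"
  proof (rule poisson_Re_holomorphic)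
    show "continuous_on (cball 0 1) (\<lambda>w. g (of_real r * w))"
      by (rule continuous_on_compose2[OF holomorphic_on_imp_continuous_on[OF g]])
        (use lt in \<open>auto intro!: continuous_intros\<close>)
    show "(\<lambda>w. g (of_real r * w)) holomorphic_on ball 0 1"
      by (rule holomorphic_on_compose_gen[OF _ g, unfolded o_def])
        (use lt in \<open>auto intro!: holomorphic_intros\<close>)
  qed auto
  finally show ?thesis using v[of 0] by simp
qed

lemma harm_imp_sub: "harm F V b \<Longrightarrow> sub F V b" and harm_imp_super: "harm F V b \<Longrightarrow> super F V b"
proof -
  assume h: "harm F V b"
  have "mean F b e r = val F b e 0" if e: "e \<in> E" "e ` cball 0 1 \<subseteq> V" and r: "0 < r" "r < 1" for e r
  proof -
    obtain g where g: "g holomorphic_on ball 0 1" "\<And>w. norm w < 1 \<Longrightarrow> val F b e w = Re (g w)"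
      using h e unfolding harm_def by force
    show ?thesis by (rule mean_Re[OF g r])
  qed
  then show "sub F V b" "super F V b" unfolding sub_def super_def by auto
qed

lemma sub_imp_lsub: "openin X V \<Longrightarrow> sub F V b \<Longrightarrow> lsub F V b"
  unfolding sub_def lsub_def using disc_ex by meson

section \<open>Maximum principle and Poisson modification\<close>

lemma disc_max:
  assumes q: "contX q" and M: "\<And>y. y \<in> topspace X \<Longrightarrow> q y \<le> M" and e: "e \<in> E" and q0: "q (e 0) = M"
    and le: "\<And>r. 0 < r \<Longrightarrow> r < 1 \<Longrightarrow> M \<le> poisson (\<lambda>w. q (e (of_real r * w))) 0" and w: "norm w < 1"
  shows "q (e w) = M"
proof (cases "w = 0")
  case True then show ?thesis using q0 by simp
next
  case False
  \<comment> \<open>The circle through w: the average of M - q over it is at most 0 while M - q is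
    nonnegative, so M - q vanishes on the whole circle.\<close>
  define r where "r = norm w"
  have r: "0 < r" "r < 1" using False w by (auto simp: r_def)
  have c: "continuous_on (sphere 0 1) (\<lambda>w. q (e (of_real r * w)))"
    using r by (intro continuous_on_scale_sphere continuous_disc e q) auto
  have "M - q (e (of_real r * sgn w)) = 0"
  proof (rule poisson_pos_zero[of "\<lambda>w. M - q (e (of_real r * w))"])
    show "poisson (\<lambda>w. M - q (e (of_real r * w))) 0 \<le> 0"
      using le[OF r] c by (subst poisson_diff) auto
    show "0 \<le> M - q (e (of_real r * w))" if "norm w = 1" for w
      using M[of "e (of_real r * w)"] disc_topspace[OF e(1), of "of_real r * w"] r that
      by (simp add: norm_mult)
  qed (use False in \<open>auto intro!: continuous_intros c simp: norm_sgn\<close>)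
  moreover have "of_real r * sgn w = w" using False by (simp add: r_def sgn_eq)
  ultimately show ?thesis by simp
qed

text \<open>A maximum above m would be attained in V only. The set of maximum points is closed by
  continuity and open by \<open>disc_max\<close>, hence all of X, although it lies in the proper
  subset V.\<close>

lemma max_principle:
  assumes q: "contX q" and V: "openin X V" "V \<noteq> topspace X"
    and out: "\<And>x. x \<in> topspace X \<Longrightarrow> x \<notin> V \<Longrightarrow> q x \<le> m"
    and sm: "\<And>x. x \<in> V \<Longrightarrow> \<exists>e\<in>E. e 0 = x \<and> (\<forall>r. 0 < r \<and> r < 1 \<longrightarrow> q x \<le> poisson (\<lambda>w. q (e (of_real r * w))) 0)"
    and x: "x \<in> topspace X"
  shows "q x \<le> m"
proof (rule ccontr)
  assume nx: "\<not> q x \<le> m"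
  have "compactin euclideanreal (q ` topspace X)"
    using image_compactin[OF _ q] compact unfolding compact_space_def by blast
  then obtain M where M: "M \<in> q ` topspace X" "\<And>y. y \<in> topspace X \<Longrightarrow> q y \<le> M"
    using compact_attains_sup[of "q ` topspace X"] x unfolding compactin_euclidean_iff
    by (metis empty_iff imageI)
  have Mm: "M > m" using M(2)[OF x] nx by simp
  define Z where "Z = {y \<in> topspace X. q y \<in> {M}}"
  have "closedin X Z" unfolding Z_def by (rule closedin_continuous_map_preimage[OF q]) auto
  moreover have "openin X Z"
  proof (subst openin_subopen, clarify)
    fix y assume y: "y \<in> Z"
    then have "y \<in> V" using out[of y] Mm by (auto simp: Z_def)
    then obtain e where e: "e \<in> E" "e 0 = y" and
      le: "\<And>r. 0 < r \<Longrightarrow> r < 1 \<Longrightarrow> q y \<le> poisson (\<lambda>w. q (e (of_real r * w))) 0"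
      using sm by meson
    have "q (e w) = M" if w: "norm w < 1" for w
      by (rule disc_max[OF q M(2) e(1) _ _ w]) (use y e le in \<open>auto simp: Z_def\<close>)
    then have "e ` ball 0 1 \<subseteq> Z" using disc_topspace[OF e(1)] by (auto simp: Z_def)
    moreover have "openin X (e ` ball 0 1)" by (rule disc_open[OF e(1)]) auto
    ultimately show "\<exists>T. openin X T \<and> y \<in> T \<and> T \<subseteq> Z" using e(2) by (metis centre_in_ball imageI zero_less_one)
  qed
  moreover have "Z \<noteq> {}" using M(1) by (auto simp: Z_def)
  ultimately have "Z = topspace X" using connected unfolding connected_space_clopen_in by blast
  moreover have "Z \<subseteq> V" using out Mm by (force simp: Z_def)
  ultimately show False using V openin_subset by blast
qed

text \<open>The lifts of F cancel in b - b', so the maximum principle for ordinary functions applies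
  although both functions being compared are multivalued.\<close>

lemma comparison:
  assumes F: "circle_map F" and b: "contX b" "contX b'" and V: "openin X V" "V \<noteq> topspace X"
    and sub: "lsub F V b" and sup: "super F V b'"
    and out: "\<And>x. x \<in> topspace X \<Longrightarrow> x \<notin> V \<Longrightarrow> b x \<le> b' x + m"
    and x: "x \<in> topspace X"
  shows "b x \<le> b' x + m"
proof -
  have "b x - b' x \<le> m"
  proof (rule max_principle[OF _ V _ _ x])
    show "contX (\<lambda>x. b x - b' x)" using b by (intro continuous_intros)
    show "b y - b' y \<le> m" if "y \<in> topspace X" "y \<notin> V" for y using out[OF that] by simp
    fix y assume "y \<in> V"
    then obtain e where e: "e \<in> E" "e 0 = y" "e ` cball 0 1 \<subseteq> V"
      and le: "\<And>r. 0 < r \<Longrightarrow> r < 1 \<Longrightarrow> val F b e 0 \<le> mean F b e r"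
      using sub unfolding lsub_def by meson
    have "b y - b' y \<le> poisson (\<lambda>w. b (e (of_real r * w)) - b' (e (of_real r * w))) 0" if r: "0 < r" "r < 1" for r
    proof -
      have "mean F b' e r \<le> val F b' e 0" using sup e r unfolding super_def by blast
      then have "val F b e 0 - val F b' e 0 \<le> mean F b e r - mean F b' e r" using le[OF r] by simp
      also have "\<dots> = poisson (\<lambda>w. val F b e (of_real r * w) - val F b' e (of_real r * w)) 0"
        unfolding mean_def using r
        by (intro poisson_diff[symmetric] continuous_on_scale_sphere continuous_val F e b) auto
      finally show ?thesis using e by (simp add: val_def)
    qed
    then show "\<exists>e\<in>E. e 0 = y \<and> (\<forall>r. 0 < r \<and> r < 1 \<longrightarrow>
        b y - b' y \<le> poisson (\<lambda>w. b (e (of_real r * w)) - b' (e (of_real r * w))) 0)"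
      using e by blast
  qed
  then show ?thesis by simp
qed

lemma disc_ball_proper:
  assumes "e \<in> E" shows "e ` ball 0 1 \<noteq> topspace X"
proof
  assume *: "e ` ball 0 1 = topspace X"
  have "e 1 \<in> topspace X" using disc_topspace[OF assms, of 1] by simp
  then obtain w where "w \<in> ball 0 1" "e 1 = e w" using * by (metis imageE)
  then have "1 = w" using disc_inj[OF assms] by (simp add: inj_on_def)
  then show False using \<open>w \<in> ball 0 1\<close> by simp
qed

lemma openin_disc_ball: "e \<in> E \<Longrightarrow> openin X (e ` ball 0 1)"
  by (rule disc_open) auto

lemma contX_disc_glue:
  assumes e: "e \<in> E" and u: "continuous_on (cball 0 1) u" and b: "contX b"
    and eq: "\<And>w. norm w = 1 \<Longrightarrow> u w = b (e w)"
  shows "contX (\<lambda>x. if x \<in> e ` cball 0 1 then u (coord e x) else b x)"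
proof (rule continuous_map_glue[of X "e ` cball 0 1" "topspace X - e ` ball 0 1"])
  show "closedin X (e ` cball 0 1)" by (rule disc_closed[OF e]) auto
  show "closedin X (topspace X - e ` ball 0 1)" using openin_disc_ball[OF e] by blast
  show "continuous_map (subtopology X (e ` cball 0 1)) euclideanreal (\<lambda>x. u (coord e x))"
    using continuous_map_compose[OF continuous_coord[OF e], of euclideanreal u] u by (simp add: o_def)
  show "continuous_map (subtopology X (topspace X - e ` ball 0 1)) euclideanreal b"
    using b by (rule continuous_map_from_subtopology)
  fix x assume x: "x \<in> e ` cball 0 1" "x \<in> topspace X - e ` ball 0 1"
  then obtain w where w: "x = e w" "norm w \<le> 1" by auto
  then have "\<not> norm w < 1" using x(2) by auto
  then show "u (coord e x) = b x" using w e eq[of w] by simp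
qed auto

lemma contX_modify:
  assumes F: "circle_map F" and e: "e \<in> E" and b: "contX b"
  shows "contX (modify F e b)"
proof -
  have "contX (\<lambda>x. if x \<in> e ` cball 0 1 then (\<lambda>w. poisson (val F b e) w - lift F e w) (coord e x) else b x)"
  proof (rule contX_disc_glue[OF e _ b])
    show "continuous_on (cball 0 1) (\<lambda>w. poisson (val F b e) w - lift F e w)"
      by (intro continuous_intros continuous_on_poisson lift[OF F e] continuous_on_subset[OF continuous_val[OF F e b]]) auto
  qed (auto simp: poisson_def val_def)
  then show ?thesis unfolding modify_def[abs_def] .
qed

lemma val_modify:
  assumes "e \<in> E" "norm w \<le> 1" shows "val F (modify F e b) e w = poisson (val F b e) w"
  using assms unfolding val_def[of F "modify F e b"] modify_def by auto

lemma modify_outside: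
  assumes "e \<in> E" "x \<notin> e ` ball 0 1" shows "modify F e b x = b x"
proof (cases "x \<in> e ` cball 0 1")
  case True
  then obtain w where w: "x = e w" "norm w \<le> 1" by auto
  then have "\<not> norm w < 1" using assms(2) by auto
  then show ?thesis using w assms(1) by (simp add: modify_def poisson_def val_def)
qed (auto simp: modify_def)

lemma harm_modify:
  assumes F: "circle_map F" and e: "e \<in> E" and b: "contX b"
  shows "harm F (e ` ball 0 1) (modify F e b)"
  unfolding harm_def
proof (intro ballI impI)
  fix e' assume e': "e' \<in> E" "e' ` cball 0 1 \<subseteq> e ` ball 0 1"
  have "continuous_on (sphere 0 1) (val F b e)"
    by (rule continuous_on_subset[OF continuous_val[OF F e b]]) auto
  then obtain g where g: "g holomorphic_on ball 0 1" "\<And>w. norm w < 1 \<Longrightarrow> poisson (val F b e) w = Re (g w)"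
    using poisson_holomorphic by blast
  have "e ` ball 0 1 \<subseteq> e ` cball 0 1" by auto
  then obtain c where c: "\<And>w b. norm w \<le> 1 \<Longrightarrow> val F b e' w = val F b e (coord e (e' w)) + c"
    using val_subdisc[OF F e e'(1)] e'(2) by (meson order_trans)
  have n: "norm (coord e (e' w)) < 1" if "norm w \<le> 1" for w
  proof -
    have "e' w \<in> e ` ball 0 1" using that e'(2) by auto
    then show ?thesis using e by auto
  qed
  have "(\<lambda>w. g (coord e (e' w)) + of_real c) holomorphic_on ball 0 1"
    by (intro holomorphic_intros holomorphic_on_compose_gen[OF disc_trans[OF e e'] g(1), unfolded o_def])
      (use n in auto)
  moreover have "val F (modify F e b) e' w = Re (g (coord e (e' w)) + of_real c)" if "norm w < 1" for w
    using that c[of w] n[of w] val_modify[OF e, of "coord e (e' w)"] g(2)[of "coord e (e' w)"] by simp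
  ultimately show "\<exists>g. g holomorphic_on ball 0 1 \<and> (\<forall>w\<in>ball 0 1. val F (modify F e b) e' w = Re (g w))"
    by (intro exI[of _ "\<lambda>w. g (coord e (e' w)) + of_real c"]) auto
qed

lemma lsub_subset:
  assumes F: "circle_map F" and b: "contX b" and V: "lsub F V b" and U: "U \<subseteq> V" "openin X U"
  shows "lsub F U b"
  unfolding lsub_def
proof
  fix x assume x: "x \<in> U"
  then obtain e where e: "e \<in> E" "e 0 = x" "e ` cball 0 1 \<subseteq> V"
      and le: "\<And>r. 0 < r \<Longrightarrow> r < 1 \<Longrightarrow> val F b e 0 \<le> mean F b e r"
    using V U(1) unfolding lsub_def by (meson subsetD)
  have "openin (top_of_set (cball 0 1)) {w \<in> topspace (top_of_set (cball 0 1)). e w \<in> U}"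
    by (rule openin_continuous_map_preimage[OF disc_cont[OF e(1)] U(2)])
  then obtain T where T: "open T" "{w \<in> cball 0 1. e w \<in> U} = cball 0 1 \<inter> T"
    by (auto simp: openin_open)
  have "0 \<in> cball 0 1 \<inter> T" using x e unfolding T(2)[symmetric] by simp
  then obtain s where s: "s > 0" "cball 0 s \<subseteq> T" using T(1) open_contains_cball by blast
  define r where "r = min s 1"
  have r: "0 < r" "r \<le> 1" "r \<le> s" using s by (auto simp: r_def)
  let ?e = "\<lambda>w. e (of_real r * w)"
  have "of_real r * w \<in> cball 0 1 \<inter> T" if "norm w \<le> 1" for w :: complex
  proof -
    have "r * norm w \<le> r * 1" using that r by (intro mult_left_mono) auto
    then have "norm (of_real r * w) \<le> r" using r by (simp add: norm_mult)
    then show ?thesis using r s(2) by (auto simp: subset_iff)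
  qed
  then have sU: "?e ` cball 0 1 \<subseteq> U" unfolding T(2)[symmetric] by auto
  obtain c where c: "\<And>w b. norm w \<le> 1 \<Longrightarrow> val F b ?e w = val F b e (of_real r * w) + c"
    using val_scale[OF F e(1) r(1,2)] by metis
  have "val F b ?e 0 \<le> mean F b ?e t" if t: "0 < t" "t < 1" for t
  proof -
    have "r * t \<le> 1 * t" using r t by (intro mult_right_mono) auto
    then have rt: "0 < r * t" "r * t < 1" using r t by (simp, linarith)
    have "mean F b ?e t = poisson (\<lambda>w. val F b e (of_real (r * t) * w) + c) 0"
      unfolding mean_def by (rule poisson_cong) (use c t in \<open>auto simp: norm_mult mult.assoc\<close>)
    also have "\<dots> = mean F b e (r * t) + c"
      unfolding mean_def using rt
      by (subst poisson_add, intro continuous_on_scale_sphere continuous_val F e b) auto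
    finally show ?thesis using le[OF rt] c[of 0 b] by simp
  qed
  then show "\<exists>e\<in>E. e 0 = x \<and> e ` cball 0 1 \<subseteq> U \<and> (\<forall>r. 0 < r \<and> r < 1 \<longrightarrow> val F b e 0 \<le> mean F b e r)"
    using disc_scale[OF e(1) r(1,2)] sU e(2) by (intro bexI[of _ ?e]) auto
qed

text \<open>The modification is harmonic in the open disc and equals b outside it, so this is
  comparison on that disc.\<close>

lemma modify_ge:
  assumes F: "circle_map F" and b: "contX b" and V: "lsub F V b" and e: "e \<in> E" "e ` ball 0 1 \<subseteq> V"
    and x: "x \<in> topspace X"
  shows "b x \<le> modify F e b x"
proof -
  have "b x \<le> modify F e b x + 0"
  proof (rule comparison[OF F b contX_modify[OF F e(1) b] openin_disc_ball[OF e(1)] disc_ball_proper[OF e(1)] _ _ _ x])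
    show "lsub F (e ` ball 0 1) b" by (rule lsub_subset[OF F b V e(2) openin_disc_ball[OF e(1)]])
    show "super F (e ` ball 0 1) (modify F e b)" by (rule harm_imp_super[OF harm_modify[OF F e(1) b]])
  qed (simp add: modify_outside[OF e(1)])
  then show ?thesis by simp
qed

text \<open>Modify b on the disc of radius r: the modification lies above b, and at the centre its
  branch is the average over the circle of radius r.\<close>

lemma lsub_imp_sub:
  assumes F: "circle_map F" and b: "contX b" and V: "lsub F V b"
  shows "sub F V b"
  unfolding sub_def
proof (intro ballI impI allI)
  fix e and r :: real assume e: "e \<in> E" "e ` cball 0 1 \<subseteq> V" and r: "0 < r \<and> r < 1"
  let ?e = "\<lambda>w. e (of_real r * w)"
  have e': "?e \<in> E" using disc_scale e r by simp
  have "?e ` ball 0 1 \<subseteq> e ` cball 0 1" using r by (auto simp: norm_mult mult_le_one)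
  then have "b (?e 0) \<le> modify F ?e b (?e 0)"
    using e disc_topspace[OF e(1)] by (intro modify_ge[OF F b V e']) auto
  then have "val F b ?e 0 \<le> val F (modify F ?e b) ?e 0" by (simp add: val_def)
  also have "\<dots> = poisson (val F b ?e) 0" using e' by (simp add: val_modify)
  finally have 1: "val F b ?e 0 \<le> poisson (val F b ?e) 0" .
  obtain c where c: "\<And>w b. norm w \<le> 1 \<Longrightarrow> val F b ?e w = val F b e (of_real r * w) + c"
    using val_scale[OF F e(1)] r by (metis less_imp_le)
  have "poisson (val F b ?e) 0 = poisson (\<lambda>w. val F b e (of_real r * w) + c) 0"
    by (rule poisson_cong) (auto simp: c)
  also have "\<dots> = mean F b e r + c"
    unfolding mean_def using r
    by (subst poisson_add) (auto intro!: continuous_on_scale_sphere continuous_val F e b)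
  finally show "val F b e 0 \<le> mean F b e r" using 1 c[of 0 b] by simp
qed

lemma modify_mono:
  assumes F: "circle_map F" and e: "e \<in> E" and b: "contX b" "contX b'"
    and le: "\<And>x. x \<in> topspace X \<Longrightarrow> b x \<le> b' x" and x: "x \<in> topspace X"
  shows "modify F e b x \<le> modify F e b' x"
proof (cases "x \<in> e ` cball 0 1")
  case True
  have "poisson (val F b e) (coord e x) \<le> poisson (val F b' e) (coord e x)"
  proof (rule poisson_mono)
    show "continuous_on (sphere 0 1) (val F b e)" "continuous_on (sphere 0 1) (val F b' e)"
      by (rule continuous_on_subset[OF continuous_val[OF F e b(1)]], auto)
        (rule continuous_on_subset[OF continuous_val[OF F e b(2)]], auto)
    show "val F b e w \<le> val F b' e w" if "norm w = 1" for w
      using le[OF disc_topspace[OF e, of w]] that by (simp add: val_def)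
  qed (rule disc_coord(2)[OF e True])
  then show ?thesis using True by (simp add: modify_def)
qed (use le[OF x] in \<open>simp add: modify_def\<close>)

lemma mean_mono:
  assumes F: "circle_map F" and e: "e \<in> E" and b: "contX b" "contX b'"
    and le: "\<And>w. norm w \<le> 1 \<Longrightarrow> b (e w) \<le> b' (e w)" and r: "0 < r" "r < 1"
  shows "mean F b e r \<le> mean F b' e r"
  unfolding mean_def
proof (rule poisson_mono)
  show "continuous_on (sphere 0 1) (\<lambda>w. val F b e (of_real r * w))"
    "continuous_on (sphere 0 1) (\<lambda>w. val F b' e (of_real r * w))"
    using r by (auto intro!: continuous_on_scale_sphere continuous_val F e b)
  show "val F b e (of_real r * w) \<le> val F b' e (of_real r * w)" if "norm w = 1" for w
    using le[of "of_real r * w"] that r by (simp add: val_def norm_mult)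
qed auto

text \<open>By \<open>lsub_imp_sub\<close> one disc per point is enough. Inside e the modification
  is harmonic; at the other points it equals b at the centre and can only raise the mean.\<close>

lemma sub_modify:
  assumes F: "circle_map F" and b: "contX b" and V: "openin X V" "sub F V b" and e: "e \<in> E" "e ` cball 0 1 \<subseteq> V"
  shows "sub F V (modify F e b)"
proof (rule lsub_imp_sub[OF F contX_modify[OF F e(1) b]], unfold lsub_def, intro ballI)
  fix x assume x: "x \<in> V"
  have ls: "lsub F V b" by (rule sub_imp_lsub[OF V])
  have eV: "e ` ball 0 1 \<subseteq> V" using e(2) by auto
  have hs: "sub F (e ` ball 0 1) (modify F e b)" by (rule harm_imp_sub[OF harm_modify[OF F e(1) b]])
  show "\<exists>e'\<in>E. e' 0 = x \<and> e' ` cball 0 1 \<subseteq> V \<and>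
     (\<forall>r. 0 < r \<and> r < 1 \<longrightarrow> val F (modify F e b) e' 0 \<le> mean F (modify F e b) e' r)"
  proof (cases "x \<in> e ` ball 0 1")
    case True
    then obtain e' where e': "e' \<in> E" "e' 0 = x" "e' ` cball 0 1 \<subseteq> e ` ball 0 1"
      using disc_ex[OF openin_disc_ball[OF e(1)] True] by auto
    then show ?thesis using hs eV unfolding sub_def by (intro bexI[of _ e']) auto
  next
    case False
    obtain e' where e': "e' \<in> E" "e' 0 = x" "e' ` cball 0 1 \<subseteq> V"
      using disc_ex[OF V(1) x] by auto
    have "val F (modify F e b) e' 0 \<le> mean F (modify F e b) e' r" if r: "0 < r" "r < 1" for r
    proof -
      have "val F (modify F e b) e' 0 = val F b e' 0"
        using False e'(2) by (simp add: val_def modify_outside[OF e(1)])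
      also have "\<dots> \<le> mean F b e' r" using V(2) e' r unfolding sub_def by blast
      also have "\<dots> \<le> mean F (modify F e b) e' r"
        using r by (intro mean_mono F e' b contX_modify[OF F e(1) b] modify_ge[OF F b ls e(1) eV] disc_topspace) auto
      finally show ?thesis .
    qed
    then show ?thesis using e' by blast
  qed
qed

lemma sub_max:
  assumes F: "circle_map F" and b: "contX b" "contX b'" and "sub F V b" "sub F V b'"
  shows "sub F V (\<lambda>x. max (b x) (b' x))"
  unfolding sub_def
proof (intro ballI impI allI)
  fix e and r :: real assume e: "e \<in> E" "e ` cball 0 1 \<subseteq> V" and r: "0 < r \<and> r < 1"
  have c: "contX (\<lambda>x. max (b x) (b' x))" using b by (intro continuous_intros)
  have "val F b e 0 \<le> mean F b e r" "val F b' e 0 \<le> mean F b' e r"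
    using assms(4,5) e r unfolding sub_def by blast+
  moreover have "mean F b e r \<le> mean F (\<lambda>x. max (b x) (b' x)) e r" "mean F b' e r \<le> mean F (\<lambda>x. max (b x) (b' x)) e r"
    using r by (auto intro!: mean_mono F e b c)
  ultimately show "val F (\<lambda>x. max (b x) (b' x)) e 0 \<le> mean F (\<lambda>x. max (b x) (b' x)) e r"
    unfolding val_def by linarith
qed

text \<open>The local witnesses give the mean value equality at every point, hence subsolutions both
  for F with b and for the conjugate of F with -b. The Poisson modification of b therefore lies
  above and below b, and on every disc the branch is its own Poisson integral. The witnesses on
  different discs are never matched with each other.\<close>

lemma harm_local:
  assumes F: "circle_map F" and b: "contX b" and V: "openin X V"
    and loc: "\<And>x. x \<in> V \<Longrightarrow> \<exists>e\<in>E. e 0 = x \<and> e ` cball 0 1 \<subseteq> V \<and>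
       (\<exists>g. g holomorphic_on ball 0 1 \<and> (\<forall>w\<in>ball 0 1. val F b e w = Re (g w)))"
  shows "harm F V b"
proof -
  have eq: "\<exists>e\<in>E. e 0 = x \<and> e ` cball 0 1 \<subseteq> V \<and> (\<forall>r. 0 < r \<and> r < 1 \<longrightarrow> mean F b e r = val F b e 0)" if x: "x \<in> V" for x
  proof -
    obtain e g where e: "e \<in> E" "e 0 = x" "e ` cball 0 1 \<subseteq> V" and g: "g holomorphic_on ball 0 1" "\<And>w. norm w < 1 \<Longrightarrow> val F b e w = Re (g w)"
      using loc[OF x] by force
    then show ?thesis using mean_Re[OF g] by blast
  qed
  have s1: "lsub F V b" unfolding lsub_def using eq by (metis order_refl)
  let ?F = "\<lambda>x. cnj (F x)" and ?b = "\<lambda>x. - b x"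
  have cb: "contX ?b" using b by (intro continuous_intros)
  have s2: "lsub ?F V ?b" unfolding lsub_def
  proof
    fix x assume "x \<in> V"
    then obtain e where e: "e \<in> E" "e 0 = x" "e ` cball 0 1 \<subseteq> V" "\<And>r. 0 < r \<Longrightarrow> r < 1 \<Longrightarrow> mean F b e r = val F b e 0"
      using eq by meson
    obtain c where c: "\<And>w b. norm w \<le> 1 \<Longrightarrow> val ?F (\<lambda>x. - b x) e w = -1 * val F b e w + c"
      using val_neg[OF F e(1)] by auto
    have "val ?F ?b e 0 \<le> mean ?F ?b e r" if "0 < r" "r < 1" for r
      using mean_neg[OF F e(1) b that c] c[of 0 b] e(4)[OF that] by simp
    then show "\<exists>e\<in>E. e 0 = x \<and> e ` cball 0 1 \<subseteq> V \<and> (\<forall>r. 0 < r \<and> r < 1 \<longrightarrow> val ?F ?b e 0 \<le> mean ?F ?b e r)"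
      using e by blast
  qed
  show ?thesis unfolding harm_def
  proof (intro ballI impI)
    fix e assume e: "e \<in> E" "e ` cball 0 1 \<subseteq> V"
    then have eV: "e ` ball 0 1 \<subseteq> V" by auto
    have c: "continuous_on (sphere 0 1) (val F b e)"
      by (rule continuous_on_subset[OF continuous_val[OF F e(1) b]]) auto
    obtain c' where c': "\<And>w b. norm w \<le> 1 \<Longrightarrow> val ?F (\<lambda>x. - b x) e w = - val F b e w + c'"
      using val_neg[OF F e(1)] by auto
    have "val F b e w = poisson (val F b e) w" if w: "norm w < 1" for w
    proof (rule antisym)
      have "b (e w) \<le> modify F e b (e w)" "?b (e w) \<le> modify ?F e ?b (e w)"
        using w disc_topspace[OF e(1)]
        by (auto intro!: modify_ge[OF F b s1 e(1) eV] modify_ge[OF circle_map_cnj[OF F] cb s2 e(1) eV])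
      then have 1: "val F b e w \<le> poisson (val F b e) w" "val ?F ?b e w \<le> poisson (val ?F ?b e) w"
        using w val_modify[OF e(1), of w, symmetric] by (auto simp: val_def)
      then show "val F b e w \<le> poisson (val F b e) w" by simp
      have "poisson (val ?F ?b e) w = poisson (\<lambda>w. -1 * val F b e w + c') w"
        by (rule poisson_cong) (use c' w in auto)
      also have "\<dots> = - poisson (val F b e) w + c'"
        using w by (subst poisson_add) (auto intro!: continuous_intros c simp: poisson_cmul[of "-1", simplified])
      finally show "poisson (val F b e) w \<le> val F b e w" using 1(2) c'[of w b] w by simp
    qed
    then show "\<exists>g. g holomorphic_on ball 0 1 \<and> (\<forall>w\<in>ball 0 1. val F b e w = Re (g w))"
      using poisson_holomorphic[OF c] by (metis mem_ball_0)
  qed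
qed

end

section \<open>Perron's method\<close>

text \<open>Harnack's principle: on the half disc the differences are controlled by their value at
  the centre, so convergence at the centre is uniform on the half disc, and the limit, rescaled to
  the unit disc, is again a Poisson integral.\<close>

lemma harnack_increasing:
  assumes c: "\<And>n. continuous_on (cball 0 1) (u n)"
    and p: "\<And>n w. norm w < 1 \<Longrightarrow> u n w = poisson (u n) w"
    and mono: "\<And>n w. norm w \<le> 1 \<Longrightarrow> u n w \<le> u (Suc n) w"
    and bd: "\<And>n w. norm w \<le> 1 \<Longrightarrow> u n w \<le> B"
  obtains h g where "continuous_on (cball 0 (1/2)) h" "\<And>w. norm w \<le> 1/2 \<Longrightarrow> (\<lambda>n. u n w) \<longlonglongrightarrow> h w"
    "g holomorphic_on ball 0 1" "\<And>w. norm w < 1 \<Longrightarrow> h (of_real (1/2) * w) = Re (g w)"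
proof -
  have cs: "continuous_on (sphere 0 1) (u n)" for n
    by (rule continuous_on_subset[OF c]) auto
  have inc: "norm w \<le> 1 \<Longrightarrow> incseq (\<lambda>n. u n w)" for w
    by (rule incseq_SucI) (rule mono)
  define h where "h = (\<lambda>w. lim (\<lambda>n. u n w))"
  have h: "(\<lambda>n. u n w) \<longlonglongrightarrow> h w" if w: "norm w \<le> 1" for w
  proof -
    obtain L where "(\<lambda>n. u n w) \<longlonglongrightarrow> L"
      using incseq_convergent[OF inc[OF w], of B] bd[OF w] by blast
    then show ?thesis unfolding h_def by (simp add: limI)
  qed
  \<comment> \<open>The factor 3 is (1 + 1/2) / (1 - 1/2), the Harnack constant of the half
    disc.\<close>
  have le: "u m w - u n w \<le> 3 * (u m 0 - u n 0)" if "n \<le> m" "norm w \<le> 1/2" for m n w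
  proof -
    have "poisson (\<lambda>z. u m z - u n z) w \<le> (1 + norm w) / (1 - norm w) * poisson (\<lambda>z. u m z - u n z) 0"
      by (rule poisson_Harnack(2)) (use incseqD[OF inc that(1)] that in \<open>auto intro!: continuous_intros cs\<close>)
    moreover have "poisson (\<lambda>z. u m z - u n z) z = u m z - u n z" if "norm z < 1" for z
      using that p by (simp add: poisson_diff cs)
    ultimately have "u m w - u n w \<le> (1 + norm w) / (1 - norm w) * (u m 0 - u n 0)"
      using that by simp
    also have "\<dots> \<le> 3 * (u m 0 - u n 0)"
      using that incseqD[OF inc that(1), of 0] by (intro mult_right_mono) (auto simp: field_simps)
    finally show ?thesis .
  qed
  have hu: "0 \<le> h w - u n w" "h w - u n w \<le> 3 * (h 0 - u n 0)" if w: "norm w \<le> 1/2" for n w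
  proof -
    show "0 \<le> h w - u n w" using incseq_le[OF inc h] w by simp
    have "(\<lambda>m. u m w - u n w) \<longlonglongrightarrow> h w - u n w" "(\<lambda>m. 3 * (u m 0 - u n 0)) \<longlonglongrightarrow> 3 * (h 0 - u n 0)"
      by (intro tendsto_intros h, use w in simp)+
    then show "h w - u n w \<le> 3 * (h 0 - u n 0)"
      by (rule LIMSEQ_le) (use le w in auto)
  qed
  have lim0: "(\<lambda>n. 3 * (h 0 - u n 0)) \<longlonglongrightarrow> 0"
    using tendsto_mult[OF tendsto_const[of 3] tendsto_diff[OF tendsto_const[of "h 0"] h[of 0]]] by simp
  have ul: "uniform_limit (cball 0 (1/2)) u h sequentially"
  proof (rule uniform_limitI)
    fix e :: real assume "e > 0"
    then have "\<forall>\<^sub>F n in sequentially. 3 * (h 0 - u n 0) < e"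
      using lim0 by (simp add: order_tendsto_iff)
    then show "\<forall>\<^sub>F n in sequentially. \<forall>x\<in>cball 0 (1/2). dist (u n x) (h x) < e"
    proof eventually_elim
      case (elim n)
      show ?case
      proof
        fix x :: complex assume "x \<in> cball 0 (1/2)"
        then have "norm x \<le> 1/2" by simp
        then show "dist (u n x) (h x) < e" using hu[of x n] elim by (simp add: dist_real_def)
      qed
    qed
  qed
  have ch: "continuous_on (cball 0 (1/2)) h"
    by (rule uniform_limit_theorem[OF _ ul]) (auto intro!: always_eventually continuous_on_subset[OF c])
  have nh: "norm (of_real (1/2) * w) \<le> 1/2" if "norm w \<le> 1" for w :: complex
    using that by (simp add: norm_mult)
  have chs: "continuous_on (sphere 0 1) (\<lambda>w. h (of_real (1/2) * w))"
    by (rule continuous_on_compose2[OF ch]) (use nh in \<open>auto intro!: continuous_intros\<close>)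
  have cus: "continuous_on (sphere 0 1) (\<lambda>w. u n (of_real (1/2) * w))" for n
    by (rule continuous_on_compose2[OF c]) (use nh in \<open>auto intro!: continuous_intros simp: norm_mult\<close>)
  have up: "u n (of_real (1/2) * w) = poisson (\<lambda>w. u n (of_real (1/2) * w)) w" if w: "norm w < 1" for n w
  proof -
    obtain g where g: "g holomorphic_on ball 0 1" "\<And>z. norm z < 1 \<Longrightarrow> poisson (u n) z = Re (g z)"
      using poisson_holomorphic[OF cs] by blast
    have *: "u n (of_real (1/2) * z) = Re (g (of_real (1/2) * z))" if "norm z \<le> 1" for z
      using p[of "of_real (1/2) * z"] g(2)[of "of_real (1/2) * z"] nh[OF that] by simp
    have "poisson (\<lambda>w. u n (of_real (1/2) * w)) w = poisson (\<lambda>w. Re (g (of_real (1/2) * w))) w"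
      by (rule poisson_cong) (use * w in auto)
    also have "\<dots> = Re (g (of_real (1/2) * w))"
    proof (rule poisson_Re_holomorphic[OF _ _ w])
      show "continuous_on (cball 0 1) (\<lambda>w. g (of_real (1/2) * w))"
        by (rule continuous_on_compose2[OF holomorphic_on_imp_continuous_on[OF g(1)]])
          (use nh in \<open>force intro!: continuous_intros\<close>)+
      show "(\<lambda>w. g (of_real (1/2) * w)) holomorphic_on ball 0 1"
        by (rule holomorphic_on_compose_gen[OF _ g(1), unfolded o_def])
          (use nh in \<open>force intro!: holomorphic_intros\<close>)+
    qed
    finally show ?thesis using *[of w] w by simp
  qed
  have hp: "h (of_real (1/2) * w) = poisson (\<lambda>w. h (of_real (1/2) * w)) w" if w: "norm w < 1" for w
  proof -
    have bnd: "0 \<le> poisson (\<lambda>w. h (of_real (1/2) * w)) w - u n (of_real (1/2) * w)"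
      "poisson (\<lambda>w. h (of_real (1/2) * w)) w - u n (of_real (1/2) * w) \<le> 3 * (h 0 - u n 0)" for n
    proof -
      have e: "poisson (\<lambda>w. h (of_real (1/2) * w)) w - u n (of_real (1/2) * w)
          = poisson (\<lambda>w. h (of_real (1/2) * w) - u n (of_real (1/2) * w)) w"
        by (subst poisson_diff[OF chs cus]) (use up[OF w] in simp)
      have "poisson (\<lambda>w. 0) w \<le> poisson (\<lambda>w. h (of_real (1/2) * w) - u n (of_real (1/2) * w)) w"
        by (intro poisson_mono continuous_on_const continuous_on_diff chs cus) (use hu(1) nh w in auto)
      moreover have "poisson (\<lambda>w. h (of_real (1/2) * w) - u n (of_real (1/2) * w)) w \<le> poisson (\<lambda>w. 3 * (h 0 - u n 0)) w"
      proof (rule poisson_mono)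
        show "h (of_real (1/2) * z) - u n (of_real (1/2) * z) \<le> 3 * (h 0 - u n 0)" if "norm z = 1" for z
          using hu(2)[OF nh] that by simp
        show "continuous_on (sphere 0 1) (\<lambda>w. h (of_real (1/2) * w) - u n (of_real (1/2) * w))"
          by (intro continuous_on_diff chs cus)
      qed (use w in auto)
      ultimately show "0 \<le> poisson (\<lambda>w. h (of_real (1/2) * w)) w - u n (of_real (1/2) * w)"
        "poisson (\<lambda>w. h (of_real (1/2) * w)) w - u n (of_real (1/2) * w) \<le> 3 * (h 0 - u n 0)"
        unfolding e using w by auto
    qed
    have "(\<lambda>n. poisson (\<lambda>w. h (of_real (1/2) * w)) w - u n (of_real (1/2) * w)) \<longlonglongrightarrow> 0"
      by (rule tendsto_sandwich[OF _ _ tendsto_const lim0]) (use bnd in auto)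
    moreover have "(\<lambda>n. poisson (\<lambda>w. h (of_real (1/2) * w)) w - u n (of_real (1/2) * w)) \<longlonglongrightarrow>
       poisson (\<lambda>w. h (of_real (1/2) * w)) w - h (of_real (1/2) * w)"
      by (intro tendsto_intros h) (use nh[of w] w in auto)
    ultimately show ?thesis using LIMSEQ_unique by fastforce
  qed
  obtain g where "g holomorphic_on ball 0 1" "\<And>z. norm z < 1 \<Longrightarrow> poisson (\<lambda>w. h (of_real (1/2) * w)) z = Re (g z)"
    using poisson_holomorphic[OF chs] by blast
  then show ?thesis using that[OF ch, of g] h hp by auto
qed

context disc_surface
begin

lemma contX_eps:
  assumes "\<And>x \<epsilon>. x \<in> topspace X \<Longrightarrow> \<epsilon> > 0 \<Longrightarrow> \<exists>U. openin X U \<and> x \<in> U \<and> (\<forall>y\<in>U. \<bar>b y - b x\<bar> < \<epsilon>)"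
  shows "contX b"
  unfolding continuous_map_def
proof (intro conjI allI impI)
  fix T :: "real set" assume "openin euclideanreal T"
  then have T: "open T" by simp
  show "openin X {x \<in> topspace X. b x \<in> T}"
  proof (subst openin_subopen, clarify)
    fix x assume x: "x \<in> topspace X" "b x \<in> T"
    then obtain \<epsilon> where \<epsilon>: "\<epsilon> > 0" "\<And>y. dist y (b x) < \<epsilon> \<Longrightarrow> y \<in> T" using T open_dist by metis
    obtain U where U: "openin X U" "x \<in> U" "\<forall>y\<in>U. \<bar>b y - b x\<bar> < \<epsilon>" using assms[OF x(1) \<epsilon>(1)] by blast
    then have "U \<subseteq> {x \<in> topspace X. b x \<in> T}" using \<epsilon>(2) openin_subset by (force simp: dist_real_def)
    then show "\<exists>U. openin X U \<and> x \<in> U \<and> U \<subseteq> {x \<in> topspace X. b x \<in> T}" using U by blast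
  qed
qed auto

lemma contX_nbhd:
  assumes "contX b" "x \<in> topspace X" "\<epsilon> > 0"
  shows "\<exists>U. openin X U \<and> x \<in> U \<and> (\<forall>y\<in>U. \<bar>b y - b x\<bar> < \<epsilon>)"
proof (intro exI conjI)
  show "openin X {y \<in> topspace X. b y \<in> ball (b x) \<epsilon>}"
    by (rule openin_continuous_map_preimage[OF assms(1)]) auto
qed (use assms in \<open>auto simp: dist_real_def\<close>)

text \<open>The solution is the supremum of all subsolutions below \<open>bp\<close>. On a disc
  inside V it is identified with the limit of an increasing sequence of modified subsolutions;
  outside V it is squeezed between \<open>bm\<close> and \<open>bp\<close>, which agree
  there.\<close>

proposition perron:
  assumes F: "circle_map F" and V: "openin X V"
    and bm: "contX bm" "sub F V bm" and bp: "contX bp" "super F V bp"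
    and le: "\<And>x. x \<in> topspace X \<Longrightarrow> bm x \<le> bp x"
    and eq: "\<And>x. x \<in> topspace X \<Longrightarrow> x \<notin> V \<Longrightarrow> bm x = bp x"
  obtains b where "contX b" "harm F V b"
    "\<And>x. x \<in> topspace X \<Longrightarrow> bm x \<le> b x" "\<And>x. x \<in> topspace X \<Longrightarrow> b x \<le> bp x"
proof -
  define P where "P = {b. contX b \<and> sub F V b \<and> (\<forall>x\<in>topspace X. b x \<le> bp x)}"
  define B where "B = (\<lambda>x. SUP b\<in>P. b x)"
  have bmP: "bm \<in> P" using bm le by (auto simp: P_def)
  have bdd: "bdd_above ((\<lambda>b. b x) ` P)" if "x \<in> topspace X" for x
    using that by (intro bdd_aboveI[of _ "bp x"]) (auto simp: P_def)
  have up: "b x \<le> B x" if "b \<in> P" "x \<in> topspace X" for b x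
    unfolding B_def by (rule cSUP_upper[OF that(1) bdd[OF that(2)]])
  have Bp: "B x \<le> bp x" if "x \<in> topspace X" for x
    unfolding B_def by (rule cSUP_least) (use bmP that in \<open>auto simp: P_def\<close>)
  \<comment> \<open>The modification of the supersolution \<open>bp\<close> lies below
    \<open>bp\<close>, which is \<open>modify_ge\<close> read through conjugation. Since
    modification is monotone, a modified member of \<open>P\<close> stays below
    \<open>bp\<close>.\<close>
  have modP: "modify F e b \<in> P" if b: "b \<in> P" and e: "e \<in> E" "e ` cball 0 1 \<subseteq> V" for b e
  proof -
    have bc: "contX b" "sub F V b" "\<And>x. x \<in> topspace X \<Longrightarrow> b x \<le> bp x" using b by (auto simp: P_def)
    have "modify F e b x \<le> bp x" if x: "x \<in> topspace X" for x
    proof -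
      have "- bp x \<le> modify (\<lambda>x. cnj (F x)) e (\<lambda>x. - bp x) x"
      proof (rule modify_ge[OF circle_map_cnj[OF F] _ _ e(1) _ x])
        show "contX (\<lambda>x. - bp x)" using bp by (intro continuous_intros)
        show "lsub (\<lambda>x. cnj (F x)) V (\<lambda>x. - bp x)"
          by (rule sub_imp_lsub[OF V]) (simp add: sub_cnj_iff[OF F bp(1)] bp)
        show "e ` ball 0 1 \<subseteq> V" using e(2) by auto
      qed
      also have "modify (\<lambda>x. cnj (F x)) e (\<lambda>x. - bp x) x = - modify F e bp x"
      proof (cases "x \<in> e ` cball 0 1")
        case True
        obtain c where c: "\<And>w b. norm w \<le> 1 \<Longrightarrow> val (\<lambda>x. cnj (F x)) (\<lambda>x. - b x) e w = - val F b e w + c"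
          using val_neg[OF F e(1)] by auto
        let ?w = "coord e x"
        have w: "norm ?w \<le> 1" using disc_coord(2)[OF e(1) True] .
        have cv: "continuous_on (sphere 0 1) (val F bp e)"
          by (rule continuous_on_subset[OF continuous_val[OF F e(1) bp(1)]]) auto
        have "poisson (val (\<lambda>x. cnj (F x)) (\<lambda>x. - bp x) e) ?w = poisson (\<lambda>z. -1 * val F bp e z + c) ?w"
          by (rule poisson_cong) (use w c in auto)
        also have "\<dots> = - poisson (val F bp e) ?w + c"
          using w by (subst poisson_add) (auto intro!: continuous_intros cv simp: poisson_cmul[of "-1", simplified])
        finally show ?thesis using c[OF w, of bp] True unfolding modify_def by (simp add: val_def)
      qed (simp add: modify_def)
      finally have "modify F e bp x \<le> bp x" by simp
      moreover have "modify F e b x \<le> modify F e bp x"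
        by (rule modify_mono[OF F e(1) bc(1) bp(1) bc(3) x])
      ultimately show ?thesis by simp
    qed
    then show ?thesis using contX_modify[OF F e(1) bc(1)] sub_modify[OF F bc(1) V bc(2) e] by (simp add: P_def)
  qed
  have maxP: "(\<lambda>x. max (b x) (b' x)) \<in> P" if "b \<in> P" "b' \<in> P" for b b'
    using that unfolding P_def by (auto intro!: sub_max[OF F] continuous_intros)
  \<comment> \<open>Harnack's principle identifies B only on the half disc; rescaling by 1/2 turns
    the limit into the real part of a holomorphic function on the unit disc.\<close>
  have key: "\<exists>h g. continuous_on (cball 0 (1/2)) h \<and> (\<forall>w. norm w < 1/2 \<longrightarrow> val F B e w = h w)
      \<and> g holomorphic_on ball 0 1 \<and> (\<forall>w. norm w < 1 \<longrightarrow> h (of_real (1/2) * w) = Re (g w))"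
    if e: "e \<in> E" "e ` cball 0 1 \<subseteq> V" for e
  proof -
    have eX: "norm w \<le> 1 \<Longrightarrow> e w \<in> topspace X" for w by (rule disc_topspace[OF e(1)])
    obtain D :: "complex set" where D: "countable D" "\<And>U. open U \<Longrightarrow> U \<noteq> {} \<Longrightarrow> \<exists>d\<in>D. d \<in> U"
      using countable_dense_exists by blast
    have "D \<noteq> {}" using D(2)[of UNIV] by auto
    define q where "q = from_nat_into D"
    have "\<exists>b\<in>P. norm (q k) \<le> 1 \<longrightarrow> B (e (q k)) - 1 / real (Suc n) < b (e (q k))" for k n
    proof (cases "norm (q k) \<le> 1")
      case True
      have "B (e (q k)) - 1 / real (Suc n) < B (e (q k))" by simp
      then show ?thesis
        using bmP less_cSUP_iff[OF _ bdd[OF eX[OF True]]] unfolding B_def by blast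
    qed (use bmP in auto)
    then obtain \<beta> where \<beta>: "\<And>k n. \<beta> k n \<in> P"
        "\<And>k n. norm (q k) \<le> 1 \<Longrightarrow> B (e (q k)) - 1 / real (Suc n) < \<beta> k n (e (q k))"
      by metis
    \<comment> \<open>Decoding n runs through all pairs of a point of D and an accuracy, and each
      step absorbs the member of \<open>P\<close> that nearly attains B there. Modifying after every
      maximum keeps all terms harmonic on e, and the sequence increases.\<close>
    define c where "c = rec_nat (modify F e bm)
       (\<lambda>n b. modify F e (\<lambda>x. max (b x) (case_prod \<beta> (prod_decode n) x)))"
    have c0: "c 0 = modify F e bm" and cS: "c (Suc n) = modify F e (\<lambda>x. max (c n x) (case_prod \<beta> (prod_decode n) x))" for n
      by (simp_all add: c_def)
    have cP: "c n \<in> P" for n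
      by (induction n) (auto simp: c0 cS split: prod.split intro!: modP[OF _ e] maxP \<beta> bmP)
    have eb: "e ` ball 0 1 \<subseteq> V" using e(2) by auto
    have mge: "b x \<le> modify F e b x" if "b \<in> P" "x \<in> topspace X" for b x
      using that by (intro modify_ge[OF F _ sub_imp_lsub[OF V] e(1) eb]) (auto simp: P_def)
    have step: "max (c n x) (case_prod \<beta> (prod_decode n) x) \<le> c (Suc n) x" if "x \<in> topspace X" for n x
      unfolding cS by (rule mge[OF _ that]) (auto split: prod.split intro!: maxP cP \<beta>)
    have cm: "\<exists>b. contX b \<and> c n = modify F e b" for n
    proof (cases n)
      case 0 then show ?thesis using c0 bm by auto
    next
      case (Suc m)
      have "contX (\<lambda>x. max (c m x) (case_prod \<beta> (prod_decode m) x))"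
      proof -
        have "case_prod \<beta> (prod_decode m) \<in> P" by (cases "prod_decode m") (simp add: \<beta>)
        from maxP[OF cP[of m] this] show ?thesis by (simp add: P_def)
      qed
      then show ?thesis using cS Suc by auto
    qed
    define u where "u = (\<lambda>n. val F (c n) e)"
    have cc: "contX (c n)" for n using cP by (auto simp: P_def)
    have uc: "continuous_on (cball 0 1) (u n)" for n
      unfolding u_def by (intro continuous_val F e cc)
    have up': "u n w = poisson (u n) w" if w: "norm w < 1" for n w
    proof -
      obtain b where b: "contX b" "c n = modify F e b" using cm by blast
      have "u n w = poisson (val F b e) w" using w val_modify[OF e(1)] by (simp add: u_def b(2))
      also have "\<dots> = poisson (u n) w"
        by (rule poisson_cong) (use w in \<open>auto simp: u_def b(2) val_modify[OF e(1)] poisson_def\<close>)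
      finally show ?thesis .
    qed
    have um: "u n w \<le> u (Suc n) w" if "norm w \<le> 1" for n w
      using step[OF eX[OF that], of n] by (simp add: u_def val_def)
    have "compact (val F bp e ` cball 0 1)"
      by (intro compact_continuous_image continuous_val F e bp) auto
    then obtain M where M: "\<And>w. norm w \<le> 1 \<Longrightarrow> val F bp e w \<le> M"
      using compact_imp_bounded bounded_imp_bdd_above bdd_above_def by (metis image_eqI mem_cball_0)
    have ub: "u n w \<le> M" if "norm w \<le> 1" for n w
      using M[OF that] cP[of n] eX[OF that] unfolding u_def val_def P_def by fastforce
    obtain h g where h: "continuous_on (cball 0 (1/2)) h" "\<And>w. norm w \<le> 1/2 \<Longrightarrow> (\<lambda>n. u n w) \<longlonglongrightarrow> h w"
      and g: "g holomorphic_on ball 0 1" "\<And>w. norm w < 1 \<Longrightarrow> h (of_real (1/2) * w) = Re (g w)"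
      using harnack_increasing[of u M, OF uc up' um ub] by blast
    have ule: "u n w \<le> h w" if "norm w \<le> 1/2" for n w
      using incseq_le[OF incseq_SucI h(2)[OF that], of n] um that by auto
    have hD: "val F B e d \<le> h d" if d: "d \<in> D" "norm d \<le> 1/2" for d
    proof -
      obtain k where k: "d = q k" using d(1) D(1) unfolding q_def by (metis from_nat_into_to_nat_on)
      have "B (e d) - 1 / real (Suc n) + lift F e d \<le> h d" for n
      proof -
        define m where "m = prod_encode (k, n)"
        have "B (e d) - 1 / real (Suc n) < \<beta> k n (e d)" using \<beta>(2)[of k n] k d(2) by simp
        also have "\<dots> \<le> c (Suc m) (e d)" using step[of "e d" m] eX[of d] d(2) by (simp add: m_def)
        finally show ?thesis using ule[OF d(2), of "Suc m"] by (simp add: u_def val_def)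
      qed
      moreover have "(\<lambda>n. B (e d) - 1 / real (Suc n) + lift F e d) \<longlonglongrightarrow> B (e d) - 0 + lift F e d"
        using lim_1_over_n[THEN LIMSEQ_Suc] by (intro tendsto_intros) simp
      ultimately show ?thesis using LIMSEQ_le_const2 by (fastforce simp: val_def)
    qed
    \<comment> \<open>A continuous excess over the limit would be positive on an open set, hence at
      a point of D, where the limit already dominates B.\<close>
    have bh: "val F b e w \<le> h w" if b: "b \<in> P" and w: "norm w < 1/2" for b w
    proof (rule ccontr)
      assume n: "\<not> val F b e w \<le> h w"
      have "continuous_on (ball 0 (1/2)) (\<lambda>w. val F b e w - h w)"
        by (intro continuous_intros continuous_on_subset[OF h(1)] continuous_on_subset[OF continuous_val[OF F e(1)]])
          (use b in \<open>auto simp: P_def\<close>)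
      then have "open ({z \<in> ball 0 (1/2). val F b e z - h z \<in> {0<..}})"
        using continuous_open_preimage[of "ball 0 (1/2)" "\<lambda>w. val F b e w - h w" "{0<..}"]
        by (simp add: vimage_def Int_def)
      moreover have "w \<in> {z \<in> ball 0 (1/2). val F b e z - h z \<in> {0<..}}" using n w by simp
      ultimately obtain d where d: "d \<in> D" "norm d < 1/2" "val F b e d > h d" using D(2) by fastforce
      have "val F b e d \<le> val F B e d" using up[OF b eX[of d]] d by (simp add: val_def)
      then show False using hD[OF d(1)] d by simp
    qed
    have "val F B e w = h w" if w: "norm w < 1/2" for w
    proof (rule antisym)
      have "B (e w) \<le> h w - lift F e w"
        unfolding B_def by (rule cSUP_least) (use bmP bh w in \<open>fastforce simp: val_def\<close>)+
      then show "val F B e w \<le> h w" by (simp add: val_def)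
      have "u n w \<le> val F B e w" for n using up[OF cP eX[of w]] w by (simp add: u_def val_def)
      then show "h w \<le> val F B e w" using LIMSEQ_le_const2[OF h(2)[of w]] w by auto
    qed
    then show ?thesis using h g by blast
  qed
  have cB: "contX B"
  proof (rule contX_eps)
    fix x and \<epsilon> :: real assume x: "x \<in> topspace X" and \<epsilon>: "\<epsilon> > 0"
    show "\<exists>U. openin X U \<and> x \<in> U \<and> (\<forall>y\<in>U. \<bar>B y - B x\<bar> < \<epsilon>)"
    proof (cases "x \<in> V")
      case True
      then obtain e where e: "e \<in> E" "e 0 = x" "e ` cball 0 1 \<subseteq> V" using disc_ex[OF V] by blast
      obtain h where h: "continuous_on (cball 0 (1/2)) h" "\<And>w. norm w < 1/2 \<Longrightarrow> val F B e w = h w"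
        using key[OF e(1,3)] by blast
      have "continuous_on (ball 0 (1/2)) (\<lambda>w. h w - lift F e w)"
        by (intro continuous_intros continuous_on_subset[OF h(1)] continuous_on_subset[OF lift(1)[OF F e(1)]]) auto
      moreover have "h w - lift F e w = B (e w)" if "norm w < 1/2" for w
        using h(2)[OF that] by (simp add: val_def)
      ultimately have "continuous_on (ball 0 (1/2)) (\<lambda>w. B (e w))"
        by (simp cong: continuous_on_cong_simp)
      then have op: "open {z \<in> ball 0 (1/2). B (e z) \<in> ball (B x) \<epsilon>}"
        using continuous_open_preimage[of "ball 0 (1/2)" "\<lambda>w. B (e w)" "ball (B x) \<epsilon>"]
        by (simp add: vimage_def Int_def)
      let ?U = "e ` {z \<in> ball 0 (1/2). B (e z) \<in> ball (B x) \<epsilon>}"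
      have "openin X ?U" by (rule disc_open[OF e(1) op]) auto
      moreover have "x \<in> ?U" using e(2) \<epsilon> by (intro image_eqI[of _ _ 0]) auto
      ultimately show ?thesis by (intro exI[of _ ?U]) (auto simp: dist_real_def)
    next
      case False
      obtain U where U: "openin X U" "x \<in> U" "\<forall>y\<in>U. \<bar>bm y - bm x\<bar> < \<epsilon>" using contX_nbhd[OF bm(1) x \<epsilon>] by blast
      obtain U' where U': "openin X U'" "x \<in> U'" "\<forall>y\<in>U'. \<bar>bp y - bp x\<bar> < \<epsilon>" using contX_nbhd[OF bp(1) x \<epsilon>] by blast
      \<comment> \<open>Outside V the two bounds coincide, so B inherits its continuity from
        them.\<close>
      have Bx: "B x = bm x" "B x = bp x" using Bp[OF x] up[OF bmP x] eq[OF x False] by auto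
      have "\<bar>B y - B x\<bar> < \<epsilon>" if y: "y \<in> U \<inter> U'" for y
      proof -
        have yX: "y \<in> topspace X" using y U(1) openin_subset by blast
        have "\<bar>bm y - bm x\<bar> < \<epsilon>" "\<bar>bp y - bp x\<bar> < \<epsilon>" using y U U' by auto
        then show ?thesis using Bp[OF yX] up[OF bmP yX] Bx by linarith
      qed
      then show ?thesis using U U' by (intro exI[of _ "U \<inter> U'"]) auto
    qed
  qed
  have "harm F V B"
  proof (rule harm_local[OF F cB V])
    fix x assume x: "x \<in> V"
    then obtain e where e: "e \<in> E" "e 0 = x" "e ` cball 0 1 \<subseteq> V" using disc_ex[OF V] by blast
    obtain h g where h: "\<And>w. norm w < 1/2 \<Longrightarrow> val F B e w = h w"
      and g: "g holomorphic_on ball 0 1" "\<And>w. norm w < 1 \<Longrightarrow> h (of_real (1/2) * w) = Re (g w)"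
      using key[OF e(1,3)] by blast
    let ?e = "\<lambda>w. e (of_real (1/2) * w)"
    obtain c where c: "\<And>w b. norm w \<le> 1 \<Longrightarrow> val F b ?e w = val F b e (of_real (1/2) * w) + c"
      using val_scale[OF F e(1), of "1/2"] by force
    have "val F B ?e w = Re (g w + of_real c)" if "norm w < 1" for w
      using that c[of w B] h[of "of_real (1/2) * w"] g(2)[OF that] by (simp add: norm_mult)
    moreover have "?e ` cball 0 1 \<subseteq> e ` cball 0 1" by (auto simp: norm_mult)
    moreover have "?e \<in> E" by (rule disc_scale[OF e(1)]) auto
    ultimately show "\<exists>e\<in>E. e 0 = x \<and> e ` cball 0 1 \<subseteq> V \<and>
       (\<exists>g. g holomorphic_on ball 0 1 \<and> (\<forall>w\<in>ball 0 1. val F B e w = Re (g w)))"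
      using e g(1) by (intro bexI[of _ ?e] conjI exI[of _ "\<lambda>w. g w + of_real c"]) (auto intro!: holomorphic_intros)
  qed
  then show ?thesis using that[of B] cB up[OF bmP] Bp by blast
qed

end

section \<open>Logarithmic barriers and potentials\<close>

context disc_surface
begin

lemma circle_map_one: "circle_map (\<lambda>x. 1)"
  by (simp add: circle_map_def)

lemma val_one:
  assumes e: "e \<in> E"
  obtains c where "\<And>w u. norm w \<le> 1 \<Longrightarrow> val (\<lambda>x. 1) u e w = u (e w) + c"
proof -
  have "\<exists>c. \<forall>w\<in>cball 0 1. lift (\<lambda>x. 1) e w = 0 + c"
    by (rule cis_lift_unique)
      (use lift[OF circle_map_one e] in \<open>auto intro!: convex_connected\<close>)
  then show ?thesis using that unfolding val_def by auto
qed

lemma mean_one_iff: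
  assumes e: "e \<in> E" and u: "contX u" and r: "0 < r" "r < 1"
  shows "val (\<lambda>x. 1) u e 0 \<le> mean (\<lambda>x. 1) u e r \<longleftrightarrow> u (e 0) \<le> poisson (\<lambda>w. u (e (of_real r * w))) 0"
    and "mean (\<lambda>x. 1) u e r \<le> val (\<lambda>x. 1) u e 0 \<longleftrightarrow> poisson (\<lambda>w. u (e (of_real r * w))) 0 \<le> u (e 0)"
proof -
  obtain c where c: "\<And>w u. norm w \<le> 1 \<Longrightarrow> val (\<lambda>x. 1) u e w = u (e w) + c" using val_one[OF e] by blast
  have "mean (\<lambda>x. 1) u e r = poisson (\<lambda>w. u (e (of_real r * w)) + c) 0"
    unfolding mean_def by (rule poisson_cong) (use c r in \<open>auto simp: norm_mult\<close>)
  also have "\<dots> = poisson (\<lambda>w. u (e (of_real r * w))) 0 + c"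
    using r by (subst poisson_add) (auto intro!: continuous_on_scale_sphere continuous_disc e u)
  finally have m: "mean (\<lambda>x. 1) u e r = poisson (\<lambda>w. u (e (of_real r * w))) 0 + c" .
  show "val (\<lambda>x. 1) u e 0 \<le> mean (\<lambda>x. 1) u e r \<longleftrightarrow> u (e 0) \<le> poisson (\<lambda>w. u (e (of_real r * w))) 0"
    "mean (\<lambda>x. 1) u e r \<le> val (\<lambda>x. 1) u e 0 \<longleftrightarrow> poisson (\<lambda>w. u (e (of_real r * w))) 0 \<le> u (e 0)"
    using c[of 0 u] by (simp_all add: m)
qed

lemma poisson_Re_scaled:
  assumes g: "g holomorphic_on ball 0 1" and r: "0 < r" "r < 1"
  shows "poisson (\<lambda>w. Re (g (of_real r * w))) 0 = Re (g 0)"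
proof -
  have lt: "norm (of_real r * w) < 1" if "norm w \<le> 1" for w :: complex
    using that r mult_le_one[of r "norm w"] by (simp add: norm_mult) (smt (verit) mult_left_le norm_ge_zero)
  have "poisson (\<lambda>w. Re (g (of_real r * w))) 0 = Re (g (of_real r * 0))"
  proof (rule poisson_Re_holomorphic)
    show "continuous_on (cball 0 1) (\<lambda>w. g (of_real r * w))"
      by (rule continuous_on_compose2[OF holomorphic_on_imp_continuous_on[OF g]])
        (use lt in \<open>auto intro!: continuous_intros\<close>)
    show "(\<lambda>w. g (of_real r * w)) holomorphic_on ball 0 1"
      by (rule holomorphic_on_compose_gen[OF _ g, unfolded o_def])
        (use lt in \<open>auto intro!: holomorphic_intros\<close>)
  qed auto
  then show ?thesis by simp
qed

lemma coord_subdisc: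
  assumes e: "e \<in> E" and e': "e' \<in> E" "e' ` cball 0 1 \<subseteq> e ` ball 0 1" and w: "norm w \<le> 1"
  shows "e (coord e (e' w)) = e' w" "norm (coord e (e' w)) < 1"
proof -
  have "e' w \<in> e ` ball 0 1" using w e'(2) by auto
  then show "e (coord e (e' w)) = e' w" "norm (coord e (e' w)) < 1" using e by auto
qed

lemma ln_coord_Re:
  assumes e: "e \<in> E" and e': "e' \<in> E" "e' ` cball 0 1 \<subseteq> e ` ball 0 1"
    and nz: "\<And>w. norm w < 1 \<Longrightarrow> coord e (e' w) \<noteq> 0"
  obtains g where "g holomorphic_on ball 0 1" "\<And>w. norm w < 1 \<Longrightarrow> ln (norm (coord e (e' w))) = Re (g w)"
proof -
  obtain g where g: "g holomorphic_on ball 0 1" "\<And>w. w \<in> ball 0 1 \<Longrightarrow> coord e (e' w) = exp (g w)"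
    using contractible_imp_holomorphic_log[OF disc_trans[OF e e'] convex_imp_contractible[OF convex_ball]] nz
    by (metis mem_ball_0)
  have "ln (norm (coord e (e' w))) = Re (g w)" if "norm w < 1" for w
    using g(2)[of w] that by simp
  then show ?thesis using that g(1) by blast
qed

text \<open>Up to sign the Green's function of the disc with pole at its centre, truncated at radius
  r and extended by 0. It is harmonic between the circles of radius r and 1.\<close>

definition outer_log :: "(complex \<Rightarrow> 'a) \<Rightarrow> real \<Rightarrow> 'a \<Rightarrow> real" where
  "outer_log e r x = (if x \<in> e ` cball 0 1 then ln (max (norm (coord e x)) r) else 0)"

lemma contX_outer_log:
  assumes "e \<in> E" "0 < r" "r < 1" shows "contX (outer_log e r)"
  unfolding outer_log_def[abs_def]
  by (rule contX_disc_glue[OF assms(1), of "\<lambda>w. ln (max (norm w) r)" "\<lambda>x. 0"])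
    (use assms in \<open>auto intro!: continuous_intros\<close>)

lemma outer_log_bounds:
  assumes "e \<in> E" "0 < r" "r < 1" shows "ln r \<le> outer_log e r x" "outer_log e r x \<le> 0"
  using assms by (auto simp: outer_log_def)

lemma outer_log_eq: "e \<in> E \<Longrightarrow> norm w \<le> 1 \<Longrightarrow> outer_log e r (e w) = ln (max (norm w) r)"
  by (auto simp: outer_log_def)

text \<open>A small disc that avoids the inner one has a coordinate without zeros, and on a simply
  connected domain such a coordinate has a holomorphic logarithm.\<close>

lemma outer_log_Re:
  assumes e: "e \<in> E" and r: "0 < r" "r < 1" and U: "openin X U" and x: "x \<in> U" "x \<in> e ` ball 0 1" "x \<notin> e ` cball 0 r"
  obtains e' g where "e' \<in> E" "e' 0 = x" "e' ` cball 0 1 \<subseteq> U" "e' ` cball 0 1 \<subseteq> e ` ball 0 1"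
    "g holomorphic_on ball 0 1" "\<And>w. norm w < 1 \<Longrightarrow> outer_log e r (e' w) = Re (g w)"
proof -
  have cl: "closedin X (e ` cball 0 r)" by (rule disc_closed[OF e]) (use r in auto)
  have "openin X (U \<inter> e ` ball 0 1 - e ` cball 0 r)"
    by (intro openin_diff openin_Int U openin_disc_ball[OF e] cl)
  then obtain e' where e': "e' \<in> E" "e' 0 = x" "e' ` cball 0 1 \<subseteq> U \<inter> e ` ball 0 1 - e ` cball 0 r"
    using disc_ex[of "U \<inter> e ` ball 0 1 - e ` cball 0 r" x] x by auto
  then have e'e: "e' ` cball 0 1 \<subseteq> e ` ball 0 1" by auto
  have gt: "norm (coord e (e' w)) > r" if "norm w \<le> 1" for w
  proof (rule ccontr)
    assume "\<not> norm (coord e (e' w)) > r"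
    then have "e' w \<in> e ` cball 0 r"
      using coord_subdisc(1)[OF e e'(1) e'e that] by (intro image_eqI[of _ _ "coord e (e' w)"]) auto
    moreover have "e' w \<in> e' ` cball 0 1" using that by simp
    ultimately show False using e'(3) by blast
  qed
  have "coord e (e' w) \<noteq> 0" if "norm w < 1" for w using gt[of w] that r by auto
  then obtain g where g: "g holomorphic_on ball 0 1" "\<And>w. norm w < 1 \<Longrightarrow> ln (norm (coord e (e' w))) = Re (g w)"
    using ln_coord_Re[OF e e'(1) e'e] by blast
  have "outer_log e r (e' w) = Re (g w)" if "norm w < 1" for w
  proof -
    have "e' w \<in> e ` cball 0 1" using e'e that by force
    then show ?thesis using gt[of w] that g(2)[OF that] by (simp add: outer_log_def)
  qed
  then show ?thesis using that e' e'e g by blast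
qed

lemma const_le_poisson:
  assumes "e \<in> E" "contX u" "0 < r" "r < 1" "\<And>x. x \<in> topspace X \<Longrightarrow> c \<le> u x"
  shows "c \<le> poisson (\<lambda>w. u (e (of_real r * w))) 0"
proof -
  have "poisson (\<lambda>w. c) 0 \<le> poisson (\<lambda>w. u (e (of_real r * w))) 0"
  proof (rule poisson_mono)
    show "c \<le> u (e (of_real r * w))" if "norm w = 1" for w
      using assms(3,4) that by (intro assms(5) disc_topspace[OF assms(1)]) (simp add: norm_mult)
  qed (use assms in \<open>auto intro!: continuous_on_scale_sphere continuous_disc\<close>)
  then show ?thesis by simp
qed

text \<open>In the open disc e the function is harmonic off the inner disc. At all other points of V
  it takes its minimum 0, so the mean value inequality is trivial there.\<close>

lemma sub_outer_log:
  assumes e: "e \<in> E" and r: "0 < r" "r < 1" and a: "a \<ge> 0" and V: "openin X V" "V \<inter> e ` cball 0 r = {}"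
  shows "sub (\<lambda>x. 1) V (\<lambda>x. - a * outer_log e r x)"
proof (rule lsub_imp_sub[OF circle_map_one])
  have c: "contX (\<lambda>x. - a * outer_log e r x)"
    by (intro continuous_intros contX_outer_log e r)
  show "contX (\<lambda>x. - a * outer_log e r x)" by fact
  show "lsub (\<lambda>x. 1) V (\<lambda>x. - a * outer_log e r x)"
    unfolding lsub_def
  proof
    fix x assume x: "x \<in> V"
    show "\<exists>e'\<in>E. e' 0 = x \<and> e' ` cball 0 1 \<subseteq> V \<and> (\<forall>t. 0 < t \<and> t < 1 \<longrightarrow>
       val (\<lambda>x. 1) (\<lambda>x. - a * outer_log e r x) e' 0 \<le> mean (\<lambda>x. 1) (\<lambda>x. - a * outer_log e r x) e' t)"
    proof (cases "x \<in> e ` ball 0 1")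
      case True
      have "x \<notin> e ` cball 0 r" using x V(2) by auto
      then obtain e' g where e': "e' \<in> E" "e' 0 = x" "e' ` cball 0 1 \<subseteq> V"
        and g: "g holomorphic_on ball 0 1" "\<And>w. norm w < 1 \<Longrightarrow> outer_log e r (e' w) = Re (g w)"
        using outer_log_Re[OF e r V(1) x True] by metis
      have "val (\<lambda>x. 1) (\<lambda>x. - a * outer_log e r x) e' 0 \<le> mean (\<lambda>x. 1) (\<lambda>x. - a * outer_log e r x) e' t"
        if t: "0 < t" "t < 1" for t
      proof (subst mean_one_iff(1)[OF e'(1) c t])
        have "poisson (\<lambda>w. - a * outer_log e r (e' (of_real t * w))) 0 = poisson (\<lambda>w. Re ((\<lambda>w. - of_real a * g w) (of_real t * w))) 0"
          by (rule poisson_cong) (use g(2) t in \<open>auto simp: norm_mult\<close>)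
        also have "\<dots> = Re (- of_real a * g 0)"
          by (rule poisson_Re_scaled[of "\<lambda>w. - of_real a * g w"]) (use t g in \<open>auto intro!: holomorphic_intros\<close>)
        finally show "- a * outer_log e r (e' 0) \<le> poisson (\<lambda>w. - a * outer_log e r (e' (of_real t * w))) 0"
          using g(2)[of 0] by simp
      qed
      then show ?thesis using e' by blast
    next
      case False
      obtain e' where e': "e' \<in> E" "e' 0 = x" "e' ` cball 0 1 \<subseteq> V" using disc_ex[OF V(1) x] by blast
      have x0: "outer_log e r x = 0"
      proof (cases "x \<in> e ` cball 0 1")
        case True
        then obtain w where w: "x = e w" "norm w \<le> 1" by auto
        then have "\<not> norm w < 1" using False by auto
        then show ?thesis using w e r by (simp add: outer_log_eq)
      qed (simp add: outer_log_def)
      have "val (\<lambda>x. 1) (\<lambda>x. - a * outer_log e r x) e' 0 \<le> mean (\<lambda>x. 1) (\<lambda>x. - a * outer_log e r x) e' t"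
        if t: "0 < t" "t < 1" for t
        using a outer_log_bounds(2)[OF e r] e'(2) x0
        by (subst mean_one_iff(1)[OF e'(1) c t], simp, intro const_le_poisson[OF e'(1) c t, simplified])
          (auto simp: mult_nonneg_nonpos)
      then show ?thesis using e' by blast
    qed
  qed
qed

lemma super_one_iff: "contX b \<Longrightarrow> super (\<lambda>x. 1) V b \<longleftrightarrow> sub (\<lambda>x. 1) V (\<lambda>x. - b x)"
  using sub_cnj_iff[OF circle_map_one, of b V] by simp

lemma sub_one_add_const:
  assumes b: "contX b" shows "sub (\<lambda>x. 1) V (\<lambda>x. b x + c) \<longleftrightarrow> sub (\<lambda>x. 1) V b"
proof -
  have cb: "contX (\<lambda>x. b x + c)" by (intro continuous_intros b)
  have "val (\<lambda>x. 1) (\<lambda>x. b x + c) e 0 \<le> mean (\<lambda>x. 1) (\<lambda>x. b x + c) e r \<longleftrightarrow> val (\<lambda>x. 1) b e 0 \<le> mean (\<lambda>x. 1) b e r"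
    if e: "e \<in> E" and r: "0 < r" "r < 1" for e r
  proof -
    have "poisson (\<lambda>w. b (e (of_real r * w)) + c) 0 = poisson (\<lambda>w. b (e (of_real r * w))) 0 + c"
      using r by (subst poisson_add) (auto intro!: continuous_on_scale_sphere continuous_disc e b)
    then show ?thesis unfolding mean_one_iff(1)[OF e cb r] mean_one_iff(1)[OF e b r] by simp
  qed
  then show ?thesis unfolding sub_def by blast
qed

text \<open>The potentials \<open>u\<close> serve as barriers: the defect of a subsolution on the disc \<open>e\<close> can be
  compensated by a large multiple of \<open>u\<close>, which is superharmonic and strictly below 1 off \<open>e\<close>.\<close>

lemma potential:
  assumes e0: "e0 \<in> E" and r: "0 < r" "r < s" "s < 1" and e: "e \<in> E" "e ` cball 0 1 \<inter> e0 ` cball 0 s = {}"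
  obtains u \<eta> where "contX u" "super (\<lambda>x. 1) (topspace X - e0 ` cball 0 r) u" "\<eta> > 0"
    "\<And>w. norm w \<le> 1/2 \<Longrightarrow> u (e w) = 1" "\<And>w. norm w \<le> r \<Longrightarrow> u (e0 w) = 0"
    "\<And>x. x \<in> topspace X \<Longrightarrow> 0 \<le> u x" "\<And>x. x \<in> topspace X \<Longrightarrow> u x \<le> 1"
    "\<And>x. x \<in> topspace X \<Longrightarrow> x \<notin> e ` ball 0 1 \<Longrightarrow> u x \<le> 1 - \<eta>"
proof -
  define K where "K = e ` cball 0 (1/2)"
  define K' where "K' = e0 ` cball 0 r"
  define V where "V = topspace X - K - K'"
  define W where "W = topspace X - K'"
  \<comment> \<open>Rescaling turns radius s into the unit circle, so the barrier of
    \<open>e1\<close> is constant off radius s, in particular on the disc e. The inner radius r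
    becomes t = r / s.\<close>
  define e1 where "e1 = (\<lambda>w. e0 (of_real s * w))"
  have e1: "e1 \<in> E" unfolding e1_def by (rule disc_scale[OF e0]) (use r in auto)
  define t where "t = r / s"
  have t: "0 < t" "t < 1" using r by (auto simp: t_def)
  have e1K: "e1 ` cball 0 t = K'"
  proof -
    have "(\<lambda>w. of_real s * w) ` cball (0::complex) t = cball 0 r"
    proof (intro subset_antisym subsetI)
      fix z :: complex assume "z \<in> cball 0 r"
      then show "z \<in> (\<lambda>w. of_real s * w) ` cball 0 t"
        using r by (intro image_eqI[of _ _ "z / of_real s"]) (auto simp: norm_divide t_def divide_right_mono)
    qed (use r in \<open>auto simp: norm_mult t_def field_simps\<close>)
    then show ?thesis unfolding K'_def e1_def by (metis image_image)
  qed
  have clK: "closedin X K" unfolding K_def by (rule disc_closed[OF e(1)]) auto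
  have clK': "closedin X K'" unfolding K'_def by (rule disc_closed[OF e0]) (use r in auto)
  have "e ` cball 0 1 \<inter> K' = {}" using e(2) r by (fastforce simp: K'_def)
  then have KK': "K \<inter> K' = {}" by (fastforce simp: K_def)
  have V: "openin X V" unfolding V_def by (intro openin_diff clK clK') auto
  have W: "openin X W" unfolding W_def by (intro openin_diff clK') auto
  have kt: "K \<subseteq> topspace X" "K' \<subseteq> topspace X" using clK clK' closedin_subset by blast+
  have e00: "e0 0 \<in> K'" using r by (auto simp: K'_def)
  have Vp: "V \<noteq> topspace X" using e00 kt(2) by (auto simp: V_def)
  \<comment> \<open>\<open>bm\<close> is 1 on K and 0 off e, while \<open>bp\<close> is 0 on K' and
    1 off \<open>e1\<close>. They agree on K and on K', so Perron's method between them solves a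
    Dirichlet problem on V.\<close>
  define bm where "bm = (\<lambda>x. - (1 / ln 2) * outer_log e (1/2) x)"
  define bp where "bp = (\<lambda>x. 1 - (1 / ln t) * outer_log e1 t x)"
  have cm: "contX bm" unfolding bm_def by (intro continuous_intros contX_outer_log e) auto
  have cp: "contX bp" unfolding bp_def by (intro continuous_intros contX_outer_log e1 t)
  have sm: "sub (\<lambda>x. 1) V bm"
    unfolding bm_def by (rule sub_outer_log[OF e(1) _ _ _ V]) (auto simp: V_def K_def)
  have lr: "ln t < 0" using t by simp
  have sp: "super (\<lambda>x. 1) V bp"
  proof -
    have "sub (\<lambda>x. 1) V (\<lambda>x. - (- 1 / ln t) * outer_log e1 t x)"
      by (rule sub_outer_log[OF e1 t _ V]) (use lr in \<open>auto simp: V_def e1K divide_simps\<close>)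
    moreover have c: "contX (\<lambda>x. - (- 1 / ln t) * outer_log e1 t x)"
      by (intro continuous_intros contX_outer_log e1 t)
    ultimately have "sub (\<lambda>x. 1) V (\<lambda>x. - (- 1 / ln t) * outer_log e1 t x + (-1))"
      by (subst sub_one_add_const)
    moreover have "(\<lambda>x. - bp x) = (\<lambda>x. - (- 1 / ln t) * outer_log e1 t x + (-1))"
      by (simp add: bp_def fun_eq_iff)
    ultimately show ?thesis unfolding super_one_iff[OF cp] by simp
  qed
  have bm: "0 \<le> bm x" "bm x \<le> 1" for x
  proof -
    have "- ln 2 \<le> outer_log e (1/2) x" "outer_log e (1/2) x \<le> 0"
      using outer_log_bounds[OF e(1), of "1/2" x] by (auto simp: ln_div)
    then show "0 \<le> bm x" "bm x \<le> 1" by (auto simp: bm_def field_simps)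
  qed
  have bp: "0 \<le> bp x" "bp x \<le> 1" for x
    using outer_log_bounds[OF e1 t, of x] lr by (auto simp: bp_def field_simps)
  have bmK: "bm x = 1" if "x \<in> K" for x
    using that by (auto simp: K_def bm_def outer_log_eq[OF e(1)] max_def ln_div)
  have bpK': "bp x = 0" if "x \<in> K'" for x
    using that t lr by (auto simp: e1K[symmetric] bp_def outer_log_eq[OF e1] max_def)
  have bpK: "bp x = 1" if "x \<in> K" for x
  proof -
    have "e1 ` cball 0 1 \<subseteq> e0 ` cball 0 s" using r by (auto simp: e1_def norm_mult mult_left_le)
    moreover have "x \<in> e ` cball 0 1" using that by (force simp: K_def)
    ultimately have "x \<notin> e1 ` cball 0 1" using e(2) by blast
    then show ?thesis by (simp add: bp_def outer_log_def)
  qed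
  have bmK': "bm x = 0" if "x \<in> K'" for x
  proof -
    have "x \<notin> e ` cball 0 1" using that \<open>e ` cball 0 1 \<inter> K' = {}\<close> by blast
    then show ?thesis by (simp add: bm_def outer_log_def)
  qed
  have eq: "bm x = bp x" if "x \<in> topspace X" "x \<notin> V" for x
    using that bmK bpK bmK' bpK' by (auto simp: V_def)
  have le: "bm x \<le> bp x" if "x \<in> topspace X" for x
    using comparison[OF circle_map_one cm cp V Vp sub_imp_lsub[OF V sm] sp _ that, of 0] eq by simp
  obtain u where u: "contX u" "harm (\<lambda>x. 1) V u"
    "\<And>x. x \<in> topspace X \<Longrightarrow> bm x \<le> u x" "\<And>x. x \<in> topspace X \<Longrightarrow> u x \<le> bp x"
    using perron[OF circle_map_one V cm sm cp sp le eq] by blast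
  have uK: "u x = 1" if "x \<in> K" for x using u(3,4)[of x] that bmK bpK kt by force
  have uK': "u x = 0" if "x \<in> K'" for x using u(3,4)[of x] that bmK' bpK' kt by force
  have u01: "0 \<le> u x" "u x \<le> 1" if "x \<in> topspace X" for x
    using u(3,4)[OF that] bm(1)[of x] bp(2)[of x] by linarith+
  have nu: "contX (\<lambda>x. - u x)" by (intro continuous_intros u)
  have subV: "sub (\<lambda>x. 1) V (\<lambda>x. - u x)"
    using harm_imp_super[OF u(2)] super_one_iff[OF u(1)] by blast
  \<comment> \<open>On K the function takes its maximum 1, so the inequality for supersolutions
    extends across K.\<close>
  have sup: "super (\<lambda>x. 1) W u"
    unfolding super_one_iff[OF u(1)]
  proof (rule lsub_imp_sub[OF circle_map_one nu], unfold lsub_def, intro ballI)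
    fix x assume x: "x \<in> W"
    show "\<exists>e\<in>E. e 0 = x \<and> e ` cball 0 1 \<subseteq> W \<and> (\<forall>r. 0 < r \<and> r < 1 \<longrightarrow>
        val (\<lambda>x. 1) (\<lambda>x. - u x) e 0 \<le> mean (\<lambda>x. 1) (\<lambda>x. - u x) e r)"
    proof (cases "x \<in> K")
      case True
      obtain e' where e': "e' \<in> E" "e' 0 = x" "e' ` cball 0 1 \<subseteq> W" using disc_ex[OF W x] by blast
      have "val (\<lambda>x. 1) (\<lambda>x. - u x) e' 0 \<le> mean (\<lambda>x. 1) (\<lambda>x. - u x) e' r" if r: "0 < r" "r < 1" for r
        unfolding mean_one_iff(1)[OF e'(1) nu r]
        by (rule const_le_poisson[OF e'(1) nu r]) (use u01 uK[OF True] e'(2) in auto)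
      then show ?thesis using e' by blast
    next
      case False
      then have "x \<in> V" using x by (auto simp: V_def W_def)
      then obtain e' where e': "e' \<in> E" "e' 0 = x" "e' ` cball 0 1 \<subseteq> V" using disc_ex[OF V] by blast
      moreover have "V \<subseteq> W" by (auto simp: V_def W_def)
      ultimately show ?thesis using subV unfolding sub_def by (intro bexI[of _ e']) auto
    qed
  qed
  define Z where "Z = {x \<in> topspace X. u x \<in> {1}}"
  have clZ: "closedin X Z" unfolding Z_def by (rule closedin_continuous_map_preimage[OF u(1)]) auto
  have opZ: "\<exists>T. openin X T \<and> x \<in> T \<and> T \<subseteq> Z \<inter> V" if x: "x \<in> Z" "x \<in> V" for x
  proof -
    obtain e' where e': "e' \<in> E" "e' 0 = x" "e' ` cball 0 1 \<subseteq> V" using disc_ex[OF V x(2)] by blast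
    have ux: "u x = 1" using x(1) by (simp add: Z_def)
    have "u (e' w) = 1" if "norm w < 1" for w
    proof (rule disc_max[OF u(1) u01(2) e'(1) _ _ that])
      show "u (e' 0) = 1" using ux e' by simp
      fix r :: real assume r: "0 < r" "r < 1"
      have "val (\<lambda>x. 1) u e' 0 \<le> mean (\<lambda>x. 1) u e' r"
        using harm_imp_sub[OF u(2)] e' r unfolding sub_def by blast
      then show "1 \<le> poisson (\<lambda>w. u (e' (of_real r * w))) 0"
        unfolding mean_one_iff(1)[OF e'(1) u(1) r] using ux e' by simp
    qed
    then have "e' ` ball 0 1 \<subseteq> Z \<inter> V" using e'(3) disc_topspace[OF e'(1)] by (auto simp: Z_def)
    then show ?thesis using openin_disc_ball[OF e'(1)] e'(2) by (metis centre_in_ball imageI zero_less_one)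
  qed
  have ZV: "openin X (Z \<inter> V)"
    by (subst openin_subopen) (use opZ in blast)
  have clopen: "S = {} \<or> S = topspace X" if "closedin X S" "openin X S" for S
    using connected that unfolding connected_space_clopen_in by blast
  have ZK': "Z \<inter> K' = {}" using uK' by (fastforce simp: Z_def)
  \<comment> \<open>The open ring between K and the edge of e is connected, so u = 1 holds on all of
    it or nowhere on it. If nowhere, the part of Z in V is clopen; if everywhere, Z itself is. Both
    contradict the connectedness of X.\<close>
  define A where "A = {w :: complex. 1/2 < norm w \<and> norm w < 1}"
  have AV: "e w \<in> V" if "w \<in> A" for w
  proof -
    have "e w \<notin> K'" using \<open>e ` cball 0 1 \<inter> K' = {}\<close> that by (force simp: A_def)
    moreover have "e w \<notin> K"
    proof
      assume "e w \<in> K"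
      then obtain z where z: "norm z \<le> 1/2" "e w = e z" by (auto simp: K_def)
      then have "w = z" using disc_inj[OF e(1)] that by (auto simp: A_def dest: inj_onD)
      then show False using that z by (simp add: A_def)
    qed
    ultimately show ?thesis using disc_topspace[OF e(1), of w] that by (auto simp: V_def A_def)
  qed
  have less: "u x < 1" if x: "x \<in> topspace X" "x \<notin> K" for x
  proof (rule ccontr)
    assume "\<not> u x < 1"
    then have xZ: "x \<in> Z" using u01(2)[OF x(1)] x by (auto simp: Z_def)
    have "connected A" unfolding A_def using connected_annulus(1)[where a = "0::complex" and ?r1.0 = "1/2" and ?r2.0 = 1] by simp
    moreover have eA: "continuous_map (top_of_set A) X e"
      by (rule continuous_map_from_subtopology_mono[OF disc_cont[OF e(1)]]) (auto simp: A_def)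
    moreover have "openin (top_of_set A) {w \<in> topspace (top_of_set A). e w \<in> Z \<inter> V}"
      by (rule openin_continuous_map_preimage[OF eA ZV])
    moreover have "{w \<in> topspace (top_of_set A). e w \<in> Z \<inter> V} = {w \<in> A. e w \<in> Z}" using AV by auto
    moreover have "closedin (top_of_set A) {w \<in> topspace (top_of_set A). e w \<in> Z}"
      by (rule closedin_continuous_map_preimage[OF eA clZ])
    ultimately have "{w \<in> A. e w \<in> Z} = {} \<or> {w \<in> A. e w \<in> Z} = A"
      unfolding connected_clopen by auto
    then show False
    proof
      assume emp: "{w \<in> A. e w \<in> Z} = {}"
      have "Z \<inter> V = Z \<inter> (topspace X - e ` ball 0 1)"
      proof -
        have "x \<in> K \<or> x \<in> K' \<or> x \<notin> Z" if xb: "x \<in> e ` ball 0 1" for x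
        proof -
          obtain w where w: "x = e w" "norm w < 1" using xb by auto
          then show ?thesis using emp by (cases "norm w \<le> 1/2") (auto simp: K_def A_def)
        qed
        moreover have "K \<subseteq> e ` ball 0 1" by (auto simp: K_def)
        ultimately show ?thesis using ZK' by (auto simp: V_def Z_def)
      qed
      moreover have "closedin X (Z \<inter> (topspace X - e ` ball 0 1))"
        by (intro closedin_Int clZ closedin_diff closedin_topspace openin_disc_ball e)
      ultimately have "Z \<inter> V = {} \<or> Z \<inter> V = topspace X" using clopen ZV by simp
      moreover have "x \<in> Z \<inter> V" using xZ x ZK' by (auto simp: V_def)
      ultimately show False using Vp openin_subset[OF V] by blast
    next
      assume all: "{w \<in> A. e w \<in> Z} = A"
      have eZ: "e ` ball 0 1 \<subseteq> Z"
      proof clarify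
        fix w :: complex assume "w \<in> ball 0 1"
        then show "e w \<in> Z" using all uK[of "e w"] disc_topspace[OF e(1), of w]
          by (cases "norm w \<le> 1/2") (auto simp: K_def Z_def A_def)
      qed
      have "Z = (Z \<inter> V) \<union> e ` ball 0 1"
      proof -
        have "K \<subseteq> e ` ball 0 1" by (auto simp: K_def)
        then show ?thesis using eZ ZK' by (auto simp: V_def Z_def)
      qed
      then have "openin X Z" using ZV openin_disc_ball[OF e(1)] by (metis openin_Un)
      then have "Z = topspace X" using clopen clZ xZ by blast
      then show False using ZK' e00 kt(2) by blast
    qed
  qed
  define S where "S = topspace X - e ` ball 0 1"
  have clS: "closedin X S" unfolding S_def by (intro closedin_diff closedin_topspace openin_disc_ball e)
  \<comment> \<open>Compactness of the complement of the open disc turns the strict inequality into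
    a uniform gap.\<close>
  have "\<exists>\<eta>>0. \<forall>x\<in>S. u x \<le> 1 - \<eta>"
  proof (cases "S = {}")
    case False
    have "compactin X S" using clS compact closedin_compact_space by blast
    then have "compact (u ` S)" using image_compactin[OF _ u(1)] by simp
    then obtain m where m: "m \<in> S" "\<And>x. x \<in> S \<Longrightarrow> u x \<le> u m"
      using compact_attains_sup[of "u ` S"] False by blast
    have "u m < 1" using m(1) by (intro less) (auto simp: S_def K_def)
    then show ?thesis using m(2) by (intro exI[of _ "1 - u m"]) auto
  qed (auto intro: exI[of _ 1])
  then obtain \<eta> where "\<eta> > 0" "\<And>x. x \<in> topspace X \<Longrightarrow> x \<notin> e ` ball 0 1 \<Longrightarrow> u x \<le> 1 - \<eta>"
    by (auto simp: S_def)
  then show ?thesis using that[OF u(1)] sup u01 uK uK' by (auto simp: W_def K_def K'_def)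
qed

end

section \<open>The Dirichlet problem off a closed disc\<close>

context disc_surface
begin

text \<open>Bounds the error of replacing the argument of F by a constant on a covering disc; the
  constants in \<open>subsolution\<close> are calibrated to the bound 1.\<close>

lemma small_disc:
  assumes F: "circle_map F" and U: "openin X U" "x \<in> U"
  shows "\<exists>e\<in>E. e 0 = x \<and> e ` cball 0 1 \<subseteq> U \<and> (\<forall>w. norm w \<le> 1 \<longrightarrow> \<bar>lift F e w - lift F e 0\<bar> \<le> 1)"
proof -
  obtain e where e: "e \<in> E" "e 0 = x" "e ` cball 0 1 \<subseteq> U" using disc_ex[OF U] by blast
  obtain \<delta> where \<delta>: "\<delta> > 0" "\<And>w. norm w \<le> 1 \<Longrightarrow> norm w < \<delta> \<Longrightarrow> \<bar>lift F e w - lift F e 0\<bar> < 1"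
    using lift(1)[OF F e(1)] unfolding continuous_on_iff
    by (metis centre_in_cball dist_0_norm dist_commute dist_real_def mem_cball_0 zero_le_one zero_less_one)
  define r where "r = min (\<delta>/2) 1"
  have r: "0 < r" "r \<le> 1" "r < \<delta>" using \<delta>(1) by (auto simp: r_def)
  let ?e = "\<lambda>w. e (of_real r * w)"
  obtain c where c: "\<And>w b. norm w \<le> 1 \<Longrightarrow> val F b ?e w = val F b e (of_real r * w) + c"
    using val_scale[OF F e(1) r(1,2)] by blast
  have l: "lift F ?e w = lift F e (of_real r * w) + c" if "norm w \<le> 1" for w
    using c[OF that, of "\<lambda>x. 0"] by (simp add: val_def)
  have n: "norm (of_real r * w) \<le> r" if "norm w \<le> 1" for w :: complex
    using that r by (simp add: norm_mult mult_left_le)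
  have "\<bar>lift F ?e w - lift F ?e 0\<bar> \<le> 1" if "norm w \<le> 1" for w
    using \<delta>(2)[of "of_real r * w"] n[OF that] r l[OF that] l[of 0] by simp
  moreover have "?e ` cball 0 1 \<subseteq> e ` cball 0 1" using n r by force
  ultimately show ?thesis using disc_scale[OF e(1) r(1,2)] e by (intro bexI[of _ ?e]) auto
qed

lemma contX_Max:
  assumes "finite I" "contX t0" "\<And>i. i \<in> I \<Longrightarrow> contX (t i)"
  shows "contX (\<lambda>x. Max (insert (t0 x) ((\<lambda>i. t i x) ` I)))"
  using assms(1,3)
proof (induction I)
  case empty then show ?case using assms(2) by simp
next
  case (insert i I)
  have "Max (insert (t0 x) ((\<lambda>i. t i x) ` insert i I)) = max (t i x) (Max (insert (t0 x) ((\<lambda>i. t i x) ` I)))" for x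
    using insert(1) by (simp add: insert_commute[of "t0 x"])
  then show ?case using insert by (simp add: continuous_intros)
qed

lemma contX_sum: "finite I \<Longrightarrow> (\<And>i. i \<in> I \<Longrightarrow> contX (t i)) \<Longrightarrow> contX (\<lambda>x. \<Sum>i\<in>I. t i x)"
  by (induction I rule: finite_induct) (auto intro!: continuous_intros)

text \<open>Where a maximum of several branches is attained, the active branch serves as m: it
  touches from below at the centre, and its own mean value inequality is enough.\<close>

lemma minorant_mean:
  assumes F: "circle_map F" and e: "e \<in> E" and b: "contX b" and m: "continuous_on (cball 0 1) m"
    and le: "\<And>w. norm w \<le> 1 \<Longrightarrow> m w \<le> val F b e w" and eq: "m 0 = val F b e 0"
    and mean: "m 0 \<le> poisson (\<lambda>w. m (of_real r * w)) 0" and r: "0 < r" "r < 1"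
  shows "val F b e 0 \<le> mean F b e r"
proof -
  have "poisson (\<lambda>w. m (of_real r * w)) 0 \<le> mean F b e r"
    unfolding mean_def
  proof (rule poisson_mono)
    show "m (of_real r * w) \<le> val F b e (of_real r * w)" if "norm w = 1" for w
      using that r by (intro le) (simp add: norm_mult)
  qed (use r in \<open>auto intro!: continuous_on_scale_sphere m continuous_val F e b\<close>)
  then show ?thesis using mean eq by simp
qed

lemma poisson_neg_sum_super:
  assumes I: "finite I" and u: "\<And>i. i \<in> I \<Longrightarrow> contX (u i)" "\<And>i. i \<in> I \<Longrightarrow> super (\<lambda>x. 1) V (u i)"
    and e: "e \<in> E" "e ` cball 0 1 \<subseteq> V" and r: "0 < r" "r < 1"
  shows "poisson (\<lambda>w. \<Sum>i\<in>I. u i (e (of_real r * w))) 0 \<le> (\<Sum>i\<in>I. u i (e 0))"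
  using I u
proof (induction I)
  case (insert i I)
  have "poisson (\<lambda>w. u i (e (of_real r * w))) 0 \<le> u i (e 0)"
    using insert.prems(2)[of i] e r mean_one_iff(2)[OF e(1) _ r, of "u i"] insert.prems(1)[of i]
    unfolding super_def by auto
  moreover have "poisson (\<lambda>w. \<Sum>i\<in>insert i I. u i (e (of_real r * w))) 0
    = poisson (\<lambda>w. u i (e (of_real r * w))) 0 + poisson (\<lambda>w. \<Sum>i\<in>I. u i (e (of_real r * w))) 0"
    using insert(1,2) r insert.prems(1)
    by (simp, subst poisson_add) (auto intro!: continuous_on_scale_sphere[of "\<lambda>w. u i (e w)" for i] continuous_on_scale_sphere[of "\<lambda>w. \<Sum>i\<in>I. u i (e w)"] continuous_disc e continuous_on_sum)
  ultimately show ?case using insert by simp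
qed auto

text \<open>b is a maximum of local branches minus N times the sum of the potentials. Where the
  branch of e is active, the lift and the potential of e cancel in \<open>val F b e\<close>, leaving
  a constant minus N times the other potentials, which is subharmonic. The constants make each
  branch sink to a common floor \<open>L\<close> before it leaves its disc, while some branch always
  lies above that floor.\<close>

lemma subsolution:
  assumes F: "circle_map F" and e0: "e0 \<in> E" and r: "0 < r" "r < 1"
    and u: "continuous_on (cball 0 1) u" and g: "g holomorphic_on ball 0 1" "\<And>w. norm w < 1 \<Longrightarrow> u w = Re (g w)"
  obtains b where "contX b" "sub F (topspace X - e0 ` cball 0 r) b" "\<And>w. norm w \<le> r \<Longrightarrow> val F b e0 w = u w"
proof -
  \<comment> \<open>The covering discs avoid radius r0, their halves cover everything beyond r1, and
    the room between r1 and r2 lets the logarithm push the central branch down before the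
    edge.\<close>
  define r0 where "r0 = r + (1 - r) / 4"
  define r1 where "r1 = r + (1 - r) / 2"
  define r2 where "r2 = r + 3 * (1 - r) / 4"
  have rr: "r < r0" "r0 < r1" "r1 < r2" "r2 < 1" using r by (auto simp: r0_def r1_def r2_def field_simps)
  define W where "W = topspace X - e0 ` cball 0 r"
  define W0 where "W0 = topspace X - e0 ` cball 0 r0"
  define C where "C = topspace X - e0 ` ball 0 r1"
  have W: "openin X W" unfolding W_def using r by (intro openin_diff openin_topspace disc_closed e0) auto
  have W0: "openin X W0" unfolding W0_def using rr by (intro openin_diff openin_topspace disc_closed e0) auto
  have "openin X (e0 ` ball 0 r1)" by (rule disc_open[OF e0]) (use rr in auto)
  then have "closedin X C" unfolding C_def by (intro closedin_diff closedin_topspace)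
  then have C: "compactin X C" using compact closedin_compact_space by blast
  have CW0: "C \<subseteq> W0"
  proof
    fix x assume "x \<in> C"
    then show "x \<in> W0" using rr by (auto simp: C_def W0_def)
  qed
  define \<E> where "\<E> = {e \<in> E. e ` cball 0 1 \<subseteq> W0 \<and> (\<forall>w. norm w \<le> 1 \<longrightarrow> \<bar>lift F e w - lift F e 0\<bar> \<le> 1)}"
  have "\<exists>I. finite I \<and> I \<subseteq> \<E> \<and> C \<subseteq> (\<Union>e\<in>I. e ` ball 0 (1/2))"
  proof -
    have "\<forall>U\<in>(\<lambda>e. e ` ball 0 (1/2)) ` \<E>. openin X U" by (auto simp: \<E>_def intro!: disc_open)
    moreover have "C \<subseteq> \<Union>((\<lambda>e. e ` ball 0 (1/2)) ` \<E>)"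
    proof
      fix x assume "x \<in> C"
      then have "x \<in> W0" using CW0 by blast
      from small_disc[OF F W0 this] obtain e where e: "e \<in> E" "e 0 = x" "e \<in> \<E>" by (auto simp: \<E>_def)
      then have "x \<in> e ` ball 0 (1/2)" by (intro image_eqI[of _ _ 0]) auto
      then show "x \<in> \<Union>((\<lambda>e. e ` ball 0 (1/2)) ` \<E>)" using e(3) by blast
    qed
    ultimately obtain \<F> where "finite \<F>" "\<F> \<subseteq> (\<lambda>e. e ` ball 0 (1/2)) ` \<E>" "C \<subseteq> \<Union>\<F>"
      using C unfolding compactin_def by meson
    then show ?thesis by (metis finite_subset_image)
  qed
  then obtain I where I: "finite I" "I \<subseteq> \<E>" "C \<subseteq> (\<Union>e\<in>I. e ` ball 0 (1/2))" by blast
  have IE: "e \<in> E" "e ` cball 0 1 \<subseteq> W0" "\<And>w. norm w \<le> 1 \<Longrightarrow> \<bar>lift F e w - lift F e 0\<bar> \<le> 1" if "e \<in> I" for e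
    using that I(2) by (auto simp: \<E>_def)
  have "\<exists>v \<eta>. contX v \<and> super (\<lambda>x. 1) W v \<and> \<eta> > 0 \<and> (\<forall>w. norm w \<le> 1/2 \<longrightarrow> v (e w) = 1) \<and>
     (\<forall>w. norm w \<le> r \<longrightarrow> v (e0 w) = 0) \<and> (\<forall>x\<in>topspace X. 0 \<le> v x \<and> v x \<le> 1) \<and>
     (\<forall>x\<in>topspace X. x \<notin> e ` ball 0 1 \<longrightarrow> v x \<le> 1 - \<eta>)" if e: "e \<in> I" for e
  proof -
    have d: "e ` cball 0 1 \<inter> e0 ` cball 0 r0 = {}" using IE(2)[OF e] by (auto simp: W0_def)
    have "r0 < 1" using rr by simp
    from potential[OF e0 r(1) rr(1) this IE(1)[OF e] d] show ?thesis unfolding W_def by metis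
  qed
  then have "\<forall>e\<in>I. \<exists>v \<eta>. contX v \<and> super (\<lambda>x. 1) W v \<and> \<eta> > 0 \<and> (\<forall>w. norm w \<le> 1/2 \<longrightarrow> v (e w) = 1) \<and>
     (\<forall>w. norm w \<le> r \<longrightarrow> v (e0 w) = 0) \<and> (\<forall>x\<in>topspace X. 0 \<le> v x \<and> v x \<le> 1) \<and>
     (\<forall>x\<in>topspace X. x \<notin> e ` ball 0 1 \<longrightarrow> v x \<le> 1 - \<eta>)" by blast
  from bchoice[OF this] obtain v where "\<forall>e\<in>I. \<exists>\<eta>. contX (v e) \<and> super (\<lambda>x. 1) W (v e) \<and> \<eta> > 0 \<and> (\<forall>w. norm w \<le> 1/2 \<longrightarrow> v e (e w) = 1) \<and>
     (\<forall>w. norm w \<le> r \<longrightarrow> v e (e0 w) = 0) \<and> (\<forall>x\<in>topspace X. 0 \<le> v e x \<and> v e x \<le> 1) \<and>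
     (\<forall>x\<in>topspace X. x \<notin> e ` ball 0 1 \<longrightarrow> v e x \<le> 1 - \<eta>)" ..
  from bchoice[OF this] obtain \<eta> where v\<eta>_all: "\<forall>e\<in>I. contX (v e) \<and> super (\<lambda>x. 1) W (v e) \<and> \<eta> e > 0 \<and> (\<forall>w. norm w \<le> 1/2 \<longrightarrow> v e (e w) = 1) \<and>
     (\<forall>w. norm w \<le> r \<longrightarrow> v e (e0 w) = 0) \<and> (\<forall>x\<in>topspace X. 0 \<le> v e x \<and> v e x \<le> 1) \<and>
     (\<forall>x\<in>topspace X. x \<notin> e ` ball 0 1 \<longrightarrow> v e x \<le> 1 - \<eta> e)" ..
  have v: "\<And>e. e \<in> I \<Longrightarrow> contX (v e)" "\<And>e. e \<in> I \<Longrightarrow> super (\<lambda>x. 1) W (v e)"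
    and \<eta>: "\<And>e. e \<in> I \<Longrightarrow> \<eta> e > 0" and v1: "\<And>e w. e \<in> I \<Longrightarrow> norm w \<le> 1/2 \<Longrightarrow> v e (e w) = 1"
    and v0: "\<And>e w. e \<in> I \<Longrightarrow> norm w \<le> r \<Longrightarrow> v e (e0 w) = 0"
    and v01: "\<And>e x. e \<in> I \<Longrightarrow> x \<in> topspace X \<Longrightarrow> 0 \<le> v e x \<and> v e x \<le> 1"
    and v\<eta>: "\<And>e x. e \<in> I \<Longrightarrow> x \<in> topspace X \<Longrightarrow> x \<notin> e ` ball 0 1 \<Longrightarrow> v e x \<le> 1 - \<eta> e"
    using v\<eta>_all by blast+
  \<comment> \<open>Ensures N * \<eta> e \<ge> 3 for each e. From the core to the edge of e the
    potential term loses at least 3, and the lift can hide at most 1 at either place, so a gap of 1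
    remains.\<close>
  define N where "N = (\<Sum>e\<in>I. 3 / \<eta> e)"
  have N0: "N \<ge> 0" unfolding N_def by (intro sum_nonneg) (use \<eta> in \<open>auto intro: less_imp_le\<close>)
  have N\<eta>: "N * \<eta> e \<ge> 3" if "e \<in> I" for e
  proof -
    have "3 / \<eta> e \<le> N" unfolding N_def by (rule member_le_sum[OF that _ I(1)]) (use \<eta> in \<open>auto intro: less_imp_le\<close>)
    then show ?thesis using \<eta>[OF that] by (simp add: field_simps)
  qed
  have "compact ((\<lambda>w. u w - lift F e0 w) ` cball 0 1)"
    by (intro compact_continuous_image continuous_intros u lift F e0) auto
  then have "bounded ((\<lambda>w. u w - lift F e0 w) ` cball 0 1)" by (rule compact_imp_bounded)
  then obtain A where "\<forall>y\<in>(\<lambda>w. u w - lift F e0 w) ` cball 0 1. norm y \<le> A"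
    unfolding bounded_iff by blast
  then have A: "\<bar>u w - lift F e0 w\<bar> \<le> A" if "norm w \<le> 1" for w using that by simp
  \<comment> \<open>Between r1 and r2 the logarithmic term drops by 2 * A + 1, enough to beat the
    oscillation 2 * A of \<open>u - lift\<close> and to leave a gap of 1.\<close>
  define Q where "Q = (2 * A + 1) / (ln r2 - ln r1)"
  have lnr: "ln r < ln r1" "ln r1 < ln r2" using rr r by (auto simp: ln_less_cancel_iff)
  have A0: "A \<ge> 0" using A[of 0] by simp
  have Q: "Q * (ln r2 - ln r1) = 2 * A + 1" "Q \<ge> 0" using lnr A0 by (auto simp: Q_def)
  \<comment> \<open>M shifts the covering branches so that all cores, including the central one up
    to radius r1, reach the level N - 1 - M. The floor \<open>L\<close> lies 1 below this
    level.\<close>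
  define M where "M = N - 1 + A + Q * (ln r1 - ln r)"
  define L where "L = N - 2 - M"
  define s where "s = (\<lambda>e w. N * v e (e w) - (lift F e w - lift F e 0) - M)"
  define t where "t = (\<lambda>e x. if x \<in> e ` cball 0 1 then max (s e (coord e x)) L else L)"
  define s0 where "s0 = (\<lambda>w. u w - lift F e0 w - Q * (ln (max (norm w) r) - ln r))"
  define t0 where "t0 = (\<lambda>x. if x \<in> e0 ` cball 0 1 then max (s0 (coord e0 x)) L else L)"
  have s_bd: "s e w \<le> L" if "e \<in> I" "norm w = 1" for e w
  proof -
    have "e w \<notin> e ` ball 0 1"
    proof
      assume "e w \<in> e ` ball 0 1"
      then obtain z where "z \<in> ball 0 1" "e w = e z" by auto
      then have "w = z" using disc_inj[OF IE(1)[OF that(1)]] that(2) by (auto dest: inj_onD)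
      then show False using \<open>z \<in> ball 0 1\<close> that(2) by simp
    qed
    then have "v e (e w) \<le> 1 - \<eta> e" using that disc_topspace[OF IE(1)] by (intro v\<eta>) auto
    then have "N * v e (e w) \<le> N * (1 - \<eta> e)" using N0 by (rule mult_left_mono)
    then have "N * v e (e w) \<le> N - 3" using N\<eta>[OF that(1)] by (simp add: algebra_simps)
    then show ?thesis using IE(3)[OF that(1), of w] that(2) unfolding s_def L_def by linarith
  qed
  have s_core: "s e w \<ge> N - 1 - M" if "e \<in> I" "norm w \<le> 1/2" for e w
    using IE(3)[OF that(1), of w] that v1[OF that] unfolding s_def by auto
  have s0_in: "s0 w \<ge> N - 1 - M" if "norm w \<le> r1" for w
  proof -
    have "ln (max (norm w) r) \<le> ln r1" using that rr r by auto
    then have "Q * (ln (max (norm w) r) - ln r) \<le> Q * (ln r1 - ln r)" using Q(2) by (intro mult_left_mono) auto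
    then show ?thesis using A[of w] that rr unfolding s0_def M_def by (simp add: abs_le_iff)
  qed
  have s0_out: "s0 w \<le> L" if "norm w = 1" for w
  proof -
    have "ln r2 \<le> ln (max (norm w) r)" using that rr r by auto
    then have "Q * (ln r2 - ln r) \<le> Q * (ln (max (norm w) r) - ln r)" using Q(2) by (intro mult_left_mono) auto
    moreover have "Q * (ln r2 - ln r) = 2 * A + 1 + Q * (ln r1 - ln r)" using Q(1) by (simp add: algebra_simps)
    ultimately show ?thesis using A[of w] that unfolding s0_def M_def L_def by (simp add: abs_le_iff)
  qed
  have cs: "continuous_on (cball 0 1) (s e)" if "e \<in> I" for e
    unfolding s_def by (intro continuous_intros lift(1)[OF F IE(1)] continuous_disc v that IE(1))
  have cs0: "continuous_on (cball 0 1) s0"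
    unfolding s0_def using r by (intro continuous_intros u lift(1)[OF F e0]) auto
  have ct: "contX (t e)" if "e \<in> I" for e
    unfolding t_def
    by (rule contX_disc_glue[OF IE(1)[OF that], of "\<lambda>w. max (s e w) L" "\<lambda>x. L"])
      (use s_bd[OF that] cs[OF that] in \<open>auto intro!: continuous_intros\<close>)
  have ct0: "contX t0"
    unfolding t0_def
    by (rule contX_disc_glue[OF e0, of "\<lambda>w. max (s0 w) L" "\<lambda>x. L"])
      (use s0_out cs0 in \<open>auto intro!: continuous_intros\<close>)
  define B where "B = (\<lambda>x. Max (insert (t0 x) ((\<lambda>e. t e x) ` I)))"
  have cB: "contX B" unfolding B_def by (rule contX_Max[OF I(1) ct0 ct])
  define S where "S = (\<lambda>x. \<Sum>e\<in>I. v e x)"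
  have cS: "contX S" unfolding S_def by (rule contX_sum[OF I(1) v(1)])
  define b where "b = (\<lambda>x. B x - N * S x)"
  have cb: "contX b" unfolding b_def by (intro continuous_intros cB cS)
  have Bt0: "t0 x \<le> B x" and Bt: "e \<in> I \<Longrightarrow> t e x \<le> B x" for e x
    unfolding B_def using I(1) by auto
  have Bs0: "s0 w \<le> B (e0 w)" if "norm w \<le> 1" for w
    using Bt0[of "e0 w"] that e0 by (auto simp: t0_def)
  have Bs: "s e w \<le> B (e w)" if "e \<in> I" "norm w \<le> 1" for e w
    using Bt[OF that(1), of "e w"] that IE(1)[OF that(1)] by (auto simp: t_def)
  \<comment> \<open>Every point lies in some core, so the floor never attains the maximum.\<close>
  have BL: "B x > L" if x: "x \<in> topspace X" for x
  proof (cases "x \<in> C")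
    case True
    then obtain e w where e: "e \<in> I" "norm w < 1/2" "x = e w" using I(3) by force
    then have "N - 1 - M \<le> B x" using s_core[of e w] Bs[of e w] by simp
    then show ?thesis by (simp add: L_def)
  next
    case False
    then obtain w where w: "x = e0 w" "norm w < r1" using x by (auto simp: C_def)
    then have "N - 1 - M \<le> B x" using s0_in[of w] Bs0[of w] rr by simp
    then show ?thesis by (simp add: L_def)
  qed
  have Bex: "(\<exists>w. norm w < 1 \<and> x = e0 w \<and> B x = s0 w) \<or> (\<exists>e\<in>I. \<exists>w. norm w < 1 \<and> x = e w \<and> B x = s e w)"
    if x: "x \<in> topspace X" for x
  proof -
    have "B x \<in> insert (t0 x) ((\<lambda>e. t e x) ` I)" unfolding B_def by (rule Max_in) (use I(1) in auto)
    then consider "B x = t0 x" | e where "e \<in> I" "B x = t e x" by auto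
    then show ?thesis
    proof cases
      case 1
      then have "t0 x > L" using BL[OF x] by simp
      then obtain w where w: "x = e0 w" "norm w \<le> 1" "t0 x = s0 w"
        unfolding t0_def using e0 by (auto split: if_splits simp: max_def)
      then have "norm w \<noteq> 1" using s0_out[of w] \<open>t0 x > L\<close> by auto
      then show ?thesis using w 1 by (intro disjI1 exI[of _ w]) auto
    next
      case 2
      then have "t e x > L" using BL[OF x] by simp
      then obtain w where w: "x = e w" "norm w \<le> 1" "t e x = s e w"
        unfolding t_def using IE(1)[OF 2(1)] by (auto split: if_splits simp: max_def)
      then have "norm w \<noteq> 1" using s_bd[OF 2(1), of w] \<open>t e x > L\<close> by auto
      then show ?thesis using w 2 by (intro disjI2 bexI[of _ e] exI[of _ w]) auto
    qed
  qed
  have "lsub F W b" unfolding lsub_def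
  proof
    fix x assume x: "x \<in> W"
    then have xt: "x \<in> topspace X" by (simp add: W_def)
    consider w where "norm w < 1" "x = e0 w" "B x = s0 w" | e w where "e \<in> I" "norm w < 1" "x = e w" "B x = s e w"
      using Bex[OF xt] by blast
    then show "\<exists>e\<in>E. e 0 = x \<and> e ` cball 0 1 \<subseteq> W \<and> (\<forall>r. 0 < r \<and> r < 1 \<longrightarrow> val F b e 0 \<le> mean F b e r)"
    proof cases
      case (2 e w)
      have eE: "e \<in> E" by (rule IE(1)[OF 2(1)])
      have "openin X (W \<inter> e ` ball 0 1)" by (intro openin_Int W openin_disc_ball eE)
      moreover have "x \<in> W \<inter> e ` ball 0 1" using x 2 by auto
      ultimately obtain e' where e': "e' \<in> E" "e' 0 = x" "e' ` cball 0 1 \<subseteq> W \<inter> e ` ball 0 1"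
        using disc_ex by meson
      then have e'e: "e' ` cball 0 1 \<subseteq> e ` ball 0 1" and e'W: "e' ` cball 0 1 \<subseteq> W" by auto
      have e'ec: "e' ` cball 0 1 \<subseteq> e ` cball 0 1" using e'e ball_subset_cball by blast
      obtain c where c: "\<And>w b. norm w \<le> 1 \<Longrightarrow> val F b e' w = val F b e (coord e (e' w)) + c"
        using val_subdisc[OF F eE e'(1) e'ec] by blast
      define k where "k = c + lift F e 0 - M"
      \<comment> \<open>The part of the branch that survives the cancellation. It stays below
        \<open>val F b e'\<close> because B dominates every branch, with equality at the centre,
        where \<open>s e\<close> is active.\<close>
      define m where "m = (\<lambda>w. k - N * (\<Sum>i\<in>I - {e}. v i (e' w)))"
      have form: "val F b e' z = B (e' z) - s e (coord e (e' z)) + m z" if z: "norm z \<le> 1" for z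
      proof -
        have ez: "e (coord e (e' z)) = e' z" by (rule coord_subdisc(1)[OF eE e'(1) e'e z])
        have "S (e' z) = v e (e' z) + (\<Sum>i\<in>I - {e}. v i (e' z))"
          unfolding S_def using I(1) 2(1) by (rule sum.remove)
        then have "m z = k + N * v e (e' z) - N * S (e' z)" by (simp add: m_def algebra_simps)
        then show ?thesis using c[OF z, of b] ez by (simp add: val_def b_def s_def k_def)
      qed
      have "val F b e' 0 \<le> mean F b e' \<rho>" if \<rho>: "0 < \<rho>" "\<rho> < 1" for \<rho>
      proof (rule minorant_mean[OF F e'(1) cb _ _ _ _ \<rho>, of m])
        show "continuous_on (cball 0 1) m"
          unfolding m_def by (intro continuous_intros continuous_disc e' v) auto
        show "m w \<le> val F b e' w" if w: "norm w \<le> 1" for w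
        proof -
          have "s e (coord e (e' w)) \<le> B (e (coord e (e' w)))"
            by (rule Bs[OF 2(1)]) (use coord_subdisc(2)[OF eE e'(1) e'e w] in simp)
          then show ?thesis using form[OF w] coord_subdisc(1)[OF eE e'(1) e'e w] by simp
        qed
        have "coord e x = w" using 2 eE by simp
        then show "m 0 = val F b e' 0" using form[of 0] e'(2) 2(4) by simp
        have "poisson (\<lambda>w. \<Sum>i\<in>I-{e}. v i (e' (of_real \<rho> * w))) 0 \<le> (\<Sum>i\<in>I-{e}. v i (e' 0))"
          by (rule poisson_neg_sum_super[OF _ _ _ e'(1) e'W \<rho>]) (use I(1) v in auto)
        moreover have "continuous_on (sphere 0 1) (\<lambda>w. \<Sum>i\<in>I-{e}. v i (e' (of_real \<rho> * w)))"
          by (rule continuous_on_sum, rule continuous_on_scale_sphere[OF continuous_disc[OF e'(1) v(1)]])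
            (use \<rho> in auto)
        then have "poisson (\<lambda>w. m (of_real \<rho> * w)) 0 = k - N * poisson (\<lambda>w. \<Sum>i\<in>I-{e}. v i (e' (of_real \<rho> * w))) 0"
          unfolding m_def using \<rho>
          by (subst poisson_diff)
            (auto simp: poisson_cmul intro!: continuous_on_mult continuous_on_const)
        ultimately show "m 0 \<le> poisson (\<lambda>w. m (of_real \<rho> * w)) 0"
          using N0 by (simp add: m_def mult_left_mono)
      qed
      then show ?thesis using e' e'W by blast
    next
      case (1 w)
      have xb: "x \<in> e0 ` ball 0 1" using 1 by auto
      have xr: "x \<notin> e0 ` cball 0 r" using x by (simp add: W_def)
      obtain e' q where e': "e' \<in> E" "e' 0 = x" "e' ` cball 0 1 \<subseteq> W" "e' ` cball 0 1 \<subseteq> e0 ` ball 0 1"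
        and q: "q holomorphic_on ball 0 1" "\<And>w. norm w < 1 \<Longrightarrow> outer_log e0 r (e' w) = Re (q w)"
        using outer_log_Re[OF e0 r W x xb xr] by metis
      have e'ec: "e' ` cball 0 1 \<subseteq> e0 ` cball 0 1" using e'(4) ball_subset_cball by blast
      obtain c where c: "\<And>w b. norm w \<le> 1 \<Longrightarrow> val F b e' w = val F b e0 (coord e0 (e' w)) + c"
        using val_subdisc[OF F e0 e'(1) e'ec] by blast
      let ?T = "\<lambda>z. coord e0 (e' z)"
      define k where "k = c + Q * ln r"
      \<comment> \<open>Off the inner disc the truncated logarithm is the real part of a holomorphic
        function on \<open>e'\<close>, so \<open>m0\<close> is harmonic, and m differs from it by -N
        times a sum of superharmonic potentials.\<close>
      define m0 where "m0 = (\<lambda>z. u (?T z) - Q * outer_log e0 r (e' z) + k)"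
      define m where "m = (\<lambda>z. m0 z - N * S (e' z))"
      have form: "val F b e' z = B (e' z) - s0 (?T z) + m z" if z: "norm z \<le> 1" for z
      proof -
        have ez: "e0 (?T z) = e' z" "norm (?T z) < 1" using coord_subdisc[OF e0 e'(1,4) z] by auto
        have "outer_log e0 r (e' z) = ln (max (norm (?T z)) r)"
          using outer_log_eq[OF e0, of "?T z" r] ez by simp
        then show ?thesis using c[OF z, of b] ez by (simp add: val_def b_def s0_def m_def m0_def k_def algebra_simps)
      qed
      have "val F b e' 0 \<le> mean F b e' \<rho>" if \<rho>: "0 < \<rho>" "\<rho> < 1" for \<rho>
      proof (rule minorant_mean[OF F e'(1) cb _ _ _ _ \<rho>, of m])
        have cT: "continuous_on (cball 0 1) ?T" "?T ` cball 0 1 \<subseteq> cball 0 1"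
        proof -
          have "continuous_map (top_of_set (cball 0 1)) (subtopology X (e0 ` cball 0 1)) e'"
            using disc_cont[OF e'(1)] e'ec by (auto simp: continuous_map_in_subtopology)
          from continuous_map_compose[OF this continuous_coord[OF e0]]
          show "continuous_on (cball 0 1) ?T" "?T ` cball 0 1 \<subseteq> cball 0 1"
            by (auto simp: o_def continuous_map_in_subtopology)
        qed
        have cm0: "continuous_on (cball 0 1) m0"
          unfolding m0_def
          by (intro continuous_intros continuous_on_compose2[OF u cT] continuous_disc e' contX_outer_log e0 r)
        show cm: "continuous_on (cball 0 1) m"
          unfolding m_def by (intro continuous_intros cm0 continuous_disc e' cS)
        show "m w \<le> val F b e' w" if w: "norm w \<le> 1" for w
        proof -
          have "s0 (?T w) \<le> B (e0 (?T w))"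
            by (rule Bs0) (use coord_subdisc(2)[OF e0 e'(1,4) w] in simp)
          then show ?thesis using form[OF w] coord_subdisc(1)[OF e0 e'(1,4) w] by simp
        qed
        have "coord e0 x = w" using 1 e0 by simp
        then show "m 0 = val F b e' 0" using form[of 0] e'(2) 1(3) by simp
        have "poisson (\<lambda>w. S (e' (of_real \<rho> * w))) 0 \<le> S (e' 0)"
          unfolding S_def by (rule poisson_neg_sum_super[OF I(1) v e'(1,3) \<rho>])
        moreover have "poisson (\<lambda>w. m (of_real \<rho> * w)) 0 = poisson (\<lambda>w. m0 (of_real \<rho> * w)) 0 - N * poisson (\<lambda>w. S (e' (of_real \<rho> * w))) 0"
          unfolding m_def using \<rho>
          by (subst poisson_diff)
            (auto simp: poisson_cmul intro!: continuous_on_scale_sphere[of "\<lambda>w. S (e' w)"] continuous_on_scale_sphere[OF cm0] continuous_intros continuous_disc e' cS)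
        moreover have "poisson (\<lambda>w. m0 (of_real \<rho> * w)) 0 = m0 0"
        proof -
          define h where "h = (\<lambda>z. g (?T z) - of_real Q * q z + of_real k)"
          have Tlt: "norm (?T z) < 1" if "norm z \<le> 1" for z using coord_subdisc(2)[OF e0 e'(1,4) that] .
          have h: "h holomorphic_on ball 0 1" unfolding h_def
            by (intro holomorphic_intros q(1) holomorphic_on_compose_gen[OF disc_trans[OF e0 e'(1,4)] g(1), unfolded o_def])
              (use Tlt in auto)
          have eq: "m0 z = Re (h z)" if "norm z < 1" for z
            using that g(2)[OF Tlt[of z]] q(2)[OF that] by (simp add: m0_def h_def)
          have "poisson (\<lambda>w. m0 (of_real \<rho> * w)) 0 = poisson (\<lambda>w. Re (h (of_real \<rho> * w))) 0"
            by (rule poisson_cong) (use \<rho> in \<open>auto intro!: eq simp: norm_mult\<close>)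
          then show ?thesis using poisson_Re_scaled[OF h \<rho>] eq[of 0] by simp
        qed
        ultimately show "m 0 \<le> poisson (\<lambda>w. m (of_real \<rho> * w)) 0"
          using N0 by (simp add: m_def mult_left_mono)
      qed
      then show ?thesis using e' by blast
    qed
  qed
  then have "sub F W b" by (rule lsub_imp_sub[OF F cb])
  moreover have "val F b e0 w = u w" if w: "norm w \<le> r" for w
  proof -
    \<comment> \<open>The covering discs miss radius r0 and the potentials vanish up to r, so here
      only the central branch counts, and its logarithmic term is 0.\<close>
    have "e0 w \<notin> e ` cball 0 1" if "e \<in> I" for e
    proof -
      have "e0 w \<in> e0 ` cball 0 r0" using w rr by auto
      then show ?thesis using IE(2)[OF that] by (auto simp: W0_def)
    qed
    then have tL: "t e (e0 w) = L" if "e \<in> I" for e using that by (simp add: t_def)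
    have s0: "s0 w = u w - lift F e0 w" using w by (simp add: s0_def max_def)
    have "s0 w \<ge> N - 1 - M" by (rule s0_in) (use w rr in simp)
    then have sL: "s0 w > L" by (simp add: L_def)
    then have t0: "t0 (e0 w) = s0 w" using w r e0 by (auto simp: t0_def max_def)
    have "B (e0 w) = s0 w" unfolding B_def
      by (rule Max_eqI) (use I(1) tL t0 sL in auto)
    moreover have "S (e0 w) = 0" unfolding S_def using v0 w by simp
    ultimately show ?thesis by (simp add: val_def b_def s0)
  qed
  ultimately show ?thesis using that[OF cb] by (simp add: W_def)
qed

text \<open>A subsolution and, through conjugation, a supersolution with the same data on the inner
  disc; Perron's method finds the harmonic function in between.\<close>

proposition dirichlet:
  assumes F: "circle_map F" and e0: "e0 \<in> E" and r: "0 < r" "r < 1"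
    and u: "continuous_on (cball 0 1) u" and g: "g holomorphic_on ball 0 1" "\<And>w. norm w < 1 \<Longrightarrow> u w = Re (g w)"
  obtains b where "contX b" "harm F (topspace X - e0 ` cball 0 r) b" "\<And>w. norm w \<le> r \<Longrightarrow> val F b e0 w = u w"
proof -
  define W where "W = topspace X - e0 ` cball 0 r"
  have W: "openin X W" unfolding W_def using r by (intro openin_diff openin_topspace disc_closed e0) auto
  have Wp: "W \<noteq> topspace X" using disc_topspace[OF e0, of 0] r by (force simp: W_def)
  let ?F = "\<lambda>x. cnj (F x)"
  obtain bm where bm: "contX bm" "sub F W bm" "\<And>w. norm w \<le> r \<Longrightarrow> val F bm e0 w = u w"
    using subsolution[OF F e0 r u g] unfolding W_def by metis
  obtain c where c: "\<And>w b. norm w \<le> 1 \<Longrightarrow> val ?F (\<lambda>x. - b x) e0 w = - val F b e0 w + c"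
    using val_neg[OF F e0] by blast
  \<comment> \<open>The lift of the conjugate is minus the lift of F only up to the constant c, so
    the data for the conjugate problem are shifted by c.\<close>
  have "continuous_on (cball 0 1) (\<lambda>w. - u w + c)" by (intro continuous_intros u)
  moreover have "(\<lambda>w. - g w + of_real c) holomorphic_on ball 0 1" by (intro holomorphic_intros g)
  moreover have "- u w + c = Re (- g w + of_real c)" if "norm w < 1" for w using g(2)[OF that] by simp
  ultimately obtain b' where b': "contX b'" "sub ?F W b'" "\<And>w. norm w \<le> r \<Longrightarrow> val ?F b' e0 w = - u w + c"
    using subsolution[OF circle_map_cnj[OF F] e0 r, of "\<lambda>w. - u w + c" "\<lambda>w. - g w + of_real c"] unfolding W_def by metis
  define bp where "bp = (\<lambda>x. - b' x)"
  have bp: "contX bp" unfolding bp_def by (intro continuous_intros b')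
  have sp: "super F W bp" using sub_cnj_iff[OF F bp, of W] b'(2) by (simp add: bp_def)
  have vp: "val F bp e0 w = u w" if "norm w \<le> r" for w
    using c[of w bp] b'(3)[OF that] that r by (simp add: bp_def)
  have eq: "bm x = bp x" if x: "x \<in> topspace X" "x \<notin> W" for x
  proof -
    obtain w where "x = e0 w" "norm w \<le> r" using x by (auto simp: W_def)
    then show ?thesis using vp[of w] bm(3)[of w] by (simp add: val_def)
  qed
  have le: "bm x \<le> bp x" if "x \<in> topspace X" for x
    using comparison[OF F bm(1) bp W Wp sub_imp_lsub[OF W bm(2)] sp _ that, of 0] eq by simp
  obtain b where b: "contX b" "harm F W b"
    "\<And>x. x \<in> topspace X \<Longrightarrow> bm x \<le> b x" "\<And>x. x \<in> topspace X \<Longrightarrow> b x \<le> bp x"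
    using perron[OF F W bm(1,2) bp sp le eq] by blast
  have "val F b e0 w = u w" if w: "norm w \<le> r" for w
  proof -
    have "e0 w \<in> topspace X" "e0 w \<notin> W" using w r disc_topspace[OF e0, of w] by (auto simp: W_def)
    then have "b (e0 w) = bm (e0 w)" using b(3,4) eq by force
    then show ?thesis using bm(3)[OF w] by (simp add: val_def)
  qed
  then show ?thesis using that b(1,2) by (simp add: W_def)
qed

end

section \<open>Increments of holomorphic germs\<close>

text \<open>A nonconstant holomorphic function is open, so its real part cannot be constant.\<close>

lemma Re_const_imp_const:
  assumes f: "f holomorphic_on S" and S: "open S" "connected S" and c: "\<And>w. w \<in> S \<Longrightarrow> Re (f w) = c"
    and "x \<in> S" "y \<in> S"
  shows "f x = f y"
proof (rule ccontr)
  assume "f x \<noteq> f y"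
  then have "\<not> f constant_on S" using assms(5,6) unfolding constant_on_def by metis
  then have "open (f ` S)" by (intro open_mapping_thm[OF f S S(1)]) auto
  then obtain e where e: "e > 0" "ball (f x) e \<subseteq> f ` S" using assms(5) open_contains_ball by blast
  have "f x + of_real (e/2) \<in> ball (f x) e" using e(1) by (simp add: dist_norm)
  then obtain w where "w \<in> S" "f x + of_real (e/2) = f w" using e(2) by auto
  then have "Re (f x) + e/2 = Re (f w)" by (metis Re_complex_of_real plus_complex.sel(1))
  then show False using c[OF \<open>w \<in> S\<close>] c[OF assms(5)] e(1) by simp
qed

context disc_surface
begin

text \<open>\<open>P e g\<close> means that \<open>g\<close> is a primitive, on the disc \<open>e\<close>, of a fixed holomorphic form.\<close>

definition germ_increments ::
  "'a set \<Rightarrow> ((complex \<Rightarrow> 'a) \<Rightarrow> (complex \<Rightarrow> complex) \<Rightarrow> bool) \<Rightarrow> ('a \<Rightarrow> 'a \<Rightarrow> complex) \<Rightarrow> bool" where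
  "germ_increments V P D \<longleftrightarrow> (\<forall>e\<in>E. \<forall>g s. e ` ball 0 1 \<subseteq> V \<and> P e g \<and> norm s < 1 \<longrightarrow>
     (\<exists>N. open N \<and> s \<in> N \<and> N \<subseteq> ball 0 1 \<and> (\<forall>t\<in>N. D (e s) (e t) = g t - g s)))"

lemma germ_incrementsD:
  assumes "germ_increments V P D" "e \<in> E" "e ` ball 0 1 \<subseteq> V" "P e g" "norm s < 1"
  shows "\<exists>N. open N \<and> s \<in> N \<and> N \<subseteq> ball 0 1 \<and> (\<forall>t\<in>N. D (e s) (e t) = g t - g s)"
  using assms unfolding germ_increments_def by simp

text \<open>\<open>L\<close> will be \<open>Re\<close> or \<open>Im\<close>, extracting real
  increments from complex ones.\<close>

lemma germ_prim:
  assumes D: "germ_increments V P D" and L: "\<And>x y. L (x - y) = L x - L y"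
    and e: "e \<in> E" "e ` ball 0 1 \<subseteq> V" "P e g"
  shows "prim (top_of_set (ball 0 1)) (\<lambda>s t. L (D (e s) (e t))) (\<lambda>s. L (g s))"
  unfolding prim_def
proof
  fix s assume "s \<in> topspace (top_of_set (ball (0::complex) 1))"
  then have "norm s < 1" by simp
  then obtain N where N: "open N" "s \<in> N" "N \<subseteq> ball 0 1" "\<forall>t\<in>N. D (e s) (e t) = g t - g s"
    using germ_incrementsD[OF D e] by metis
  then have "openin (top_of_set (ball 0 1)) N" by (intro open_subset)
  moreover have "L (g y) - L (g s) = L (D (e s) (e y))" if "y \<in> N" for y
    using N(4) that L[of "g y" "g s"] by simp
  ultimately show "\<exists>N. openin (top_of_set (ball 0 1)) N \<and> s \<in> N \<and> (\<forall>y\<in>N. L (g y) - L (g s) = L (D (e s) (e y)))"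
    using N(2) by blast
qed

lemma germ_cocycle:
  assumes D: "germ_increments V P D" and V: "openin X V"
    and ex: "\<And>x. x \<in> V \<Longrightarrow> \<exists>e\<in>E. \<exists>g. e 0 = x \<and> e ` cball 0 1 \<subseteq> V \<and> P e g"
    and L: "\<And>x y. L (x - y) = L x - L y"
  shows "cocycle (subtopology X V) (\<lambda>x y. L (D x y))"
  unfolding cocycle_def
proof
  fix x assume "x \<in> topspace (subtopology X V)"
  then have x: "x \<in> V" by simp
  then obtain e g where e: "e \<in> E" "e 0 = x" "e ` cball 0 1 \<subseteq> V" "P e g" using ex by blast
  let ?N = "e ` ball 0 1"
  have NV: "?N \<subseteq> V" using e(3) by auto
  have "openin (subtopology X V) ?N"
    using openin_disc_ball[OF e(1)] NV by (metis inf.absorb1 openin_subtopology_Int)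
  moreover have "x \<in> ?N" using e(2) by (auto intro!: image_eqI[of _ _ 0])
  moreover have "prim (subtopology (subtopology X V) ?N) (\<lambda>x y. L (D x y)) (\<lambda>z. L (g (coord e z)))"
  proof -
    have "?N \<subseteq> e ` cball 0 1" by auto
    then have "continuous_map (subtopology X ?N) (top_of_set (ball 0 1)) (coord e)"
      using continuous_map_from_subtopology_mono[OF continuous_coord[OF e(1)], of ?N] e(1)
      by (auto simp: continuous_map_in_subtopology)
    from prim_pullback[OF germ_prim[where L = L, OF D L e(1) NV e(4)] this]
    have "prim (subtopology X ?N) (\<lambda>x y. L (D x y)) (\<lambda>z. L (g (coord e z)))"
      by (rule prim_cong) (use e(1) in auto)
    then show ?thesis using NV by (simp add: subtopology_subtopology Int_absorb1)
  qed
  ultimately show "\<exists>N f. openin (subtopology X V) N \<and> x \<in> N \<and> prim (subtopology (subtopology X V) N) (\<lambda>x y. L (D x y)) f"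
    by blast
qed

text \<open>Choose one disc and one primitive centred at each x and measure the increments from x
  with it. On a common subdisc any other primitive differs by a constant, which disappears in
  increments.\<close>

lemma germ_increments_exist:
  assumes V: "V \<subseteq> topspace X" and ex: "\<And>x. x \<in> V \<Longrightarrow> \<exists>e\<in>E. \<exists>g. e 0 = x \<and> e ` cball 0 1 \<subseteq> V \<and> P e g"
    and sub: "\<And>e e' g. e \<in> E \<Longrightarrow> e' \<in> E \<Longrightarrow> e' ` cball 0 1 \<subseteq> e ` ball 0 1 \<Longrightarrow> P e g \<Longrightarrow> P e' (\<lambda>w. g (coord e (e' w)))"
    and uniq: "\<And>e g g'. e \<in> E \<Longrightarrow> P e g \<Longrightarrow> P e g' \<Longrightarrow> \<exists>c. \<forall>w\<in>ball 0 1. g w = g' w + (c::complex)"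
  shows "\<exists>D. germ_increments V P D"
proof -
  have "\<forall>x\<in>V. \<exists>e. \<exists>g. e \<in> E \<and> e 0 = x \<and> e ` cball 0 1 \<subseteq> V \<and> P e g" using ex by blast
  from bchoice[OF this] obtain ee where "\<forall>x\<in>V. \<exists>g. ee x \<in> E \<and> ee x 0 = x \<and> ee x ` cball 0 1 \<subseteq> V \<and> P (ee x) g" ..
  from bchoice[OF this] obtain gg where eg: "\<forall>x\<in>V. ee x \<in> E \<and> ee x 0 = x \<and> ee x ` cball 0 1 \<subseteq> V \<and> P (ee x) (gg x)" ..
  define D where "D = (\<lambda>x y. gg x (coord (ee x) y) - gg x 0)"
  have loc: "\<exists>N. open N \<and> s \<in> N \<and> N \<subseteq> ball 0 1 \<and> (\<forall>t\<in>N. D (e s) (e t) = g t - g s)"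
    if e: "e \<in> E" "e ` ball 0 1 \<subseteq> V" and P: "P e g" and s: "norm s < 1" for e g s
  proof -
    define y where "y = e s"
    have yV: "y \<in> V" using e(2) s by (auto simp: y_def)
    have ey: "ee y \<in> E" "ee y 0 = y" "P (ee y) (gg y)" using eg yV by auto
    have o: "openin X (e ` ball 0 1 \<inter> ee y ` ball 0 1)" by (intro openin_Int openin_disc_ball e ey)
    have "y \<in> e ` ball 0 1 \<inter> ee y ` ball 0 1" using s ey(2) by (auto simp: y_def intro!: image_eqI[of _ _ 0])
    then obtain e' where e': "e' \<in> E" "e' 0 = y" "e' ` cball 0 1 \<subseteq> e ` ball 0 1 \<inter> ee y ` ball 0 1"
      using disc_ex[OF o] by blast
    then have e'e: "e' ` cball 0 1 \<subseteq> e ` ball 0 1" and e'y: "e' ` cball 0 1 \<subseteq> ee y ` ball 0 1" by auto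
    from uniq[OF e'(1) sub[OF e(1) e'(1) e'e P] sub[OF ey(1) e'(1) e'y ey(3)]]
    obtain c where c: "\<And>w. norm w < 1 \<Longrightarrow> g (coord e (e' w)) = gg y (coord (ee y) (e' w)) + c" by auto
    define N where "N = {t \<in> ball 0 1. e t \<in> e' ` ball 0 1}"
    have "openin (top_of_set (cball 0 1)) {t \<in> topspace (top_of_set (cball 0 1)). e t \<in> e' ` ball 0 1}"
      by (rule openin_continuous_map_preimage[OF disc_cont[OF e(1)] openin_disc_ball[OF e'(1)]])
    then obtain T where T: "open T" "{t \<in> cball 0 1. e t \<in> e' ` ball 0 1} = cball 0 1 \<inter> T"
      by (auto simp: openin_open)
    have "N = ball 0 1 \<inter> {t \<in> cball 0 1. e t \<in> e' ` ball 0 1}" by (auto simp: N_def)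
    also have "\<dots> = ball 0 1 \<inter> T" unfolding T(2) by auto
    finally have "open N" using T(1) by (metis open_Int open_ball)
    moreover have "s \<in> N" using s e'(2) by (auto simp: N_def y_def[symmetric] intro!: image_eqI[of _ _ 0])
    moreover have "D (e s) (e t) = g t - g s" if t: "t \<in> N" for t
    proof -
      obtain w where w: "norm w < 1" "e t = e' w" using t by (auto simp: N_def)
      have "coord e (e' w) = t" using t e(1) by (simp add: N_def w(2)[symmetric])
      moreover have "coord e (e' 0) = s" using s e(1) e'(2) by (simp add: y_def)
      moreover have "coord (ee y) (e' 0) = 0" using e'(2) ey(1,2) coord_eq[of "ee y" 0] by simp
      ultimately show ?thesis
        using c[of w] c[of 0] w unfolding D_def y_def[symmetric] by simp
    qed
    ultimately show ?thesis by (intro exI[of _ N]) (auto simp: N_def)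
  qed
  then show ?thesis unfolding germ_increments_def by blast
qed

text \<open>The free constant absorbs the choice of lifts, so that the notion restricts to smaller
  discs.\<close>

definition Re_prim :: "('a \<Rightarrow> complex) \<Rightarrow> ('a \<Rightarrow> real) \<Rightarrow> (complex \<Rightarrow> 'a) \<Rightarrow> (complex \<Rightarrow> complex) \<Rightarrow> bool" where
  "Re_prim F b e g \<longleftrightarrow> g holomorphic_on ball 0 1 \<and> (\<exists>c. \<forall>w\<in>ball 0 1. val F b e w = Re (g w) + c)"

lemma harm_Re_prim: "harm F V b \<Longrightarrow> e \<in> E \<Longrightarrow> e ` cball 0 1 \<subseteq> V \<Longrightarrow> \<exists>g. Re_prim F b e g"
  unfolding harm_def Re_prim_def by (metis add.right_neutral)

lemma Re_prim_unique:
  assumes "Re_prim F b e g" "Re_prim F b e g'" shows "\<exists>c. \<forall>w\<in>ball 0 1. g w = g' w + c"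
proof -
  obtain c c' where c: "\<And>w. norm w < 1 \<Longrightarrow> val F b e w = Re (g w) + c" "\<And>w. norm w < 1 \<Longrightarrow> val F b e w = Re (g' w) + c'"
    using assms unfolding Re_prim_def by (metis mem_ball_0)
  have "g w - g' w = g 0 - g' 0" if "norm w < 1" for w
  proof (rule Re_const_imp_const[of "\<lambda>w. g w - g' w" "ball 0 1" "c' - c"])
    show "Re (g w - g' w) = c' - c" if "w \<in> ball 0 1" for w
      using c[of w] that by simp
  qed (use assms that in \<open>auto simp: Re_prim_def intro!: holomorphic_intros\<close>)
  then show ?thesis by (intro exI[of _ "g 0 - g' 0"]) (auto simp: algebra_simps)
qed

lemma Re_prim_sub:
  assumes F: "circle_map F" and e: "e \<in> E" "e' \<in> E" "e' ` cball 0 1 \<subseteq> e ` ball 0 1" and g: "Re_prim F b e g"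
  shows "Re_prim F b e' (\<lambda>w. g (coord e (e' w)))"
proof -
  obtain c where c: "\<And>w. norm w < 1 \<Longrightarrow> val F b e w = Re (g w) + c" and h: "g holomorphic_on ball 0 1"
    using g unfolding Re_prim_def by auto
  have ec: "e' ` cball 0 1 \<subseteq> e ` cball 0 1" using e(3) ball_subset_cball by blast
  obtain c' where c': "\<And>w b. norm w \<le> 1 \<Longrightarrow> val F b e' w = val F b e (coord e (e' w)) + c'"
    using val_subdisc[OF F e(1,2) ec] by blast
  note lt = coord_subdisc(2)[OF e]
  have "val F b e' w = Re (g (coord e (e' w))) + (c + c')" if "norm w < 1" for w
    using c'[of w b] c[OF lt[of w]] that by simp
  moreover have "(\<lambda>w. g (coord e (e' w))) holomorphic_on ball 0 1"
    by (rule holomorphic_on_compose_gen[OF disc_trans[OF e] h, unfolded o_def]) (use lt in auto)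
  ultimately show ?thesis unfolding Re_prim_def by (metis mem_ball_0)
qed

lemma harm_Re_prim_exists:
  assumes V: "openin X V" and h: "harm F V b" and x: "x \<in> V"
  shows "\<exists>e\<in>E. \<exists>g. e 0 = x \<and> e ` cball 0 1 \<subseteq> V \<and> Re_prim F b e g"
  using disc_ex[OF V x] harm_Re_prim[OF h] by meson

lemma harm_germ_increments:
  assumes F: "circle_map F" and V: "openin X V" and h: "harm F V b"
  shows "\<exists>D. germ_increments V (Re_prim F b) D"
  by (rule germ_increments_exist[OF openin_subset[OF V] harm_Re_prim_exists[OF V h] Re_prim_sub[OF F] Re_prim_unique])

end

section \<open>Harmonic representatives\<close>

text \<open>Locally H differs from b times a logarithm by a function with constant real part, so the
  derivative of H is b / w. Its integral around a circle is 0, because H is a primitive, but also 2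
  \<pi> i b.\<close>

lemma holomorphic_Re_ln_coefficient_zero:
  assumes H: "H holomorphic_on {w. r < norm w \<and> norm w < 1}" and r: "0 < r" "r < 1"
    and Re: "\<And>w. r < norm w \<Longrightarrow> norm w < 1 \<Longrightarrow> Re (H w) = a + b * ln (norm w)"
  shows "b = 0"
proof -
  define A where "A = {w::complex. r < norm w \<and> norm w < 1}"
  have A: "open A" unfolding A_def
    by (intro open_Collect_conj open_Collect_less continuous_intros)
  have der: "(H has_field_derivative of_real b / w) (at w)" if w: "w \<in> A" for w
  proof -
    obtain e where e: "e > 0" "ball w e \<subseteq> A" using A w open_contains_ball by blast
    \<comment> \<open>The ball around w has radius at most r < |w|, so z / w stays in the right half
      plane, where the principal logarithm is holomorphic.\<close>
    define d where "d = min e r"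
    have d: "d > 0" "ball w d \<subseteq> A" "d \<le> norm w" using e r w by (auto simp: d_def A_def)
    have w0: "w \<noteq> 0" using w r by (auto simp: A_def)
    have pos: "Re (z / w) > 0" if "z \<in> ball w d" for z
    proof -
      have "norm (z / w - 1) = norm (z - w) / norm w" using w0 by (simp add: norm_divide[symmetric] diff_divide_distrib)
      also have "\<dots> < 1" using that d w0 by (simp add: dist_norm norm_minus_commute divide_simps)
      finally have "\<bar>Re (z / w - 1)\<bar> < 1" using abs_Re_le_cmod order_le_less_trans by blast
      then show ?thesis by simp
    qed
    define K where "K = (\<lambda>z. H z - of_real b * Ln (z / w))"
    have np: "z / w \<notin> \<real>\<^sub>\<le>\<^sub>0" if "z \<in> ball w d" for z using pos[OF that] by (auto simp: complex_nonpos_Reals_iff)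
    have Kh: "K holomorphic_on ball w d" unfolding K_def
      by (intro holomorphic_intros holomorphic_on_subset[OF H]) (use np d(2) w0 in \<open>auto simp: A_def\<close>)
    have ReK: "Re (K z) = a + b * ln (norm w)" if z: "z \<in> ball w d" for z
    proof -
      have zA: "z \<in> A" using z d by auto
      then have "z \<noteq> 0" using r by (auto simp: A_def)
      then have "Re (Ln (z / w)) = ln (norm z) - ln (norm w)"
        using w0 by (simp add: Re_Ln norm_divide ln_div)
      then have "Re (K z) = a + b * ln (norm z) - b * (ln (norm z) - ln (norm w))"
        using Re[of z] zA by (simp add: K_def A_def)
      then show ?thesis by (simp add: algebra_simps)
    qed
    have Kc: "K z = K w" if "z \<in> ball w d" for z
      by (rule Re_const_imp_const[OF Kh _ _ ReK]) (use that d in auto)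
    have "((\<lambda>z. K w + of_real b * Ln (z / w)) has_field_derivative of_real b / w) (at w)"
      by (auto intro!: derivative_eq_intros simp: w0)
    moreover have "\<forall>\<^sub>F z in nhds w. K w + of_real b * Ln (z / w) = H z"
    proof (rule eventually_mono[OF eventually_nhds_in_open[of "ball w d" w]])
      fix z assume "z \<in> ball w d"
      from Kc[OF this] show "K w + of_real b * Ln (z / w) = H z" by (simp add: K_def w0 algebra_simps)
    qed (use d in auto)
    ultimately show ?thesis by (simp add: DERIV_cong_ev)
  qed
  define s where "s = (r + 1) / 2"
  have s: "s > 0" "r < s" "s < 1" using r by (auto simp: s_def)
  have "((\<lambda>w. of_real b / w) has_contour_integral 0) (circlepath 0 s)"
  proof (rule Cauchy_theorem_primitive[of A H])
    show "(H has_field_derivative of_real b / x) (at x within A)" if "x \<in> A" for x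
      using der[OF that] by (rule has_field_derivative_at_within)
    show "path_image (circlepath 0 s) \<subseteq> A" using s by (auto simp: A_def)
  qed auto
  moreover have "((\<lambda>w. of_real b * (1 / (w - 0))) has_contour_integral of_real b * (2 * of_real pi * \<i>)) (circlepath 0 s)"
  proof (rule has_contour_integral_lmul)
    show "((\<lambda>w. 1 / (w - 0)) has_contour_integral 2 * of_real pi * \<i>) (circlepath 0 s)"
      using Cauchy_integral_circlepath_simple[of "\<lambda>w. 1" 0 s 0] s by simp
  qed
  ultimately have "of_real b * (2 * of_real pi * \<i>) = (0::complex)"
    using has_contour_integral_unique by force
  then show ?thesis by simp
qed

context disc_surface
begin

definition stretch :: "real \<Rightarrow> complex \<Rightarrow> complex" where
  "stretch r w = of_real (r + (1 - r) * norm w) * sgn w"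

lemma norm_stretch: "w \<noteq> 0 \<Longrightarrow> 0 < r \<Longrightarrow> r < 1 \<Longrightarrow> norm (stretch r w) = r + (1 - r) * norm w"
  unfolding stretch_def norm_mult norm_of_real by (simp add: norm_sgn)

text \<open>The conjugate differential lives off a closed disc only. Stretching the complement of the centre onto
  the complement of the disc turns it into a cocycle on the punctured surface, where it is a combination of the
  \<open>dlog (Fs i)\<close> plus something exact; these have no period around the puncture. Hence the flux vanishes.\<close>

lemma flux:
  assumes F: "circle_map F" and e0: "e0 \<in> E" and r: "0 < r" "r < 1" and b: "contX b"
    and h: "harm F (topspace X - e0 ` cball 0 r) b"
    and I: "finite I" and Fs: "\<And>i. i \<in> I \<Longrightarrow> circle_map (Fs i)"
    and span: "\<And>d. cocycle (subtopology X (topspace X - {e0 0})) d \<Longrightarrow>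
       \<exists>a f. prim (subtopology X (topspace X - {e0 0})) (\<lambda>x y. d x y - (\<Sum>i\<in>I. a i * dlog (Fs i) x y)) f"
  obtains G where "G holomorphic_on {w. r < norm w \<and> norm w < 1}"
    "\<And>w. r < norm w \<Longrightarrow> norm w < 1 \<Longrightarrow> Re (G w) = val F b e0 w"
proof -
  define W where "W = topspace X - e0 ` cball 0 r"
  define Y where "Y = topspace X - {e0 0}"
  have W: "openin X W" unfolding W_def using r by (intro openin_diff openin_topspace disc_closed e0) auto
  have hW: "harm F W b" using h by (simp add: W_def)
  obtain D where D: "germ_increments W (Re_prim F b) D" using harm_germ_increments[OF F W hW] by blast
  have co: "cocycle (subtopology X W) (\<lambda>x y. Im (D x y))"
    by (rule germ_cocycle[where L = Im, OF D W harm_Re_prim_exists[OF W hW]]) auto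
  \<comment> \<open>\<open>q\<close> moves the punctured disc onto the ring r < |w| \<le> 1 and
    fixes everything else; the two rules agree on the unit circle, which \<open>stretch\<close>
    fixes.\<close>
  define q where "q = (\<lambda>x. if x \<in> e0 ` cball 0 1 - {e0 0} then e0 (stretch r (coord e0 x)) else x)"
  have st1: "r < norm (stretch r w)" "norm (stretch r w) \<le> 1" if "w \<noteq> 0" "norm w \<le> 1" for w
  proof -
    have 1: "(1 - r) * norm w \<le> (1 - r) * 1" using that r by (intro mult_left_mono) auto
    have 2: "0 < (1 - r) * norm w" using that r by simp
    show "r < norm (stretch r w)" using 2 by (simp add: norm_stretch[OF that(1) r])
    show "norm (stretch r w) \<le> 1" using 1 by (simp add: norm_stretch[OF that(1) r] algebra_simps)
  qed
  have inW: "e0 w \<in> W" if "r < norm w" "norm w \<le> 1" for w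
  proof -
    have "e0 w \<notin> e0 ` cball 0 r"
    proof
      assume "e0 w \<in> e0 ` cball 0 r"
      then obtain z where z: "norm z \<le> r" "e0 w = e0 z" by auto
      then have "w = z" using that r inj_onD[OF disc_inj[OF e0], of w z] by auto
      then show False using that z by simp
    qed
    then show ?thesis using disc_topspace[OF e0 that(2)] by (simp add: W_def)
  qed
  have cst: "continuous_on (cball 0 1 - {0}) (stretch r)"
    unfolding stretch_def by (intro continuous_intros) auto
  have q: "continuous_map (subtopology X Y) (subtopology X W) q"
    unfolding q_def
  proof (rule continuous_map_glue[of _ _ "topspace X - e0 ` ball 0 1"])
    have "closedin X (e0 ` cball 0 1)" by (rule disc_closed[OF e0]) auto
    moreover have "e0 ` cball 0 1 - {e0 0} = Y \<inter> e0 ` cball 0 1"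
      using disc_image_topspace[OF e0, of "cball 0 1"] by (auto simp: Y_def)
    ultimately show "closedin (subtopology X Y) (e0 ` cball 0 1 - {e0 0})"
      by (auto simp: closedin_subtopology)
    have 0: "e0 0 \<in> e0 ` ball 0 1" by simp
    then have eY: "topspace X - e0 ` ball 0 1 \<subseteq> Y" by (auto simp: Y_def)
    have "closedin X (topspace X - e0 ` ball 0 1)" by (intro closedin_diff closedin_topspace openin_disc_ball e0)
    then show "closedin (subtopology X Y) (topspace X - e0 ` ball 0 1)"
      using eY by (meson closedin_subset_topspace)
    show "topspace (subtopology X Y) \<subseteq> e0 ` cball 0 1 - {e0 0} \<union> (topspace X - e0 ` ball 0 1)"
      by (auto simp: Y_def)
    have nz: "coord e0 x \<noteq> 0 \<and> norm (coord e0 x) \<le> 1" if "x \<in> e0 ` cball 0 1 - {e0 0}" for x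
      using that e0 by auto
    have "continuous_map (subtopology X (e0 ` cball 0 1 - {e0 0})) (top_of_set (cball 0 1 - {0})) (coord e0)"
      using continuous_map_from_subtopology_mono[OF continuous_coord[OF e0], of "e0 ` cball 0 1 - {e0 0}"] nz
      by (auto simp: continuous_map_in_subtopology)
    moreover have "continuous_map (top_of_set (cball 0 1 - {0})) (top_of_set (cball 0 1)) (stretch r)"
      using cst st1 by (auto simp: continuous_map_in_subtopology)
    ultimately have "continuous_map (subtopology X (e0 ` cball 0 1 - {e0 0})) X (\<lambda>x. e0 (stretch r (coord e0 x)))"
      using continuous_map_compose[OF continuous_map_compose disc_cont[OF e0]] by (fastforce simp: o_def)
    moreover have "e0 (stretch r (coord e0 x)) \<in> W" if "x \<in> e0 ` cball 0 1 - {e0 0}" for x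
      using nz[OF that] st1[of "coord e0 x"] by (intro inW) auto
    ultimately show "continuous_map (subtopology (subtopology X Y) (e0 ` cball 0 1 - {e0 0})) (subtopology X W) (\<lambda>x. e0 (stretch r (coord e0 x)))"
      by (auto simp: subtopology_subtopology continuous_map_in_subtopology intro: continuous_map_from_subtopology_mono)
    have "topspace X - e0 ` ball 0 1 \<subseteq> W"
    proof -
      have "e0 ` cball 0 r \<subseteq> e0 ` ball 0 1" using r by auto
      then show ?thesis by (auto simp: W_def)
    qed
    then show "continuous_map (subtopology (subtopology X Y) (topspace X - e0 ` ball 0 1)) (subtopology X W) (\<lambda>x. x)"
      by (auto simp: subtopology_subtopology continuous_map_in_subtopology intro: continuous_map_from_subtopology)
    fix x assume x: "x \<in> e0 ` cball 0 1 - {e0 0}" "x \<in> topspace X - e0 ` ball 0 1"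
    then obtain w where w: "x = e0 w" "norm w \<le> 1" by auto
    then have "\<not> norm w < 1" using x(2) by auto
    then have "norm w = 1" using w by simp
    then have "stretch r w = w" by (simp add: stretch_def sgn_div_norm)
    then show "e0 (stretch r (coord e0 x)) = x" using w e0 by simp
  qed
  have "cocycle (subtopology X Y) (\<lambda>x y. Im (D (q x) (q y)))"
    using cocycle_pullback[OF co q] .
  then obtain a f where f: "prim (subtopology X Y) (\<lambda>x y. Im (D (q x) (q y)) - (\<Sum>i\<in>I. a i * dlog (Fs i) x y)) f"
    using span unfolding Y_def by blast
  define A where "A = {w::complex. r < norm w \<and> norm w < 1}"
  have oA: "open A" unfolding A_def
    by (intro open_Collect_conj open_Collect_less continuous_intros)
  \<comment> \<open>The inverse of \<open>stretch r\<close> on the ring; it carries the primitive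
    found on the punctured surface back to the ring.\<close>
  define shrink where "shrink = (\<lambda>w::complex. of_real ((norm w - r) / (1 - r)) * sgn w)"
  have nsh: "norm (shrink w) = (norm w - r) / (1 - r)" if "w \<in> A" for w
  proof -
    have "w \<noteq> 0" using that r by (auto simp: A_def)
    then show ?thesis using that r unfolding shrink_def norm_mult norm_of_real by (simp add: norm_sgn A_def)
  qed
  have sh1: "shrink w \<noteq> 0" "norm (shrink w) < 1" if "w \<in> A" for w
    using nsh[OF that] that r by (auto simp: A_def)
  have stsh: "stretch r (shrink w) = w" if "w \<in> A" for w
  proof -
    have "w \<noteq> 0" using that r by (auto simp: A_def)
    have "sgn (shrink w) = sgn w"
    proof -
      have "(norm w - r) / (1 - r) > 0" using that r by (simp add: A_def)
      moreover have "sgn (of_real t * sgn w) = sgn w" if "t > 0" for t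
        using that by (simp add: sgn_mult sgn_of_real)
      ultimately show ?thesis unfolding shrink_def by blast
    qed
    moreover have "r + (1 - r) * norm (shrink w) = norm w" using nsh[OF that] r by (simp add: field_simps)
    ultimately show ?thesis unfolding stretch_def using \<open>w \<noteq> 0\<close> by (simp add: sgn_div_norm scaleR_conv_of_real)
  qed
  have csh: "continuous_on A shrink"
    unfolding shrink_def by (intro continuous_intros) (use r in \<open>auto simp: A_def\<close>)
  have cesh: "continuous_map (top_of_set A) (subtopology X Y) (\<lambda>w. e0 (shrink w))"
  proof -
    have "continuous_map (top_of_set A) (top_of_set (cball 0 1)) shrink"
      using csh sh1 by (auto simp: continuous_map_in_subtopology less_imp_le)
    from continuous_map_compose[OF this disc_cont[OF e0]]
    have "continuous_map (top_of_set A) X (\<lambda>w. e0 (shrink w))" by (simp add: o_def)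
    moreover have "e0 (shrink w) \<in> Y" if "w \<in> A" for w
    proof -
      have "e0 (shrink w) \<noteq> e0 0"
        using inj_onD[OF disc_inj[OF e0], of "shrink w" 0] sh1[OF that] by auto
      then show ?thesis using disc_topspace[OF e0, of "shrink w"] sh1[OF that] by (simp add: Y_def)
    qed
    ultimately show ?thesis by (auto simp: continuous_map_in_subtopology)
  qed
  have qsh: "q (e0 (shrink w)) = e0 w" if "w \<in> A" for w
  proof -
    have "e0 (shrink w) \<noteq> e0 0"
      using inj_onD[OF disc_inj[OF e0], of "shrink w" 0] sh1[OF that] by auto
    then have "e0 (shrink w) \<in> e0 ` cball 0 1 - {e0 0}" using sh1[OF that] by auto
    then show ?thesis using sh1(2)[OF that] e0 stsh[OF that] by (simp add: q_def)
  qed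
  have lp: "prim (top_of_set A) (\<lambda>s t. a i * dlog (Fs i) (e0 (shrink s)) (e0 (shrink t))) (\<lambda>s. a i * lift (Fs i) e0 (shrink s))"
    if i: "i \<in> I" for i
  proof -
    have "prim (top_of_set A) (dlog (\<lambda>s. Fs i (e0 (shrink s)))) (\<lambda>s. lift (Fs i) e0 (shrink s))"
    proof (rule prim_dlog)
      have "continuous_on A (\<lambda>s. lift (Fs i) e0 (shrink s))"
        by (rule continuous_on_compose2[OF lift(1)[OF Fs[OF i] e0] csh]) (use sh1 in \<open>auto simp: less_imp_le\<close>)
      then show "continuous_map (top_of_set A) euclideanreal (\<lambda>s. lift (Fs i) e0 (shrink s))" by simp
      show "Fs i (e0 (shrink x)) = cis (lift (Fs i) e0 (shrink x))" if "x \<in> topspace (top_of_set A)" for x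
        using sh1(2)[of x] that by (intro lift(2)[OF Fs[OF i] e0]) simp
    qed
    from prim_cmul[OF this, of "a i"] show ?thesis by (simp add: dlog_def)
  qed
  \<comment> \<open>The maps \<open>Fs i\<close> are defined on the whole disc, centre included, so
    their lifts are single-valued there. Hence k is a single-valued harmonic conjugate of the branch
    on the ring.\<close>
  define k where "k = (\<lambda>s. f (e0 (shrink s)) + (\<Sum>i\<in>I. a i * lift (Fs i) e0 (shrink s)))"
  have k: "prim (top_of_set A) (\<lambda>s t. Im (D (e0 s) (e0 t))) k"
    unfolding k_def
    by (rule prim_cong[OF prim_add[OF prim_pullback[OF f cesh] prim_sum[OF I lp]]]) (auto simp: qsh)
  define G where "G = (\<lambda>w. Complex (val F b e0 w) (k w))"
  \<comment> \<open>Near each point G agrees up to a constant with a local primitive g, since the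
    real and the imaginary parts of both have the same increments.\<close>
  have "G holomorphic_on A"
    unfolding holomorphic_on_open[OF oA]
  proof
    fix s assume s: "s \<in> A"
    obtain \<rho> where \<rho>: "\<rho> > 0" "cball s \<rho> \<subseteq> A" using oA s open_contains_cball by blast
    have sub: "cball s \<rho> \<subseteq> cball 0 1" using \<rho>(2) by (auto simp: A_def)
    let ?e = "\<lambda>w. e0 (s + of_real \<rho> * w)"
    have in': "s + of_real \<rho> * w \<in> cball s \<rho>" if "norm w \<le> 1" for w :: complex
      using that \<rho>(1) by (simp add: dist_norm norm_mult mult_left_le)
    have e: "?e \<in> E" by (rule disc_sub[OF e0 \<rho>(1) sub])
    have eW: "?e ` cball 0 1 \<subseteq> W"
    proof
      fix x assume "x \<in> ?e ` cball 0 1"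
      then obtain w where w: "norm w \<le> 1" "x = ?e w" by auto
      then have "s + of_real \<rho> * w \<in> A" using in'[OF w(1)] \<rho>(2) by blast
      then show "x \<in> W" unfolding w(2) by (intro inW) (auto simp: A_def)
    qed
    obtain g where g: "g holomorphic_on ball 0 1" "\<And>w. norm w < 1 \<Longrightarrow> val F b ?e w = Re (g w)"
      using hW e eW unfolding harm_def by force
    have Pg: "Re_prim F b ?e g" unfolding Re_prim_def using g by (metis add.right_neutral mem_ball_0)
    have ee: "?e ` cball 0 1 \<subseteq> e0 ` cball 0 1"
    proof
      fix x assume "x \<in> ?e ` cball 0 1"
      then obtain w where w: "norm w \<le> 1" "x = ?e w" by auto
      then have "s + of_real \<rho> * w \<in> cball 0 1" using in'[OF w(1)] sub by blast
      then show "x \<in> e0 ` cball 0 1" unfolding w(2) by (rule imageI)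
    qed
    obtain c where c: "\<And>w b. norm w \<le> 1 \<Longrightarrow> val F b ?e w = val F b e0 (coord e0 (?e w)) + c"
      using val_subdisc[OF F e0 e ee] by blast
    have co1: "coord e0 (?e w) = s + of_real \<rho> * w" if "norm w \<le> 1" for w
    proof -
      have "s + of_real \<rho> * w \<in> cball 0 1" using in'[OF that] sub by blast
      then show ?thesis using e0 by (intro coord_eq) auto
    qed
    have eWb: "?e ` ball 0 1 \<subseteq> W" using eW by auto
    have "\<exists>N. open N \<and> 0 \<in> N \<and> N \<subseteq> ball 0 1 \<and> (\<forall>t\<in>N. D (?e 0) (?e t) = g t - g 0)"
      by (rule germ_incrementsD[where e = ?e and g = g and s = 0, OF D e eWb Pg]) simp
    then obtain N where N: "open N" "0 \<in> N" "N \<subseteq> ball 0 1" "\<forall>t\<in>N. D (?e 0) (?e t) = g t - g 0" by blast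
    obtain M where M: "openin (top_of_set A) M" "s \<in> M" "\<forall>y\<in>M. k y - k s = Im (D (e0 s) (e0 y))"
      using k s unfolding prim_def by auto
    have oM: "open M" using M(1) oA openin_open_trans by blast
    define C where "C = G s - g 0"
    have near: "G z = g ((z - s) / of_real \<rho>) + C" if z: "z \<in> M" "(z - s) / of_real \<rho> \<in> N" for z
    proof -
      define w where "w = (z - s) / of_real \<rho>"
      have zw: "z = s + of_real \<rho> * w" using \<rho>(1) by (simp add: w_def)
      have wN: "w \<in> N" "norm w < 1" using z(2) N(3) by (auto simp: w_def)
      have "val F b e0 z = Re (g w) - c" using c[of w b] co1[of w] wN g(2)[of w] zw by simp
      moreover have "val F b e0 s = Re (g 0) - c" using c[of 0 b] co1[of 0] g(2)[of 0] by simp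
      moreover have "k z - k s = Im (g w - g 0)"
        using M(3) z(1) N(4) wN(1) zw by (metis add.right_neutral mult_zero_right)
      ultimately show ?thesis unfolding w_def[symmetric] by (simp add: complex_eq_iff G_def C_def)
    qed
    have g0: "(g has_field_derivative deriv g 0) (at 0)"
      by (rule holomorphic_derivI[OF g(1)]) auto
    have "((\<lambda>z. g ((z - s) / of_real \<rho>) + C) has_field_derivative deriv g 0 / of_real \<rho>) (at s)"
    proof -
      have "((\<lambda>z. (z - s) / of_real \<rho>) has_field_derivative 1 / of_real \<rho>) (at s)"
        using \<rho>(1) by (auto intro!: derivative_eq_intros)
      from DERIV_chain2[of g "deriv g 0" "\<lambda>z. (z - s) / of_real \<rho>", OF _ this] g0
      have "((\<lambda>z. g ((z - s) / of_real \<rho>)) has_field_derivative deriv g 0 * (1 / of_real \<rho>)) (at s)" by simp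
      from DERIV_add[OF this DERIV_const[of C]] show ?thesis by simp
    qed
    moreover have "\<forall>\<^sub>F z in nhds s. g ((z - s) / of_real \<rho>) + C = G z"
    proof -
      have "open (M \<inter> (\<lambda>z. (z - s) / of_real \<rho>) -` N)"
        by (intro open_Int oM open_vimage N continuous_intros) (use \<rho> in auto)
      from eventually_nhds_in_open[OF this, of s] show ?thesis
        using M(2) N(2) by (auto elim!: eventually_mono dest: near)
    qed
    ultimately show "\<exists>f'. (G has_field_derivative f') (at s)" by (auto simp: DERIV_cong_ev)
  qed
  then show ?thesis using that[of G] by (simp add: G_def A_def)
qed

text \<open>The difference of the branch and u is harmonic in the ring, 0 on the inner circle and c
  on the outer one. By the maximum principle it is the affine function of log |w| with these
  boundary values.\<close>

lemma annulus_agree: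
  assumes F: "circle_map F" and e0: "e0 \<in> E" and r: "0 < r" "r < 1" and b: "contX b"
    and h: "harm F (topspace X - e0 ` cball 0 r) b"
    and u: "continuous_on (cball 0 1) u" and g: "g holomorphic_on ball 0 1" "\<And>w. norm w < 1 \<Longrightarrow> u w = Re (g w)"
    and inner: "\<And>w. norm w \<le> r \<Longrightarrow> val F b e0 w = u w" and outer: "\<And>w. norm w = 1 \<Longrightarrow> val F b e0 w = u w + c"
    and w: "norm w \<le> 1"
  shows "val F b e0 w = u w + c * (1 - outer_log e0 r (e0 w) / ln r)"
proof -
  have lr: "ln r < 0" using r by simp
  define W where "W = topspace X - e0 ` cball 0 r"
  have W: "openin X W" unfolding W_def using r by (intro openin_diff openin_topspace disc_closed e0) auto
  define p where "p = (\<lambda>w. val F b e0 w - u w - c * (1 - ln (max (norm w) r) / ln r))"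
  have cp: "continuous_on (cball 0 1) p"
    unfolding p_def using r by (intro continuous_intros continuous_val F e0 b u) auto
  \<comment> \<open>Extended by 0, the error becomes a continuous function on X, so the maximum
    principle of the whole surface applies, with the open ring as V.\<close>
  define q where "q = (\<lambda>x. if x \<in> e0 ` cball 0 1 then p (coord e0 x) else 0)"
  have p1: "p w = 0" if "norm w = 1" for w using outer[OF that] that r by (simp add: p_def)
  have p0: "p w = 0" if "norm w \<le> r" for w using inner[OF that] that r lr by (simp add: p_def max_def)
  have cq: "contX q" unfolding q_def by (rule contX_disc_glue[OF e0 cp]) (auto simp: p1)
  define V where "V = e0 ` {w. r < norm w \<and> norm w < 1}"
  have V: "openin X V" unfolding V_def
    by (rule disc_open[OF e0]) (auto intro!: open_Collect_conj open_Collect_less continuous_intros)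
  have Vp: "V \<noteq> topspace X"
  proof -
    have "V \<subseteq> e0 ` ball 0 1" by (auto simp: V_def)
    then show ?thesis using disc_ball_proper[OF e0] openin_subset[OF openin_disc_ball[OF e0]] by blast
  qed
  have out: "q x = 0" if "x \<notin> V" for x
  proof (cases "x \<in> e0 ` cball 0 1")
    case True
    then obtain z where z: "x = e0 z" "norm z \<le> 1" by auto
    then have "norm z \<le> r \<or> norm z = 1" using that by (force simp: V_def)
    then show ?thesis using z e0 p0 p1 True by (auto simp: q_def)
  qed (simp add: q_def)
  have mv: "\<exists>e\<in>E. e 0 = x \<and> (\<forall>t. 0 < t \<and> t < 1 \<longrightarrow> poisson (\<lambda>w. q (e (of_real t * w))) 0 = q x)" if x: "x \<in> V" for x
  proof -
    have VW: "V \<subseteq> W"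
    proof
      fix x assume "x \<in> V"
      then obtain z where z: "x = e0 z" "r < norm z" "norm z < 1" by (auto simp: V_def)
      have "x \<notin> e0 ` cball 0 r"
      proof
        assume "x \<in> e0 ` cball 0 r"
        then obtain z' where z': "norm z' \<le> r" "e0 z = e0 z'" using z by auto
        then show False using inj_onD[OF disc_inj[OF e0], of z z'] z r by auto
      qed
      then show "x \<in> W" using disc_topspace[OF e0, of z] z by (simp add: W_def)
    qed
    have xb: "x \<in> e0 ` ball 0 1" using x by (auto simp: V_def)
    have xr: "x \<notin> e0 ` cball 0 r" using x VW by (auto simp: W_def)
    obtain e' k where e': "e' \<in> E" "e' 0 = x" "e' ` cball 0 1 \<subseteq> V" "e' ` cball 0 1 \<subseteq> e0 ` ball 0 1"
      and k: "k holomorphic_on ball 0 1" "\<And>w. norm w < 1 \<Longrightarrow> outer_log e0 r (e' w) = Re (k w)"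
      using outer_log_Re[OF e0 r V x xb xr] by metis
    have e'ec: "e' ` cball 0 1 \<subseteq> e0 ` cball 0 1" using e'(4) ball_subset_cball by blast
    obtain c' where c': "\<And>w b. norm w \<le> 1 \<Longrightarrow> val F b e' w = val F b e0 (coord e0 (e' w)) + c'"
      using val_subdisc[OF F e0 e'(1) e'ec] by blast
    have e'W: "e' ` cball 0 1 \<subseteq> W" using e'(3) VW by blast
    obtain j where j: "j holomorphic_on ball 0 1" "\<And>w. norm w < 1 \<Longrightarrow> val F b e' w = Re (j w)"
      using h e'(1) e'W unfolding harm_def W_def by force
    let ?T = "\<lambda>z. coord e0 (e' z)"
    note T = coord_subdisc[OF e0 e'(1,4)]
    define m where "m = (\<lambda>z. j z - of_real c' - g (?T z) - of_real c * (1 - k z / of_real (ln r)))"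
    have m: "m holomorphic_on ball 0 1" unfolding m_def using lr
      by (intro holomorphic_intros j k holomorphic_on_compose_gen[OF disc_trans[OF e0 e'(1,4)] g(1), unfolded o_def])
        (use T in auto)
    have qm: "q (e' z) = Re (m z)" if z: "norm z < 1" for z
    proof -
      have Tz: "e0 (?T z) = e' z" "norm (?T z) < 1" using T[of z] z by auto
      have "e' z \<in> e0 ` cball 0 1" using Tz by (intro image_eqI[of _ _ "?T z"]) auto
      then have "q (e' z) = p (?T z)" by (simp add: q_def)
      also have "\<dots> = Re (m z)"
        using c'[of z b] z j(2)[OF z] g(2)[OF Tz(2)] k(2)[OF z] outer_log_eq[OF e0, of "?T z" r] Tz
        by (simp add: p_def m_def)
      finally show ?thesis .
    qed
    have "poisson (\<lambda>w. q (e' (of_real t * w))) 0 = q x" if t: "0 < t" "t < 1" for t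
    proof -
      have "poisson (\<lambda>w. q (e' (of_real t * w))) 0 = poisson (\<lambda>w. Re (m (of_real t * w))) 0"
        by (rule poisson_cong) (use t in \<open>auto intro!: qm simp: norm_mult\<close>)
      then show ?thesis using poisson_Re_scaled[OF m t] qm[of 0] e'(2) by simp
    qed
    then show ?thesis using e' by blast
  qed
  have "q (e0 w) \<le> 0"
  proof (rule max_principle[OF cq V Vp _ _ disc_topspace[OF e0 w]])
    fix x assume "x \<in> V" then show "\<exists>e\<in>E. e 0 = x \<and> (\<forall>t. 0 < t \<and> t < 1 \<longrightarrow> q x \<le> poisson (\<lambda>w. q (e (of_real t * w))) 0)"
      using mv by (metis order_refl)
  qed (simp add: out)
  moreover have "- q (e0 w) \<le> 0"
  proof (rule max_principle[OF _ V Vp _ _ disc_topspace[OF e0 w]])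
    show "contX (\<lambda>x. - q x)" by (intro continuous_intros cq)
    fix x assume "x \<in> V"
    then obtain e where e: "e \<in> E" "e 0 = x" "\<And>t. 0 < t \<Longrightarrow> t < 1 \<Longrightarrow> poisson (\<lambda>w. q (e (of_real t * w))) 0 = q x"
      using mv by meson
    then show "\<exists>e\<in>E. e 0 = x \<and> (\<forall>t. 0 < t \<and> t < 1 \<longrightarrow> - q x \<le> poisson (\<lambda>w. - q (e (of_real t * w))) 0)"
      using poisson_cmul[of "-1" "\<lambda>w. q (e (of_real t * w))" 0 for t] by (intro bexI[of _ e]) auto
  qed (simp add: out)
  ultimately have "p w = 0" using w e0 by (auto simp: q_def)
  then show ?thesis using w by (simp add: p_def outer_log_eq[OF e0])
qed

section \<open>Fixed point for the boundary values\<close>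

lemma poisson_osc:
  assumes c: "continuous_on (sphere 0 1) \<gamma>" and bd: "\<And>w. norm w = 1 \<Longrightarrow> k \<le> \<gamma> w \<and> \<gamma> w \<le> k + \<delta>"
  shows "\<exists>k'. \<forall>w. norm w \<le> 1/4 \<longrightarrow> k' \<le> poisson \<gamma> w \<and> poisson \<gamma> w \<le> k' + 2/5 * \<delta>"
proof -
  \<comment> \<open>\<mu> and \<delta> - \<mu> are the values at the centre belonging to the
    nonnegative data \<gamma> - k and k + \<delta> - \<gamma>. Harnack's inequality for both cuts
    3/5 off the width: 3/5 of \<mu> from below and 3/5 of \<delta> - \<mu> from above.\<close>
  define \<mu> where "\<mu> = poisson \<gamma> 0 - k"
  have P1: "poisson (\<lambda>w. \<gamma> w - k) w = poisson \<gamma> w - k" if "norm w \<le> 1" for w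
    using that by (subst poisson_diff) (auto intro: c)
  have P2: "poisson (\<lambda>w. k + \<delta> - \<gamma> w) w = k + \<delta> - poisson \<gamma> w" if "norm w \<le> 1" for w
    using that by (subst poisson_diff) (auto intro: c)
  have "k + 3/5 * \<mu> \<le> poisson \<gamma> w \<and> poisson \<gamma> w \<le> k + 3/5 * \<mu> + 2/5 * \<delta>" if w: "norm w \<le> 1/4" for w
  proof -
    \<comment> \<open>3/5 is (1 - 1/4) / (1 + 1/4), the lower Harnack constant for radius
      1/4.\<close>
    have K: "3/5 \<le> (1 - norm w) / (1 + norm w)" using w by (simp add: field_simps add_pos_nonneg)
    have "continuous_on (sphere 0 1) (\<lambda>w. \<gamma> w - k)" "continuous_on (sphere 0 1) (\<lambda>w. k + \<delta> - \<gamma> w)"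
      by (intro continuous_intros c)+
    then have "0 \<le> poisson (\<lambda>w. \<gamma> w - k) 0" "0 \<le> poisson (\<lambda>w. k + \<delta> - \<gamma> w) 0"
      using poisson_mono[of "\<lambda>w. 0" "\<lambda>w. \<gamma> w - k" 0] poisson_mono[of "\<lambda>w. 0" "\<lambda>w. k + \<delta> - \<gamma> w" 0] bd
      by auto
    then have \<mu>: "0 \<le> \<mu>" "0 \<le> \<delta> - \<mu>" using P1[of 0] P2[of 0] by (auto simp: \<mu>_def)
    have e: "poisson (\<lambda>w. \<gamma> w - k) 0 = \<mu>" "poisson (\<lambda>w. \<gamma> w - k) w = poisson \<gamma> w - k"
      "poisson (\<lambda>w. k + \<delta> - \<gamma> w) 0 = \<delta> - \<mu>" "poisson (\<lambda>w. k + \<delta> - \<gamma> w) w = k + \<delta> - poisson \<gamma> w"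
      using P1[of 0] P1[of w] P2[of 0] P2[of w] w by (simp_all add: \<mu>_def)
    have "(1 - norm w) / (1 + norm w) * poisson (\<lambda>w. \<gamma> w - k) 0 \<le> poisson (\<lambda>w. \<gamma> w - k) w"
      by (rule poisson_Harnack(1)) (use bd w c in \<open>auto intro!: continuous_intros\<close>)
    then have "(1 - norm w) / (1 + norm w) * \<mu> \<le> poisson \<gamma> w - k" unfolding e .
    from order_trans[OF mult_right_mono[OF K \<mu>(1)] this] have 1: "3/5 * \<mu> \<le> poisson \<gamma> w - k" .
    have "(1 - norm w) / (1 + norm w) * poisson (\<lambda>w. k + \<delta> - \<gamma> w) 0 \<le> poisson (\<lambda>w. k + \<delta> - \<gamma> w) w"
      by (rule poisson_Harnack(1)) (use bd w c in \<open>auto intro!: continuous_intros\<close>)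
    then have "(1 - norm w) / (1 + norm w) * (\<delta> - \<mu>) \<le> k + \<delta> - poisson \<gamma> w" unfolding e .
    from order_trans[OF mult_right_mono[OF K \<mu>(2)] this] have "3/5 * (\<delta> - \<mu>) \<le> k + \<delta> - poisson \<gamma> w" .
    then show ?thesis using 1 by (simp add: field_simps)
  qed
  then show ?thesis by blast
qed

text \<open>The map sending \<open>\<beta>\<close> to the values on the outer circle of the solution of the Dirichlet problem with
  inner data \<open>poisson \<beta>\<close> contracts oscillations, so it has a fixed point up to a constant \<open>c\<close>.
  The flux argument later shows \<open>c = 0\<close>, so that the two solutions fit together.\<close>

lemma dirichlet_fixpoint:
  assumes F: "circle_map F" and e0: "e0 \<in> E"
  obtains b \<beta> c where "contX b" "harm F (topspace X - e0 ` cball 0 (1/4)) b" "continuous_on (sphere 0 1) \<beta>"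
    "\<And>w. norm w \<le> 1/4 \<Longrightarrow> val F b e0 w = poisson \<beta> w" "\<And>w. norm w = 1 \<Longrightarrow> val F b e0 w = \<beta> w + c"
proof -
  define W where "W = topspace X - e0 ` cball 0 (1/4)"
  have W: "openin X W" unfolding W_def by (intro openin_diff openin_topspace disc_closed e0) auto
  have Wp: "W \<noteq> topspace X" using disc_topspace[OF e0, of 0] by (force simp: W_def)
  have "\<exists>b. continuous_on (sphere 0 1) \<beta> \<longrightarrow> contX b \<and> harm F W b \<and> (\<forall>w. norm w \<le> 1/4 \<longrightarrow> val F b e0 w = poisson \<beta> w)" for \<beta>
  proof (cases "continuous_on (sphere 0 1) \<beta>")
    case True
    obtain g where g: "g holomorphic_on ball 0 1" "\<And>z. norm z < 1 \<Longrightarrow> poisson \<beta> z = Re (g z)"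
      using poisson_holomorphic[OF True] by blast
    have "0 < (1/4::real)" "(1/4::real) < 1" by auto
    from dirichlet[OF F e0 this continuous_on_poisson[OF True] g] show ?thesis unfolding W_def by metis
  qed simp
  then obtain D where D: "\<And>\<beta>. continuous_on (sphere 0 1) \<beta> \<Longrightarrow> contX (D \<beta>)"
    "\<And>\<beta>. continuous_on (sphere 0 1) \<beta> \<Longrightarrow> harm F W (D \<beta>)"
    "\<And>\<beta> w. continuous_on (sphere 0 1) \<beta> \<Longrightarrow> norm w \<le> 1/4 \<Longrightarrow> val F (D \<beta>) e0 w = poisson \<beta> w"
    by metis
  define S where "S = (\<lambda>\<beta>. val F (D \<beta>) e0)"
  \<comment> \<open>By comparison the solution changes by no more than its data on the inner disc;
    these are Poisson integrals, and that is where the contraction enters.\<close>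
  have le: "S \<beta> w \<le> S \<beta>' w + m"
    if \<beta>: "continuous_on (sphere 0 1) \<beta>" "continuous_on (sphere 0 1) \<beta>'"
      and m: "\<And>w. norm w \<le> 1/4 \<Longrightarrow> poisson (\<lambda>w. \<beta> w - \<beta>' w) w \<le> m" and w: "norm w \<le> 1" for \<beta> \<beta>' m w
  proof -
    have "D \<beta> x \<le> D \<beta>' x + m" if "x \<in> topspace X" for x
    proof (rule comparison[OF F D(1)[OF \<beta>(1)] D(1)[OF \<beta>(2)] W Wp sub_imp_lsub[OF W harm_imp_sub[OF D(2)[OF \<beta>(1)]]]
          harm_imp_super[OF D(2)[OF \<beta>(2)]] _ that])
      fix x assume "x \<in> topspace X" "x \<notin> W"
      then obtain z where z: "x = e0 z" "norm z \<le> 1/4" by (auto simp: W_def)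
      have "poisson (\<lambda>w. \<beta> w - \<beta>' w) z = poisson \<beta> z - poisson \<beta>' z" by (rule poisson_diff[OF \<beta>])
      then show "D \<beta> x \<le> D \<beta>' x + m"
        using m[OF z(2)] D(3)[OF \<beta>(1) z(2)] D(3)[OF \<beta>(2) z(2)] z(1) by (simp add: val_def)
    qed
    then show ?thesis using disc_topspace[OF e0 w] by (simp add: S_def val_def)
  qed
  have cS: "continuous_on (cball 0 1) (S \<beta>)" if "continuous_on (sphere 0 1) \<beta>" for \<beta>
    unfolding S_def by (intro continuous_val F e0 D that)
  \<comment> \<open>Each iterate is normalised to vanish at 1: the estimates contract oscillations
    only, so constants have to be removed by hand.\<close>
  define B where "B = rec_nat (\<lambda>w. 0) (\<lambda>n \<beta> w. S \<beta> w - S \<beta> 1)"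
  have B0: "B 0 = (\<lambda>w. 0)" and BS: "B (Suc n) = (\<lambda>w. S (B n) w - S (B n) 1)" for n
    by (simp_all add: B_def)
  have cB: "continuous_on (sphere 0 1) (B n)" for n
  proof (induction n)
    case (Suc n)
    have "continuous_on (sphere 0 1) (S (B n))" by (rule continuous_on_subset[OF cS[OF Suc]]) auto
    then show ?case unfolding BS by (intro continuous_intros)
  qed (simp add: B0)
  have "continuous_on (sphere 0 1) (\<lambda>w. B 1 w - B 0 w)" by (intro continuous_intros cB)
  then have "compact ((\<lambda>w. B 1 w - B 0 w) ` sphere 0 1)" by (intro compact_continuous_image) auto
  then have "bounded ((\<lambda>w. B 1 w - B 0 w) ` sphere 0 1)" by (rule compact_imp_bounded)
  then obtain M where "\<forall>y\<in>(\<lambda>w. B 1 w - B 0 w) ` sphere 0 1. norm y \<le> M" unfolding bounded_iff by blast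
  then have M: "\<bar>B 1 w - B 0 w\<bar> \<le> M" if "norm w = 1" for w using that by simp
  have osc: "\<exists>k. \<forall>w. norm w = 1 \<longrightarrow> k \<le> B (Suc n) w - B n w \<and> B (Suc n) w - B n w \<le> k + (2/5)^n * (2 * M)" for n
  proof (induction n)
    case 0
    show ?case using M by (intro exI[of _ "-M"]) (auto simp: abs_le_iff, smt (verit) M)
  next
    case (Suc n)
    then obtain k where k: "\<And>w. norm w = 1 \<Longrightarrow> k \<le> B (Suc n) w - B n w \<and> B (Suc n) w - B n w \<le> k + (2/5)^n * (2 * M)" by blast
    have "continuous_on (sphere 0 1) (\<lambda>w. B (Suc n) w - B n w)" by (intro continuous_intros cB)
    from poisson_osc[OF this k] obtain k' where k': "\<And>w. norm w \<le> 1/4 \<Longrightarrow> k' \<le> poisson (\<lambda>w. B (Suc n) w - B n w) w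
         \<and> poisson (\<lambda>w. B (Suc n) w - B n w) w \<le> k' + 2/5 * ((2/5)^n * (2 * M))" by blast
    have neg: "poisson (\<lambda>w. B n w - B (Suc n) w) w = - poisson (\<lambda>w. B (Suc n) w - B n w) w" for w
      by (simp add: poisson_diff cB)
    have "S (B (Suc n)) w \<le> S (B n) w + (k' + 2/5 * ((2/5)^n * (2 * M)))" if "norm w = 1" for w
      by (rule le[OF cB cB]) (use k' that in auto)
    moreover have "S (B n) w \<le> S (B (Suc n)) w + (- k')" if "norm w = 1" for w
      by (rule le[OF cB cB]) (use k' that neg in auto)
    ultimately show ?case
      unfolding BS[of "Suc n"] BS[of n]
      by (intro exI[of _ "k' - (S (B (Suc n)) 1 - S (B n) 1)"]) (force simp: BS)
  qed
  have B1: "B n 1 = 0" for n by (cases n) (simp_all add: B0 BS)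
  \<comment> \<open>All iterates vanish at 1, so the interval that contains their difference also
    contains 0, and its length bounds the absolute value.\<close>
  have diff: "\<bar>B (Suc n) w - B n w\<bar> \<le> (2/5)^n * (2 * M)" if w: "norm w = 1" for n w
  proof -
    obtain k where k: "\<And>w. norm w = 1 \<Longrightarrow> k \<le> B (Suc n) w - B n w \<and> B (Suc n) w - B n w \<le> k + (2/5)^n * (2 * M)"
      using osc by blast
    show ?thesis using k[OF w] k[of 1] B1 by (simp add: abs_le_iff)
  qed
  define \<beta> where "\<beta> = (\<lambda>w. \<Sum>i. B (Suc i) w - B i w)"
  have sumB: "(\<Sum>i<n. B (Suc i) w - B i w) = B n w" for n w
    by (induction n) (simp_all add: B0)
  have ul: "uniform_limit (sphere 0 1) B \<beta> sequentially"
  proof -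
    have "uniform_limit (sphere 0 1) (\<lambda>n w. \<Sum>i<n. B (Suc i) w - B i w) \<beta> sequentially"
      unfolding \<beta>_def
      by (rule Weierstrass_m_test[of _ _ "\<lambda>n. (2/5)^n * (2 * M)"])
        (use diff in \<open>auto intro!: summable_mult2 summable_geometric\<close>)
    then show ?thesis by (simp add: sumB)
  qed
  have c\<beta>: "continuous_on (sphere 0 1) \<beta>"
    by (rule uniform_limit_theorem[OF _ ul]) (auto intro!: always_eventually cB)
  \<comment> \<open>By comparison S is continuous under uniform convergence on the circle, so the
    limit solves the fixed point equation up to the normalising constant.\<close>
  have fixp: "S \<beta> w = \<beta> w + S \<beta> 1" if w: "norm w = 1" for w
  proof -
    have limS: "(\<lambda>n. S (B n) z) \<longlonglongrightarrow> S \<beta> z" if z: "norm z = 1" for z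
    proof (rule LIMSEQ_I)
      fix \<epsilon> :: real assume "\<epsilon> > 0"
      then have "\<forall>\<^sub>F n in sequentially. \<forall>w\<in>sphere 0 1. dist (B n w) (\<beta> w) < \<epsilon> / 2"
        using uniform_limitD[OF ul, of "\<epsilon>/2"] by simp
      then obtain n0 where "\<forall>n\<ge>n0. \<forall>w\<in>sphere 0 1. dist (B n w) (\<beta> w) < \<epsilon> / 2"
        unfolding eventually_sequentially by blast
      then have n0: "\<bar>B n w - \<beta> w\<bar> < \<epsilon> / 2" if "n \<ge> n0" "norm w = 1" for n w
        using that by (simp add: dist_real_def)
      have "\<bar>S (B n) z - S \<beta> z\<bar> < \<epsilon>" if n: "n \<ge> n0" for n
      proof -
        have "S (B n) z \<le> S \<beta> z + \<epsilon> / 2"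
        proof (rule le[OF cB c\<beta>])
          fix w :: complex assume w: "norm w \<le> 1/4"
          have "poisson (\<lambda>w. B n w - \<beta> w) w \<le> poisson (\<lambda>w. \<epsilon> / 2) w"
          proof (rule poisson_mono)
            show "B n w - \<beta> w \<le> \<epsilon> / 2" if "norm w = 1" for w using n0[OF n that] by linarith
          qed (use w in \<open>auto intro!: continuous_intros cB c\<beta>\<close>)
          then show "poisson (\<lambda>w. B n w - \<beta> w) w \<le> \<epsilon> / 2" using w by simp
        qed (use z in simp)
        moreover have "S \<beta> z \<le> S (B n) z + \<epsilon> / 2"
        proof (rule le[OF c\<beta> cB])
          fix w :: complex assume w: "norm w \<le> 1/4"
          have "poisson (\<lambda>w. \<beta> w - B n w) w \<le> poisson (\<lambda>w. \<epsilon> / 2) w"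
          proof (rule poisson_mono)
            show "\<beta> w - B n w \<le> \<epsilon> / 2" if "norm w = 1" for w using n0[OF n that] by linarith
          qed (use w in \<open>auto intro!: continuous_intros cB c\<beta>\<close>)
          then show "poisson (\<lambda>w. \<beta> w - B n w) w \<le> \<epsilon> / 2" using w by simp
        qed (use z in simp)
        ultimately show ?thesis using \<open>\<epsilon> > 0\<close> by (simp add: abs_less_iff)
      qed
      then show "\<exists>no. \<forall>n\<ge>no. norm (S (B n) z - S \<beta> z) < \<epsilon>" by (auto simp: real_norm_def)
    qed
    have "(\<lambda>n. B (Suc n) w) \<longlonglongrightarrow> \<beta> w"
      using LIMSEQ_Suc[OF tendsto_uniform_limitI[OF ul, of w]] w by simp
    moreover have "(\<lambda>n. B (Suc n) w) \<longlonglongrightarrow> S \<beta> w - S \<beta> 1"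
      unfolding BS by (intro tendsto_intros limS) (use w in auto)
    ultimately show ?thesis using LIMSEQ_unique by fastforce
  qed
  show ?thesis
  proof (rule that[of "D \<beta>" \<beta> "S \<beta> 1"])
    show "harm F (topspace X - e0 ` cball 0 (1/4)) (D \<beta>)" using D(2)[OF c\<beta>] by (simp add: W_def)
    show "val F (D \<beta>) e0 w = \<beta> w + S \<beta> 1" if "norm w = 1" for w using fixp[OF that] by (simp add: S_def)
  qed (use D c\<beta> in simp_all)
qed

proposition harmonic_representative:
  assumes F: "circle_map F" and e0: "e0 \<in> E"
    and I: "finite I" and Fs: "\<And>i. i \<in> I \<Longrightarrow> circle_map (Fs i)"
    and span: "\<And>d. cocycle (subtopology X (topspace X - {e0 0})) d \<Longrightarrow>
       \<exists>a f. prim (subtopology X (topspace X - {e0 0})) (\<lambda>x y. d x y - (\<Sum>i\<in>I. a i * dlog (Fs i) x y)) f"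
  obtains b where "contX b" "harm F (topspace X) b"
proof -
  define r where "r = (1/4 :: real)"
  have r: "0 < r" "r < 1" by (auto simp: r_def)
  define W where "W = topspace X - e0 ` cball 0 r"
  have W: "openin X W" unfolding W_def using r by (intro openin_diff openin_topspace disc_closed e0) auto
  obtain b \<beta> c where b: "contX b" "harm F (topspace X - e0 ` cball 0 r) b" "continuous_on (sphere 0 1) \<beta>"
    "\<And>w. norm w \<le> r \<Longrightarrow> val F b e0 w = poisson \<beta> w" "\<And>w. norm w = 1 \<Longrightarrow> val F b e0 w = \<beta> w + c"
    using dirichlet_fixpoint[OF F e0] unfolding r_def by blast
  obtain g where g: "g holomorphic_on ball 0 1" "\<And>z. norm z < 1 \<Longrightarrow> poisson \<beta> z = Re (g z)"
    using poisson_holomorphic[OF b(3)] by blast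
  obtain G where G: "G holomorphic_on {w. r < norm w \<and> norm w < 1}"
    "\<And>w. r < norm w \<Longrightarrow> norm w < 1 \<Longrightarrow> Re (G w) = val F b e0 w"
    using flux[OF F e0 r b(1,2) I Fs span] by blast
  have bnd: "val F b e0 w = poisson \<beta> w + c" if "norm w = 1" for w
    using b(5)[OF that] that by (simp add: poisson_def)
  have eq: "val F b e0 w = poisson \<beta> w + c * (1 - outer_log e0 r (e0 w) / ln r)" if "norm w \<le> 1" for w
    by (rule annulus_agree[OF F e0 r b(1,2) continuous_on_poisson[OF b(3)] g b(4) bnd that])
  \<comment> \<open>In the ring the branch and the Poisson integral differ by c - (c / ln r) ln |w|.
    This is the real part of the holomorphic function G - g, so the logarithm has coefficient
    0.\<close>
  have "- c / ln r = 0"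
  proof (rule holomorphic_Re_ln_coefficient_zero[OF _ r])
    show "(\<lambda>w. G w - g w) holomorphic_on {w. r < norm w \<and> norm w < 1}"
      by (intro holomorphic_intros G holomorphic_on_subset[OF g(1)]) auto
    show "Re (G w - g w) = c + - c / ln r * ln (norm w)" if "r < norm w" "norm w < 1" for w
      using G(2)[OF that] eq[of w] g(2)[OF that(2)] that
      by (simp add: outer_log_eq[OF e0] max_def algebra_simps)
  qed
  then have c0: "c = 0" using r by simp
  \<comment> \<open>With c = 0 the branch on \<open>e0\<close> is its own Poisson integral, so b is
    harmonic inside \<open>e0\<close> too. The open disc and the complement of the inner disc cover
    X.\<close>
  have mod: "modify F e0 b x = b x" if "x \<in> topspace X" for x
  proof (cases "x \<in> e0 ` cball 0 1")
    case True
    then obtain w where w: "x = e0 w" "norm w \<le> 1" by auto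
    have "poisson (val F b e0) w = poisson \<beta> w"
      by (rule poisson_cong) (use b(5) c0 w in auto)
    also have "\<dots> = val F b e0 w" using eq[OF w(2)] c0 by simp
    finally show ?thesis using w e0 by (auto simp: modify_def val_def)
  qed (simp add: modify_def)
  have "harm F (topspace X) b"
  proof (rule harm_local[OF F b(1)])
    fix x assume x: "x \<in> topspace X"
    show "\<exists>e\<in>E. e 0 = x \<and> e ` cball 0 1 \<subseteq> topspace X \<and>
       (\<exists>g. g holomorphic_on ball 0 1 \<and> (\<forall>w\<in>ball 0 1. val F b e w = Re (g w)))"
    proof (cases "x \<in> e0 ` ball 0 1")
      case True
      obtain e where e: "e \<in> E" "e 0 = x" "e ` cball 0 1 \<subseteq> e0 ` ball 0 1"
        using disc_ex[OF openin_disc_ball[OF e0] True] by blast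
      then obtain h where h: "h holomorphic_on ball 0 1" "\<And>w. norm w < 1 \<Longrightarrow> val F (modify F e0 b) e w = Re (h w)"
        using harm_modify[OF F e0 b(1)] unfolding harm_def by force
      have "val F b e w = Re (h w)" if "norm w < 1" for w
        using h(2)[OF that] mod[OF disc_topspace[OF e(1), of w]] that by (simp add: val_def)
      then show ?thesis using e h(1) disc_image_topspace[OF e(1), of "cball 0 1"] by (intro bexI[of _ e]) auto
    next
      case False
      have "x \<in> W" using False x r by (auto simp: W_def)
      then obtain e where e: "e \<in> E" "e 0 = x" "e ` cball 0 1 \<subseteq> W" using disc_ex[OF W] by blast
      then obtain h where h: "h holomorphic_on ball 0 1" "\<forall>w\<in>ball 0 1. val F b e w = Re (h w)"
        using b(2) unfolding harm_def W_def by blast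
      then show ?thesis using e disc_image_topspace[OF e(1), of "cball 0 1"] by (intro bexI[of _ e]) auto
    qed
  qed auto
  then show ?thesis using that b(1) by blast
qed

end

section \<open>The plane with holes and the annulus\<close>

definition upper :: "complex set \<Rightarrow> complex set" where "upper S = {z \<in> S. 0 \<le> Im z}"
definition lower :: "complex set \<Rightarrow> complex set" where "lower S = {z \<in> S. Im z \<le> 0}"

lemma prim_halves:
  assumes "prim (top_of_set (upper S)) d f" "prim (top_of_set (lower S)) d h"
    and "\<And>x. of_real x \<in> S \<Longrightarrow> f (of_real x) = h (of_real x) + c"
  shows "prim (top_of_set S) d (\<lambda>z. if 0 \<le> Im z then f z else h z + c)"
proof -
  have sub: "upper S \<subseteq> S" "lower S \<subseteq> S" by (auto simp: upper_def lower_def)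
  have "upper S = S \<inter> {z. 0 \<le> Im z}" "lower S = S \<inter> {z. Im z \<le> 0}" by (auto simp: upper_def lower_def)
  then have cl: "closedin (top_of_set S) (upper S)" "closedin (top_of_set S) (lower S)"
    by (auto intro!: closedin_closed_Int closed_halfspace_Im_ge closed_halfspace_Im_le)
  have "f z = h z + c" if z: "z \<in> upper S \<inter> lower S" for z
  proof -
    have "z = of_real (Re z)" using z by (simp add: upper_def lower_def complex_eq_iff)
    then show ?thesis using assms(3)[of "Re z"] z by (metis IntD1 sub(1) subsetD)
  qed
  have "prim (top_of_set S) d (\<lambda>z. if z \<in> upper S then f z else h z + c)"
  proof (rule prim_glue[OF cl])
    show "prim (subtopology (top_of_set S) (upper S)) d f"
      using assms(1) sub by (simp add: subtopology_subtopology Int_absorb1)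
    show "prim (subtopology (top_of_set S) (lower S)) d (\<lambda>z. h z + c)"
      using prim_shift[OF assms(2)] sub by (simp add: subtopology_subtopology Int_absorb1)
  qed (use \<open>\<And>z. z \<in> upper S \<inter> lower S \<Longrightarrow> f z = h z + c\<close> in \<open>auto simp: upper_def lower_def\<close>)
  then show ?thesis by (rule prim_cong) (auto simp: upper_def)
qed

text \<open>Compares primitives that live on different spaces along a connected set mapped into
  both; in this way values are carried across glued circles and along the real axis.\<close>

lemma prim_transfer:
  assumes T: "connected T" and f: "prim Y d f" and h: "prim Z d' h"
    and p: "continuous_map (top_of_set T) Y p" and p': "continuous_map (top_of_set T) Z p'"
    and eq: "\<And>s t. s \<in> T \<Longrightarrow> t \<in> T \<Longrightarrow> d (p s) (p t) = d' (p' s) (p' t)" and "x \<in> T" "y \<in> T"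
  shows "f (p y) - h (p' y) = f (p x) - h (p' x)"
proof -
  have "connected_space (top_of_set T)"
    using T connectedin_iff_connected[of T] unfolding connectedin_def by blast
  moreover have "prim (top_of_set T) (\<lambda>s t. d (p s) (p t)) (\<lambda>s. f (p s))" by (rule prim_pullback[OF f p])
  moreover have "prim (top_of_set T) (\<lambda>s t. d (p s) (p t)) (\<lambda>s. h (p' s))"
    by (rule prim_cong[OF prim_pullback[OF h p']]) (auto simp: eq)
  ultimately show ?thesis using prim_unique[of "top_of_set T"] assms(7,8) by (metis topspace_euclidean_subtopology)
qed

lemma prim_segment:
  assumes "prim (top_of_set (upper S)) d f" "prim (top_of_set (lower S)) d h"
    and "x \<le> y" "\<And>t. x \<le> t \<Longrightarrow> t \<le> y \<Longrightarrow> of_real t \<in> S"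
  shows "f (of_real y) - h (of_real y) = f (of_real x) - h (of_real x)"
  by (rule prim_transfer[of "{x..y}", OF _ assms(1,2), where p = of_real and p' = of_real])
    (use assms(3,4) in \<open>auto simp: upper_def lower_def continuous_map_in_subtopology intro!: continuous_intros\<close>)

primrec profile :: "nat \<Rightarrow> real \<Rightarrow> real" where
  "profile 0 x = 0"
| "profile (Suc n) x = max (profile n x) (sqrt (max 0 (1 - (x - 3 * real n)\<^sup>2)))"

definition holed_plane :: "nat \<Rightarrow> complex set" where
  "holed_plane g = {z. \<forall>n<2*g. 1 \<le> cmod (z - hole_centre n)}"

lemma hole_centre_of_real: "hole_centre n = of_real (3 * real n)"
  by (simp add: hole_centre_def)

lemma profile_le_iff:
  "profile N (Re z) \<le> Im z \<longleftrightarrow> 0 \<le> Im z \<and> (\<forall>n<N. 1 \<le> cmod (z - hole_centre n))"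
proof (induction N)
  case (Suc N)
  have "sqrt (max 0 (1 - (Re z - 3 * real N)\<^sup>2)) \<le> Im z \<longleftrightarrow> 1 \<le> cmod (z - hole_centre N)" if "0 \<le> Im z"
  proof -
    have "1 \<le> cmod (z - hole_centre N) \<longleftrightarrow> 1 \<le> (Re z - 3 * real N)\<^sup>2 + (Im z)\<^sup>2"
      by (simp add: cmod_def hole_centre_of_real)
    also have "\<dots> \<longleftrightarrow> sqrt (max 0 (1 - (Re z - 3 * real N)\<^sup>2)) \<le> sqrt ((Im z)\<^sup>2)"
      unfolding real_sqrt_le_iff by auto
    finally show ?thesis using that by simp
  qed
  then show ?case using Suc by (auto simp: less_Suc_eq)
qed simp

lemma continuous_profile [continuous_intros]:
  "continuous_on S f \<Longrightarrow> continuous_on S (\<lambda>x. profile N (f x))"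
  by (induction N) (auto intro!: continuous_intros)

lemma upper_holed_plane: "upper (holed_plane g) = {z. profile (2 * g) (Re z) \<le> Im z}"
  by (auto simp: upper_def holed_plane_def profile_le_iff)

lemma cnj_holed_plane [simp]: "cnj z \<in> holed_plane g \<longleftrightarrow> z \<in> holed_plane g"
proof -
  have "cmod (cnj z - hole_centre n) = cmod (z - hole_centre n)" for n
    by (metis complex_cnj_complex_of_real complex_cnj_diff complex_mod_cnj hole_centre_of_real)
  then show ?thesis by (simp add: holed_plane_def)
qed

text \<open>The retraction onto the upper half of the holed plane moves points up vertically to the graph of
  \<open>profile\<close>, the upper boundary of the union of the lower half plane and the holes.\<close>

definition push_up :: "nat \<Rightarrow> complex \<Rightarrow> complex" where
  "push_up g z = Complex (Re z) (max (Im z) (profile (2 * g) (Re z)))"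

lemma continuous_push_up: "continuous_on S (push_up g)"
  unfolding push_up_def Complex_eq by (intro continuous_intros)

lemma push_up_in: "push_up g z \<in> upper (holed_plane g)"
  by (simp add: upper_holed_plane push_up_def)

lemma push_up_id: "z \<in> upper (holed_plane g) \<Longrightarrow> push_up g z = z"
  by (simp add: upper_holed_plane push_up_def max_def complex_eq_iff)

lemma lower_iff_cnj: "z \<in> lower (holed_plane g) \<longleftrightarrow> cnj z \<in> upper (holed_plane g)"
  by (simp add: upper_def lower_def)

lemma exact_upper_holed_plane:
  assumes "cocycle (top_of_set (upper (holed_plane g))) d"
  shows "\<exists>f. prim (top_of_set (upper (holed_plane g))) d f"
  by (rule exact_retract[OF assms, of "\<lambda>z. z" "push_up g"])
    (auto simp: continuous_map_in_subtopology continuous_push_up push_up_in push_up_id)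

lemma exact_lower_holed_plane:
  assumes "cocycle (top_of_set (lower (holed_plane g))) d"
  shows "\<exists>f. prim (top_of_set (lower (holed_plane g))) d f"
proof (rule exact_retract[OF assms, of "\<lambda>z. z" "\<lambda>z. cnj (push_up g (cnj z))"])
  show "continuous_map euclidean (top_of_set (lower (holed_plane g))) (\<lambda>z. cnj (push_up g (cnj z)))"
    using push_up_in
    by (auto simp: continuous_map_in_subtopology lower_iff_cnj intro!: continuous_on_cnj continuous_on_compose2[OF continuous_push_up[of UNIV]] continuous_intros)
qed (auto simp: lower_iff_cnj push_up_id)

lemma connected_upper_holed_plane: "connected (upper (holed_plane g))"
proof -
  have "upper (holed_plane g) = push_up g ` UNIV"
    using push_up_in push_up_id by (metis image_eqI subsetI subset_antisym UNIV_I image_subsetI)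
  then show ?thesis by (simp add: connected_continuous_image[OF continuous_push_up connected_UNIV])
qed

lemma connected_lower_holed_plane: "connected (lower (holed_plane g))"
proof -
  have "lower (holed_plane g) = cnj ` upper (holed_plane g)"
  proof (intro subset_antisym subsetI)
    fix z assume "z \<in> lower (holed_plane g)"
    then show "z \<in> cnj ` upper (holed_plane g)" by (intro image_eqI[of _ _ "cnj z"]) (auto simp: lower_iff_cnj)
  qed (auto simp: lower_iff_cnj)
  then show ?thesis
    by (simp add: connected_continuous_image connected_upper_holed_plane continuous_on_cnj)
qed

lemma of_real_in_holed_plane: "of_real x \<in> holed_plane g \<longleftrightarrow> (\<forall>n<2*g. 1 \<le> \<bar>x - 3 * real n\<bar>)"
proof -
  have "cmod (of_real x - hole_centre n) = \<bar>x - 3 * real n\<bar>" for n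
    unfolding hole_centre_of_real by (metis norm_of_real of_real_diff)
  then show ?thesis by (simp add: holed_plane_def)
qed

text \<open>The difference of the two primitives is constant on each interval of the real axis
  between holes, and the hypothesis carries it across each hole. So a single constant fits the two
  halves together.\<close>

lemma exact_holed_plane:
  assumes f: "prim (top_of_set (upper (holed_plane g))) d f" and h: "prim (top_of_set (lower (holed_plane g))) d h"
    and jump: "\<And>n. n < 2 * g \<Longrightarrow>
      f (of_real (3 * real n + 1)) - h (of_real (3 * real n + 1)) = f (of_real (3 * real n - 1)) - h (of_real (3 * real n - 1))"
  shows "\<exists>c. prim (top_of_set (holed_plane g)) d (\<lambda>z. if 0 \<le> Im z then f z else h z + c)"
proof -
  define \<kappa> where "\<kappa> = (\<lambda>x::real. f (of_real x) - h (of_real x))"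
  have seg: "\<kappa> y = \<kappa> x" if "x \<le> y" "\<And>t n. x \<le> t \<Longrightarrow> t \<le> y \<Longrightarrow> n < 2 * g \<Longrightarrow> 1 \<le> \<bar>t - 3 * real n\<bar>" for x y
    unfolding \<kappa>_def by (rule prim_segment[OF f h that(1)]) (use that(2) in \<open>auto simp: of_real_in_holed_plane\<close>)
  have gap: "1 \<le> \<bar>t - 3 * real n\<bar>" if "t \<le> 3 * real k - 1" "0 < k \<Longrightarrow> 3 * real k - 2 \<le> t" for t n k
  proof (cases "n < k")
    case True
    then have "real n + 1 \<le> real k" by simp
    then show ?thesis using that(2) True by auto
  next
    case False
    then have "real k \<le> real n" by simp
    then show ?thesis using that(1) by auto
  qed
  have gap2: "1 \<le> \<bar>t - 3 * real n\<bar>" if "3 * real (2 * g) - 2 \<le> t" "n < 2 * g" for t n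
  proof -
    have "real n + 1 \<le> real (2 * g)" using that(2) by linarith
    then show ?thesis using that(1) by auto
  qed
  have kk: "\<kappa> (3 * real k - 1) = \<kappa> (-1)" if "k \<le> 2 * g" for k
    using that
  proof (induction k)
    case (Suc k)
    have "\<kappa> (3 * real k + 1) = \<kappa> (-1)" using jump[of k] Suc by (simp add: \<kappa>_def)
    moreover have "\<kappa> (3 * real (Suc k) - 1) = \<kappa> (3 * real k + 1)"
      by (rule seg) (use gap[of _ "Suc k"] in auto)
    ultimately show ?case by simp
  qed simp
  have all: "\<kappa> x = \<kappa> (-1)" if x: "of_real x \<in> holed_plane g" for x
  proof (cases "x \<ge> 3 * real (2 * g) - 1")
    case True
    then have "\<kappa> x = \<kappa> (3 * real (2 * g) - 1)" by (intro seg) (use gap2 in auto)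
    then show ?thesis using kk[of "2 * g"] by simp
  next
    case False
    \<comment> \<open>The first hole, or the virtual one with index 2 * g, whose left end is not to
      the left of x. Minimality and membership in the holed plane place x beyond the hole before
      it.\<close>
    define k where "k = (LEAST k. x \<le> 3 * real k - 1)"
    have k1: "x \<le> 3 * real k - 1" unfolding k_def by (rule LeastI[of _ "2 * g"]) (use False in simp)
    have k2: "k \<le> 2 * g" unfolding k_def by (rule Least_le) (use False in simp)
    have k3: "3 * real k - 2 \<le> x" if "0 < k"
    proof -
      have "\<not> x \<le> 3 * real (k - 1) - 1" using not_less_Least[of "k - 1" "\<lambda>k. x \<le> 3 * real k - 1"] that by (simp add: k_def)
      moreover have "k - 1 < 2 * g" using k2 that by simp
      then have "1 \<le> \<bar>x - 3 * real (k - 1)\<bar>" using x unfolding of_real_in_holed_plane by blast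
      ultimately show ?thesis using that by (auto simp: of_nat_diff abs_if split: if_splits)
    qed
    have "\<kappa> (3 * real k - 1) = \<kappa> x" by (rule seg[OF k1]) (use gap[of _ k] k3 in force)
    then show ?thesis using kk[OF k2] by simp
  qed
  have "prim (top_of_set (holed_plane g)) d (\<lambda>z. if 0 \<le> Im z then f z else h z + \<kappa> (-1))"
  proof (rule prim_halves[OF f h])
    fix x :: real assume "of_real x \<in> holed_plane g"
    from all[OF this] have "\<kappa> x = \<kappa> (-1)" .
    then show "f (of_real x) = h (of_real x) + \<kappa> (-1)" unfolding \<kappa>_def by linarith
  qed
  then show ?thesis by blast
qed

section \<open>The closed annulus\<close>

definition annulus :: "complex set" where "annulus = {z. 1 \<le> cmod z \<and> cmod z \<le> 2}"

text \<open>\<open>polar_clamp\<close> exhibits the upper half annulus as a retract of the plane.\<close>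

definition polar_clamp :: "complex \<Rightarrow> complex" where
  "polar_clamp z = of_real (max 1 (min 2 (Re z))) * cis (max 0 (min pi (Im z)))"

definition polar_coord :: "complex \<Rightarrow> complex" where
  "polar_coord z = Complex (cmod z) (arccos (Re z / cmod z))"

lemma annulus_ratio:
  assumes "z \<in> annulus" shows "-1 \<le> Re z / cmod z" "Re z / cmod z \<le> 1" "cmod z \<noteq> 0"
  using assms abs_Re_le_cmod[of z] by (auto simp: annulus_def divide_simps abs_le_iff)

lemma polar_clamp_coord:
  assumes z: "z \<in> upper annulus" shows "polar_clamp (polar_coord z) = z"
proof -
  have a: "z \<in> annulus" "0 \<le> Im z" using z by (auto simp: upper_def)
  note r = annulus_ratio[OF a(1)]
  have "max 1 (min 2 (cmod z)) = cmod z" using a(1) by (auto simp: annulus_def)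
  moreover have "max 0 (min pi (arccos (Re z / cmod z))) = arccos (Re z / cmod z)"
    using arccos_lbound[OF r(1,2)] arccos_ubound[OF r(1,2)] by simp
  moreover have "sin (arccos (Re z / cmod z)) = Im z / cmod z"
  proof -
    have "1 - (Re z / cmod z)\<^sup>2 = ((cmod z)\<^sup>2 - (Re z)\<^sup>2) / (cmod z)\<^sup>2"
      using r(3) by (simp add: power_divide diff_divide_distrib)
    also have "\<dots> = (Im z / cmod z)\<^sup>2" by (simp add: cmod_power2 power_divide)
    finally have "1 - (Re z / cmod z)\<^sup>2 = (Im z / cmod z)\<^sup>2" .
    then show ?thesis using a(2) r by (simp add: sin_arccos)
  qed
  ultimately show ?thesis
    using r by (simp add: polar_clamp_def polar_coord_def complex_eq_iff cos_arccos)
qed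

lemma continuous_polar_clamp: "continuous_on S polar_clamp"
  unfolding polar_clamp_def cis_conv_exp by (intro continuous_intros)

lemma polar_clamp_in: "polar_clamp z \<in> upper annulus"
proof -
  have "0 \<le> sin (max 0 (min pi (Im z)))" by (rule sin_ge_zero) auto
  then show ?thesis by (auto simp: polar_clamp_def upper_def annulus_def norm_mult)
qed

lemma continuous_polar_coord: "continuous_on (upper annulus) polar_coord"
  unfolding polar_coord_def Complex_eq
  by (intro continuous_intros) (auto simp: upper_def dest: annulus_ratio)

lemma exact_upper_annulus:
  assumes "cocycle (top_of_set (upper annulus)) d"
  shows "\<exists>f. prim (top_of_set (upper annulus)) d f"
  by (rule exact_retract[OF assms, of polar_coord polar_clamp])
    (auto simp: continuous_map_in_subtopology continuous_polar_clamp polar_clamp_in continuous_polar_coord polar_clamp_coord)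

lemma lower_annulus_iff_cnj: "z \<in> lower annulus \<longleftrightarrow> cnj z \<in> upper annulus"
  by (simp add: upper_def lower_def annulus_def)

lemma exact_lower_annulus:
  assumes "cocycle (top_of_set (lower annulus)) d"
  shows "\<exists>f. prim (top_of_set (lower annulus)) d f"
proof (rule exact_retract[OF assms, of "\<lambda>z. polar_coord (cnj z)" "\<lambda>z. cnj (polar_clamp z)"])
  show "continuous_map euclidean (top_of_set (lower annulus)) (\<lambda>z. cnj (polar_clamp z))"
    using polar_clamp_in
    by (auto simp: continuous_map_in_subtopology lower_annulus_iff_cnj intro!: continuous_on_cnj continuous_polar_clamp)
  show "continuous_map (top_of_set (lower annulus)) euclidean (\<lambda>z. polar_coord (cnj z))"
    by (auto intro!: continuous_on_compose2[OF continuous_polar_coord] continuous_intros continuous_on_cnj simp: lower_annulus_iff_cnj)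
qed (auto simp: lower_annulus_iff_cnj polar_clamp_coord)

lemma connected_annulus_closed: "connected annulus"
  using connected_annulus(4)[where a = "0::complex" and ?r1.0 = 1 and ?r2.0 = 2] by (simp add: annulus_def)

text \<open>On each half the cocycle is exact; the obstruction to gluing is the jump between the two primitives
  along the real axis. The opposite sign at the outer end comes from the conjugation in \<open>handle_glue\<close>.\<close>

lemma annulus_jump:
  assumes d: "cocycle (top_of_set annulus) d"
    and f: "prim (top_of_set (upper (holed_plane g))) d0 f" and h: "prim (top_of_set (lower (holed_plane g))) d0 h"
    and c: "\<And>w. cmod w = 1 \<Longrightarrow> c1 + w \<in> holed_plane g" "\<And>w. cmod w = 1 \<Longrightarrow> c2 + w \<in> holed_plane g"
      "Im c1 = 0" "Im c2 = 0"
    and inner: "\<And>s t. cmod s = 1 \<Longrightarrow> cmod t = 1 \<Longrightarrow> d s t = d0 (c1 + s) (c1 + t)"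
    and outer: "\<And>s t. cmod s = 1 \<Longrightarrow> cmod t = 1 \<Longrightarrow> d (2 * s) (2 * t) = d0 (c2 + cnj s) (c2 + cnj t)"
  shows "(f (c1 + 1) - h (c1 + 1)) - (f (c1 - 1) - h (c1 - 1)) = - ((f (c2 + 1) - h (c2 + 1)) - (f (c2 - 1) - h (c2 - 1)))"
    and "f (c1 + 1) - h (c1 + 1) = f (c1 - 1) - h (c1 - 1) \<Longrightarrow> \<exists>b. prim (top_of_set annulus) d b"
proof -
  have sub: "upper annulus \<subseteq> annulus" "lower annulus \<subseteq> annulus" by (auto simp: upper_def lower_def)
  have "cocycle (top_of_set (upper annulus)) d" "cocycle (top_of_set (lower annulus)) d"
    using cocycle_subtopology[OF d, of "upper annulus"] cocycle_subtopology[OF d, of "lower annulus"] sub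
    by (simp_all add: subtopology_subtopology Int_absorb1)
  then obtain p m where p: "prim (top_of_set (upper annulus)) d p" and m: "prim (top_of_set (lower annulus)) d m"
    using exact_upper_annulus exact_lower_annulus by blast
  \<comment> \<open>The upper unit semicircle, with the lower one below: along them the primitives
    on the annulus are compared with those on the plane.\<close>
  define U where "U = cis ` {0..pi}"
  define L where "L = cnj ` U"
  have U: "connected U" unfolding U_def cis_conv_exp by (intro connected_continuous_image continuous_intros) auto
  then have L: "connected L" unfolding L_def by (intro connected_continuous_image continuous_on_cnj continuous_intros)
  have Uin: "cmod w = 1 \<and> 0 \<le> Im w" if "w \<in> U" for w using that by (auto simp: U_def intro: sin_ge_zero)
  then have Lin: "cmod w = 1 \<and> Im w \<le> 0" if "w \<in> L" for w using that by (auto simp: L_def)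
  have "1 \<in> U" "-1 \<in> U" unfolding U_def by (auto intro: image_eqI[of _ _ 0] image_eqI[of _ _ pi])
  then have pts: "1 \<in> U" "-1 \<in> U" "1 \<in> L" "-1 \<in> L" unfolding L_def by (auto intro: image_eqI[of _ _ 1] image_eqI[of _ _ "-1"])
  have mem: "w \<in> upper annulus" "2 * w \<in> upper annulus" "c1 + w \<in> upper (holed_plane g)" "c2 + cnj w \<in> lower (holed_plane g)" if "w \<in> U" for w
    using Uin[OF that] c(1)[of w] c(2)[of "cnj w"] c(3,4) by (auto simp: upper_def lower_def annulus_def norm_mult)
  have mem': "w \<in> lower annulus" "2 * w \<in> lower annulus" "c1 + w \<in> lower (holed_plane g)" "c2 + cnj w \<in> upper (holed_plane g)" if "w \<in> L" for w
    using Lin[OF that] c(1)[of w] c(2)[of "cnj w"] c(3,4) by (auto simp: upper_def lower_def annulus_def norm_mult)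
  have 1: "p 1 - f (c1 + 1) = p (-1) - f (c1 + -1)"
    by (rule prim_transfer[OF U p f, of "\<lambda>w. w" "\<lambda>w. c1 + w"])
      (use mem pts Uin inner in \<open>auto simp: continuous_map_in_subtopology intro!: continuous_intros\<close>)
  have 2: "m 1 - h (c1 + 1) = m (-1) - h (c1 + -1)"
    by (rule prim_transfer[OF L m h, of "\<lambda>w. w" "\<lambda>w. c1 + w"])
      (use mem' pts Lin inner in \<open>auto simp: continuous_map_in_subtopology intro!: continuous_intros\<close>)
  \<comment> \<open>At the outer end conjugation swaps the half planes, so p is compared with h here
    and m with f next. This produces the minus sign.\<close>
  have 3: "p (2 * 1) - h (c2 + cnj 1) = p (2 * -1) - h (c2 + cnj (-1))"
    by (rule prim_transfer[OF U p h, of "\<lambda>w. 2 * w" "\<lambda>w. c2 + cnj w"])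
      (use mem pts Uin outer in \<open>auto simp: continuous_map_in_subtopology intro!: continuous_intros continuous_on_cnj\<close>)
  have 4: "m (2 * 1) - f (c2 + cnj 1) = m (2 * -1) - f (c2 + cnj (-1))"
    by (rule prim_transfer[OF L m f, of "\<lambda>w. 2 * w" "\<lambda>w. c2 + cnj w"])
      (use mem' pts Lin outer in \<open>auto simp: continuous_map_in_subtopology intro!: continuous_intros continuous_on_cnj\<close>)
  \<comment> \<open>The annulus meets the real axis in two segments, and p - m is constant on each
    of them.\<close>
  have seg: "p (of_real y) - m (of_real y) = p (of_real x) - m (of_real x)"
    if "x \<le> y" "(1 \<le> x \<and> y \<le> 2) \<or> (-2 \<le> x \<and> y \<le> -1)" for x y
    by (rule prim_segment[OF p m that(1)]) (use that(2) in \<open>auto simp: annulus_def\<close>)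
  have 5: "p 2 - m 2 = p 1 - m 1" using seg[of 1 2] by simp
  have 6: "p (-1) - m (-1) = p (-2) - m (-2)" using seg[of "-2" "-1"] by simp
  show "(f (c1 + 1) - h (c1 + 1)) - (f (c1 - 1) - h (c1 - 1)) = - ((f (c2 + 1) - h (c2 + 1)) - (f (c2 - 1) - h (c2 - 1)))"
    using 1 2 3 4 5 6 by simp
  \<comment> \<open>Without a jump at the inner end the constants on the two segments agree, and one
    shift glues p and m.\<close>
  assume e: "f (c1 + 1) - h (c1 + 1) = f (c1 - 1) - h (c1 - 1)"
  then have 7: "p (-1) - m (-1) = p 1 - m 1" using 1 2 by simp
  have "p (of_real x) = m (of_real x) + (p 1 - m 1)" if x: "of_real x \<in> annulus" for x
  proof -
    have "1 \<le> x \<and> x \<le> 2 \<or> -2 \<le> x \<and> x \<le> -1" using x by (auto simp: annulus_def abs_if split: if_splits)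
    then show ?thesis using seg[of 1 x] seg[of x "-1"] 7 by auto
  qed
  from prim_halves[OF p m this] show "\<exists>b. prim (top_of_set annulus) d b" by blast
qed

text \<open>\<open>circ_plane j\<close> winds once around each of the holes \<open>2 * j\<close> and \<open>2 * j + 1\<close>, in opposite directions,
  and not around the others.\<close>

definition bump :: "nat \<Rightarrow> real \<Rightarrow> real" where
  "bump j x = max 0 (min 1 (min ((x - 6 * real j + 1) / 2) ((6 * real j + 4 - x) / 2)))"

text \<open>As a function of Re z, \<open>bump j\<close> rises from 0 to 1 across the hole 2 j and
  falls back across the hole 2 j + 1. On the real axis off the holes it is thus 0 or 1, so the angle
  is a multiple of 2 \<pi> and the map joins the constant 1 of the lower half plane. The second
  factor switches the angle off between the heights 1 and 2, which makes the map constant near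
  infinity.\<close>

definition bump_lift :: "nat \<Rightarrow> complex \<Rightarrow> real" where
  "bump_lift j z = 2 * pi * (bump j (Re z) * max 0 (min 1 (2 - Im z)))"

definition circ_plane :: "nat \<Rightarrow> complex \<Rightarrow> complex" where
  "circ_plane j z = (if 0 \<le> Im z then cis (bump_lift j z) else 1)"

lemma bump_real:
  assumes "\<forall>n<2*g. 1 \<le> \<bar>x - 3 * real n\<bar>" "j < g" shows "bump j x = 0 \<or> bump j x = 1"
proof -
  have "2 * j < 2 * g" "2 * j + 1 < 2 * g" using assms(2) by auto
  then have "1 \<le> \<bar>x - 3 * real (2 * j)\<bar>" "1 \<le> \<bar>x - 3 * real (2 * j + 1)\<bar>" using assms(1) by blast+
  then show ?thesis by (auto simp: bump_def max_def min_def abs_if split: if_splits)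
qed

lemma bump_values: "bump j (6 * real j + 1) = 1" "bump j (6 * real j - 1) = 0" "bump j (6 * real j + 2) = 1" "bump j (-1) = 0"
  by (auto simp: bump_def max_def min_def)

lemma bump_other:
  assumes "i \<noteq> j" "6 * real i - 1 \<le> x" "x \<le> 6 * real i + 4" shows "bump j x = 0"
proof -
  have "real i + 1 \<le> real j \<or> real j + 1 \<le> real i" using assms(1) by linarith
  then show ?thesis using assms(2,3) by (auto simp: bump_def max_def min_def)
qed

lemma circ_plane_real:
  assumes "j < g" "z \<in> holed_plane g" "Im z = 0" shows "circ_plane j z = 1"
proof -
  have "z = of_real (Re z)" using assms(3) by (simp add: complex_eq_iff)
  then have "of_real (Re z) \<in> holed_plane g" using assms(2) by metis
  then have "bump j (Re z) = 0 \<or> bump j (Re z) = 1" using bump_real[OF _ assms(1)] unfolding of_real_in_holed_plane by blast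
  then show ?thesis using assms(3) by (auto simp: circ_plane_def bump_lift_def)
qed

lemma continuous_bump_lift: "continuous_on S (bump_lift j)"
  unfolding bump_lift_def bump_def by (intro continuous_intros) auto

lemma continuous_circ_plane:
  assumes "j < g" shows "continuous_on (holed_plane g) (circ_plane j)"
proof -
  have eq: "holed_plane g = upper (holed_plane g) \<union> lower (holed_plane g)" by (auto simp: upper_def lower_def)
  have "upper (holed_plane g) = holed_plane g \<inter> {z. 0 \<le> Im z}" "lower (holed_plane g) = holed_plane g \<inter> {z. Im z \<le> 0}"
    by (auto simp: upper_def lower_def)
  then have cl: "closedin (top_of_set (upper (holed_plane g) \<union> lower (holed_plane g))) (upper (holed_plane g))"
     "closedin (top_of_set (upper (holed_plane g) \<union> lower (holed_plane g))) (lower (holed_plane g))"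
    unfolding eq[symmetric] by (auto intro!: closedin_closed_Int closed_halfspace_Im_ge closed_halfspace_Im_le)
  have 1: "continuous_on (upper (holed_plane g)) (\<lambda>z. cis (bump_lift j z))"
    unfolding cis_conv_exp by (intro continuous_intros continuous_bump_lift)
  have "continuous_on (upper (holed_plane g) \<union> lower (holed_plane g)) (\<lambda>z. if 0 \<le> Im z then cis (bump_lift j z) else 1)"
  proof (rule continuous_on_cases_local[OF cl 1 continuous_on_const])
    fix z assume "(z \<in> upper (holed_plane g) \<and> \<not> 0 \<le> Im z) \<or> (z \<in> lower (holed_plane g) \<and> 0 \<le> Im z)"
    then have z: "z \<in> holed_plane g" "Im z = 0" by (auto simp: upper_def lower_def)
    then show "cis (bump_lift j z) = 1" using circ_plane_real[OF assms z] by (simp add: circ_plane_def)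
  qed
  then show ?thesis unfolding eq[symmetric] circ_plane_def[abs_def] .
qed

lemma norm_circ_plane [simp]: "cmod (circ_plane j z) = 1"
  by (simp add: circ_plane_def)

lemma circ_plane_far: "cmod z \<ge> 6 * real j + 10 \<Longrightarrow> circ_plane j z = 1"
proof (cases "\<bar>Re z\<bar> \<ge> 6 * real j + 5")
  case True
  then have "bump j (Re z) = 0" by (auto simp: bump_def max_def min_def)
  then show ?thesis by (simp add: circ_plane_def bump_lift_def)
next
  case False
  assume "cmod z \<ge> 6 * real j + 10"
  then have "\<bar>Im z\<bar> > 2" using False cmod_le[of z] by linarith
  then show ?thesis by (auto simp: circ_plane_def bump_lift_def)
qed

lemma circle_in_holed_plane:
  assumes "cmod w = 1" shows "hole_centre n + w \<in> holed_plane g"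
  unfolding holed_plane_def
proof clarify
  fix m assume "m < 2 * g"
  show "1 \<le> cmod (hole_centre n + w - hole_centre m)"
  proof (cases "m = n")
    case False
    have "hole_centre n - hole_centre m = of_real (3 * (real n - real m))" by (simp add: hole_centre_def algebra_simps)
    then have "cmod (hole_centre n - hole_centre m) = 3 * \<bar>real n - real m\<bar>"
      by (simp only: norm_of_real abs_mult)
    moreover have "1 \<le> \<bar>real n - real m\<bar>" using False by linarith
    ultimately have "3 \<le> cmod (hole_centre n - hole_centre m)" by simp
    then show ?thesis using norm_triangle_ineq2[of "hole_centre n - hole_centre m" "- w"] assms by (simp add: algebra_simps)
  next
    case True
    then show ?thesis using assms by simp
  qed
qed

text \<open>The angle falls across the second hole as it rises across the first, so the conjugated
  point on the rim of the second matches the opposite point on the rim of the first. The half turn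
  in \<open>circ_piece\<close> accounts for the opposite sign.\<close>

lemma circ_plane_ends:
  assumes "cmod w = 1"
  shows "circ_plane j (hole_centre (2 * j + 1) + cnj w) = circ_plane j (hole_centre (2 * j) - w)"
proof -
  have w: "\<bar>Re w\<bar> \<le> 1" "\<bar>Im w\<bar> \<le> 1" using abs_Re_le_cmod[of w] abs_Im_le_cmod[of w] assms by auto
  have "bump j (Re (hole_centre (2 * j + 1) + cnj w)) = (1 - Re w) / 2"
    "bump j (Re (hole_centre (2 * j) - w)) = (1 - Re w) / 2"
    using w by (auto simp: bump_def hole_centre_of_real max_def min_def abs_le_iff field_simps)
  then have "bump j (Re (hole_centre (2 * j + 1) + cnj w)) = bump j (Re (hole_centre (2 * j) - w))" by simp
  then have "bump_lift j (hole_centre (2 * j + 1) + cnj w) = bump_lift j (hole_centre (2 * j) - w)"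
    unfolding bump_lift_def by (simp only:) (simp add: hole_centre_of_real)
  then show ?thesis by (simp add: circ_plane_def hole_centre_of_real)
qed

lemma circ_plane_other:
  assumes "cmod w = 1" "i \<noteq> j"
  shows "circ_plane j (hole_centre (2 * i) + w) = 1" "circ_plane j (hole_centre (2 * i + 1) + w) = 1"
proof -
  have w: "\<bar>Re w\<bar> \<le> 1" using abs_Re_le_cmod[of w] assms by auto
  have "bump j (Re (hole_centre (2 * i) + w)) = 0"
    by (rule bump_other[OF assms(2)]) (use w in \<open>simp_all add: hole_centre_of_real abs_le_iff\<close>)
  moreover have "bump j (Re (hole_centre (2 * i + 1) + w)) = 0"
    by (rule bump_other[OF assms(2)]) (use w in \<open>simp_all add: hole_centre_of_real abs_le_iff\<close>)
  ultimately show "circ_plane j (hole_centre (2 * i) + w) = 1" "circ_plane j (hole_centre (2 * i + 1) + w) = 1"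
    by (simp_all add: circ_plane_def bump_lift_def)
qed

section \<open>The sphere with handles\<close>

definition point_class :: "nat \<Rightarrow> nat \<times> complex option \<Rightarrow> (nat \<times> complex option) set" where
  "point_class g s = Collect (equivclp (handle_glue g) s)"

text \<open>The value at an arbitrary representative, meaningful for functions that respect the
  gluing.\<close>

definition descend :: "('b \<Rightarrow> 'c) \<Rightarrow> 'b set \<Rightarrow> 'c" where
  "descend f c = f (SOME s. s \<in> c)"

lemma equivclp_respects:
  assumes "\<And>s t. r s t \<Longrightarrow> f s = f t" "equivclp r s t" shows "f s = f t"
  using assms(2) by (induction rule: equivclp_induct) (use assms(1) in metis)+

lemma descend_point_class:
  assumes "\<And>s t. handle_glue g s t \<Longrightarrow> f s = f t"
  shows "descend f (point_class g s) = f s"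
proof -
  have "s \<in> point_class g s" by (simp add: point_class_def equivclp_def)
  then have "(SOME t. t \<in> point_class g s) \<in> point_class g s" by (rule someI)
  then show ?thesis
    using equivclp_respects[of "handle_glue g" f s] assms unfolding descend_def point_class_def by auto
qed

lemma point_class_eqI: "handle_glue g s t \<Longrightarrow> point_class g s = point_class g t"
proof -
  assume "handle_glue g s t"
  then have "equivclp (handle_glue g) s t" by (auto simp: equivclp_def symclp_def)
  then show ?thesis unfolding point_class_def
    by (intro Collect_cong) (meson equivclp_sym equivclp_trans)
qed

lemma quotient_point_class: "quotient_map (handle_pieces g) (sphere_with_handles g) (point_class g)"
  unfolding sphere_with_handles_def point_class_def[abs_def] by (rule quotient_map_quotient_topology)

lemma handle_piece_0: "handle_piece g 0 = insert None (Some ` holed_plane g)"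
proof -
  have "x \<in> handle_piece g 0 \<longleftrightarrow> x \<in> insert None (Some ` holed_plane g)" for x
  proof (cases x)
    case None then show ?thesis by (auto simp: handle_piece_def)
  next
    case (Some z)
    then show ?thesis
      by (simp add: handle_piece_def holed_plane_def inj_image_mem_iff[OF inj_Some] dist_norm norm_minus_commute not_less Ball_def)
  qed
  then show ?thesis by blast
qed

lemma handle_piece_Suc: "handle_piece g (Suc j) = Some ` annulus"
  by (simp add: handle_piece_def annulus_def)

lemma topspace_handle_pieces:
  "topspace (handle_pieces g) = {(0, None)} \<union> {0} \<times> Some ` holed_plane g \<union> (Suc ` {..<g}) \<times> Some ` annulus"
proof -
  have "topspace (handle_pieces g) = Sigma {..g} (handle_piece g)"
    by (simp add: handle_pieces_def o_def UNIV_option_conv[symmetric])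
  also have "{..g} = insert 0 (Suc ` {..<g})" by (simp only: lessThan_Suc_atMost[symmetric] lessThan_Suc_eq_insert_0)
  finally have *: "topspace (handle_pieces g) = Sigma (insert 0 (Suc ` {..<g})) (handle_piece g)" .
  have "Sigma (insert 0 (Suc ` {..<g})) (handle_piece g) = {0} \<times> handle_piece g 0 \<union> Sigma (Suc ` {..<g}) (handle_piece g)"
    by blast
  also have "Sigma (Suc ` {..<g}) (handle_piece g) = (Suc ` {..<g}) \<times> Some ` annulus"
    by (rule Sigma_cong) (auto simp only: handle_piece_Suc)
  also have "{0} \<times> handle_piece g 0 = {(0, None)} \<union> {0} \<times> Some ` holed_plane g"
    unfolding handle_piece_0 by blast
  finally show ?thesis unfolding * .
qed

lemma openin_handle_pieces_plane:
  assumes "openin (top_of_set (holed_plane g)) N"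
  shows "openin (handle_pieces g) ({0} \<times> Some ` N)"
proof -
  obtain T where T: "open T" "N = holed_plane g \<inter> T" using assms by (auto simp: openin_open)
  have "Some ` N = Some ` T \<inter> handle_piece g 0" by (auto simp: T handle_piece_0)
  then have "openin (subtopology (Alexandroff_compactification euclidean) (handle_piece g 0)) (Some ` N)"
    unfolding openin_subtopology by (intro exI[of _ "Some ` T"] conjI) (use T(1) in simp_all)
  then have "openin (handle_pieces g) ((\<lambda>x. (0::nat, x)) ` Some ` N)"
    unfolding handle_pieces_def by (rule open_map_component_injection[unfolded open_map_def, rule_format, rotated]) simp
  moreover have "(\<lambda>x. (0::nat, x)) ` Some ` N = {0} \<times> Some ` N" by auto
  ultimately show ?thesis by metis
qed

lemma openin_handle_pieces_cylinder:
  assumes "j < g" "openin (top_of_set annulus) N"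
  shows "openin (handle_pieces g) ({Suc j} \<times> Some ` N)"
proof -
  obtain T where T: "open T" "N = annulus \<inter> T" using assms by (auto simp: openin_open)
  have "Some ` N = Some ` T \<inter> handle_piece g (Suc j)" by (auto simp: T handle_piece_Suc)
  then have "openin (subtopology (Alexandroff_compactification euclidean) (handle_piece g (Suc j))) (Some ` N)"
    unfolding openin_subtopology by (intro exI[of _ "Some ` T"] conjI) (use T(1) in simp_all)
  then have "openin (handle_pieces g) ((\<lambda>x. (Suc j, x)) ` Some ` N)"
    unfolding handle_pieces_def by (rule open_map_component_injection[unfolded open_map_def, rule_format, rotated]) (use assms in simp)
  moreover have "(\<lambda>x. (Suc j, x)) ` Some ` N = {Suc j} \<times> Some ` N" by auto
  ultimately show ?thesis by metis
qed

lemma continuous_plane_inclusion: "continuous_map (top_of_set (holed_plane g)) (handle_pieces g) (\<lambda>z. (0, Some z))"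
proof -
  have "continuous_map (top_of_set (holed_plane g)) (subtopology (Alexandroff_compactification euclidean) (handle_piece g 0)) Some"
    using continuous_map_from_subtopology[OF continuous_map_Some[of euclidean]]
    by (auto simp: continuous_map_in_subtopology handle_piece_0)
  from continuous_map_compose[OF this continuous_map_component_injection[of 0 "{..g}" "\<lambda>i. subtopology (Alexandroff_compactification euclidean) (handle_piece g i)"]]
  show ?thesis unfolding handle_pieces_def by (simp add: o_def)
qed

lemma continuous_cylinder_inclusion:
  assumes "j < g" shows "continuous_map (top_of_set annulus) (handle_pieces g) (\<lambda>z. (Suc j, Some z))"
proof -
  have "continuous_map (top_of_set annulus) (subtopology (Alexandroff_compactification euclidean) (handle_piece g (Suc j))) Some"
    using continuous_map_from_subtopology[OF continuous_map_Some[of euclidean]]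
    by (auto simp: continuous_map_in_subtopology handle_piece_Suc)
  from continuous_map_compose[OF this continuous_map_component_injection[of "Suc j" "{..g}" "\<lambda>i. subtopology (Alexandroff_compactification euclidean) (handle_piece g i)"]]
  show ?thesis unfolding handle_pieces_def using assms by (simp add: o_def)
qed

definition pole :: "nat \<Rightarrow> (nat \<times> complex option) set" where
  "pole g = point_class g (0, None)"

text \<open>No gluing touches the point at infinity, so the indicator of that point is constant on
  classes and separates its class from all others.\<close>

lemma point_class_eq_pole_iff: "point_class g s = pole g \<longleftrightarrow> s = (0, None)"
proof
  assume "point_class g s = pole g"
  then have "descend (\<lambda>t. t = (0, None)) (point_class g s) = descend (\<lambda>t. t = (0, None)) (point_class g (0, None))"
    by (simp add: pole_def)
  moreover have "(s = (0, None)) = (t = (0, None))" if "handle_glue g s t" for s t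
    using that by cases auto
  ultimately show "s = (0, None)" by (simp add: descend_point_class)
qed (simp add: pole_def)

definition punctured_pieces :: "nat \<Rightarrow> (nat \<times> complex option) topology" where
  "punctured_pieces g = subtopology (handle_pieces g) (topspace (handle_pieces g) - {(0, None)})"

definition punctured :: "nat \<Rightarrow> (nat \<times> complex option) set topology" where
  "punctured g = subtopology (sphere_with_handles g) (topspace (sphere_with_handles g) - {pole g})"

lemma point_class_in: "s \<in> topspace (handle_pieces g) \<Longrightarrow> point_class g s \<in> topspace (sphere_with_handles g)"
  using quotient_point_class[of g] unfolding quotient_map_def by blast

lemma pole_in: "pole g \<in> topspace (sphere_with_handles g)"
  unfolding pole_def by (rule point_class_in) (simp add: topspace_handle_pieces)

lemma openin_punctured_pieces: "openin (handle_pieces g) (topspace (handle_pieces g) - {(0, None)})"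
proof -
  have "openin (handle_pieces g) (({0} \<times> Some ` holed_plane g) \<union> (\<Union>j<g. {Suc j} \<times> Some ` annulus))"
    by (intro openin_Un openin_handle_pieces_plane openin_Union) (auto intro!: openin_handle_pieces_cylinder)
  moreover have "({0} \<times> Some ` holed_plane g) \<union> (\<Union>j<g. {Suc j} \<times> Some ` annulus) = topspace (handle_pieces g) - {(0, None)}"
    by (auto simp: topspace_handle_pieces)
  ultimately show ?thesis by simp
qed

lemma openin_punctured: "openin (sphere_with_handles g) (topspace (sphere_with_handles g) - {pole g})"
proof -
  have "{s \<in> topspace (handle_pieces g). point_class g s \<in> topspace (sphere_with_handles g) - {pole g}}
      = topspace (handle_pieces g) - {(0, None)}"
    using point_class_in by (auto simp: point_class_eq_pole_iff)
  then show ?thesis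
    using quotient_point_class[of g, unfolded quotient_map_def, THEN conjunct2, rule_format,
        of "topspace (sphere_with_handles g) - {pole g}"] openin_punctured_pieces[of g] by simp
qed

lemma quotient_punctured: "quotient_map (punctured_pieces g) (punctured g) (point_class g)"
  unfolding punctured_pieces_def punctured_def
  by (rule quotient_map_restriction[OF quotient_point_class])
    (use point_class_in openin_punctured in \<open>auto simp: point_class_eq_pole_iff\<close>)

lemma continuous_plane: "continuous_map (top_of_set (holed_plane g)) (punctured_pieces g) (\<lambda>z. (0, Some z))"
  using continuous_plane_inclusion[of g] unfolding punctured_pieces_def
  by (auto simp: continuous_map_in_subtopology topspace_handle_pieces)

lemma continuous_cylinder: "j < g \<Longrightarrow> continuous_map (top_of_set annulus) (punctured_pieces g) (\<lambda>z. (Suc j, Some z))"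
  using continuous_cylinder_inclusion[of j g] unfolding punctured_pieces_def
  by (auto simp: continuous_map_in_subtopology topspace_handle_pieces)

lemma continuous_plane_class: "continuous_map (top_of_set (holed_plane g)) (punctured g) (\<lambda>z. point_class g (0, Some z))"
  using continuous_map_compose[OF continuous_plane quotient_imp_continuous_map[OF quotient_punctured]] by (simp add: o_def)

lemma continuous_cylinder_class:
  "j < g \<Longrightarrow> continuous_map (top_of_set annulus) (punctured g) (\<lambda>z. point_class g (Suc j, Some z))"
  using continuous_map_compose[OF continuous_cylinder quotient_imp_continuous_map[OF quotient_punctured]] by (simp add: o_def)

lemma prim_punctured_pieces:
  assumes p: "prim (top_of_set (holed_plane g)) (\<lambda>s t. d (0, Some s) (0, Some t)) (\<lambda>s. f (0, Some s))"
    and c: "\<And>j. j < g \<Longrightarrow> prim (top_of_set annulus) (\<lambda>s t. d (Suc j, Some s) (Suc j, Some t)) (\<lambda>s. f (Suc j, Some s))"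
  shows "prim (punctured_pieces g) d f"
  unfolding prim_def
proof
  fix x assume x: "x \<in> topspace (punctured_pieces g)"
  then have "x \<in> {0} \<times> Some ` holed_plane g \<or> x \<in> (Suc ` {..<g}) \<times> Some ` annulus"
    by (auto simp: punctured_pieces_def topspace_handle_pieces)
  then consider z where "x = (0, Some z)" "z \<in> holed_plane g" | j z where "x = (Suc j, Some z)" "j < g" "z \<in> annulus"
    by auto
  then have "\<exists>N. openin (handle_pieces g) N \<and> (0, None) \<notin> N \<and> x \<in> N \<and> (\<forall>y\<in>N. f y - f x = d x y)"
  proof cases
    case 1
    then obtain N where N: "openin (top_of_set (holed_plane g)) N" "z \<in> N" "\<forall>y\<in>N. f (0, Some y) - f (0, Some z) = d (0, Some z) (0, Some y)"
      using p unfolding prim_def by auto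
    show ?thesis by (rule exI[of _ "{0} \<times> Some ` N"]) (use N 1 openin_handle_pieces_plane[OF N(1)] in auto)
  next
    case 2
    then obtain N where N: "openin (top_of_set annulus) N" "z \<in> N" "\<forall>y\<in>N. f (Suc j, Some y) - f (Suc j, Some z) = d (Suc j, Some z) (Suc j, Some y)"
      using c[OF 2(2)] unfolding prim_def by auto
    show ?thesis by (rule exI[of _ "{Suc j} \<times> Some ` N"]) (use N 2 openin_handle_pieces_cylinder[OF 2(2) N(1)] in auto)
  qed
  then obtain N where N: "openin (handle_pieces g) N" "(0, None) \<notin> N" "x \<in> N" "\<forall>y\<in>N. f y - f x = d x y" by blast
  then have "openin (punctured_pieces g) N"
    unfolding punctured_pieces_def using openin_subset[OF N(1)] openin_punctured_pieces by (subst openin_open_subtopology) auto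
  then show "\<exists>N. openin (punctured_pieces g) N \<and> x \<in> N \<and> (\<forall>y\<in>N. f y - f x = d x y)" using N by blast
qed

text \<open>Continuity at infinity comes from F being constant outside a bounded set.\<close>

lemma continuous_map_pieces:
  assumes h: "continuous_on (holed_plane g) (\<lambda>z. F (0, Some z))" "F (0, None) = c"
      "\<And>z. z \<in> holed_plane g \<Longrightarrow> B \<le> cmod z \<Longrightarrow> F (0, Some z) = c"
    and k: "\<And>j. j < g \<Longrightarrow> continuous_on annulus (\<lambda>z. F (Suc j, Some z))"
  shows "continuous_map (handle_pieces g) euclidean (F :: _ \<Rightarrow> complex)"
  unfolding continuous_map_def
proof (intro conjI allI impI)
  fix U :: "complex set" assume "openin euclidean U"
  then have U: "open U" by simp
  have cyl: "openin (handle_pieces g) ({Suc j} \<times> Some ` {z \<in> annulus. F (Suc j, Some z) \<in> U})" if "j < g" for j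
  proof (rule openin_handle_pieces_cylinder[OF that])
    have "annulus \<inter> (\<lambda>z. F (Suc j, Some z)) -` U = {z \<in> annulus. F (Suc j, Some z) \<in> U}" by blast
    then show "openin (top_of_set annulus) {z \<in> annulus. F (Suc j, Some z) \<in> U}"
      using continuous_openin_preimage_gen[OF k[OF that] U] by simp
  qed
  have "openin (handle_pieces g) ({0} \<times> {x \<in> handle_piece g 0. F (0, x) \<in> U})"
  proof (cases "c \<in> U")
    case False
    then have "{x \<in> handle_piece g 0. F (0, x) \<in> U} = Some ` {z \<in> holed_plane g. F (0, Some z) \<in> U}"
      using h(2) by (auto simp: handle_piece_0)
    moreover have "holed_plane g \<inter> (\<lambda>z. F (0, Some z)) -` U = {z \<in> holed_plane g. F (0, Some z) \<in> U}" by blast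
    then have "openin (top_of_set (holed_plane g)) {z \<in> holed_plane g. F (0, Some z) \<in> U}"
      using continuous_openin_preimage_gen[OF h(1) U] by simp
    ultimately show ?thesis using openin_handle_pieces_plane by simp
  next
    case True
    \<comment> \<open>The points where the value leaves U lie within radius B, so they form a
      compact set, and a neighbourhood of infinity may omit a compact set.\<close>
    define K where "K = {z \<in> holed_plane g. F (0, Some z) \<notin> U}"
    have clh: "closed (holed_plane g)"
    proof -
      have "holed_plane g = (\<Inter>n\<in>{..<2*g}. {z. 1 \<le> cmod (z - hole_centre n)})" by (auto simp: holed_plane_def)
      then show ?thesis by (auto intro!: closed_INT closed_Collect_le continuous_intros)
    qed
    have "closedin (top_of_set (holed_plane g)) (holed_plane g \<inter> (\<lambda>z. F (0, Some z)) -` (- U))"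
      by (rule continuous_closedin_preimage[OF h(1)]) (use U in auto)
    moreover have "holed_plane g \<inter> (\<lambda>z. F (0, Some z)) -` (- U) = K" by (auto simp: K_def)
    ultimately have "closed K" using clh closedin_closed_trans by metis
    moreover have "bounded K"
    proof (rule boundedI)
      fix z assume "z \<in> K"
      then show "norm z \<le> B" using h(3)[of z] True by (fastforce simp: K_def)
    qed
    ultimately have "compact K" by (simp add: compact_eq_bounded_closed)
    then have "openin (Alexandroff_compactification euclidean) (insert None (Some ` (- K)))"
      unfolding openin_Alexandroff_compactification by (intro disjI2 exI[of _ K]) (auto simp: compact_imp_closed Compl_eq_Diff_UNIV)
    moreover have "{x \<in> handle_piece g 0. F (0, x) \<in> U} = insert None (Some ` (- K)) \<inter> handle_piece g 0"
      unfolding handle_piece_0 using h(2) True by (auto simp: K_def)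
    ultimately have "openin (subtopology (Alexandroff_compactification euclidean) (handle_piece g 0)) {x \<in> handle_piece g 0. F (0, x) \<in> U}"
      unfolding openin_subtopology by (intro exI[of _ "insert None (Some ` (- K))"] conjI)
    then have "openin (handle_pieces g) ((\<lambda>x. (0::nat, x)) ` {x \<in> handle_piece g 0. F (0, x) \<in> U})"
      unfolding handle_pieces_def by (rule open_map_component_injection[unfolded open_map_def, rule_format, rotated]) simp
    moreover have "(\<lambda>x. (0::nat, x)) ` {x \<in> handle_piece g 0. F (0, x) \<in> U} = {0} \<times> {x \<in> handle_piece g 0. F (0, x) \<in> U}" by auto
    ultimately show ?thesis by (simp only:)
  qed
  then have "openin (handle_pieces g) (({0} \<times> {x \<in> handle_piece g 0. F (0, x) \<in> U}) \<union>
      (\<Union>j<g. {Suc j} \<times> Some ` {z \<in> annulus. F (Suc j, Some z) \<in> U}))"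
    by (intro openin_Un openin_Union) (auto intro: cyl)
  moreover have "(({0} \<times> {x \<in> handle_piece g 0. F (0, x) \<in> U}) \<union>
      (\<Union>j<g. {Suc j} \<times> Some ` {z \<in> annulus. F (Suc j, Some z) \<in> U})) = {x \<in> topspace (handle_pieces g). F x \<in> U}"
    unfolding topspace_handle_pieces handle_piece_0 by blast
  ultimately show "openin (handle_pieces g) {x \<in> topspace (handle_pieces g). F x \<in> U}" by simp
qed auto

text \<open>\<open>circ_piece j\<close> winds around the \<open>j\<close>-th cylinder, and \<open>hand_piece j\<close> along it.\<close>

definition circ_piece :: "nat \<Rightarrow> nat \<times> complex option \<Rightarrow> complex" where
  "circ_piece j s = (case s of (i, None) \<Rightarrow> 1 | (i, Some z) \<Rightarrow>
     if i = 0 then circ_plane j z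
     else if i = Suc j then circ_plane j (hole_centre (2 * j) + sgn z * cis (pi * (cmod z - 1)))
     else 1)"

definition hand_piece :: "nat \<Rightarrow> nat \<times> complex option \<Rightarrow> complex" where
  "hand_piece j s = (case s of (i, None) \<Rightarrow> 1 | (i, Some z) \<Rightarrow> if i = Suc j then cis (2 * pi * (cmod z - 1)) else 1)"

lemma circ_piece_glue: "handle_glue g s t \<Longrightarrow> circ_piece j s = circ_piece j t"
proof (induction rule: handle_glue.induct)
  case (inner_end i z)
  then show ?case using circ_plane_other(1)[of z i j] by (auto simp: circ_piece_def sgn_div_norm)
next
  case (outer_end i z)
  \<comment> \<open>At radius 2 the twist cis (\<pi> (|z| - 1)) has reached a half turn.\<close>
  have "sgn (2 * z) * cis (pi * (cmod (2 * z) - 1)) = - z"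
    using outer_end(2) by (simp add: sgn_div_norm norm_mult scaleR_conv_of_real)
  then show ?case using outer_end circ_plane_other(2)[of "cnj z" i j] circ_plane_ends[of z j]
    by (auto simp: circ_piece_def)
qed

lemma hand_piece_glue: "handle_glue g s t \<Longrightarrow> hand_piece j s = hand_piece j t"
  by (induction rule: handle_glue.induct) (auto simp: hand_piece_def norm_mult)

definition basis_map :: "nat \<Rightarrow> nat \<times> bool \<Rightarrow> (nat \<times> complex option) set \<Rightarrow> complex" where
  "basis_map g i = descend (if snd i then circ_piece (fst i) else hand_piece (fst i))"

lemma basis_map_class:
  "basis_map g (j, True) (point_class g s) = circ_piece j s"
  "basis_map g (j, False) (point_class g s) = hand_piece j s"
  using descend_point_class[of g "circ_piece j"] descend_point_class[of g "hand_piece j"] circ_piece_glue hand_piece_glue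
  by (auto simp: basis_map_def)

lemma continuous_circ_piece:
  assumes "j < g" shows "continuous_map (handle_pieces g) euclidean (circ_piece j)"
proof (rule continuous_map_pieces[where c = 1 and B = "6 * real j + 10"])
  show "continuous_on (holed_plane g) (\<lambda>z. circ_piece j (0, Some z))"
    using continuous_circ_plane[OF assms] by (simp add: circ_piece_def)
  fix i assume "i < g"
  show "continuous_on annulus (\<lambda>z. circ_piece j (Suc i, Some z))"
  proof (cases "i = j")
    case True
    have nz: "z \<noteq> 0" if "z \<in> annulus" for z using that by (auto simp: annulus_def)
    have "continuous_on annulus (\<lambda>z. circ_plane j (hole_centre (2 * j) + sgn z * cis (pi * (cmod z - 1))))"
    proof (rule continuous_on_compose2[OF continuous_circ_plane[OF assms]])
      show "continuous_on annulus (\<lambda>z. hole_centre (2 * j) + sgn z * cis (pi * (cmod z - 1)))"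
        unfolding cis_conv_exp by (intro continuous_intros) (use nz in auto)
      show "(\<lambda>z. hole_centre (2 * j) + sgn z * cis (pi * (cmod z - 1))) ` annulus \<subseteq> holed_plane g"
        using nz by (auto intro!: circle_in_holed_plane simp: norm_mult norm_sgn)
    qed
    then show ?thesis using True by (simp add: circ_piece_def)
  qed (simp add: circ_piece_def)
qed (auto simp: circ_piece_def circ_plane_far)

lemma continuous_hand_piece: "continuous_map (handle_pieces g) euclidean (hand_piece j)"
proof (rule continuous_map_pieces[where c = 1 and B = 0])
  fix i assume "i < g"
  show "continuous_on annulus (\<lambda>z. hand_piece j (Suc i, Some z))"
  proof (cases "i = j")
    case True
    have "continuous_on annulus (\<lambda>z. cis (2 * pi * (cmod z - 1)))"
      unfolding cis_conv_exp by (intro continuous_intros)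
    then show ?thesis using True by (simp add: hand_piece_def)
  qed (simp add: hand_piece_def)
qed (auto simp: hand_piece_def)

lemma continuous_basis_map:
  assumes "fst i < g" shows "continuous_map (sphere_with_handles g) euclidean (basis_map g i)"
proof (rule continuous_compose_quotient_map[OF quotient_point_class])
  obtain j b where i: "i = (j, b)" by (cases i)
  have "basis_map g i \<circ> point_class g = (if b then circ_piece j else hand_piece j)"
    using basis_map_class[of g j] by (auto simp: i fun_eq_iff)
  then show "continuous_map (handle_pieces g) euclidean (basis_map g i \<circ> point_class g)"
    using continuous_circ_piece continuous_hand_piece assms i by auto
qed

lemma norm_basis_map:
  assumes "c \<in> topspace (sphere_with_handles g)" shows "cmod (basis_map g i c) = 1"
proof -
  obtain s where s: "c = point_class g s" using assms quotient_point_class[of g] unfolding quotient_map_def by blast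
  obtain j b where i: "i = (j, b)" by (cases i)
  have "cmod (circ_piece j s) = 1" "cmod (hand_piece j s) = 1"
    by (auto simp: circ_piece_def hand_piece_def split: prod.split option.split)
  then show ?thesis using basis_map_class[of g j s] by (cases b) (auto simp: i s)
qed

lemma sum_pairs: "(\<Sum>i\<in>{..<g::nat} \<times> (UNIV :: bool set). G i) = (\<Sum>j<g. G (j, True)) + (\<Sum>j<g. G (j, False) :: real)"
proof -
  have "(\<Sum>i\<in>{..<g} \<times> (UNIV :: bool set). G i) = (\<Sum>j<g. \<Sum>b\<in>UNIV. G (j, b))"
    by (simp add: sum.cartesian_product)
  then show ?thesis by (simp add: UNIV_bool sum.distrib)
qed

lemma hole_centre_shift:
  "hole_centre n + 1 = of_real (3 * real n + 1)" "hole_centre n - 1 = of_real (3 * real n - 1)"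
  by (simp_all add: hole_centre_of_real)

lemma glue_class:
  assumes "j < g" "cmod w = 1"
  shows "point_class g (Suc j, Some w) = point_class g (0, Some (hole_centre (2 * j) + w))"
    and "point_class g (Suc j, Some (2 * w)) = point_class g (0, Some (hole_centre (2 * j + 1) + cnj w))"
  by (rule point_class_eqI, rule handle_glue.inner_end, fact+)
    (rule point_class_eqI, rule handle_glue.outer_end, fact+)

lemma dlog_comp: "dlog F (q s) (q t) = dlog (\<lambda>x. F (q x)) s t"
  by (simp add: dlog_def)

lemma subset_halves: "upper S \<subseteq> S" "lower S \<subseteq> S"
  by (auto simp: upper_def lower_def)

lemma prim_circ_upper:
  "prim (top_of_set (upper (holed_plane g)))
     (\<lambda>s t. dlog (basis_map g (j, True)) (point_class g (0, Some s)) (point_class g (0, Some t))) (bump_lift j)"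
  unfolding dlog_comp
  by (rule prim_dlog)
    (auto simp: continuous_bump_lift basis_map_class circ_piece_def circ_plane_def upper_def)

lemma prim_circ_lower:
  assumes "j < g"
  shows "prim (top_of_set (lower (holed_plane g)))
     (\<lambda>s t. dlog (basis_map g (j, True)) (point_class g (0, Some s)) (point_class g (0, Some t))) (\<lambda>z. 0)"
  unfolding dlog_comp
proof (rule prim_dlog)
  fix z assume "z \<in> topspace (top_of_set (lower (holed_plane g)))"
  then have z: "z \<in> holed_plane g" "Im z \<le> 0" by (auto simp: lower_def)
  have "circ_plane j z = 1"
    using z circ_plane_real[OF assms z(1)] by (cases "Im z = 0") (auto simp: circ_plane_def)
  then show "basis_map g (j, True) (point_class g (0, Some z)) = cis 0"
    by (simp add: basis_map_class circ_piece_def)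
qed auto

lemma prim_hand_plane:
  "prim (top_of_set (holed_plane g))
     (\<lambda>s t. dlog (basis_map g (j, False)) (point_class g (0, Some s)) (point_class g (0, Some t))) (\<lambda>z. 0)"
  unfolding dlog_comp by (rule prim_dlog) (auto simp: basis_map_class hand_piece_def)

lemma prim_hand_cylinder:
  "prim (top_of_set annulus)
     (\<lambda>s t. dlog (basis_map g (j, False)) (point_class g (Suc i, Some s)) (point_class g (Suc i, Some t)))
     (\<lambda>z. if i = j then 2 * pi * (cmod z - 1) else 0)"
  unfolding dlog_comp
  by (rule prim_dlog) (auto simp: basis_map_class hand_piece_def intro!: continuous_intros)

lemma cocycle_basis_map:
  assumes "fst i < g" shows "cocycle (punctured g) (dlog (basis_map g i))"
  unfolding punctured_def
  by (rule cocycle_subtopology, rule cocycle_dlog)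
    (use continuous_basis_map[OF assms] norm_basis_map in auto)

lemma bump_lift_ends:
  "bump_lift i (hole_centre (2 * j) + 1) = (if i = j then 2 * pi else 0)" "bump_lift i (hole_centre (2 * j) - 1) = 0"
  using bump_values[of j] bump_other[of j i "6 * real j + 1"] bump_other[of j i "6 * real j - 1"]
  by (auto simp: bump_lift_def hole_centre_of_real)

lemma prim_top_of_set_subset: "prim (top_of_set S) d f \<Longrightarrow> T \<subseteq> S \<Longrightarrow> prim (top_of_set T) d f"
  using prim_subset[of euclidean S d f T] by simp

lemma cocycle_top_of_set_subset: "cocycle (top_of_set S) d \<Longrightarrow> T \<subseteq> S \<Longrightarrow> cocycle (top_of_set T) d"
  using cocycle_subtopology[of "top_of_set S" d T] by (simp add: subtopology_subtopology Int_absorb1)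

section \<open>The first cohomology of the punctured surface\<close>

text \<open>A multiple of the j-th map around the cylinder removes the jump across the hole 2 j, and
  the cylinder forces the jump across 2 j + 1 to vanish as well. The cocycle is then exact on the
  plane and on each cylinder, and the mismatch left between the two ends of a cylinder is removed by
  the map along it.\<close>

proposition punctured_span:
  assumes d: "cocycle (punctured g) d"
  shows "\<exists>a f. prim (punctured g) (\<lambda>x y. d x y - (\<Sum>i\<in>{..<g} \<times> UNIV. a i * dlog (basis_map g i) x y)) f"
proof -
  let ?P = "\<lambda>z. point_class g (0, Some z)"
  let ?C = "\<lambda>j z. point_class g (Suc j, Some z)"
  have d0: "cocycle (top_of_set (holed_plane g)) (\<lambda>s t. d (?P s) (?P t))"
    by (rule cocycle_pullback[OF d continuous_plane_class])
  obtain ap where ap: "prim (top_of_set (upper (holed_plane g))) (\<lambda>s t. d (?P s) (?P t)) ap"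
    using exact_upper_holed_plane[OF cocycle_top_of_set_subset[OF d0 subset_halves(1)]] by blast
  obtain am where am: "prim (top_of_set (lower (holed_plane g))) (\<lambda>s t. d (?P s) (?P t)) am"
    using exact_lower_holed_plane[OF cocycle_top_of_set_subset[OF d0 subset_halves(2)]] by blast
  \<comment> \<open>The jump of the primitives across the hole 2 j, measured in units of 2 \<pi>,
    which is the jump of \<open>bump_lift j\<close>.\<close>
  define r where "r = (\<lambda>j. ((ap (hole_centre (2 * j) + 1) - am (hole_centre (2 * j) + 1))
      - (ap (hole_centre (2 * j) - 1) - am (hole_centre (2 * j) - 1))) / (2 * pi))"
  define d1 where "d1 = (\<lambda>x y. d x y - (\<Sum>j<g. r j * dlog (basis_map g (j, True)) x y))"
  have d1: "cocycle (punctured g) d1"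
    unfolding d1_def by (intro cocycle_diff d cocycle_sum cocycle_cmul cocycle_basis_map) auto
  define f1 where "f1 = (\<lambda>z. ap z - (\<Sum>j<g. r j * bump_lift j z))"
  have f1: "prim (top_of_set (upper (holed_plane g))) (\<lambda>s t. d1 (?P s) (?P t)) f1"
    unfolding d1_def f1_def by (intro prim_diff ap prim_sum prim_cmul prim_circ_upper) auto
  have "prim (top_of_set (lower (holed_plane g))) (\<lambda>s t. d1 (?P s) (?P t)) (\<lambda>z. am z - (\<Sum>j<g. r j * 0))"
    unfolding d1_def by (intro prim_diff am prim_sum prim_cmul prim_circ_lower) auto
  then have am1: "prim (top_of_set (lower (holed_plane g))) (\<lambda>s t. d1 (?P s) (?P t)) am" by simp
  have even: "f1 (hole_centre (2 * j) + 1) - am (hole_centre (2 * j) + 1)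
      = f1 (hole_centre (2 * j) - 1) - am (hole_centre (2 * j) - 1)" if "j < g" for j
  proof -
    have "(\<Sum>i<g. r i * bump_lift i (hole_centre (2 * j) + 1)) = (\<Sum>i<g. if i = j then r j * (2 * pi) else 0)"
      by (rule sum.cong) (auto simp: bump_lift_ends)
    also have "\<dots> = r j * (2 * pi)" using that by simp
    finally show ?thesis unfolding f1_def by (simp add: bump_lift_ends) (simp add: r_def)
  qed
  have dj: "cocycle (top_of_set annulus) (\<lambda>s t. d1 (?C j s) (?C j t))" if "j < g" for j
    by (rule cocycle_pullback[OF d1 continuous_cylinder_class[OF that]])
  have Imhc: "Im (hole_centre n) = 0" for n by (simp add: hole_centre_of_real)
  \<comment> \<open>By \<open>annulus_jump\<close> the jumps at the two ends of a cylinder are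
    opposite, so one vanishes with the other.\<close>
  have odd: "f1 (hole_centre (2 * j + 1) + 1) - am (hole_centre (2 * j + 1) + 1)
      = f1 (hole_centre (2 * j + 1) - 1) - am (hole_centre (2 * j + 1) - 1)"
    and cyl: "\<exists>b. prim (top_of_set annulus) (\<lambda>s t. d1 (?C j s) (?C j t)) b" if j: "j < g" for j
  proof -
    show "\<exists>b. prim (top_of_set annulus) (\<lambda>s t. d1 (?C j s) (?C j t)) b"
      by (rule annulus_jump(2)[OF dj[OF j] f1 am1 _ _ Imhc Imhc[of "2 * j + 1"] _ _ even[OF j]])
        (simp_all only: circle_in_holed_plane glue_class[OF j])
    have "f1 (hole_centre (2 * j) + 1) - am (hole_centre (2 * j) + 1) - (f1 (hole_centre (2 * j) - 1) - am (hole_centre (2 * j) - 1)) =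
      - (f1 (hole_centre (2 * j + 1) + 1) - am (hole_centre (2 * j + 1) + 1)
        - (f1 (hole_centre (2 * j + 1) - 1) - am (hole_centre (2 * j + 1) - 1)))"
      by (rule annulus_jump(1)[OF dj[OF j] f1 am1 _ _ Imhc Imhc])
        (simp_all only: circle_in_holed_plane glue_class[OF j])
    then show "f1 (hole_centre (2 * j + 1) + 1) - am (hole_centre (2 * j + 1) + 1)
      = f1 (hole_centre (2 * j + 1) - 1) - am (hole_centre (2 * j + 1) - 1)"
      using even[OF j] by simp
  qed
  have "\<exists>c. prim (top_of_set (holed_plane g)) (\<lambda>s t. d1 (?P s) (?P t)) (\<lambda>z. if 0 \<le> Im z then f1 z else am z + c)"
  proof (rule exact_holed_plane[OF f1 am1])
    fix n assume n: "n < 2 * g"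
    obtain j where "n = 2 * j \<or> n = 2 * j + 1" by (metis oddE evenE)
    then show "f1 (of_real (3 * real n + 1)) - am (of_real (3 * real n + 1))
        = f1 (of_real (3 * real n - 1)) - am (of_real (3 * real n - 1))"
      using even[of j] odd[of j] n unfolding hole_centre_shift by auto
  qed
  then obtain A where A: "prim (top_of_set (holed_plane g)) (\<lambda>s t. d1 (?P s) (?P t)) A" by blast
  obtain b where b: "\<And>j. j < g \<Longrightarrow> prim (top_of_set annulus) (\<lambda>s t. d1 (?C j s) (?C j t)) (b j)"
    using cyl by metis
  have con: "connected (sphere (0::complex) 1)" by (rule connected_sphere) simp
  have inner: "b j w - A (hole_centre (2 * j) + w) = b j 1 - A (hole_centre (2 * j) + 1)" if j: "j < g" and w: "cmod w = 1" for j w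
    by (rule prim_transfer[OF con b[OF j] A, where p = "\<lambda>w. w" and p' = "\<lambda>w. hole_centre (2 * j) + w"])
      (use w glue_class[OF j] circle_in_holed_plane in \<open>auto simp: continuous_map_in_subtopology annulus_def intro!: continuous_intros\<close>)
  have outer: "b j (2 * w) - A (hole_centre (2 * j + 1) + cnj w) = b j (2 * 1) - A (hole_centre (2 * j + 1) + cnj 1)"
    if j: "j < g" and w: "cmod w = 1" for j w
    by (rule prim_transfer[OF con b[OF j] A, where p = "\<lambda>w. 2 * w" and p' = "\<lambda>w. hole_centre (2 * j + 1) + cnj w"])
      (use w glue_class[OF j] circle_in_holed_plane in \<open>auto simp: continuous_map_in_subtopology annulus_def norm_mult intro!: continuous_intros continuous_on_cnj\<close>)
  \<comment> \<open>\<open>s j\<close> aligns the cylinder with the plane at the inner end;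
    \<open>h j\<close> below is the gap then left at the outer end.\<close>
  define s where "s = (\<lambda>j. b j 1 - A (hole_centre (2 * j) + 1))"
  define h where "h = (\<lambda>j. b j 2 - A (hole_centre (2 * j + 1) + 1) - s j)"
  define d2 where "d2 = (\<lambda>x y. d1 x y - (\<Sum>j<g. (h j / (2 * pi)) * dlog (basis_map g (j, False)) x y))"
  have d2: "cocycle (punctured g) d2"
    unfolding d2_def by (intro cocycle_diff d1 cocycle_sum cocycle_cmul cocycle_basis_map) auto
  \<comment> \<open>The term with |z| - 1 is 0 at the inner end and \<open>h j\<close> at the outer
    one, so it closes the gap and keeps the inner end aligned.\<close>
  define k where "k = (\<lambda>x. case x of (i, None) \<Rightarrow> 0 | (0, Some z) \<Rightarrow> A z | (Suc j, Some z) \<Rightarrow> b j z - s j - h j * (cmod z - 1))"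
  have "prim (top_of_set (holed_plane g)) (\<lambda>s t. d2 (?P s) (?P t)) (\<lambda>z. A z - (\<Sum>j<g. (h j / (2 * pi)) * 0))"
    unfolding d2_def by (intro prim_diff A prim_sum prim_cmul prim_hand_plane) auto
  then have k0: "prim (top_of_set (holed_plane g)) (\<lambda>s t. d2 (?P s) (?P t)) (\<lambda>z. k (0, Some z))" by (simp add: k_def)
  have kj: "prim (top_of_set annulus) (\<lambda>s t. d2 (?C i s) (?C i t)) (\<lambda>z. k (Suc i, Some z))" if i: "i < g" for i
  proof -
    have "prim (top_of_set annulus) (\<lambda>s t. d2 (?C i s) (?C i t))
        (\<lambda>z. b i z - (\<Sum>j<g. (h j / (2 * pi)) * (if i = j then 2 * pi * (cmod z - 1) else 0)))"
      unfolding d2_def by (intro prim_diff b[OF i] prim_sum prim_cmul prim_hand_cylinder) auto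
    moreover have "(\<Sum>j<g. (h j / (2 * pi)) * (if i = j then 2 * pi * (cmod z - 1) else 0)) = h i * (cmod z - 1)" for z
    proof -
      have "(\<Sum>j<g. (h j / (2 * pi)) * (if i = j then 2 * pi * (cmod z - 1) else 0)) = (\<Sum>j<g. if i = j then h i * (cmod z - 1) else 0)"
        by (rule sum.cong) auto
      then show ?thesis using i by simp
    qed
    ultimately have "prim (top_of_set annulus) (\<lambda>s t. d2 (?C i s) (?C i t)) (\<lambda>z. b i z - h i * (cmod z - 1))" by simp
    from prim_shift[OF this, of "- s i"] show ?thesis by (simp add: k_def algebra_simps)
  qed
  have kg: "k x = k y" if "handle_glue g x y" for x y
    using that
  proof cases
    case (inner_end j z)
    then show ?thesis using inner[of j z] by (simp add: k_def s_def)
  next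
    case (outer_end j z)
    then show ?thesis using outer[of j z] by (simp add: k_def h_def norm_mult)
  qed
  have "prim (punctured_pieces g) (\<lambda>x y. d2 (point_class g x) (point_class g y)) k"
    by (rule prim_punctured_pieces[OF k0 kj])
  then have "prim (punctured_pieces g) (\<lambda>x y. d2 (point_class g x) (point_class g y)) (\<lambda>x. descend k (point_class g x))"
    by (rule prim_cong) (simp_all add: descend_point_class[of g k, OF kg])
  from prim_quotient[OF quotient_punctured d2 this]
  have fin: "prim (punctured g) d2 (descend k)" .
  define a where "a = (\<lambda>(j, b). if b then r j else h j / (2 * pi))"
  have "d2 = (\<lambda>x y. d x y - (\<Sum>i\<in>{..<g} \<times> UNIV. a i * dlog (basis_map g i) x y))"
    by (simp add: fun_eq_iff d2_def d1_def sum_pairs a_def)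
  then show ?thesis using fin by (intro exI[of _ a] exI[of _ "descend k"]) simp
qed

text \<open>On the lower half of the holed plane all basis maps are constant, hence so is f. Passing
  above the hole 2 j isolates the coefficient of (j, True), and then crossing the j-th cylinder
  isolates that of (j, False), since both paths end at real points.\<close>

proposition punctured_independent:
  assumes f: "prim (punctured g) (\<lambda>x y. \<Sum>i\<in>{..<g} \<times> UNIV. a i * dlog (basis_map g i) x y) f"
    and i: "i \<in> {..<g} \<times> UNIV"
  shows "a i = 0"
proof -
  let ?P = "\<lambda>z. point_class g (0, Some z)"
  let ?C = "\<lambda>j z. point_class g (Suc j, Some z)"
  let ?d = "\<lambda>x y. (\<Sum>j<g. a (j, True) * dlog (basis_map g (j, True)) x y) + (\<Sum>j<g. a (j, False) * dlog (basis_map g (j, False)) x y)"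
  have f': "prim (punctured g) ?d f" using f by (simp add: sum_pairs)
  have F0: "prim (top_of_set (holed_plane g)) (\<lambda>s t. ?d (?P s) (?P t)) (\<lambda>z. f (?P z))"
    by (rule prim_pullback[OF f' continuous_plane_class])
  have up: "prim (top_of_set (upper (holed_plane g))) (\<lambda>s t. ?d (?P s) (?P t))
      (\<lambda>z. (\<Sum>j<g. a (j, True) * bump_lift j z) + (\<Sum>j<g. a (j, False) * 0))"
    by (intro prim_add prim_sum prim_cmul prim_circ_upper prim_top_of_set_subset[OF prim_hand_plane subset_halves(1)]) auto
  have lo: "prim (top_of_set (lower (holed_plane g))) (\<lambda>s t. ?d (?P s) (?P t))
      (\<lambda>z. (\<Sum>j<g. a (j, True) * 0) + (\<Sum>j<g. a (j, False) * 0))"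
    by (intro prim_add prim_sum prim_cmul prim_circ_lower prim_top_of_set_subset[OF prim_hand_plane subset_halves(2)]) auto
  have sp: "connected_space (top_of_set (upper (holed_plane g)))" "connected_space (top_of_set (lower (holed_plane g)))"
    using connected_upper_holed_plane connected_lower_holed_plane connectedin_iff_connected unfolding connectedin_def by blast+
  have fl: "f (?P x) = f (?P y)" if "x \<in> lower (holed_plane g)" "y \<in> lower (holed_plane g)" for x y
    using prim_unique[OF sp(2) prim_top_of_set_subset[OF F0 subset_halves(2)] lo, of x y] that by simp
  have pt: "hole_centre n + w \<in> upper (holed_plane g)" "hole_centre n + w \<in> lower (holed_plane g)" if "w = 1 \<or> w = -1" for n w
    using that circle_in_holed_plane[of w n g] by (auto simp: upper_def lower_def hole_centre_of_real)
  have T: "a (j, True) = 0" if j: "j < g" for j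
  proof -
    let ?x = "hole_centre (2 * j) + 1" and ?y = "hole_centre (2 * j) - 1"
    have in': "?x \<in> upper (holed_plane g)" "?y \<in> upper (holed_plane g)" "?x \<in> lower (holed_plane g)" "?y \<in> lower (holed_plane g)"
      using pt[of 1 "2 * j"] pt[of "-1" "2 * j"] by auto
    have "f (?P ?x) - (\<Sum>i<g. a (i, True) * bump_lift i ?x) = f (?P ?y) - (\<Sum>i<g. a (i, True) * bump_lift i ?y)"
      using prim_unique[OF sp(1) prim_top_of_set_subset[OF F0 subset_halves(1)] up, of ?y ?x] in' by simp
    moreover have "(\<Sum>i<g. a (i, True) * bump_lift i ?x) = (\<Sum>i<g. if i = j then a (j, True) * (2 * pi) else 0)"
      by (rule sum.cong) (auto simp: bump_lift_ends)
    ultimately show ?thesis using fl[OF in'(3,4)] j by (simp add: bump_lift_ends)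
  qed
  have H: "a (j, False) = 0" if j: "j < g" for j
  proof -
    have F1: "prim (top_of_set annulus) (\<lambda>s t. ?d (?C j s) (?C j t)) (\<lambda>z. f (?C j z))"
      by (rule prim_pullback[OF f' continuous_cylinder_class[OF j]])
    have "prim (top_of_set annulus) (\<lambda>s t. \<Sum>i<g. a (i, False) * dlog (basis_map g (i, False)) (?C j s) (?C j t))
        (\<lambda>z. \<Sum>i<g. a (i, False) * (if j = i then 2 * pi * (cmod z - 1) else 0))"
      by (intro prim_sum prim_cmul prim_hand_cylinder) auto
    then have F2: "prim (top_of_set annulus) (\<lambda>s t. ?d (?C j s) (?C j t))
        (\<lambda>z. \<Sum>i<g. a (i, False) * (if j = i then 2 * pi * (cmod z - 1) else 0))"
      by (simp add: T)
    have eq: "(\<Sum>i<g. a (i, False) * (if j = i then 2 * pi * (cmod z - 1) else 0)) = a (j, False) * (2 * pi * (cmod z - 1))" for z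
    proof -
      have "(\<Sum>i<g. a (i, False) * (if j = i then 2 * pi * (cmod z - 1) else 0)) = (\<Sum>i<g. if j = i then a (j, False) * (2 * pi * (cmod z - 1)) else 0)"
        by (rule sum.cong) auto
      then show ?thesis using j by simp
    qed
    have ca: "connected_space (top_of_set annulus)"
      using connected_annulus_closed connectedin_iff_connected unfolding connectedin_def by blast
    \<comment> \<open>The path runs from 1 on the inner end to -2 on the outer end; both are glued
      to real points, which belong to the lower half, where f is constant.\<close>
    have "f (?C j (2 * -1)) - a (j, False) * (2 * pi * (cmod (2 * -1) - 1)) = f (?C j 1) - a (j, False) * (2 * pi * (cmod 1 - 1))"
      using prim_unique[OF ca F1 F2, of 1 "2 * -1"] unfolding eq by (simp add: annulus_def)
    moreover have "f (?C j 1) = f (?P (hole_centre (2 * j) + 1))" "f (?C j (2 * -1)) = f (?P (hole_centre (2 * j + 1) + -1))"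
      using glue_class(1)[OF j, of 1] glue_class(2)[OF j, of "-1"] by auto
    moreover have "f (?P (hole_centre (2 * j) + 1)) = f (?P (hole_centre (2 * j + 1) + -1))"
      by (rule fl) (use pt(2)[of 1 "2 * j"] pt(2)[of "-1" "2 * j + 1"] in simp_all)
    ultimately show ?thesis by simp
  qed
  show ?thesis using i T H by (cases i; cases "snd i") auto
qed

section \<open>Coordinate discs and primitives of forms\<close>

definition chart_inv :: "'a chart \<Rightarrow> complex \<Rightarrow> 'a" where
  "chart_inv k = the_inv_into (fst k) (snd k)"

definition chart_disc :: "'a chart \<Rightarrow> complex \<Rightarrow> real \<Rightarrow> complex \<Rightarrow> 'a" where
  "chart_disc k c r w = chart_inv k (c + of_real r * w)"

definition chart_discs :: "'a chart set \<Rightarrow> (complex \<Rightarrow> 'a) set" where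
  "chart_discs A = {chart_disc k c r |k c r. k \<in> A \<and> 0 < r \<and> cball c r \<subseteq> chart_image k}"

lemma affine_in_cball: "0 < r \<Longrightarrow> norm w \<le> 1 \<Longrightarrow> c + of_real r * w \<in> cball c r" for c w :: complex
  by (simp add: dist_norm norm_mult mult_left_le)

context riemann_surface
begin

lemma chart_facts:
  assumes "k \<in> A"
  shows "openin X (fst k)" "open (chart_image k)" "inj_on (snd k) (fst k)"
    "continuous_map (subtopology X (fst k)) (top_of_set (chart_image k)) (snd k)"
    "continuous_map (top_of_set (chart_image k)) (subtopology X (fst k)) (chart_inv k)"
    "\<And>x. x \<in> fst k \<Longrightarrow> chart_inv k (snd k x) = x"
    "\<And>z. z \<in> chart_image k \<Longrightarrow> snd k (chart_inv k z) = z"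
    "\<And>z. z \<in> chart_image k \<Longrightarrow> chart_inv k z \<in> fst k"
    "\<And>x. x \<in> fst k \<Longrightarrow> snd k x \<in> chart_image k"
proof -
  have c: "openin X (fst k)" "open (chart_image k)"
    and h: "homeomorphic_map (subtopology X (fst k)) (top_of_set (chart_image k)) (snd k)"
    using charts[OF assms] by (auto simp: is_chart_def)
  show "openin X (fst k)" "open (chart_image k)" by fact+
  have ts: "topspace (subtopology X (fst k)) = fst k" using openin_subset[OF c(1)] by auto
  have inj: "inj_on (snd k) (fst k)" using homeomorphic_imp_injective_map[OF h] unfolding ts .
  then show "inj_on (snd k) (fst k)" .
  show "continuous_map (subtopology X (fst k)) (top_of_set (chart_image k)) (snd k)"
    by (rule homeomorphic_imp_continuous_map[OF h])
  show i1: "chart_inv k (snd k x) = x" if "x \<in> fst k" for x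
    unfolding chart_inv_def by (rule the_inv_into_f_f[OF inj that])
  show "snd k (chart_inv k z) = z" if "z \<in> chart_image k" for z
    unfolding chart_inv_def by (rule f_the_inv_into_f[OF inj]) (use that in \<open>simp add: chart_image_def\<close>)
  show "chart_inv k z \<in> fst k" if "z \<in> chart_image k" for z
    unfolding chart_inv_def by (rule the_inv_into_into[OF inj]) (use that in \<open>simp_all add: chart_image_def\<close>)
  show "snd k x \<in> chart_image k" if "x \<in> fst k" for x using that by (simp add: chart_image_def)
  obtain h' where h': "homeomorphic_maps (subtopology X (fst k)) (top_of_set (chart_image k)) (snd k) h'"
    using h homeomorphic_map_maps by blast
  have "continuous_map (top_of_set (chart_image k)) (subtopology X (fst k)) h'"
    using h' by (simp add: homeomorphic_maps_def)
  moreover have "h' z = chart_inv k z" if zt: "z \<in> topspace (top_of_set (chart_image k))" for z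
  proof -
    obtain x where x: "x \<in> fst k" "z = snd k x" using zt by (auto simp: chart_image_def)
    have "h' (snd k x) = x" using h' x(1) unfolding homeomorphic_maps_def ts by blast
    then show ?thesis using i1[OF x(1)] x(2) by simp
  qed
  ultimately show "continuous_map (top_of_set (chart_image k)) (subtopology X (fst k)) (chart_inv k)"
    by (rule continuous_map_eq)
qed

lemma chart_disc_facts:
  assumes k: "k \<in> A" and r: "0 < r" "cball c r \<subseteq> chart_image k" and w: "norm w \<le> 1"
  shows "snd k (chart_disc k c r w) = c + of_real r * w" "chart_disc k c r w \<in> fst k"
    "c + of_real r * w \<in> chart_image k"
proof -
  show z: "c + of_real r * w \<in> chart_image k" using affine_in_cball[OF r(1) w] r(2) by blast
  show "snd k (chart_disc k c r w) = c + of_real r * w" "chart_disc k c r w \<in> fst k"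
    unfolding chart_disc_def using chart_facts(7,8)[OF k z] by auto
qed

lemma chart_disc_inj:
  assumes "k \<in> A" "0 < r" "cball c r \<subseteq> chart_image k"
  shows "inj_on (chart_disc k c r) (cball 0 1)"
proof (rule inj_onI)
  fix x y assume "x \<in> cball 0 1" "y \<in> cball 0 1" and e: "chart_disc k c r x = chart_disc k c r y"
  then have "c + of_real r * x = c + of_real r * y" using chart_disc_facts(1)[OF assms] by (metis mem_cball_0)
  then show "x = y" using assms(2) by simp
qed

lemma coord_chart_disc:
  assumes "k \<in> A" "0 < r" "cball c r \<subseteq> chart_image k" and "x \<in> chart_disc k c r ` cball 0 1"
  shows "coord (chart_disc k c r) x = (snd k x - c) / of_real r"
proof -
  obtain w where w: "norm w \<le> 1" "x = chart_disc k c r w" using assms(4) by auto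
  have "coord (chart_disc k c r) x = w"
    unfolding coord_def w(2) by (rule the_inv_into_f_f[OF chart_disc_inj[OF assms(1-3)]]) (use w in simp)
  then show ?thesis using chart_disc_facts(1)[OF assms(1-3) w(1)] w(2) assms(2) by simp
qed

lemma chart_disc_open:
  assumes k: "k \<in> A" and r: "0 < r" "cball c r \<subseteq> chart_image k" and S: "open S" "S \<subseteq> ball 0 1"
  shows "openin X (chart_disc k c r ` S)"
proof -
  define T where "T = (\<lambda>z. (z - c) / of_real r) -` S"
  have T: "open T" unfolding T_def using r by (intro open_vimage S continuous_intros) auto
  have "chart_disc k c r ` S = {x \<in> topspace (subtopology X (fst k)). snd k x \<in> T}"
  proof (intro subset_antisym subsetI)
    fix x assume "x \<in> chart_disc k c r ` S"
    then obtain w where w: "w \<in> S" "x = chart_disc k c r w" by auto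
    have "norm w \<le> 1" using w(1) S(2) by auto
    note f = chart_disc_facts[OF k r this]
    show "x \<in> {x \<in> topspace (subtopology X (fst k)). snd k x \<in> T}"
      using f w r openin_subset[OF chart_facts(1)[OF k]] by (auto simp: T_def)
  next
    fix x assume "x \<in> {x \<in> topspace (subtopology X (fst k)). snd k x \<in> T}"
    then have x: "x \<in> fst k" "(snd k x - c) / of_real r \<in> S" by (auto simp: T_def)
    have "chart_disc k c r ((snd k x - c) / of_real r) = x"
      using chart_facts(6)[OF k x(1)] r by (simp add: chart_disc_def)
    then show "x \<in> chart_disc k c r ` S" using x(2) by (metis imageI)
  qed
  moreover have "openin (subtopology X (fst k)) {x \<in> topspace (subtopology X (fst k)). snd k x \<in> T}"
    using openin_continuous_map_preimage[OF continuous_map_into_fulltopology[OF chart_facts(4)[OF k]]] T by simp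
  ultimately show ?thesis using openin_trans_full[OF _ chart_facts(1)[OF k]] by simp
qed

lemma small_chart_disc:
  assumes k: "k \<in> A" and U: "openin X U" and z: "z \<in> chart_image k" "chart_inv k z \<in> U"
  obtains r where "0 < r" "cball z r \<subseteq> chart_image k" "chart_disc k z r ` cball 0 1 \<subseteq> U"
proof -
  have "openin (top_of_set (chart_image k)) {y \<in> topspace (top_of_set (chart_image k)). chart_inv k y \<in> U}"
    by (rule openin_continuous_map_preimage[OF continuous_map_into_fulltopology[OF chart_facts(5)[OF k]] U])
  then have "open {y \<in> chart_image k. chart_inv k y \<in> U}"
    using openin_open_trans[OF _ chart_facts(2)[OF k]] by simp
  then obtain r where r: "r > 0" "cball z r \<subseteq> {y \<in> chart_image k. chart_inv k y \<in> U}"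
    using z open_contains_cball by blast
  moreover have "chart_disc k z r ` cball 0 1 \<subseteq> U"
    using affine_in_cball[OF r(1)] r(2) by (force simp: chart_disc_def)
  ultimately show ?thesis using that by blast
qed

lemma chart_disc_trans:
  assumes k: "k \<in> A" and r: "0 < r" "cball c r \<subseteq> chart_image k" and l: "l \<in> A"
    and w: "norm w \<le> 1" "chart_disc k c r w \<in> fst l"
  shows "c + of_real r * w \<in> overlap k l" "snd l (chart_disc k c r w) = transition k l (c + of_real r * w)"
proof -
  note f = chart_disc_facts[OF k r w(1)]
  show "c + of_real r * w \<in> overlap k l"
    unfolding overlap_def using f(1,2) w(2) by (metis IntI imageI)
  show "snd l (chart_disc k c r w) = transition k l (c + of_real r * w)"
    by (simp add: transition_def chart_disc_def chart_inv_def)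
qed

lemma open_overlap:
  assumes "k \<in> A" "l \<in> A" shows "open (overlap k l)"
proof -
  have "overlap k l = {y \<in> chart_image k. chart_inv k y \<in> fst l}"
  proof (intro subset_antisym subsetI)
    fix y assume "y \<in> overlap k l"
    then obtain x where "x \<in> fst k" "x \<in> fst l" "y = snd k x" by (auto simp: overlap_def)
    then show "y \<in> {y \<in> chart_image k. chart_inv k y \<in> fst l}"
      using chart_facts(6,9)[OF assms(1)] by auto
  next
    fix y assume "y \<in> {y \<in> chart_image k. chart_inv k y \<in> fst l}"
    then show "y \<in> overlap k l" unfolding overlap_def
      using chart_facts(7,8)[OF assms(1), of y] by (intro image_eqI[of _ _ "chart_inv k y"]) auto
  qed
  moreover have "openin (top_of_set (chart_image k)) {y \<in> topspace (top_of_set (chart_image k)). chart_inv k y \<in> fst l}"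
    by (rule openin_continuous_map_preimage[OF continuous_map_into_fulltopology[OF chart_facts(5)[OF assms(1)]] chart_facts(1)[OF assms(2)]])
  ultimately show ?thesis using openin_open_trans[OF _ chart_facts(2)[OF assms(1)]] by simp
qed

lemma disc_surface_chart_discs:
  assumes "compact_space X" "connected_space X"
  shows "disc_surface X (chart_discs A)"
proof
  show "compact_space X" "connected_space X" "Hausdorff_space X" by (fact assms Hausdorff)+
  fix e assume "e \<in> chart_discs A"
  then obtain k c r where e: "e = chart_disc k c r" "k \<in> A" "0 < r" "cball c r \<subseteq> chart_image k"
    by (auto simp: chart_discs_def)
  show "continuous_map (top_of_set (cball 0 1)) X e"
  proof -
    have "continuous_map (top_of_set (cball 0 1)) (top_of_set (chart_image k)) (\<lambda>w. c + of_real r * w)"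
      using chart_disc_facts(3)[OF e(2-4)] by (auto simp: continuous_map_in_subtopology intro!: continuous_intros)
    from continuous_map_compose[OF this continuous_map_into_fulltopology[OF chart_facts(5)[OF e(2)]]]
    show ?thesis by (simp add: o_def e(1) chart_disc_def[abs_def])
  qed
  show "inj_on e (cball 0 1)" unfolding e(1) by (rule chart_disc_inj[OF e(2-4)])
  show "openin X (e ` S)" if "open S" "S \<subseteq> ball 0 1" for S
    unfolding e(1) by (rule chart_disc_open[OF e(2-4) that])
  show "(\<lambda>w. e (c' + of_real s * w)) \<in> chart_discs A" if s: "0 < s" "cball c' s \<subseteq> cball 0 1" for s c'
  proof -
    have "(\<lambda>w. e (c' + of_real s * w)) = chart_disc k (c + of_real r * c') (r * s)"
      by (simp add: e(1) chart_disc_def fun_eq_iff algebra_simps)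
    moreover have "cball (c + of_real r * c') (r * s) \<subseteq> chart_image k"
    proof
      fix z assume z: "z \<in> cball (c + of_real r * c') (r * s)"
      define w where "w = (z - (c + of_real r * c')) / of_real (r * s)"
      have "norm w \<le> 1" using z s e(3)
        by (simp add: w_def norm_divide dist_norm norm_minus_commute norm_mult)
      then have "c' + of_real s * w \<in> cball 0 1" using affine_in_cball[OF s(1)] s(2) by blast
      then have "c + of_real r * (c' + of_real s * w) \<in> chart_image k" using chart_disc_facts(3)[OF e(2-4)] by simp
      moreover have "c + of_real r * (c' + of_real s * w) = z"
        using s e(3) by (simp add: w_def field_simps)
      ultimately show "z \<in> chart_image k" by simp
    qed
    moreover have "0 < r * s" using e(3) s(1) by simp
    ultimately show ?thesis unfolding chart_discs_def mem_Collect_eq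
      using e(2) by blast
  qed
  show "(\<lambda>w. coord e (e' w)) holomorphic_on ball 0 1" if "e' \<in> chart_discs A" "e' ` cball 0 1 \<subseteq> e ` ball 0 1" for e'
  proof -
    obtain l c' r' where e': "e' = chart_disc l c' r'" "l \<in> A" "0 < r'" "cball c' r' \<subseteq> chart_image l"
      using \<open>e' \<in> chart_discs A\<close> by (auto simp: chart_discs_def)
    have in': "e' w \<in> e ` cball 0 1" "e' w \<in> fst k" if "norm w \<le> 1" for w
    proof -
      have "e' w \<in> e ` ball 0 1" using \<open>e' ` cball 0 1 \<subseteq> e ` ball 0 1\<close> that by auto
      then show "e' w \<in> e ` cball 0 1" "e' w \<in> fst k" using chart_disc_facts(2)[OF e(2-4)] e(1) by auto
    qed
    note t = chart_disc_trans[OF e'(2-4) e(2)]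
    have "(\<lambda>w. (transition l k (c' + of_real r' * w) - c) / of_real r) holomorphic_on ball 0 1"
      by (intro holomorphic_intros holomorphic_on_compose_gen[OF _ holomorphic_transition[OF e'(2) e(2)], unfolded o_def])
        (use t(1) in' e' e(3) in auto)
    then show ?thesis
      by (rule holomorphic_transform)
        (use coord_chart_disc[OF e(2-4)] in' t(2) e(1) e'(1) in auto)
  qed
next
  fix U x assume U: "openin X U" "x \<in> U"
  then have "x \<in> topspace X" using openin_subset by blast
  then obtain k where k: "k \<in> A" "x \<in> fst k" using cover by blast
  have x: "chart_inv k (snd k x) = x" "snd k x \<in> chart_image k" using chart_facts(6,9)[OF k(1)] k(2) by auto
  obtain r where r: "0 < r" "cball (snd k x) r \<subseteq> chart_image k" "chart_disc k (snd k x) r ` cball 0 1 \<subseteq> U"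
    using small_chart_disc[OF k(1) U(1) x(2)] x(1) U(2) by auto
  have "chart_disc k (snd k x) r 0 = x" by (simp add: chart_disc_def x)
  then show "\<exists>e\<in>chart_discs A. e 0 = x \<and> e ` cball 0 1 \<subseteq> U"
    unfolding chart_discs_def using r k by blast
qed

lemma chart_on_disc_differentiable:
  assumes "e \<in> chart_discs A" "l \<in> A" "norm w < 1" "e w \<in> fst l"
  shows "(\<lambda>w. snd l (e w)) field_differentiable (at w)"
    and "\<exists>N. open N \<and> w \<in> N \<and> N \<subseteq> ball 0 1 \<and> e ` N \<subseteq> fst l"
proof -
  obtain k c r where e: "e = chart_disc k c r" "k \<in> A" "0 < r" "cball c r \<subseteq> chart_image k"
    using assms(1) by (auto simp: chart_discs_def)
  define N where "N = ball 0 1 \<inter> (\<lambda>w. c + of_real r * w) -` overlap k l"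
  have o: "open N" unfolding N_def
    by (intro open_Int open_ball open_vimage open_overlap e assms continuous_intros)
  have wN: "w \<in> N" using chart_disc_trans(1)[OF e(2-4) assms(2), of w] assms e(1) by (simp add: N_def)
  have NB: "N \<subseteq> ball 0 1" by (auto simp: N_def)
  have Nl: "e v \<in> fst l" if v: "v \<in> N" for v
  proof -
    obtain x where x: "x \<in> fst k" "x \<in> fst l" "c + of_real r * v = snd k x" using v by (auto simp: N_def overlap_def)
    have "e v = x" unfolding e(1) chart_disc_def x(3) by (rule chart_facts(6)[OF e(2) x(1)])
    then show ?thesis using x by simp
  qed
  then show "\<exists>N. open N \<and> w \<in> N \<and> N \<subseteq> ball 0 1 \<and> e ` N \<subseteq> fst l" using o wN NB by blast
  have "(\<lambda>w. transition k l (c + of_real r * w)) holomorphic_on N"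
    by (intro holomorphic_on_compose_gen[OF _ holomorphic_transition[OF e(2) assms(2)], unfolded o_def] holomorphic_intros)
      (auto simp: N_def)
  then have "(\<lambda>w. snd l (e w)) holomorphic_on N"
    by (rule holomorphic_transform) (use chart_disc_trans(2)[OF e(2-4) assms(2)] NB Nl e(1) in auto)
  then show "(\<lambda>w. snd l (e w)) field_differentiable (at w)"
    using wN o by (simp add: holomorphic_on_imp_differentiable_at)
qed

lemma chart_on_disc_deriv:
  assumes k: "k \<in> A" "0 < r" "cball c r \<subseteq> chart_image k" and l: "l \<in> A"
    and w: "norm w < 1" "chart_disc k c r w \<in> fst l"
  shows "deriv (\<lambda>w. snd l (chart_disc k c r w)) w = deriv (transition k l) (c + of_real r * w) * of_real r"
proof -
  let ?z = "c + of_real r * w" and ?e = "chart_disc k c r"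
  have z: "?z \<in> overlap k l" using chart_disc_trans(1)[OF k l] w by simp
  have "?e \<in> chart_discs A" using k unfolding chart_discs_def by blast
  from chart_on_disc_differentiable(2)[OF this l w]
  obtain N where N: "open N" "w \<in> N" "N \<subseteq> ball 0 1" "?e ` N \<subseteq> fst l" by blast
  have "((\<lambda>w. transition k l (c + of_real r * w)) has_field_derivative deriv (transition k l) ?z * of_real r) (at w)"
  proof (rule DERIV_chain2[where g = "\<lambda>w. c + of_real r * w"])
    show "(transition k l has_field_derivative deriv (transition k l) ?z) (at ?z)"
      by (rule holomorphic_derivI[OF holomorphic_transition[OF k(1) l] open_overlap[OF k(1) l] z])
  qed (auto intro!: derivative_eq_intros)
  moreover have "\<forall>\<^sub>F v in nhds w. transition k l (c + of_real r * v) = snd l (?e v)"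
  proof (rule eventually_mono[OF eventually_nhds_in_open[OF N(1,2)]])
    fix v assume "v \<in> N"
    then have "norm v \<le> 1" "?e v \<in> fst l" using N by (auto simp: subset_iff less_imp_le)
    then show "transition k l (c + of_real r * v) = snd l (?e v)"
      using chart_disc_trans(2)[OF k l] by simp
  qed
  ultimately have "((\<lambda>w. snd l (?e w)) has_field_derivative deriv (transition k l) ?z * of_real r) (at w)"
    by (simp add: DERIV_cong_ev)
  then show ?thesis by (rule DERIV_imp_deriv)
qed

lemma chart_on_own_disc_deriv:
  assumes k: "k \<in> A" "0 < r" "cball c r \<subseteq> chart_image k" and w: "norm w < 1"
  shows "deriv (\<lambda>w. snd k (chart_disc k c r w)) w = of_real r"
proof -
  have "\<forall>\<^sub>F v in nhds w. c + of_real r * v = snd k (chart_disc k c r v)"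
    by (rule eventually_mono[OF eventually_nhds_in_open[of "ball 0 1"]])
      (use w chart_disc_facts(1)[OF k] in auto)
  moreover have "((\<lambda>v. c + of_real r * v) has_field_derivative of_real r) (at w)"
    by (auto intro!: derivative_eq_intros)
  ultimately have "((\<lambda>v. snd k (chart_disc k c r v)) has_field_derivative of_real r) (at w)"
    by (simp add: DERIV_cong_ev)
  then show ?thesis by (rule DERIV_imp_deriv)
qed

text \<open>A form is recorded by its primitives on coordinate discs; the condition is stated in all charts, so it
  does not depend on the chart from which the disc comes.\<close>

definition form_prim :: "('a chart \<Rightarrow> complex \<Rightarrow> complex) \<Rightarrow> (complex \<Rightarrow> 'a) \<Rightarrow> (complex \<Rightarrow> complex) \<Rightarrow> bool" where
  "form_prim \<omega> e g \<longleftrightarrow> g holomorphic_on ball 0 1 \<and>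
     (\<forall>k\<in>A. \<forall>w\<in>ball 0 1. e w \<in> fst k \<longrightarrow> deriv g w = \<omega> k (snd k (e w)) * deriv (\<lambda>w. snd k (e w)) w)"

text \<open>Integrate the local expression in the chart of the disc; the transformation law of the
  form then gives the condition in all other charts.\<close>

lemma form_prim_exists:
  assumes \<omega>: "\<omega> \<in> holomorphic_forms A" and e: "e \<in> chart_discs A"
  shows "\<exists>g. form_prim \<omega> e g"
proof -
  obtain k c r where e: "e = chart_disc k c r" "k \<in> A" "0 < r" "cball c r \<subseteq> chart_image k"
    using e by (auto simp: chart_discs_def)
  note f = chart_disc_facts[OF e(2-4)]
  have hk: "\<omega> k holomorphic_on chart_image k" using \<omega> e(2) by (simp add: holomorphic_forms_def)
  have "(\<lambda>w. \<omega> k (c + of_real r * w) * of_real r) holomorphic_on ball 0 1"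
    by (intro holomorphic_intros holomorphic_on_compose_gen[OF _ hk, unfolded o_def]) (use f in auto)
  from holomorphic_convex_primitive'[OF convex_ball open_ball this]
  obtain g where g: "\<And>w. w \<in> ball 0 1 \<Longrightarrow> (g has_field_derivative \<omega> k (c + of_real r * w) * of_real r) (at w within ball 0 1)"
    by blast
  have g': "(g has_field_derivative \<omega> k (c + of_real r * w) * of_real r) (at w)" if "norm w < 1" for w
    using g[of w] that at_within_open[of w "ball 0 1"] by simp
  have "g holomorphic_on ball 0 1" unfolding holomorphic_on_open[OF open_ball] using g' by (metis mem_ball_0)
  moreover have "deriv g w = \<omega> l (snd l (e w)) * deriv (\<lambda>w. snd l (e w)) w"
    if l: "l \<in> A" and w: "norm w < 1" "e w \<in> fst l" for l w
  proof -
    let ?z = "c + of_real r * w"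
    have z: "?z \<in> overlap k l" using chart_disc_trans(1)[OF e(2-4) l] w e(1) by simp
    have "deriv (\<lambda>w. snd l (e w)) w = deriv (transition k l) ?z * of_real r"
      using chart_on_disc_deriv[OF e(2-4) l w(1)] w(2) e(1) by simp
    moreover have "\<omega> k ?z = \<omega> l (transition k l ?z) * deriv (transition k l) ?z"
      using \<omega> e(2) l z by (simp add: holomorphic_forms_def)
    moreover have "transition k l ?z = snd l (e w)" using chart_disc_trans(2)[OF e(2-4) l] w e(1) by simp
    ultimately show ?thesis using DERIV_imp_deriv[OF g'[OF w(1)]] by simp
  qed
  ultimately show ?thesis unfolding form_prim_def by auto
qed

lemma form_prim_unique:
  assumes e: "e \<in> chart_discs A" and g: "form_prim \<omega> e g" "form_prim \<omega> e g'"
  shows "\<exists>c. \<forall>w\<in>ball 0 1. g w = g' w + c"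
proof -
  obtain k c r where e: "e = chart_disc k c r" "k \<in> A" "0 < r" "cball c r \<subseteq> chart_image k"
    using e by (auto simp: chart_discs_def)
  have h: "g holomorphic_on ball 0 1" "g' holomorphic_on ball 0 1" using g by (auto simp: form_prim_def)
  have "g w - g' w = g 0 - g' 0" if w: "norm w < 1" for w
  proof -
    have "((\<lambda>w. g w - g' w) has_field_derivative 0) (at v within ball 0 1)" if v: "v \<in> ball 0 1" for v
    proof -
      have "e v \<in> fst k" using chart_disc_facts(2)[OF e(2-4)] v e(1) by simp
      then have "deriv g v = deriv g' v" using g e(2) v unfolding form_prim_def by metis
      then have "((\<lambda>w. g w - g' w) has_field_derivative 0) (at v)"
        using DERIV_diff[OF holomorphic_derivI[OF h(1) open_ball v] holomorphic_derivI[OF h(2) open_ball v]] by simp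
      then show ?thesis by (rule has_field_derivative_at_within)
    qed
    from has_field_derivative_zero_constant[OF convex_ball this]
    obtain c where c: "\<And>x. x \<in> ball 0 1 \<Longrightarrow> g x - g' x = c" by blast
    show ?thesis using c[of w] c[of 0] w by simp
  qed
  then show ?thesis by (intro exI[of _ "g 0 - g' 0"]) (auto simp: algebra_simps)
qed

end

context riemann_surface
begin

lemma form_prim_add:
  assumes "form_prim \<omega> e g" "form_prim \<eta> e h"
  shows "form_prim (\<omega> + \<eta>) e (\<lambda>w. g w + h w)"
proof -
  have h: "g holomorphic_on ball 0 1" "h holomorphic_on ball 0 1" using assms by (auto simp: form_prim_def)
  have "deriv (\<lambda>w. g w + h w) w = deriv g w + deriv h w" if "w \<in> ball 0 1" for w
    by (intro DERIV_imp_deriv DERIV_add holomorphic_derivI[OF h(1) open_ball that] holomorphic_derivI[OF h(2) open_ball that])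
  then show ?thesis using assms h unfolding form_prim_def
    by (simp add: holomorphic_on_add distrib_right)
qed

lemma form_prim_scale:
  assumes "form_prim \<omega> e g"
  shows "form_prim (form_scale c \<omega>) e (\<lambda>w. c * g w)"
proof -
  have h: "g holomorphic_on ball 0 1" using assms by (auto simp: form_prim_def)
  have "deriv (\<lambda>w. c * g w) w = c * deriv g w" if "w \<in> ball 0 1" for w
    by (intro DERIV_imp_deriv DERIV_cmult holomorphic_derivI[OF h open_ball that])
  then show ?thesis using assms h unfolding form_prim_def form_scale_def
    by (simp add: holomorphic_on_mult)
qed

lemma form_prim_zero: "form_prim 0 e (\<lambda>w. 0)"
  unfolding form_prim_def by simp

lemma form_prim_sum:
  assumes "finite I" "\<And>i. i \<in> I \<Longrightarrow> form_prim (\<omega> i) e (g i)"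
  shows "form_prim (\<Sum>i\<in>I. \<omega> i) e (\<lambda>w. \<Sum>i\<in>I. g i w)"
  using assms by (induction I rule: finite_induct) (simp_all add: form_prim_zero form_prim_add)

end

section \<open>Holomorphic forms on a compact surface\<close>

locale compact_riemann_surface = riemann_surface X A for X :: "'a topology" and A +
  assumes compact_X: "compact_space X" and connected_X: "connected_space X"
begin

sublocale disc?: disc_surface X "chart_discs A"
  by (rule disc_surface_chart_discs[OF compact_X connected_X])

text \<open>By the chain rule, composing with the change of disc multiplies both derivatives in the
  condition by the same factor.\<close>

lemma form_prim_sub:
  assumes e: "e \<in> chart_discs A" "e' \<in> chart_discs A" "e' ` cball 0 1 \<subseteq> e ` ball 0 1" and g: "form_prim \<omega> e g"
  shows "form_prim \<omega> e' (\<lambda>w. g (coord e (e' w)))"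
proof -
  note sd = coord_subdisc[OF e]
  have h: "g holomorphic_on ball 0 1" using g by (simp add: form_prim_def)
  let ?T = "\<lambda>w. coord e (e' w)"
  have "(\<lambda>w. g (?T w)) holomorphic_on ball 0 1"
    by (rule holomorphic_on_compose_gen[OF disc_trans[OF e] h, unfolded o_def]) (use sd in auto)
  moreover have "deriv (\<lambda>w. g (?T w)) w = \<omega> l (snd l (e' w)) * deriv (\<lambda>w. snd l (e' w)) w"
    if l: "l \<in> A" and w: "w \<in> ball 0 1" "e' w \<in> fst l" for l w
  proof -
    have n: "norm w \<le> 1" using w by simp
    note T = sd[OF n]
    have dT: "(?T has_field_derivative deriv ?T w) (at w)"
      by (rule holomorphic_derivI[OF disc_trans[OF e] open_ball w(1)])
    have "?T w \<in> ball 0 1" using T(2) by simp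
    from DERIV_chain2[OF holomorphic_derivI[OF h open_ball this] dT]
    have d1: "deriv (\<lambda>w. g (?T w)) w = deriv g (?T w) * deriv ?T w" by (rule DERIV_imp_deriv)
    have "e (?T w) \<in> fst l" using T(1) w(2) by simp
    note df = chart_on_disc_differentiable(1)[OF e(1) l T(2) this]
    from DERIV_chain2[OF this[unfolded DERIV_deriv_iff_field_differentiable[symmetric]] dT]
    have "((\<lambda>w. snd l (e (?T w))) has_field_derivative deriv (\<lambda>w. snd l (e w)) (?T w) * deriv ?T w) (at w)" .
    moreover have "\<forall>\<^sub>F v in nhds w. snd l (e (?T v)) = snd l (e' v)"
      by (rule eventually_mono[OF eventually_nhds_in_open[OF open_ball w(1)]]) (use sd(1) in auto)
    ultimately have "((\<lambda>w. snd l (e' w)) has_field_derivative deriv (\<lambda>w. snd l (e w)) (?T w) * deriv ?T w) (at w)"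
      by (simp add: DERIV_cong_ev)
    then have "deriv (\<lambda>w. snd l (e' w)) w = deriv (\<lambda>w. snd l (e w)) (?T w) * deriv ?T w" by (rule DERIV_imp_deriv)
    moreover have "deriv g (?T w) = \<omega> l (snd l (e (?T w))) * deriv (\<lambda>w. snd l (e w)) (?T w)"
      using g l \<open>?T w \<in> ball 0 1\<close> \<open>e (?T w) \<in> fst l\<close> unfolding form_prim_def by blast
    ultimately show ?thesis using d1 T(1) by simp
  qed
  ultimately show ?thesis unfolding form_prim_def by simp
qed

text \<open>The form is the complex differential whose real part is the differential of \<open>arg F + b\<close>.\<close>

lemma form_of_harm:
  assumes F: "circle_map F" and h: "harm F (topspace X) b"
  obtains \<omega> where "\<omega> \<in> holomorphic_forms A"
    "\<And>e g. e \<in> chart_discs A \<Longrightarrow> Re_prim F b e g \<Longrightarrow> form_prim \<omega> e g"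
proof -
  have "\<exists>r g. 0 < r \<and> cball z r \<subseteq> chart_image k \<and> Re_prim F b (chart_disc k z r) g"
    if k: "k \<in> A" "z \<in> chart_image k" for k z
  proof -
    obtain r where r: "0 < r" "cball z r \<subseteq> chart_image k"
      using chart_facts(2)[OF k(1)] k(2) open_contains_cball by blast
    then have e: "chart_disc k z r \<in> chart_discs A" using k(1) unfolding chart_discs_def by blast
    have "chart_disc k z r ` cball 0 1 \<subseteq> topspace X" by (rule disc_image_topspace[OF e]) simp
    from harm_Re_prim[OF h e this] show ?thesis using r by blast
  qed
  then have "\<exists>r g. k \<in> A \<and> z \<in> chart_image k \<longrightarrow> 0 < r \<and> cball z r \<subseteq> chart_image k \<and> Re_prim F b (chart_disc k z r) g" for k z
    by blast
  \<comment> \<open>At each point of each chart one centred coordinate disc is fixed, together with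
    a primitive on it.\<close>
  then obtain \<rho> \<gamma> where \<rho>\<gamma>: "\<And>k z. k \<in> A \<and> z \<in> chart_image k \<longrightarrow>
      0 < \<rho> k z \<and> cball z (\<rho> k z) \<subseteq> chart_image k \<and> Re_prim F b (chart_disc k z (\<rho> k z)) (\<gamma> k z)" by metis
  \<comment> \<open>The coordinate of the disc is that of the chart scaled by \<rho>, so the
    derivative has to be divided by \<rho>.\<close>
  define \<omega> where "\<omega> k z = (if k \<in> A \<and> z \<in> chart_image k then deriv (\<gamma> k z) 0 / of_real (\<rho> k z) else 0)" for k z
  \<comment> \<open>Independence of the choices: on a common subdisc g and the chosen \<gamma>
    differ by a constant, so they yield the same derivative.\<close>
  have fp: "form_prim \<omega> e g" if e: "e \<in> chart_discs A" and g: "Re_prim F b e g" for e g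
    unfolding form_prim_def
  proof (intro conjI ballI impI)
    show hg: "g holomorphic_on ball 0 1" using g by (simp add: Re_prim_def)
    fix k w assume k: "k \<in> A" and w: "w \<in> ball 0 1" and ew: "e w \<in> fst k"
    define z where "z = snd k (e w)"
    have z: "z \<in> chart_image k" using chart_facts(9)[OF k ew] by (simp add: z_def)
    define \<rho>0 \<gamma>0 where "\<rho>0 = \<rho> k z" and "\<gamma>0 = \<gamma> k z"
    have \<rho>: "0 < \<rho>0" "cball z \<rho>0 \<subseteq> chart_image k" and \<gamma>: "Re_prim F b (chart_disc k z \<rho>0) \<gamma>0"
      using \<rho>\<gamma>[of k z] k z unfolding \<rho>0_def \<gamma>0_def by simp_all
    let ?d = "chart_disc k z \<rho>0"
    have d: "?d \<in> chart_discs A" using k \<rho> unfolding chart_discs_def by blast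
    have d0: "?d 0 = e w" using chart_facts(6)[OF k ew] by (simp add: chart_disc_def z_def)
    have "openin (top_of_set (cball 0 1)) {t \<in> topspace (top_of_set (cball 0 1)). e t \<in> ?d ` ball 0 1}"
      by (rule openin_continuous_map_preimage[OF disc_cont[OF e] openin_disc_ball[OF d]])
    then obtain T where T: "open T" "{t \<in> cball 0 1. e t \<in> ?d ` ball 0 1} = cball 0 1 \<inter> T"
      by (auto simp: openin_open)
    have "e w \<in> ?d ` ball 0 1" using d0 by (metis centre_in_ball imageI zero_less_one)
    then have "w \<in> {t \<in> cball 0 1. e t \<in> ?d ` ball 0 1}" using w by simp
    then have "w \<in> T \<inter> ball 0 1" using T(2) w by blast
    then obtain r where r: "0 < r" "cball w r \<subseteq> T \<inter> ball 0 1"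
      using open_contains_cball T(1) open_Int open_ball by meson
    define e' where "e' = (\<lambda>v. e (w + of_real r * v))"
    have inr: "w + of_real r * v \<in> ball 0 1" "e (w + of_real r * v) \<in> ?d ` ball 0 1" if "norm v \<le> 1" for v
    proof -
      have "w + of_real r * v \<in> T \<inter> ball 0 1" using affine_in_cball[OF r(1) that] r(2) by blast
      then show "w + of_real r * v \<in> ball 0 1" "e (w + of_real r * v) \<in> ?d ` ball 0 1" using T(2) by auto
    qed
    have "cball w r \<subseteq> cball 0 1" using r(2) by auto
    then have e': "e' \<in> chart_discs A" unfolding e'_def by (rule disc_sub[OF e r(1)])
    have sub: "e' ` cball 0 1 \<subseteq> e ` ball 0 1" "e' ` cball 0 1 \<subseteq> ?d ` ball 0 1"
      using inr unfolding e'_def by auto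
    obtain c where c: "\<And>v. norm v < 1 \<Longrightarrow> g (coord e (e' v)) = \<gamma>0 (coord ?d (e' v)) + c"
      using Re_prim_unique[OF Re_prim_sub[OF F e e' sub(1) g] Re_prim_sub[OF F d e' sub(2) \<gamma>]] by auto
    let ?q = "\<lambda>t. (snd k (e t) - z) / of_real \<rho>0"
    have eq: "\<gamma>0 (?q t) + c = g t" if t: "t \<in> ball w r" for t
    proof -
      define v where "v = (t - w) / of_real r"
      have v: "norm v < 1" "w + of_real r * v = t"
        using t r(1) by (auto simp: v_def norm_divide dist_norm norm_minus_commute)
      have "coord e (e' v) = t" using coord_eq[OF e, of t] inr(1)[of v] v by (simp add: e'_def)
      moreover have "e t \<in> ?d ` cball 0 1" using inr(2)[of v] v by auto
      then have "coord ?d (e' v) = ?q t" using coord_chart_disc[OF k \<rho>] v by (simp add: e'_def)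
      ultimately show ?thesis using c[OF v(1)] by simp
    qed
    have "norm w < 1" using w by simp
    note df = chart_on_disc_differentiable(1)[OF e k this ew, folded DERIV_deriv_iff_field_differentiable]
    have "(?q has_field_derivative deriv (\<lambda>t. snd k (e t)) w / of_real \<rho>0) (at w)"
      using \<rho>(1) by (auto intro!: derivative_eq_intros df)
    moreover have "(\<gamma>0 has_field_derivative deriv \<gamma>0 0) (at (?q w))"
      using holomorphic_derivI[of \<gamma>0 "ball 0 1" 0] \<gamma> by (simp add: Re_prim_def z_def)
    ultimately have "((\<lambda>t. \<gamma>0 (?q t)) has_field_derivative deriv \<gamma>0 0 * (deriv (\<lambda>t. snd k (e t)) w / of_real \<rho>0)) (at w)"
      by (rule DERIV_chain2[rotated])
    then have "((\<lambda>t. \<gamma>0 (?q t) + c) has_field_derivative deriv \<gamma>0 0 * (deriv (\<lambda>t. snd k (e t)) w / of_real \<rho>0)) (at w)"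
      by (auto intro!: derivative_eq_intros)
    moreover have "\<forall>\<^sub>F t in nhds w. \<gamma>0 (?q t) + c = g t"
      by (rule eventually_mono[OF eventually_nhds_in_open[of "ball w r"]]) (use r eq in auto)
    ultimately have "(g has_field_derivative deriv \<gamma>0 0 * (deriv (\<lambda>t. snd k (e t)) w / of_real \<rho>0)) (at w)"
      by (simp add: DERIV_cong_ev)
    from DERIV_imp_deriv[OF this] show "deriv g w = \<omega> k (snd k (e w)) * deriv (\<lambda>w. snd k (e w)) w"
      using k z by (simp add: \<omega>_def z_def \<rho>0_def \<gamma>0_def)
  qed
  have "\<omega> \<in> holomorphic_forms A"
    unfolding holomorphic_forms_def mem_Collect_eq
  proof (intro conjI ballI allI impI)
    fix k assume k: "k \<in> A"
    show "\<omega> k holomorphic_on chart_image k"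
      unfolding holomorphic_on_def
    proof
      fix z assume z: "z \<in> chart_image k"
      define r g where "r = \<rho> k z" and "g = \<gamma> k z"
      have r: "0 < r" "cball z r \<subseteq> chart_image k" and g: "Re_prim F b (chart_disc k z r) g"
        using \<rho>\<gamma>[of k z] k z unfolding r_def g_def by simp_all
      have d: "chart_disc k z r \<in> chart_discs A" using k r unfolding chart_discs_def by blast
      have hg: "deriv g holomorphic_on ball 0 1" using g by (simp add: Re_prim_def holomorphic_deriv)
      have nb: "norm ((y - z) / of_real r) < 1" if "y \<in> ball z r" for y
        using that r(1) by (simp add: norm_divide dist_norm norm_minus_commute)
      have "(\<lambda>y. deriv g ((y - z) / of_real r) / of_real r) holomorphic_on ball z r"
        by (intro holomorphic_intros holomorphic_on_compose_gen[OF _ hg, unfolded o_def]) (use r nb in auto)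
      moreover have "deriv g ((y - z) / of_real r) / of_real r = \<omega> k y" if y: "y \<in> ball z r" for y
      proof -
        define w where "w = (y - z) / of_real r"
        have w: "norm w < 1" "z + of_real r * w = y" using nb[OF y] r(1) by (auto simp: w_def)
        have f: "snd k (chart_disc k z r w) = y" "chart_disc k z r w \<in> fst k"
          using chart_disc_facts(1,2)[OF k r, of w] w by auto
        have "deriv g w = \<omega> k y * of_real r"
          using fp[OF d g] k f w(1) chart_on_own_disc_deriv[OF k r w(1)] unfolding form_prim_def by auto
        then show ?thesis using r(1) by (simp add: w_def)
      qed
      ultimately have "\<omega> k holomorphic_on ball z r" by (rule holomorphic_transform)
      then have "\<omega> k field_differentiable at z" using r(1) by (simp add: holomorphic_on_imp_differentiable_at)
      then show "\<omega> k field_differentiable at z within chart_image k" by (rule field_differentiable_at_within)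
    qed
  next
    fix k l z assume k: "k \<in> A" and l: "l \<in> A" and zo: "z \<in> overlap k l"
    obtain x where x: "x \<in> fst k" "x \<in> fst l" "z = snd k x" using zo by (auto simp: overlap_def)
    have z: "z \<in> chart_image k" using chart_facts(9)[OF k x(1)] x(3) by simp
    define r g where "r = \<rho> k z" and "g = \<gamma> k z"
    have r: "0 < r" "cball z r \<subseteq> chart_image k" and g: "Re_prim F b (chart_disc k z r) g"
      using \<rho>\<gamma>[of k z] k z unfolding r_def g_def by simp_all
    have d: "chart_disc k z r \<in> chart_discs A" using k r unfolding chart_discs_def by blast
    have d0: "chart_disc k z r 0 = x" using chart_facts(6)[OF k x(1)] by (simp add: chart_disc_def x(3))
    have l0: "snd l x = transition k l z" using chart_disc_trans(2)[OF k r l, of 0] d0 x(2) by simp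
    \<comment> \<open>Both charts compute the derivative of one primitive at the centre; cancelling
      r gives the transformation law.\<close>
    have "deriv g 0 = \<omega> k z * of_real r"
      using fp[OF d g] k x chart_on_own_disc_deriv[OF k r, of 0] d0 unfolding form_prim_def by auto
    moreover have "deriv g 0 = \<omega> l (transition k l z) * (deriv (transition k l) z * of_real r)"
      using fp[OF d g] l x chart_on_disc_deriv[OF k r l, of 0] d0 l0 unfolding form_prim_def by auto
    ultimately show "\<omega> k z = \<omega> l (transition k l z) * deriv (transition k l) z" using r(1) by simp
  qed (auto simp: \<omega>_def)
  then show ?thesis using fp that by blast
qed

text \<open>On a disc the lift of F is \<open>Re g - b\<close> up to a constant, so the real part of
  the form has the cohomology class of \<open>dlog F\<close>.\<close>

lemma form_dlog_prim:
  assumes F: "circle_map F" and h: "harm F (topspace X) b"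
    and \<omega>: "\<And>e g. e \<in> chart_discs A \<Longrightarrow> Re_prim F b e g \<Longrightarrow> form_prim \<omega> e g"
    and e: "e \<in> chart_discs A" and g: "form_prim \<omega> e g"
  shows "prim (top_of_set (ball 0 1)) (\<lambda>s t. dlog F (e s) (e t)) (\<lambda>s. Re (g s) - b (e s))"
proof -
  have "e ` cball 0 1 \<subseteq> topspace X" by (rule disc_image_topspace[OF e]) simp
  then obtain g' where g': "Re_prim F b e g'" using harm_Re_prim[OF h e] by blast
  then obtain c' where c': "\<And>w. norm w < 1 \<Longrightarrow> val F b e w = Re (g' w) + c'" unfolding Re_prim_def by auto
  obtain c where c: "\<And>w. norm w < 1 \<Longrightarrow> g w = g' w + c"
    using form_prim_unique[OF e g \<omega>[OF e g']] by auto
  have "prim (top_of_set (ball 0 1)) (dlog (\<lambda>w. F (e w))) (lift F e)"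
    by (rule prim_dlog) (use lift[OF F e] in \<open>auto intro: continuous_on_subset\<close>)
  from prim_shift[OF this, of "Re c - c'"] show ?thesis
  proof (rule prim_cong)
    fix w assume "w \<in> topspace (top_of_set (ball (0::complex) 1))"
    then have "norm w < 1" by simp
    then show "lift F e w + (Re c - c') = Re (g w) - b (e w)"
      using c[of w] c'[of w] by (simp add: val_def)
  qed (simp add: dlog_def)
qed

lemma prim_by_discs:
  assumes "\<And>e. e \<in> chart_discs A \<Longrightarrow> prim (top_of_set (ball 0 1)) (\<lambda>s t. d (e s) (e t)) (\<lambda>s. f (e s))"
  shows "prim X d f"
proof (rule prim_local)
  fix x assume "x \<in> topspace X"
  then obtain e where e: "e \<in> chart_discs A" "e 0 = x" using disc_ex[OF openin_topspace] by blast
  let ?N = "e ` ball 0 1"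
  have "?N \<subseteq> e ` cball 0 1" by auto
  then have "continuous_map (subtopology X ?N) (top_of_set (ball 0 1)) (coord e)"
    using continuous_map_from_subtopology_mono[OF continuous_coord[OF e(1)], of ?N] e(1)
    by (auto simp: continuous_map_in_subtopology)
  from prim_pullback[OF assms[OF e(1)] this]
  have "prim (subtopology X ?N) d f" by (rule prim_cong) (use e(1) in auto)
  then show "\<exists>N. openin X N \<and> x \<in> N \<and> prim (subtopology X N) d f"
    using openin_disc_ball[OF e(1)] e(2) by (intro exI[of _ ?N]) (auto intro!: image_eqI[of _ _ 0])
qed

text \<open>A form with a globally defined real part of a primitive vanishes, by the maximum principle.\<close>

lemma exact_real_part_imp_zero:
  assumes \<theta>: "\<theta> \<in> holomorphic_forms A"
    and loc: "\<And>x. x \<in> topspace X \<Longrightarrow> \<exists>e\<in>chart_discs A. \<exists>G c. e 0 = x \<and> form_prim \<theta> e G \<and>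
       (\<forall>s\<in>ball 0 1. h (e s) = Re (G s) + c)"
  shows "\<theta> = 0"
proof -
  have hc: "contX h"
  proof (rule contX_eps)
    fix x and \<epsilon> :: real assume x: "x \<in> topspace X" and \<epsilon>: "\<epsilon> > 0"
    obtain e G c where e: "e \<in> chart_discs A" "e 0 = x" "form_prim \<theta> e G" "\<And>s. norm s < 1 \<Longrightarrow> h (e s) = Re (G s) + c"
      using loc[OF x] by (metis mem_ball_0)
    have "continuous_on (ball 0 1) G" using e(3) by (simp add: form_prim_def holomorphic_on_imp_continuous_on)
    then obtain \<delta> where \<delta>: "\<delta> > 0" "\<And>s. norm s < 1 \<Longrightarrow> norm s < \<delta> \<Longrightarrow> norm (G s - G 0) < \<epsilon>"
      unfolding continuous_on_iff using \<epsilon> by (metis centre_in_ball diff_zero dist_norm mem_ball_0 zero_less_one)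
    have "openin X (e ` (ball 0 1 \<inter> ball 0 \<delta>))" by (rule disc_open[OF e(1)]) auto
    moreover have "x \<in> e ` (ball 0 1 \<inter> ball 0 \<delta>)" using e(2) \<delta>(1) by (auto intro!: image_eqI[of _ _ 0])
    moreover have "\<bar>h y - h x\<bar> < \<epsilon>" if y: "y \<in> e ` (ball 0 1 \<inter> ball 0 \<delta>)" for y
    proof -
      obtain s where s: "norm s < 1" "norm s < \<delta>" "y = e s" using y by auto
      have "h y - h x = Re (G s - G 0)" using e(4)[OF s(1)] e(4)[of 0] e(2) s(3) by simp
      then show ?thesis using \<delta>(2)[OF s(1,2)] abs_Re_le_cmod[of "G s - G 0"] by simp
    qed
    ultimately show "\<exists>U. openin X U \<and> x \<in> U \<and> (\<forall>y\<in>U. \<bar>h y - h x\<bar> < \<epsilon>)" by blast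
  qed
  have const: "\<exists>m. \<forall>x\<in>topspace X. h x = m"
  proof (cases "topspace X = {}")
    case False
    have "compact (h ` topspace X)"
      using image_compactin[OF _ hc, of "topspace X"] compact_X by (simp add: compact_space_def compactin_euclidean_iff)
    then obtain y where y: "y \<in> topspace X" "\<And>x. x \<in> topspace X \<Longrightarrow> h x \<le> h y"
      using compact_attains_sup[of "h ` topspace X"] False by auto
    let ?M = "{x \<in> topspace X. h x \<in> {h y}}"
    have "closedin X ?M" by (rule closedin_continuous_map_preimage[OF hc]) simp
    moreover have "openin X ?M"
    proof (subst openin_subopen, clarify)
      fix x assume x: "x \<in> topspace X" "h x = h y"
      obtain e G c where e: "e \<in> chart_discs A" "e 0 = x" "form_prim \<theta> e G" "\<And>s. norm s < 1 \<Longrightarrow> h (e s) = Re (G s) + c"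
        using loc[OF x(1)] by (metis mem_ball_0)
      have hG: "G holomorphic_on ball 0 1" using e(3) by (simp add: form_prim_def)
      have le: "Re (G s) \<le> Re (G 0)" if "norm s < 1" for s
        using y(2)[OF disc_topspace[OF e(1), of s]] that e(4)[OF that] e(4)[of 0] x(2) e(2) by simp
      \<comment> \<open>The modulus of exp G is exp (Re G), which takes its maximum at the
        centre.\<close>
      have "(\<lambda>s. exp (G s)) constant_on ball 0 1"
        by (rule maximum_modulus_principle[of _ _ "ball 0 1" 0]) (use le hG in \<open>auto intro!: holomorphic_intros\<close>)
      then obtain q where q: "\<And>s. norm s < 1 \<Longrightarrow> exp (G s) = q" unfolding constant_on_def by auto
      have "h (e s) = h y" if s: "norm s < 1" for s
      proof -
        have "exp (G s) = exp (G 0)" using q[OF s] q[of 0] by simp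
        then have "exp (Re (G s)) = exp (Re (G 0))" by (metis norm_exp_eq_Re)
        then show ?thesis using e(4)[OF s] e(4)[of 0] x(2) e(2) by simp
      qed
      then have "e ` ball 0 1 \<subseteq> ?M" using disc_topspace[OF e(1)] by auto
      moreover have "x \<in> e ` ball 0 1" using e(2) by (auto intro!: image_eqI[of _ _ 0])
      ultimately show "\<exists>T. openin X T \<and> x \<in> T \<and> T \<subseteq> ?M" using openin_disc_ball[OF e(1)] by blast
    qed
    ultimately have "?M = {} \<or> ?M = topspace X" using connected_X unfolding connected_space_clopen_in by blast
    then show ?thesis using y(1) by blast
  qed auto
  have z: "\<theta> k z = 0" if k: "k \<in> A" "z \<in> chart_image k" for k z
  proof -
    obtain r where r: "0 < r" "cball z r \<subseteq> chart_image k"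
      using chart_facts(2)[OF k(1)] k(2) open_contains_cball by blast
    let ?d = "chart_disc k z r"
    have d: "?d \<in> chart_discs A" using k(1) r unfolding chart_discs_def by blast
    have d0: "?d 0 \<in> fst k" "snd k (?d 0) = z" using chart_disc_facts(1,2)[OF k(1) r, of 0] by auto
    obtain e G c where e: "e \<in> chart_discs A" "e 0 = ?d 0" "form_prim \<theta> e G" "\<And>s. norm s < 1 \<Longrightarrow> h (e s) = Re (G s) + c"
      using loc[OF disc_topspace[OF d, of 0]] by (metis mem_ball_0 norm_zero zero_le_one)
    have o: "openin X (?d ` ball 0 1 \<inter> e ` ball 0 1)" by (intro openin_Int openin_disc_ball d e)
    have "?d 0 \<in> ?d ` ball 0 1 \<inter> e ` ball 0 1" using e(2) by (auto intro!: image_eqI[of _ _ 0])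
    then have zin: "z \<in> chart_image k" "chart_inv k z \<in> ?d ` ball 0 1 \<inter> e ` ball 0 1"
      using k(2) by (auto simp: chart_disc_def)
    obtain r' where r': "0 < r'" "cball z r' \<subseteq> chart_image k" "chart_disc k z r' ` cball 0 1 \<subseteq> ?d ` ball 0 1 \<inter> e ` ball 0 1"
      using small_chart_disc[OF k(1) o zin] by blast
    let ?d' = "chart_disc k z r'"
    have d': "?d' \<in> chart_discs A" using k(1) r' unfolding chart_discs_def by blast
    have sub: "?d' ` cball 0 1 \<subseteq> e ` ball 0 1" using r'(3) by blast
    let ?g = "\<lambda>w. G (coord e (?d' w))"
    have fp: "form_prim \<theta> ?d' ?g" by (rule form_prim_sub[OF e(1) d' sub e(3)])
    obtain m where m: "\<And>x. x \<in> topspace X \<Longrightarrow> h x = m" using const by blast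
    \<comment> \<open>Since h is constant, so is the real part of the primitive, hence the primitive
      itself; its derivative at the centre is \<theta> k z times r'.\<close>
    have re: "Re (?g w) = m - c" if "w \<in> ball 0 1" for w
    proof -
      have "norm w \<le> 1" using that by simp
      note T = coord_subdisc[OF e(1) d' sub this]
      show ?thesis using e(4)[OF T(2)] m[OF disc_topspace[OF d' \<open>norm w \<le> 1\<close>]] T(1) by simp
    qed
    have hg: "?g holomorphic_on ball 0 1" using fp by (simp add: form_prim_def)
    have "0 \<in> ball (0::complex) 1" by simp
    then have "?g 0 = ?g w" if "w \<in> ball 0 1" for w
      using Re_const_imp_const[OF hg open_ball connected_ball re] that by blast
    then have "\<forall>\<^sub>F w in nhds 0. ?g 0 = ?g w"
      by (rule eventually_mono[OF eventually_nhds_in_open[OF open_ball \<open>0 \<in> ball 0 1\<close>]])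
    from DERIV_cong_ev[THEN iffD1, OF refl this refl DERIV_const]
    have "(?g has_field_derivative 0) (at 0)" .
    then have "deriv ?g 0 = 0" by (rule DERIV_imp_deriv)
    moreover have "deriv ?g 0 = \<theta> k z * of_real r'"
      using fp k(1) chart_disc_facts(1,2)[OF k(1) r'(1,2), of 0] chart_on_own_disc_deriv[OF k(1) r'(1,2), of 0]
      unfolding form_prim_def by auto
    ultimately show ?thesis using r'(1) by simp
  qed
  have "\<theta> k z = 0" for k z
  proof (cases "k \<in> A \<and> z \<in> chart_image k")
    case True
    then show ?thesis using z by simp
  next
    case False
    then show ?thesis using \<theta> unfolding holomorphic_forms_def mem_Collect_eq by blast
  qed
  then show ?thesis by (intro ext) simp
qed

end

context compact_riemann_surface
begin

text \<open>A form is determined by the cohomology class of its real part: subtracting the combination with the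
  same class leaves an exact real part, first off the point \<open>e0 0\<close> and then, by uniqueness of primitives on a
  punctured disc, everywhere.\<close>

lemma real_basis_forms:
  assumes e0: "e0 \<in> chart_discs A" and I: "finite (I :: 'i set)" and Fs: "\<And>i. i \<in> I \<Longrightarrow> circle_map (Fs i)"
    and span: "\<And>d. cocycle (subtopology X (topspace X - {e0 0})) d \<Longrightarrow>
       \<exists>a f. prim (subtopology X (topspace X - {e0 0})) (\<lambda>x y. d x y - (\<Sum>i\<in>I. a i * dlog (Fs i) x y)) f"
    and indep: "\<And>a f i. prim (subtopology X (topspace X - {e0 0})) (\<lambda>x y. \<Sum>i\<in>I. a i * dlog (Fs i) x y) f \<Longrightarrow>
       i \<in> I \<Longrightarrow> a i = 0"
  obtains \<omega> where "\<And>i. i \<in> I \<Longrightarrow> \<omega> i \<in> holomorphic_forms A"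
    "\<And>\<eta>. \<eta> \<in> holomorphic_forms A \<Longrightarrow> \<exists>a :: 'i \<Rightarrow> real. \<eta> = (\<Sum>i\<in>I. form_scale (of_real (a i)) (\<omega> i))"
    "\<And>(a :: 'i \<Rightarrow> real) i. (\<Sum>i\<in>I. form_scale (of_real (a i)) (\<omega> i)) = 0 \<Longrightarrow> i \<in> I \<Longrightarrow> a i = 0"
proof -
  define Y where "Y = topspace X - {e0 0}"
  have p0: "e0 0 \<in> topspace X" by (rule disc_topspace[OF e0]) simp
  have Yo: "openin X Y" unfolding Y_def
    by (rule openin_diff[OF openin_topspace closedin_Hausdorff_singleton[OF disc.Hausdorff p0]])
  have YX: "Y \<subseteq> topspace X" by (auto simp: Y_def)
  have "\<exists>b. \<exists>\<omega>. harm (Fs i) (topspace X) b \<and> \<omega> \<in> holomorphic_forms A \<and>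
      (\<forall>e\<in>chart_discs A. \<forall>g. Re_prim (Fs i) b e g \<longrightarrow> form_prim \<omega> e g)" if i: "i \<in> I" for i
  proof -
    obtain b where b: "contX b" "harm (Fs i) (topspace X) b"
      using harmonic_representative[OF Fs[OF i] e0 I Fs span] by blast
    obtain \<omega> where "\<omega> \<in> holomorphic_forms A" "\<And>e g. e \<in> chart_discs A \<Longrightarrow> Re_prim (Fs i) b e g \<Longrightarrow> form_prim \<omega> e g"
      using form_of_harm[OF Fs[OF i] b(2)] by blast
    then show ?thesis using b(2) by (intro exI[of _ b] exI[of _ \<omega>]) simp
  qed
  then have "\<forall>i\<in>I. \<exists>b. \<exists>\<omega>. harm (Fs i) (topspace X) b \<and> \<omega> \<in> holomorphic_forms A \<and>
      (\<forall>e\<in>chart_discs A. \<forall>g. Re_prim (Fs i) b e g \<longrightarrow> form_prim \<omega> e g)" by blast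
  from bchoice[OF this] obtain b where "\<forall>i\<in>I. \<exists>\<omega>. harm (Fs i) (topspace X) (b i) \<and> \<omega> \<in> holomorphic_forms A \<and>
      (\<forall>e\<in>chart_discs A. \<forall>g. Re_prim (Fs i) (b i) e g \<longrightarrow> form_prim \<omega> e g)" ..
  from bchoice[OF this] obtain \<omega> where \<omega>: "\<forall>i\<in>I. harm (Fs i) (topspace X) (b i) \<and> \<omega> i \<in> holomorphic_forms A \<and>
      (\<forall>e\<in>chart_discs A. \<forall>g. Re_prim (Fs i) (b i) e g \<longrightarrow> form_prim (\<omega> i) e g)" ..
  have dp: "prim (top_of_set (ball 0 1)) (\<lambda>s t. dlog (Fs i) (e s) (e t)) (\<lambda>s. Re (g s) - b i (e s))"
    if "i \<in> I" "e \<in> chart_discs A" "form_prim (\<omega> i) e g" for i e g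
    by (rule form_dlog_prim[OF Fs[OF that(1)], where \<omega> = "\<omega> i"]) (use \<omega> that in auto)
  have gex: "\<exists>gg. \<forall>i\<in>I. form_prim (\<omega> i) e (gg i)" if "e \<in> chart_discs A" for e
  proof -
    have "\<forall>i\<in>I. \<exists>g. form_prim (\<omega> i) e g" using form_prim_exists[OF _ that] \<omega> by blast
    from bchoice[OF this] show ?thesis .
  qed
  show thesis
  proof (rule that[of \<omega>])
    show "\<omega> i \<in> holomorphic_forms A" if "i \<in> I" for i using \<omega> that by blast
  next
    fix \<eta> assume \<eta>: "\<eta> \<in> holomorphic_forms A"
    have ex: "\<exists>e\<in>chart_discs A. \<exists>g. e 0 = x \<and> e ` cball 0 1 \<subseteq> topspace X \<and> form_prim \<eta> e g" if "x \<in> topspace X" for x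
      using disc_ex[OF openin_topspace that] form_prim_exists[OF \<eta>] by metis
    have "\<exists>D. germ_increments (topspace X) (form_prim \<eta>) D"
      by (rule germ_increments_exist[OF subset_refl ex form_prim_sub form_prim_unique])
    then obtain D where D: "germ_increments (topspace X) (form_prim \<eta>) D" ..
    have ReL: "Re (x - y) = Re x - Re y" for x y by simp
    have "cocycle X (\<lambda>x y. Re (D x y))"
      using germ_cocycle[where L = Re, OF D openin_topspace ex ReL] by simp
    from span[OF cocycle_subtopology[OF this]] obtain a f where
      f: "prim (subtopology X Y) (\<lambda>x y. Re (D x y) - (\<Sum>i\<in>I. a i * dlog (Fs i) x y)) f"
      unfolding Y_def by blast
    \<comment> \<open>The combination whose real part has the class of \<open>Re \<eta>\<close> off
      the puncture. Below, h corrects the primitive f by the functions \<open>b i\<close> that make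
      the representatives harmonic.\<close>
    define \<sigma> where "\<sigma> = (\<Sum>i\<in>I. form_scale (of_real (a i)) (\<omega> i))"
    define \<theta> where "\<theta> = \<eta> + form_scale (-1) \<sigma>"
    define h where "h x = f x - (\<Sum>i\<in>I. a i * b i x)" for x
    have \<theta>: "\<theta> \<in> holomorphic_forms A" unfolding \<theta>_def \<sigma>_def
      by (intro forms.subspace_add forms.subspace_scale forms.subspace_sum subspace_holomorphic_forms \<eta>) (use \<omega> in auto)
    have loc: "\<exists>G c. form_prim \<theta> e G \<and> (\<forall>s\<in>S. h (e s) = Re (G s) + c)"
      if e: "e \<in> chart_discs A" and S: "connected S" "S \<subseteq> ball 0 1" "e ` S \<subseteq> Y" for e S
    proof -
      obtain g where g: "form_prim \<eta> e g" using form_prim_exists[OF \<eta> e] by blast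
      obtain gg where gg: "\<forall>i\<in>I. form_prim (\<omega> i) e (gg i)" using gex[OF e] by blast
      let ?G = "\<lambda>w. g w + (-1) * (\<Sum>i\<in>I. of_real (a i) * gg i w)"
      have G: "form_prim \<theta> e ?G" unfolding \<theta>_def \<sigma>_def
        by (intro form_prim_add form_prim_scale form_prim_sum g I) (use gg in blast)
      have eb: "e ` ball 0 1 \<subseteq> topspace X" by (rule disc_image_topspace[OF e]) auto
      have "prim (top_of_set (ball 0 1)) (\<lambda>s t. Re (D (e s) (e t))) (\<lambda>s. Re (g s))"
        by (rule germ_prim[where L = Re and e = e and g = g and D = D, OF D ReL e eb g])
      note pb = this
      have p1: "prim (top_of_set S) (\<lambda>s t. Re (D (e s) (e t))) (\<lambda>s. Re (g s))"
        by (rule prim_subset[OF pb S(2)])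
      have p2: "prim (top_of_set S) (\<lambda>s t. a i * dlog (Fs i) (e s) (e t)) (\<lambda>s. a i * (Re (gg i s) - b i (e s)))"
        if i: "i \<in> I" for i
      proof -
        have "form_prim (\<omega> i) e (gg i)" using gg i by blast
        from prim_subset[OF dp[OF i e this] S(2)] show ?thesis by (rule prim_cmul)
      qed
      note p3 = prim_diff[OF p1 prim_sum[OF I p2]]
      have "S \<subseteq> cball 0 1" using S(2) ball_subset_cball by blast
      then have "continuous_map (top_of_set S) (subtopology X Y) e"
        using continuous_map_from_subtopology_mono[OF disc_cont[OF e], of S] S(3)
        by (auto simp: continuous_map_in_subtopology)
      note p4 = prim_pullback[OF f this]
      have cS: "connected_space (top_of_set S)" using S(1) by (simp add: connected_space_subtopology connectedin_iff_connected)
      have "\<exists>c. \<forall>s\<in>S. h (e s) = Re (?G s) + c"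
      proof (cases "S = {}")
        case False
        then obtain x where x: "x \<in> S" by blast
        let ?u = "\<lambda>s. f (e s) - (Re (g s) - (\<Sum>i\<in>I. a i * (Re (gg i s) - b i (e s))))"
        show ?thesis
        proof (intro exI ballI)
          fix s assume "s \<in> S"
          then have u: "?u s = ?u x" using prim_unique[OF cS p4 p3, of x s] x by simp
          have "h (e s) = Re (?G s) + ?u s"
            by (simp add: h_def right_diff_distrib sum_subtractf)
          then show "h (e s) = Re (?G s) + ?u x" unfolding u .
        qed
      qed auto
      then show ?thesis using G by blast
    qed
    \<comment> \<open>The punctured disc is connected, so one constant c0 relates h to the real part
      of the primitive on all of it; this determines the value with which h is filled in at the
      puncture.\<close>
    have inj0: "e0 s \<noteq> e0 0" if "norm s < 1" "s \<noteq> 0" for s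
      using inj_onD[OF disc_inj[OF e0], of s 0] that by auto
    have "connected (ball 0 1 - {0 :: complex})" by (rule connected_punctured_ball) simp
    moreover have "e0 ` (ball 0 1 - {0}) \<subseteq> Y"
      using inj0 disc_topspace[OF e0] unfolding Y_def by auto
    ultimately obtain G0 c0 where G0: "form_prim \<theta> e0 G0" "\<And>s. s \<in> ball 0 1 - {0} \<Longrightarrow> h (e0 s) = Re (G0 s) + c0"
      using loc[OF e0, of "ball 0 1 - {0}"] by blast
    define h' where "h' x = (if x = e0 0 then Re (G0 0) + c0 else h x)" for x
    have "\<theta> = 0"
    proof (rule exact_real_part_imp_zero[OF \<theta>])
      fix x assume x: "x \<in> topspace X"
      show "\<exists>e\<in>chart_discs A. \<exists>G c. e 0 = x \<and> form_prim \<theta> e G \<and> (\<forall>s\<in>ball 0 1. h' (e s) = Re (G s) + c)"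
      proof (cases "x = e0 0")
        case True
        have "h' (e0 s) = Re (G0 s) + c0" if "s \<in> ball 0 1" for s
          using G0(2)[of s] inj0[of s] that by (cases "s = 0") (auto simp: h'_def)
        then show ?thesis using e0 True G0(1) by blast
      next
        case False
        then have "x \<in> Y" using x by (simp add: Y_def)
        then obtain e where e: "e \<in> chart_discs A" "e 0 = x" "e ` cball 0 1 \<subseteq> Y" using disc_ex[OF Yo] by blast
        have eb: "e ` ball 0 1 \<subseteq> Y" using e(3) by auto
        obtain G c where G: "form_prim \<theta> e G" "\<And>s. s \<in> ball 0 1 \<Longrightarrow> h (e s) = Re (G s) + c"
          using loc[OF e(1) connected_ball subset_refl eb] by blast
        have "h' (e s) = Re (G s) + c" if s: "s \<in> ball 0 1" for s
        proof -
          have "e s \<in> Y" using eb s by blast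
          then show ?thesis using G(2)[OF s] by (simp add: h'_def Y_def)
        qed
        then show ?thesis using e(1,2) G(1) by blast
      qed
    qed
    then have "\<eta> = \<sigma>" unfolding \<theta>_def by (simp add: forms.scale_minus_left)
    then show "\<exists>a :: 'i \<Rightarrow> real. \<eta> = (\<Sum>i\<in>I. form_scale (of_real (a i)) (\<omega> i))" unfolding \<sigma>_def by blast
  next
    fix a :: "'i \<Rightarrow> real" and i
    assume z: "(\<Sum>i\<in>I. form_scale (of_real (a i)) (\<omega> i)) = 0" and i: "i \<in> I"
    \<comment> \<open>The real part of \<open>\<omega> i\<close> is the differential of the argument
      of \<open>Fs i\<close> plus that of \<open>b i\<close>. A real relation between the forms
      therefore makes the same combination of the \<open>dlog (Fs i)\<close> the increments of a
      global function.\<close>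
    have "prim X (\<lambda>x y. \<Sum>i\<in>I. a i * dlog (Fs i) x y) (\<lambda>x. - (\<Sum>i\<in>I. a i * b i x))"
    proof (rule prim_by_discs)
      fix e assume e: "e \<in> chart_discs A"
      obtain gg where gg: "\<forall>i\<in>I. form_prim (\<omega> i) e (gg i)" using gex[OF e] by blast
      have "form_prim (\<Sum>i\<in>I. form_scale (of_real (a i)) (\<omega> i)) e (\<lambda>w. \<Sum>i\<in>I. of_real (a i) * gg i w)"
        by (intro form_prim_sum form_prim_scale I) (use gg in blast)
      from form_prim_unique[OF e this[unfolded z] form_prim_zero]
      obtain c where c: "\<And>w. w \<in> ball 0 1 \<Longrightarrow> (\<Sum>i\<in>I. of_real (a i) * gg i w) = c" by auto
      have re: "(\<Sum>i\<in>I. a i * Re (gg i w)) = Re c" if "w \<in> ball 0 1" for w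
        using arg_cong[OF c[OF that], of Re] by simp
      have "prim (top_of_set (ball 0 1)) (\<lambda>s t. \<Sum>i\<in>I. a i * dlog (Fs i) (e s) (e t))
          (\<lambda>s. \<Sum>i\<in>I. a i * (Re (gg i s) - b i (e s)))"
        by (intro prim_sum I prim_cmul dp e) (use gg in blast)+
      from prim_shift[OF this, of "- Re c"]
      show "prim (top_of_set (ball 0 1)) (\<lambda>s t. \<Sum>i\<in>I. a i * dlog (Fs i) (e s) (e t)) (\<lambda>s. - (\<Sum>i\<in>I. a i * b i (e s)))"
        by (rule prim_cong) (simp_all add: re right_diff_distrib sum_subtractf)
    qed
    from indep[OF prim_subtopology[OF this] i] show "a i = 0" .
  qed
qed

end

section \<open>Counting real and complex dimensions\<close>

lemma (in vector_space) dim_eq_card_family: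
  assumes I: "finite I" and V: "\<And>i. i \<in> I \<Longrightarrow> v i \<in> V"
    and sp: "\<And>x. x \<in> V \<Longrightarrow> \<exists>a. x = (\<Sum>i\<in>I. scale (a i) (v i))"
    and ind: "\<And>a i. (\<Sum>i\<in>I. scale (a i) (v i)) = 0 \<Longrightarrow> i \<in> I \<Longrightarrow> a i = 0"
  shows "dim V = card I"
proof -
  have inj: "inj_on v I"
  proof (rule inj_onI, rule ccontr)
    fix i j assume ij: "i \<in> I" "j \<in> I" "v i = v j" "i \<noteq> j"
    \<comment> \<open>A repeated vector would give the nontrivial relation v i - v j = 0.\<close>
    let ?a = "\<lambda>k. if k = i then 1 else if k = j then -1 else 0"
    have "(\<Sum>k\<in>I. scale (?a k) (v k)) = (\<Sum>k\<in>{i, j}. scale (?a k) (v k))"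
      by (rule sum.mono_neutral_right) (use ij I in auto)
    also have "\<dots> = 0" using ij by simp
    finally show False using ind[of ?a i] ij(1) by simp
  qed
  have "independent (v ` I)"
  proof (rule independent_if_scalars_zero)
    fix f x assume z: "(\<Sum>x\<in>v ` I. scale (f x) x) = 0" and x: "x \<in> v ` I"
    have "(\<Sum>i\<in>I. scale (f (v i)) (v i)) = 0" using z by (simp add: sum.reindex[OF inj])
    then show "f x = 0" using ind[of "\<lambda>i. f (v i)"] x by blast
  qed (use I in simp)
  moreover have "span (v ` I) = span V"
    unfolding span_eq
  proof
    show "v ` I \<subseteq> span V" using V span_base by blast
    show "V \<subseteq> span (v ` I)"
    proof
      fix x assume "x \<in> V"
      then obtain a where "x = (\<Sum>i\<in>I. scale (a i) (v i))" using sp by blast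
      then show "x \<in> span (v ` I)" by (simp only:) (intro span_sum span_scale span_base imageI)
    qed
  qed
  ultimately have "dim V = card (v ` I)" by (intro dim_eq_card)
  then show ?thesis by (simp add: card_image[OF inj])
qed

text \<open>The real dimension is counted twice: by the given family, and by a complex basis C
  together with its multiples by the imaginary unit.\<close>

lemma forms_dim_of_real_basis:
  assumes V: "forms.subspace (V :: ('a chart \<Rightarrow> complex \<Rightarrow> complex) set)" and I: "finite (I :: 'i set)" and \<omega>: "\<And>i. i \<in> I \<Longrightarrow> \<omega> i \<in> V"
    and sp: "\<And>\<eta>. \<eta> \<in> V \<Longrightarrow> \<exists>a :: 'i \<Rightarrow> real. \<eta> = (\<Sum>i\<in>I. form_scale (of_real (a i)) (\<omega> i))"
    and ind: "\<And>(a :: 'i \<Rightarrow> real) i. (\<Sum>i\<in>I. form_scale (of_real (a i)) (\<omega> i)) = 0 \<Longrightarrow> i \<in> I \<Longrightarrow> a i = 0"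
  shows "(\<exists>B. finite B \<and> forms.span B = V) \<and> card I = 2 * forms.dim V"
proof -
  have "V \<subseteq> forms.span (\<omega> ` I)"
  proof
    fix \<eta> assume "\<eta> \<in> V"
    then obtain a :: "'i \<Rightarrow> real" where "\<eta> = (\<Sum>i\<in>I. form_scale (of_real (a i)) (\<omega> i))" using sp by blast
    then show "\<eta> \<in> forms.span (\<omega> ` I)" by (simp only:) (intro forms.span_sum forms.span_scale forms.span_base imageI)
  qed
  moreover have "forms.span (\<omega> ` I) \<subseteq> V" by (rule forms.span_minimal) (use \<omega> V in auto)
  ultimately have B: "forms.span (\<omega> ` I) = V" by blast
  obtain C where C: "C \<subseteq> V" "forms.independent C" "V \<subseteq> forms.span C" "card C = forms.dim V"
    using forms.basis_exists[of V] by blast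
  have fC: "finite C"
    using forms.independent_span_bound[OF _ C(2), of "\<omega> ` I"] I C(1) B by auto
  \<comment> \<open>The same additive group, with the scalars restricted to the reals.\<close>
  interpret rf: vector_space "\<lambda>r::real. form_scale (of_real r) :: ('a chart \<Rightarrow> complex \<Rightarrow> complex) \<Rightarrow> _"
    by unfold_locales (auto simp: form_scale_def fun_eq_iff algebra_simps)
  have 1: "rf.dim V = card I" by (rule rf.dim_eq_card_family[where v = \<omega>, OF I \<omega> sp]) (assumption | rule ind)+
  define v where "v = (\<lambda>(x :: 'a chart \<Rightarrow> complex \<Rightarrow> complex, t). if t then form_scale \<i> x else x)"
  have vsum: "(\<Sum>p\<in>C \<times> UNIV. form_scale (of_real (a p)) (v p)) =
      (\<Sum>x\<in>C. form_scale (Complex (a (x, False)) (a (x, True))) x)" for a :: "_ \<Rightarrow> real"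
  proof -
    have "(\<Sum>p\<in>C \<times> UNIV. form_scale (of_real (a p)) (v p)) = (\<Sum>x\<in>C. \<Sum>t\<in>UNIV. form_scale (of_real (a (x, t))) (v (x, t)))"
      by (simp add: sum.cartesian_product)
    also have "\<dots> = (\<Sum>x\<in>C. form_scale (Complex (a (x, False)) (a (x, True))) x)"
      by (rule sum.cong[OF refl])
        (simp add: UNIV_bool v_def form_scale_def plus_fun_def fun_eq_iff Complex_eq distrib_right)
    finally show ?thesis .
  qed
  have 2: "rf.dim V = card (C \<times> (UNIV :: bool set))"
  proof (rule rf.dim_eq_card_family[where v = v])
    show "v p \<in> V" if "p \<in> C \<times> UNIV" for p
      using that C(1) forms.subspace_scale[OF V] by (auto simp: v_def)
    show "\<exists>a :: _ \<Rightarrow> real. \<eta> = (\<Sum>p\<in>C \<times> UNIV. form_scale (of_real (a p)) (v p))" if "\<eta> \<in> V" for \<eta>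
    proof -
      have "\<eta> \<in> range (\<lambda>u. \<Sum>x\<in>C. form_scale (u x) x)"
        using subsetD[OF C(3) that] unfolding forms.span_finite[OF fC] .
      then obtain u where u: "\<eta> = (\<Sum>x\<in>C. form_scale (u x) x)" by (rule rangeE)
      show ?thesis unfolding vsum
        by (rule exI[of _ "\<lambda>(x, t). if t then Im (u x) else Re (u x)"]) (simp add: u)
    qed
    show "a p = 0" if z: "(\<Sum>p\<in>C \<times> UNIV. form_scale (of_real (a p)) (v p)) = 0" and p: "p \<in> C \<times> UNIV"
      for a :: "_ \<Rightarrow> real" and p
    proof -
      obtain x t where xt: "p = (x, t)" "x \<in> C" using p by auto
      have "Complex (a (x, False)) (a (x, True)) = 0"
        using forms.independentD[OF C(2) fC subset_refl z[unfolded vsum] xt(2)] .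
      then show ?thesis using xt(1) by (cases t) (simp_all add: complex_eq_iff)
    qed
  qed (use fC in simp)
  have "card I = 2 * card C" using 1 2 by (simp add: card_cartesian_product)
  then show ?thesis using B I C(4) by auto
qed

theorem theorem3p7:
  fixes X :: "'a topology" and A :: "'a chart set" and g :: nat
  assumes "riemann_surface X A"
    and "compact_space X"
    and "connected_space X"
    and "has_genus X g"
  shows "(\<exists>B. finite B \<and> forms.span B = holomorphic_forms A) \<and>
         forms.dim (holomorphic_forms A) = g"
proof -
  interpret compact_riemann_surface X A
    using assms(1-3) by (simp add: compact_riemann_surface_def compact_riemann_surface_axioms_def)
  let ?M = "sphere_with_handles g" and ?I = "{..<g} \<times> (UNIV :: bool set)"
  obtain \<Phi> \<Psi> where "homeomorphic_maps X ?M \<Phi> \<Psi>"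
    using assms(4) unfolding has_genus_def homeomorphic_space_def by blast
  then have \<Phi>: "continuous_map X ?M \<Phi>" and \<Psi>: "continuous_map ?M X \<Psi>"
    and \<Psi>\<Phi>: "\<And>x. x \<in> topspace X \<Longrightarrow> \<Psi> (\<Phi> x) = x" and \<Phi>\<Psi>: "\<And>y. y \<in> topspace ?M \<Longrightarrow> \<Phi> (\<Psi> y) = y"
    unfolding homeomorphic_maps_def by blast+
  have \<Phi>in: "\<Phi> x \<in> topspace ?M" if "x \<in> topspace X" for x using \<Phi> that by (meson continuous_map_image_subset_topspace image_subset_iff)
  have \<Psi>in: "\<Psi> y \<in> topspace X" if "y \<in> topspace ?M" for y using \<Psi> that by (meson continuous_map_image_subset_topspace image_subset_iff)
  \<comment> \<open>The disc is centred at the point that corresponds to the pole, so that the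
    homeomorphism restricts to the two punctured spaces.\<close>
  obtain e0 where e0: "e0 \<in> chart_discs A" "e0 0 = \<Psi> (pole g)"
    using disc_ex[OF openin_topspace \<Psi>in[OF pole_in]] by blast
  let ?Y = "subtopology X (topspace X - {e0 0})"
  have \<Phi>ne: "\<Phi> x \<noteq> pole g" if "x \<in> topspace X" "x \<noteq> e0 0" for x
    using \<Psi>\<Phi>[OF that(1)] that(2) e0(2) by auto
  have \<Psi>ne: "\<Psi> y \<noteq> e0 0" if "y \<in> topspace ?M" "y \<noteq> pole g" for y
    using \<Phi>\<Psi>[OF that(1)] \<Phi>\<Psi>[OF pole_in] that(2) e0(2) by metis
  have \<Phi>Y: "continuous_map ?Y (punctured g) \<Phi>"
    unfolding punctured_def using continuous_map_from_subtopology[OF \<Phi>] \<Phi>in \<Phi>ne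
    by (auto simp: continuous_map_in_subtopology)
  have \<Psi>Y: "continuous_map (punctured g) ?Y \<Psi>"
    unfolding punctured_def using continuous_map_from_subtopology[OF \<Psi>] \<Psi>in \<Psi>ne
    by (auto simp: continuous_map_in_subtopology)
  let ?F = "\<lambda>i x. basis_map g i (\<Phi> x)"
  have F: "circle_map (?F i)" if "i \<in> ?I" for i
    unfolding circle_map_def
    using continuous_map_compose[OF \<Phi> continuous_basis_map, of i] that norm_basis_map \<Phi>in
    by (auto simp: o_def)
  \<comment> \<open>Cocycles on the surface are pulled back along \<Psi> to the model, and the
    primitives found there return along \<Phi>.\<close>
  have span: "\<exists>a f. prim ?Y (\<lambda>x y. d x y - (\<Sum>i\<in>?I. a i * dlog (?F i) x y)) f" if d: "cocycle ?Y d" for d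
  proof -
    obtain a f where f: "prim (punctured g) (\<lambda>x y. d (\<Psi> x) (\<Psi> y) - (\<Sum>i\<in>?I. a i * dlog (basis_map g i) x y)) f"
      using punctured_span[OF cocycle_pullback[OF d \<Psi>Y]] by blast
    have "prim ?Y (\<lambda>x y. d x y - (\<Sum>i\<in>?I. a i * dlog (?F i) x y)) (\<lambda>x. f (\<Phi> x))"
      by (rule prim_cong[OF prim_pullback[OF f \<Phi>Y]]) (simp_all add: \<Psi>\<Phi> dlog_def)
    then show ?thesis by blast
  qed
  have indep: "a i = 0" if f: "prim ?Y (\<lambda>x y. \<Sum>i\<in>?I. a i * dlog (?F i) x y) f" and i: "i \<in> ?I" for a f i
  proof -
    have "prim (punctured g) (\<lambda>x y. \<Sum>i\<in>?I. a i * dlog (basis_map g i) x y) (\<lambda>x. f (\<Psi> x))"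
      by (rule prim_cong[OF prim_pullback[OF f \<Psi>Y]]) (simp_all add: \<Phi>\<Psi> dlog_def punctured_def)
    from punctured_independent[OF this i] show ?thesis .
  qed
  have fin: "finite ?I" by simp
  show ?thesis
  proof (rule real_basis_forms[where Fs = ?F, OF e0(1) fin])
    fix \<omega> assume \<omega>: "\<And>i. i \<in> ?I \<Longrightarrow> \<omega> i \<in> holomorphic_forms A"
      "\<And>\<eta>. \<eta> \<in> holomorphic_forms A \<Longrightarrow> \<exists>a :: nat \<times> bool \<Rightarrow> real. \<eta> = (\<Sum>i\<in>?I. form_scale (of_real (a i)) (\<omega> i))"
    assume ind: "\<And>(a :: nat \<times> bool \<Rightarrow> real) i. (\<Sum>i\<in>?I. form_scale (of_real (a i)) (\<omega> i)) = 0 \<Longrightarrow> i \<in> ?I \<Longrightarrow> a i = 0"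
    have "(\<exists>B. finite B \<and> forms.span B = holomorphic_forms A) \<and> card ?I = 2 * forms.dim (holomorphic_forms A)"
      by (rule forms_dim_of_real_basis[where \<omega> = \<omega>, OF subspace_holomorphic_forms fin \<omega>]) (assumption | rule ind)+
    then show ?thesis by (simp add: card_cartesian_product)
  qed (assumption | rule F span indep)+
qed

end
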